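(* Let $n \geq 3$, and let $\phi \colon \mathrm{Aut}(F_n) \to G$ be a homomorphism to a group $G$ that has no subgroup isomorphic to $W_n = (\mathbb{Z}/2)^n \rtimes S_n$. Then either $\mathrm{Im}(\phi) \cong \mathrm{PGL}(n,\mathbb{Z})$ or else $\mathrm{Im}(\phi)$ is finite.
   Context: $F_n$ denotes the free group of rank $n$ and $\mathrm{Aut}(F_n)$ its automorphism group. In $W_n = (\mathbb{Z}/2)^n \rtimes S_n$ the symmetric group $S_n$ acts on $(\mathbb{Z}/2)^n$ by permuting the $n$ factors. $\mathrm{PGL}(n,\mathbb{Z})$ is the quotient of $\mathrm{GL}(n,\mathbb{Z})$ by its centre $\{\pm I\}$. *)

theory Defs
  imports
    "HOL-Algebra.Bij"
    "HOL-Algebra.Sym_Groups"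
    "HOL-Algebra.Product_Groups"
    "HOL-Algebra.Elementary_Groups"
    "Jordan_Normal_Form.Column_Operations"
begin

section \<open>Free groups\<close>

text \<open>The letter \<open>(x, True)\<close> stands for the generator \<open>x\<close>, the letter \<open>(x, False)\<close> for its
  inverse.  Elements of the free group are the reduced words.\<close>

type_synonym 'a letter = "'a \<times> bool"

definition inv_letter :: "'a letter \<Rightarrow> 'a letter" where
  "inv_letter a = (fst a, \<not> snd a)"

definition reduced_word :: "'a letter list \<Rightarrow> bool" where
  "reduced_word w \<longleftrightarrow> successively (\<lambda>a b. b \<noteq> inv_letter a) w"

definition cancel_cons :: "'a letter \<Rightarrow> 'a letter list \<Rightarrow> 'a letter list" where
  "cancel_cons a w = (case w of [] \<Rightarrow> [a] | b # v \<Rightarrow> if b = inv_letter a then v else a # w)"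

text \<open>If \<open>v\<close> is reduced, then \<open>foldr cancel_cons u v\<close> is the reduced form of the
  concatenation \<open>u @ v\<close>.\<close>

definition free_group :: "'a set \<Rightarrow> 'a letter list monoid" where
  "free_group S = \<lparr>carrier = {w. fst ` set w \<subseteq> S \<and> reduced_word w},
                   monoid.mult = (\<lambda>u v. foldr cancel_cons u v),
                   one = []\<rparr>"

lemma inv_letter_inv_letter [simp]: "inv_letter (inv_letter a) = a"
  by (simp add: inv_letter_def)

lemma fst_inv_letter [simp]: "fst (inv_letter a) = fst a"
  by (simp add: inv_letter_def)

lemma inv_letter_neq [simp]: "inv_letter a \<noteq> a" "a \<noteq> inv_letter a"
  by (auto simp: inv_letter_def prod_eq_iff)

lemma reduced_cancel_cons: "reduced_word w \<Longrightarrow> reduced_word (cancel_cons a w)"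
  by (auto simp: reduced_word_def cancel_cons_def successively_Cons split: list.splits)

lemma reduced_foldr_cancel_cons:
  "reduced_word v \<Longrightarrow> reduced_word (foldr cancel_cons u v)"
  by (induction u) (auto intro: reduced_cancel_cons)

lemma set_cancel_cons: "set (cancel_cons a w) \<subseteq> insert a (set w)"
  by (auto simp: cancel_cons_def split: list.splits if_splits)

lemma set_foldr_cancel_cons: "set (foldr cancel_cons u v) \<subseteq> set u \<union> set v"
  by (induction u) (use set_cancel_cons in fastforce)+

lemma cancel_cons_inv_letter:
  "reduced_word w \<Longrightarrow> cancel_cons a (cancel_cons (inv_letter a) w) = w"
  by (cases w; cases "tl w")
     (auto simp: reduced_word_def cancel_cons_def successively_Cons split: list.splits if_splits)

lemma foldr_cancel_cons_cancel_cons: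
  assumes "reduced_word w"
  shows "foldr cancel_cons (cancel_cons a v) w = cancel_cons a (foldr cancel_cons v w)"
proof (cases v)
  case (Cons b u)
  have "cancel_cons a (cancel_cons (inv_letter a) (foldr cancel_cons u w)) = foldr cancel_cons u w"
    using assms by (intro cancel_cons_inv_letter reduced_foldr_cancel_cons)
  then show ?thesis
    by (auto simp: Cons cancel_cons_def[of a "b # u"])
qed (simp add: cancel_cons_def)

lemma foldr_cancel_cons_assoc:
  "reduced_word w \<Longrightarrow>
   foldr cancel_cons (foldr cancel_cons u v) w = foldr cancel_cons u (foldr cancel_cons v w)"
  by (induction u) (simp_all add: foldr_cancel_cons_cancel_cons)

lemma foldr_cancel_cons_Nil: "reduced_word w \<Longrightarrow> foldr cancel_cons w [] = w"
  by (induction w)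
     (auto simp: reduced_word_def cancel_cons_def successively_Cons split: list.splits)

lemma foldr_cancel_cons_inverse:
  "reduced_word v \<Longrightarrow> foldr cancel_cons (rev (map inv_letter w)) (foldr cancel_cons w v) = v"
proof (induction w)
  case (Cons a w)
  then show ?case
    using cancel_cons_inv_letter[of "foldr cancel_cons w v" "inv_letter a"]
    by (simp add: reduced_foldr_cancel_cons)
qed simp

lemma reduced_inverse_word: "reduced_word w \<Longrightarrow> reduced_word (rev (map inv_letter w))"
  unfolding reduced_word_def
  by (auto simp: successively_map elim!: successively_mono)

lemma group_free_group: "group (free_group S)"
proof (rule groupI)
  fix u v
  assume "u \<in> carrier (free_group S)" "v \<in> carrier (free_group S)"
  then have "fst ` (set u \<union> set v) \<subseteq> S" "reduced_word v"
    by (auto simp: free_group_def)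
  moreover from this(1) have "fst ` set (foldr cancel_cons u v) \<subseteq> S"
    by (rule order_trans[OF image_mono[OF set_foldr_cancel_cons]])
  ultimately show "u \<otimes>\<^bsub>free_group S\<^esub> v \<in> carrier (free_group S)"
    by (simp add: free_group_def reduced_foldr_cancel_cons)
next
  fix w
  assume w: "w \<in> carrier (free_group S)"
  let ?w' = "rev (map inv_letter w)"
  have "?w' \<in> carrier (free_group S)"
    using w reduced_inverse_word by (auto simp: free_group_def)
  moreover have "?w' \<otimes>\<^bsub>free_group S\<^esub> w = \<one>\<^bsub>free_group S\<^esub>"
    using w foldr_cancel_cons_inverse[of "[]" w]
    by (simp add: free_group_def foldr_cancel_cons_Nil) (simp add: reduced_word_def)
  ultimately show "\<exists>y\<in>carrier (free_group S). y \<otimes>\<^bsub>free_group S\<^esub> w = \<one>\<^bsub>free_group S\<^esub>"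
    by blast
qed (auto simp: free_group_def reduced_word_def[of "[]"] foldr_cancel_cons_assoc)

abbreviation Aut_free :: "nat \<Rightarrow> (nat letter list \<Rightarrow> nat letter list) monoid" where
  "Aut_free n \<equiv> AutoGroup (free_group {1..n})"


section \<open>The group \<open>W\<^sub>n\<close>\<close>

definition semidirect_product ::
  "('a, 'm) monoid_scheme \<Rightarrow> ('b, 'k) monoid_scheme \<Rightarrow> ('b \<Rightarrow> 'a \<Rightarrow> 'a) \<Rightarrow> ('a \<times> 'b) monoid" where
  "semidirect_product N H \<alpha> =
     \<lparr>carrier = carrier N \<times> carrier H,
      monoid.mult = (\<lambda>(a, g) (b, h). (a \<otimes>\<^bsub>N\<^esub> \<alpha> g b, g \<otimes>\<^bsub>H\<^esub> h)),
      one = (\<one>\<^bsub>N\<^esub>, \<one>\<^bsub>H\<^esub>)\<rparr>"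

lemma group_semidirect_product:
  assumes "group N" "group H" and hom: "\<alpha> \<in> hom H (AutoGroup N)"
  shows "group (semidirect_product N H \<alpha>)"
proof -
  interpret N: group N by fact
  interpret H: group H by fact
  interpret A: group "AutoGroup N" by (rule N.AutoGroup)
  interpret \<alpha>: group_hom H "AutoGroup N" \<alpha>
    by unfold_locales (rule hom)
  have auto: "\<alpha> g \<in> auto N" if "g \<in> carrier H" for g
    using \<alpha>.hom_closed[OF that] by (simp add: AutoGroup_def)
  have closed: "\<alpha> g a \<in> carrier N" if "g \<in> carrier H" "a \<in> carrier N" for g a
    using auto[OF that(1)] that(2) by (auto simp: auto_def hom_def)
  have mult: "\<alpha> g (a \<otimes>\<^bsub>N\<^esub> b) = \<alpha> g a \<otimes>\<^bsub>N\<^esub> \<alpha> g b"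
    if "g \<in> carrier H" "a \<in> carrier N" "b \<in> carrier N" for g a b
    using auto[OF that(1)] that(2,3) by (auto simp: auto_def hom_def)
  have comp: "\<alpha> (g \<otimes>\<^bsub>H\<^esub> h) a = \<alpha> g (\<alpha> h a)"
    if "g \<in> carrier H" "h \<in> carrier H" "a \<in> carrier N" for g h a
    using \<alpha>.hom_mult[OF that(1,2)] auto[OF that(1)] auto[OF that(2)] that(3)
    by (simp add: AutoGroup_def BijGroup_def auto_def compose_def)
  have one: "\<alpha> \<one>\<^bsub>H\<^esub> a = a" if "a \<in> carrier N" for a
    using \<alpha>.hom_one that by (simp add: AutoGroup_def BijGroup_def)
  show ?thesis
  proof (rule groupI)
    fix x
    assume "x \<in> carrier (semidirect_product N H \<alpha>)"
    then obtain a g where x: "x = (a, g)" "a \<in> carrier N" "g \<in> carrier H"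
      by (auto simp: semidirect_product_def)
    let ?y = "(\<alpha> (inv\<^bsub>H\<^esub> g) (inv\<^bsub>N\<^esub> a), inv\<^bsub>H\<^esub> g)"
    have "\<alpha> (inv\<^bsub>H\<^esub> g) (inv\<^bsub>N\<^esub> a) \<otimes>\<^bsub>N\<^esub> \<alpha> (inv\<^bsub>H\<^esub> g) a = \<alpha> (inv\<^bsub>H\<^esub> g) \<one>\<^bsub>N\<^esub>"
      using x by (simp del: \<alpha>.hom_inv flip: mult)
    moreover have "\<alpha> (inv\<^bsub>H\<^esub> g) \<one>\<^bsub>N\<^esub> = \<one>\<^bsub>N\<^esub>"
    proof -
      have "\<alpha> (inv\<^bsub>H\<^esub> g) \<one>\<^bsub>N\<^esub> \<otimes>\<^bsub>N\<^esub> \<alpha> (inv\<^bsub>H\<^esub> g) \<one>\<^bsub>N\<^esub> = \<alpha> (inv\<^bsub>H\<^esub> g) \<one>\<^bsub>N\<^esub>"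
        using x by (simp del: \<alpha>.hom_inv flip: mult)
      then show ?thesis
        using closed[of "inv\<^bsub>H\<^esub> g" "\<one>\<^bsub>N\<^esub>"] x N.l_cancel_one
        by (simp del: \<alpha>.hom_inv)
    qed
    ultimately show "\<exists>y\<in>carrier (semidirect_product N H \<alpha>).
        y \<otimes>\<^bsub>semidirect_product N H \<alpha>\<^esub> x = \<one>\<^bsub>semidirect_product N H \<alpha>\<^esub>"
      using x closed by (intro bexI[of _ ?y]) (auto simp: semidirect_product_def simp del: \<alpha>.hom_inv)
  qed (auto simp: semidirect_product_def closed mult comp one N.m_assoc H.m_assoc
      simp del: \<alpha>.hom_mult \<alpha>.hom_one)
qed

definition perm_action :: "nat \<Rightarrow> (nat \<Rightarrow> nat) \<Rightarrow> (nat \<Rightarrow> int) \<Rightarrow> (nat \<Rightarrow> int)" where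
  "perm_action n \<sigma> =
     (\<lambda>v \<in> carrier (product_group {1..n} (\<lambda>_. integer_mod_group 2)).
        \<lambda>i \<in> {1..n}. v (inv_into UNIV \<sigma> i))"

definition W_group :: "nat \<Rightarrow> ((nat \<Rightarrow> int) \<times> (nat \<Rightarrow> nat)) monoid" where
  "W_group n =
     semidirect_product (product_group {1..n} (\<lambda>_. integer_mod_group 2)) (sym_group n) (perm_action n)"

lemma perm_action_closed:
  assumes "\<sigma> permutes {1..n}" "v \<in> carrier (product_group {1..n} (\<lambda>_. integer_mod_group 2))"
  shows "perm_action n \<sigma> v \<in> carrier (product_group {1..n} (\<lambda>_. integer_mod_group 2))"
  using assms permutes_in_image[OF permutes_inv[OF assms(1)]]
  by (fastforce simp: perm_action_def)

lemma perm_action_comp: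
  assumes "\<sigma> permutes {1..n}" "\<tau> permutes {1..n}"
    "v \<in> carrier (product_group {1..n} (\<lambda>_. integer_mod_group 2))"
  shows "perm_action n (\<sigma> \<circ> \<tau>) v = perm_action n \<sigma> (perm_action n \<tau> v)"
  using assms perm_action_closed[OF assms(2,3)] permutes_in_image[OF permutes_inv[OF assms(1)]]
  by (auto simp: perm_action_def permutes_inv_o o_inv_distrib permutes_bij fun_eq_iff)

lemma perm_action_id:
  "v \<in> carrier (product_group {1..n} (\<lambda>_. integer_mod_group 2)) \<Longrightarrow> perm_action n id v = v"
  by (auto simp: perm_action_def PiE_def extensional_def fun_eq_iff)

lemma perm_action_hom:
  "perm_action n \<in> hom (sym_group n) (AutoGroup (product_group {1..n} (\<lambda>_. integer_mod_group 2)))"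
  (is "_ \<in> hom _ (AutoGroup ?N)")
proof -
  have auto: "perm_action n \<sigma> \<in> auto ?N" if \<sigma>: "\<sigma> permutes {1..n}" for \<sigma>
  proof -
    let ?\<tau> = "inv_into UNIV \<sigma>"
    have \<tau>: "?\<tau> permutes {1..n}" using \<sigma> by (rule permutes_inv)
    have "bij_betw (perm_action n \<sigma>) (carrier ?N) (carrier ?N)"
    proof (rule bij_betw_byWitness[where f' = "perm_action n ?\<tau>"])
      show "\<forall>v\<in>carrier ?N. perm_action n ?\<tau> (perm_action n \<sigma> v) = v"
        using perm_action_comp[OF \<tau> \<sigma>] perm_action_id permutes_inv_o[OF \<sigma>] by metis
      show "\<forall>v\<in>carrier ?N. perm_action n \<sigma> (perm_action n ?\<tau> v) = v"
        using perm_action_comp[OF \<sigma> \<tau>] perm_action_id permutes_inv_o[OF \<sigma>] by metis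
    qed (use perm_action_closed \<sigma> \<tau> in blast)+
    moreover have "perm_action n \<sigma> \<in> hom ?N ?N"
    proof (rule homI)
      fix u v
      assume uv: "u \<in> carrier ?N" "v \<in> carrier ?N"
      have "u \<otimes>\<^bsub>?N\<^esub> v \<in> carrier ?N"
        using uv by (intro group.is_monoid[THEN monoid.m_closed]) auto
      with uv show "perm_action n \<sigma> (u \<otimes>\<^bsub>?N\<^esub> v) = perm_action n \<sigma> u \<otimes>\<^bsub>?N\<^esub> perm_action n \<sigma> v"
        using permutes_in_image[OF \<tau>]
        by (auto simp: perm_action_def fun_eq_iff simp del: carrier_product_group)
    qed (use perm_action_closed \<sigma> in blast)
    ultimately show ?thesis
      by (auto simp: auto_def Bij_def perm_action_def)
  qed
  show ?thesis
  proof (rule homI)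
    fix \<sigma> \<tau>
    assume "\<sigma> \<in> carrier (sym_group n)" "\<tau> \<in> carrier (sym_group n)"
    then have st: "\<sigma> permutes {1..n}" "\<tau> permutes {1..n}"
      by (auto simp: sym_group_def)
    have "perm_action n (\<sigma> \<circ> \<tau>) = compose (carrier ?N) (perm_action n \<sigma>) (perm_action n \<tau>)"
    proof
      fix v
      show "perm_action n (\<sigma> \<circ> \<tau>) v = compose (carrier ?N) (perm_action n \<sigma>) (perm_action n \<tau>) v"
        using perm_action_comp[OF st, of v]
        by (cases "v \<in> carrier ?N") (simp_all add: compose_def perm_action_def)
    qed
    then show "perm_action n (\<sigma> \<otimes>\<^bsub>sym_group n\<^esub> \<tau>)
      = perm_action n \<sigma> \<otimes>\<^bsub>AutoGroup ?N\<^esub> perm_action n \<tau>"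
      using auto[OF st(1)] auto[OF st(2)]
      by (simp add: sym_group_def AutoGroup_def BijGroup_def auto_def)
  qed (use auto in \<open>auto simp: sym_group_def AutoGroup_def\<close>)
qed

lemma group_W_group: "group (W_group n)"
  unfolding W_group_def
  by (intro group_semidirect_product perm_action_hom sym_group_is_group) auto


section \<open>The group \<open>PGL(n, \<int>)\<close>\<close>

definition group_center :: "('a, 'm) monoid_scheme \<Rightarrow> 'a set" where
  "group_center G = {z \<in> carrier G. \<forall>x \<in> carrier G. z \<otimes>\<^bsub>G\<^esub> x = x \<otimes>\<^bsub>G\<^esub> z}"

definition GL_int :: "nat \<Rightarrow> int mat monoid" where
  "GL_int n = units_of (ring_mat TYPE(int) n ())"

definition PGL_int :: "nat \<Rightarrow> int mat set monoid" where
  "PGL_int n = GL_int n Mod group_center (GL_int n)"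

lemma group_GL_int: "group (GL_int n)"
  unfolding GL_int_def by (intro monoid.units_group ring.is_monoid ring_mat)

lemma (in group) normal_group_center: "group_center G \<lhd> G"
proof (rule normal_invI)
  show "subgroup (group_center G) G"
  proof (rule subgroupI)
    fix a assume "a \<in> group_center G"
    then have a: "a \<in> carrier G" "\<And>x. x \<in> carrier G \<Longrightarrow> a \<otimes> x = x \<otimes> a"
      by (auto simp: group_center_def)
    have "inv a \<otimes> x = x \<otimes> inv a" if x: "x \<in> carrier G" for x
    proof -
      have "inv a \<otimes> x = inv a \<otimes> (x \<otimes> a) \<otimes> inv a"
        using a(1) x by (simp add: m_assoc)
      also have "\<dots> = inv a \<otimes> (a \<otimes> x) \<otimes> inv a"
        using a(2) x by simp
      also have "\<dots> = x \<otimes> inv a"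
        using a(1) x by (simp flip: m_assoc)
      finally show ?thesis .
    qed
    then show "inv a \<in> group_center G"
      using a by (auto simp: group_center_def)
  next
    fix a b assume "a \<in> group_center G" "b \<in> group_center G"
    then have a: "a \<in> carrier G" "\<And>x. x \<in> carrier G \<Longrightarrow> a \<otimes> x = x \<otimes> a"
      and b: "b \<in> carrier G" "\<And>x. x \<in> carrier G \<Longrightarrow> b \<otimes> x = x \<otimes> b"
      by (auto simp: group_center_def)
    have "a \<otimes> b \<otimes> x = x \<otimes> (a \<otimes> b)" if x: "x \<in> carrier G" for x
    proof -
      have "a \<otimes> b \<otimes> x = a \<otimes> (x \<otimes> b)"
        using a(1) b x by (simp add: m_assoc)
      also have "\<dots> = (a \<otimes> x) \<otimes> b"
        using a(1) b(1) x by (simp add: m_assoc)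
      also have "\<dots> = x \<otimes> (a \<otimes> b)"
        using a(1) b(1) x by (simp add: a(2) m_assoc)
      finally show ?thesis .
    qed
    then show "a \<otimes> b \<in> group_center G"
      using a(1) b(1) by (simp add: group_center_def)
  qed (auto simp: group_center_def)
next
  fix x h assume x: "x \<in> carrier G" and h: "h \<in> group_center G"
  then have "h \<in> carrier G" "x \<otimes> h = h \<otimes> x"
    by (auto simp: group_center_def)
  with x have "x \<otimes> h \<otimes> inv x = h"
    by (simp add: m_assoc)
  with h show "x \<otimes> h \<otimes> inv x \<in> group_center G"
    by simp
qed

lemma group_PGL_int: "group (PGL_int n)"
  unfolding PGL_int_def
  by (intro normal.factorgroup_is_group group.normal_group_center group_GL_int)

lemma carrier_GL_int:
  "A \<in> carrier (GL_int n) \<longleftrightarrow>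
   A \<in> carrier_mat n n \<and> (\<exists>B \<in> carrier_mat n n. B * A = 1\<^sub>m n \<and> A * B = 1\<^sub>m n)"
  by (auto simp: GL_int_def units_of_def Units_def ring_mat_def)

lemma mult_GL_int: "A \<otimes>\<^bsub>GL_int n\<^esub> B = A * B"
  by (simp add: GL_int_def units_of_def ring_mat_def)

lemma group_center_GL_int: "group_center (GL_int n) = {1\<^sub>m n, - 1\<^sub>m n}"
proof
  have "- 1\<^sub>m n * - 1\<^sub>m n = (1\<^sub>m n :: int mat)"
    by (simp add: uminus_mult_left_mat uminus_mult_right_mat)
  then have "- 1\<^sub>m n \<in> carrier (GL_int n)"
    unfolding carrier_GL_int by (intro conjI bexI[of _ "- 1\<^sub>m n"]) auto
  moreover have "- 1\<^sub>m n * A = A * - 1\<^sub>m n" if "A \<in> carrier_mat n n" for A :: "int mat"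
    using that by simp
  ultimately show "{1\<^sub>m n, - 1\<^sub>m n} \<subseteq> group_center (GL_int n)"
    by (auto simp: group_center_def mult_GL_int) (auto simp: carrier_GL_int)
next
  show "group_center (GL_int n) \<subseteq> {1\<^sub>m n, - 1\<^sub>m n}"
  proof
    fix z assume z: "z \<in> group_center (GL_int n)"
    then have zc: "z \<in> carrier_mat n n"
      by (simp add: group_center_def carrier_GL_int)
    obtain B where B: "B \<in> carrier_mat n n" "B * z = 1\<^sub>m n" "z * B = 1\<^sub>m n"
      using z by (auto simp: group_center_def carrier_GL_int)
    have entry: "z $$ (k, i) = (if k = i then z $$ (j, j) else 0)"
      if "i < n" "j < n" "k < n" "i \<noteq> j" for i j k
    proof -
      let ?E = "addrow_mat n 1 i j :: int mat"
      have "?E \<in> carrier (GL_int n)"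
        using addrow_mat_Unit[of i n j "1 :: int" "()"] that
        by (simp add: GL_int_def units_of_def)
      then have "z * ?E = ?E * z"
        using z by (simp add: group_center_def mult_GL_int)
      moreover have "z * ?E = addcol 1 j i z"
        using addcol_mat[OF zc, of i 1 j] that by simp
      moreover have "?E * z = addrow 1 i j z"
        using addrow_mat[OF zc, of j 1 i] that by simp
      ultimately have "addcol 1 j i z $$ (k, j) = addrow 1 i j z $$ (k, j)"
        by simp
      then show ?thesis
        using that zc by (auto split: if_splits)
    qed
    show "z \<in> {1\<^sub>m n, - 1\<^sub>m n}"
    proof (cases "n = 0")
      case True
      then show ?thesis using zc by (auto intro!: eq_matI)
    next
      case False
      define c where "c = z $$ (0, 0)"
      have zij: "z $$ (i, j) = (if i = j then c else 0)" if "i < n" "j < n" for i j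
      proof (cases "j = 0")
        case True
        then show ?thesis
        proof (cases "i = 0")
          case False
          then show ?thesis using entry[of j i i] that \<open>j = 0\<close> by auto
        qed (simp add: c_def)
      next
        case j: False
        then show ?thesis using entry[of j 0 i] that by (auto simp: c_def)
      qed
      then have "z = c \<cdot>\<^sub>m 1\<^sub>m n"
        using zc by (intro eq_matI) auto
      then have "z * B = c \<cdot>\<^sub>m B"
        using B(1) by (simp add: mult_smult_assoc_mat[of _ n n])
      with B(3) have "(c \<cdot>\<^sub>m B) $$ (0, 0) = 1\<^sub>m n $$ (0, 0)"
        by simp
      then have "c * B $$ (0, 0) = 1"
        using B(1) False by simp
      then have "c = 1 \<or> c = - 1"
        by (auto simp: zmult_eq_1_iff)
      then show ?thesis
        using \<open>z = c \<cdot>\<^sub>m 1\<^sub>m n\<close> by (auto intro!: eq_matI)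
    qed
  qed
qed

end

theory Submission
  imports Defs "HOL-Algebra.Generated_Groups" "HOL-Combinatorics.Permutations" "HOL-Computational_Algebra.Primes" "HOL-Library.Sublist"
begin

text \<open>If \<open>\<phi>\<close> is injective on the signed permutations, then their image is a copy of \<open>W\<^sub>n\<close>.  Otherwise
  \<open>\<phi>\<close> kills the inversion \<open>\<Delta>\<close> of all generators or identifies all the inversions \<open>\<epsilon>\<^sub>i\<close> of single
  generators; both force \<open>\<phi>\<close> to identify right and left transvections.  The images of the Nielsen
  generators then satisfy a Steinberg-type presentation of \<open>GL(n, \<int>)\<close>, proved by reducing the
  \<open>l\<^sup>1\<close>-norm of integer vectors, so that \<open>\<phi>\<close> factors through \<open>GL(n, \<int>)\<close>.  If the kernel of the
  induced map is central, it is \<open>{\<plusminus>1}\<close> because it contains the image of \<open>\<Delta>\<close>.  A noncentral kernel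
  contains all elementary matrices congruent to one modulo some \<open>q\<close>; then the perfect image of the
  elementary group has a center of finite index, and Schur's theorem makes it finite.\<close>

section \<open>Steinberg presentations acting on integer vectors\<close>

text \<open>No presentation by words occurs. An automorphism is paired with its image,
  \<open>\<Psi> \<alpha> = (ab \<alpha>, \<phi> \<alpha>)\<close> in
  \<open>GL_int n \<times>\<times> G\<close>, and \<open>\<phi>\<close> factors through matrices
  once every such pair that acts trivially on vectors is shown to be trivial. Only the images of
  generators have to satisfy relations, and those among signed permutations come for free, since
  these form a subgroup of the automorphism group that acts faithfully on vectors. The obstacle is
  that a vector has many norm-reducing paths. Each path records a group element, and its coset
  modulo the stabilizer of a basis vector is shown not to depend on the path: any two first steps
  extend to a polygon through vectors of smaller norm. The stabilizer is a unipotent group times the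
  group of one rank less, so induction on the rank applies. Identifying left and right transvections
  is what makes the relations hold: right multiplications of one generator by two others do not
  commute. The bound \<open>n \<ge> 3\<close> supplies a third index for commutators, a linear form
  vanishing on two vectors, and the stable range.\<close>

lemma (in group) inv_cancel_left:
  assumes "x \<in> carrier G" "y \<in> carrier G"
  shows "inv x \<otimes> (x \<otimes> y) = y" "x \<otimes> (inv x \<otimes> y) = y"
  using assms by (simp_all flip: m_assoc)

lemma (in group) commute_inv:
  assumes "x \<in> carrier G" "y \<in> carrier G" "x \<otimes> y = y \<otimes> x"
  shows "inv x \<otimes> y = y \<otimes> inv x"
proof -
  have "inv x \<otimes> y = inv x \<otimes> (y \<otimes> x) \<otimes> inv x"
    using assms(1,2) by (simp add: m_assoc)
  also have "\<dots> = inv x \<otimes> (x \<otimes> y) \<otimes> inv x"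
    by (simp only: assms(3))
  also have "\<dots> = y \<otimes> inv x"
    using assms(1,2) by (simp flip: m_assoc)
  finally show ?thesis .
qed

lemma (in group) int_pow_commute:
  fixes a b :: int
  assumes "x \<in> carrier G" "y \<in> carrier G" and xy: "x \<otimes> y = y \<otimes> x"
  shows "x [^] a \<otimes> y [^] b = y [^] b \<otimes> x [^] a"
proof -
  have int: "y [^] (k::int) \<otimes> x = x \<otimes> y [^] k"
    if xy: "x \<in> carrier G" "y \<in> carrier G" and c: "y \<otimes> x = x \<otimes> y" for x y k
  proof -
    have "y [^] l \<otimes> x = x \<otimes> y [^] l" for l :: nat
      by (rule group_commutes_pow[OF c xy(2,1)])
    moreover from this have "inv (y [^] l) \<otimes> x = x \<otimes> inv (y [^] l)" for l :: nat
      using xy by (intro commute_inv) auto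
    ultimately show ?thesis
      unfolding int_pow_def2 by (simp only: split: if_split) blast
  qed
  have "y [^] b \<otimes> x = x \<otimes> y [^] b"
    by (rule int[OF assms(1,2) xy[symmetric]])
  then show ?thesis
    using assms by (intro int) auto
qed

text \<open>\<open>z\<close> is central in the subgroup generated by \<open>x\<close> and
  \<open>y\<close>, so the commutator is multiplicative in each argument and a sign on either side
  moves to \<open>z\<close>. Unit exponents suffice because every step of the norm reduction uses a
  unit multiple.\<close>

lemma (in group) commutator_shift_sign:
  fixes a b :: int
  assumes xyz: "x \<in> carrier G" "y \<in> carrier G" "z \<in> carrier G"
    and xy: "x \<otimes> y = y \<otimes> x \<otimes> z" and xz: "x \<otimes> z = z \<otimes> x" and yz: "y \<otimes> z = z \<otimes> y"
    and ab: "a \<in> {1, -1}" "b \<in> {1, -1}"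
  shows "x [^] a \<otimes> y [^] b = y [^] b \<otimes> x [^] a \<otimes> z [^] (a * b)"
proof -
  have left: "inv x \<otimes> y = y \<otimes> inv x \<otimes> inv z"
    if xyz: "x \<in> carrier G" "y \<in> carrier G" "z \<in> carrier G"
      and xy: "x \<otimes> y = y \<otimes> x \<otimes> z" and xz: "x \<otimes> z = z \<otimes> x" for x y z
  proof -
    have "x \<otimes> (y \<otimes> inv x \<otimes> inv z) = (x \<otimes> y) \<otimes> inv x \<otimes> inv z"
      using xyz by (simp add: m_assoc)
    also have "\<dots> = y \<otimes> (x \<otimes> z) \<otimes> inv x \<otimes> inv z"
      using xyz by (simp add: xy m_assoc)
    also have "\<dots> = y"
      unfolding xz using xyz by (simp add: m_assoc inv_cancel_left)
    finally have "inv x \<otimes> (x \<otimes> (y \<otimes> inv x \<otimes> inv z)) = inv x \<otimes> y"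
      by simp
    then show ?thesis using xyz by (simp add: inv_cancel_left)
  qed
  have right: "x \<otimes> inv y = inv y \<otimes> x \<otimes> inv z"
    if xyz: "x \<in> carrier G" "y \<in> carrier G" "z \<in> carrier G"
      and xy: "x \<otimes> y = y \<otimes> x \<otimes> z" and yz: "inv y \<otimes> inv z = inv z \<otimes> inv y" for x y z
  proof -
    have "y \<otimes> (x \<otimes> inv y) = y \<otimes> x \<otimes> (z \<otimes> inv z) \<otimes> inv y"
      using xyz by (simp add: m_assoc)
    also have "\<dots> = (y \<otimes> x \<otimes> z) \<otimes> (inv z \<otimes> inv y)"
      using xyz by (simp add: m_assoc inv_cancel_left)
    also have "\<dots> = (x \<otimes> y) \<otimes> (inv y \<otimes> inv z)"
      by (simp only: xy yz)
    also have "\<dots> = x \<otimes> inv z"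
      using xyz by (simp add: m_assoc inv_cancel_left)
    finally have "inv y \<otimes> (y \<otimes> (x \<otimes> inv y)) = inv y \<otimes> (x \<otimes> inv z)" by simp
    then show ?thesis using xyz by (simp add: m_assoc inv_cancel_left)
  qed
  have c: "inv y \<otimes> z = z \<otimes> inv y"
    by (rule commute_inv[OF xyz(2,3) yz])
  have c': "inv y \<otimes> inv z = inv z \<otimes> inv y"
    using commute_inv[OF xyz(3) inv_closed[OF xyz(2)] c[symmetric]] by (rule sym)
  have 1: "inv x \<otimes> y = y \<otimes> inv x \<otimes> inv z"
    using left[OF xyz xy xz] .
  have 2: "x \<otimes> inv y = inv y \<otimes> x \<otimes> inv z"
    using right[OF xyz xy c'] .
  have 3: "inv x \<otimes> inv y = inv y \<otimes> inv x \<otimes> z"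
    using right[OF _ _ _ 1] xyz c by (simp only: inv_closed inv_inv)
  show ?thesis
    using ab xyz xy 1 2 3 by (auto simp: int_pow_neg)
qed

text \<open>Here \<open>a\<close> and \<open>c\<close> are the entries at the target and at the
  source of a move and \<open>s\<close> is its sign. Either the move or its inverse shortens the
  target without passing zero, or the target passes zero; then one of its two values, old or new, is
  smaller than \<open>c\<close> in absolute value but at least half as large.\<close>

lemma move_cases:
  fixes a c s :: int
  assumes "s \<in> {1, -1}" "c \<noteq> 0"
  shows "(\<bar>c\<bar> \<le> \<bar>a + s * c\<bar> \<and> s = sgn (a + s * c) * sgn c) \<or> (\<bar>c\<bar> \<le> \<bar>a\<bar> \<and> - s = sgn a * sgn c)
    \<or> (a \<noteq> 0 \<and> \<bar>a\<bar> < \<bar>c\<bar> \<and> \<bar>c\<bar> \<le> 2 * \<bar>a\<bar> \<and> s = - (sgn a * sgn c))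
    \<or> (a + s * c \<noteq> 0 \<and> \<bar>a + s * c\<bar> < \<bar>c\<bar> \<and> \<bar>c\<bar> \<le> 2 * \<bar>a + s * c\<bar> \<and> - s = - (sgn (a + s * c) * sgn c))"
    (is "?A a s c \<or> ?B a s c \<or> ?C a s c \<or> ?D a s c")
proof -
  \<comment> \<open>The other sign patterns follow from this one by negating \<open>a\<close> or
    \<open>c\<close>.\<close>
  have pos: "?A a 1 c \<or> ?B a 1 c \<or> ?C a 1 c \<or> ?D a 1 c" if "c > 0" for a c
  proof -
    consider "a \<ge> 0" | "a \<le> - c" | "- c < a" "a < 0" "c \<le> - 2 * a" | "- 2 * a < c" "a < 0"
      by linarith
    then show ?thesis
    proof cases
      case 1 then have "?A a 1 c" using that by (simp add: sgn_if) then show ?thesis by blast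
    next
      case 2 then have "?B a 1 c" using that by (simp add: sgn_if) then show ?thesis by blast
    next
      case 3 then have "?C a 1 c" using that by (simp add: sgn_if) then show ?thesis by blast
    next
      case 4 then have "?D a 1 c" using that by (simp add: sgn_if) then show ?thesis by blast
    qed
  qed
  consider "s = 1" "c > 0" | "s = 1" "c < 0" | "s = -1" "c > 0" | "s = -1" "c < 0"
    using assms by force
  then show ?thesis
  proof cases
    case 1 then show ?thesis using pos by simp
  next
    case 2
    have "\<bar>- a - c\<bar> = \<bar>a + c\<bar>" by arith
    moreover have "sgn (- a - c) = - sgn (a + c)" by (auto simp: sgn_if)
    moreover have "- a = c \<longleftrightarrow> a + c = 0" by arith
    ultimately show ?thesis using 2 pos[of "- c" "- a"] by simp
  next
    case 3
    have "\<bar>c - a\<bar> = \<bar>a - c\<bar>" "sgn (c - a) = - sgn (a - c)" "c = a \<longleftrightarrow> a = c"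
      by (auto simp: sgn_if)
    with 3 show ?thesis using pos[of c "- a"] by (simp add: eq_commute[of "- 1"])
  next
    case 4
    then show ?thesis using pos[of "- c" a] by (simp add: eq_commute[of "- 1"])
  qed
qed

lemma abs_diff_sgn_le:
  fixes x c :: int
  assumes "0 \<le> c" "c \<le> 2 * \<bar>x\<bar>"
  shows "\<bar>x - sgn x * c\<bar> \<le> \<bar>x\<bar>"
  using assms by (cases "x > 0") (auto simp: sgn_if)

lemma abs_diff_sgn_less:
  fixes x c :: int
  assumes "0 < c" "c < 2 * \<bar>x\<bar>"
  shows "\<bar>x - sgn x * c\<bar> < \<bar>x\<bar>"
  using assms by (cases "x > 0") (auto simp: sgn_if)
definition basis_vec :: "nat \<Rightarrow> nat \<Rightarrow> int" where
  "basis_vec b = (\<lambda>i. if i = b then 1 else 0)"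

section \<open>Groups with Steinberg relations that act on integer vectors\<close>

lemma (in group) conjugation_hom:
  assumes "w \<in> carrier G"
  shows "(\<lambda>x. w \<otimes> x \<otimes> inv w) \<in> hom G G"
  using assms by (intro homI) (simp_all add: m_assoc inv_cancel_left)

text \<open>Axioms for elementary elements and a group \<open>W\<close> of signed permutations,
  where faithfulness of the action is assumed for \<open>W\<close> alone; the section extends it to
  the subgroup that both generate. \<open>E_weyl\<close> ties the two families together. Vectors are
  functions on all of \<open>nat\<close>, and \<open>W\<close> leaves the coordinates from
  \<open>n\<close> on alone, so that one type serves every rank.\<close>

locale steinberg_action = group Q for Q (structure) +
  fixes n :: nat
    and act :: "'a \<Rightarrow> (nat \<Rightarrow> int) \<Rightarrow> (nat \<Rightarrow> int)"
    and E :: "nat \<Rightarrow> nat \<Rightarrow> 'a"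
    and W :: "'a set"
  assumes act_one: "act \<one> v = v"
    and act_mult: "\<lbrakk>g \<in> carrier Q; h \<in> carrier Q\<rbrakk> \<Longrightarrow> act (g \<otimes> h) v = act g (act h v)"
    and E_closed: "\<lbrakk>i < n; j < n; i \<noteq> j\<rbrakk> \<Longrightarrow> E i j \<in> carrier Q"
    and act_E: "\<lbrakk>i < n; j < n; i \<noteq> j\<rbrakk> \<Longrightarrow> act (E i j) v = v(i := v i + v j)"
    and E_commute: "\<lbrakk>i < n; j < n; k < n; l < n; i \<noteq> j; k \<noteq> l; j \<noteq> k; i \<noteq> l\<rbrakk>
      \<Longrightarrow> E i j \<otimes> E k l = E k l \<otimes> E i j"
    and E_steinberg: "\<lbrakk>i < n; j < n; k < n; i \<noteq> j; j \<noteq> k; i \<noteq> k\<rbrakk>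
      \<Longrightarrow> E i j \<otimes> E j k = E j k \<otimes> E i j \<otimes> E i k"
    and E_weyl: "\<lbrakk>i < n; j < n; i \<noteq> j\<rbrakk> \<Longrightarrow> E i j \<otimes> inv (E j i) \<otimes> E i j \<in> W"
    and W_subgroup: "subgroup W Q"
    and W_signed: "w \<in> W \<Longrightarrow> \<exists>\<sigma> s. \<sigma> permutes {..<n} \<and> (\<forall>i. s i \<in> {1, -1})
      \<and> (\<forall>v i. act w v (\<sigma> i) = s i * v i)
      \<and> (\<forall>i j. i < n \<longrightarrow> j < n \<longrightarrow> i \<noteq> j \<longrightarrow> w \<otimes> E i j \<otimes> inv w = E (\<sigma> i) (\<sigma> j) [^] (s i * s j :: int))"
    and act_outside: "\<lbrakk>w \<in> W; n \<le> i\<rbrakk> \<Longrightarrow> act w v i = v i"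
    and W_faithful: "\<lbrakk>w \<in> W; \<And>v. act w v = v\<rbrakk> \<Longrightarrow> w = \<one>"
begin

abbreviation e :: "nat \<Rightarrow> nat \<Rightarrow> int \<Rightarrow> 'a" where "e i j s \<equiv> E i j [^] s"

lemma e_closed: "\<lbrakk>i < n; j < n; i \<noteq> j\<rbrakk> \<Longrightarrow> e i j s \<in> carrier Q"
  by (simp add: E_closed)

lemma e_cancel: "\<lbrakk>i < n; j < n; i \<noteq> j; g \<in> carrier Q\<rbrakk> \<Longrightarrow> e i j s \<otimes> (e i j (- s) \<otimes> g) = g"
   "\<lbrakk>i < n; j < n; i \<noteq> j; g \<in> carrier Q\<rbrakk> \<Longrightarrow> e i j (- s) \<otimes> (e i j s \<otimes> g) = g"
  by (simp_all add: E_closed int_pow_neg flip: m_assoc)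

lemma act_inv: "g \<in> carrier Q \<Longrightarrow> act (inv g) (act g v) = v"
   "g \<in> carrier Q \<Longrightarrow> act g (act (inv g) v) = v"
  by (simp_all add: act_one flip: act_mult)

lemma act_e:
  assumes "i < n" "j < n" "i \<noteq> j"
  shows "act (e i j k) v = v(i := v i + k * v j)"
proof -
  have nat: "act (E i j [^] l) v = v(i := v i + int l * v j)" for l :: nat and v
    using assms
    by (induction l arbitrary: v) (simp_all add: act_one act_mult act_E E_closed algebra_simps)
  show ?thesis
  proof (cases k)
    case (nonneg l)
    then show ?thesis by (simp add: int_pow_int nat)
  next
    case (neg l)
    let ?u = "v(i := v i + k * v j)"
    have "act (E i j [^] Suc l) ?u = v"
      unfolding nat neg using assms(3) by (simp add: algebra_simps)
    then have "act (inv (E i j [^] Suc l)) v = ?u"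
      using act_inv(1)[OF nat_pow_closed[OF E_closed[OF assms]], of "Suc l" ?u] by (simp only:)
    moreover have "e i j k = inv (E i j [^] Suc l)"
      by (simp only: neg int_pow_neg_int[OF E_closed[OF assms]])
    ultimately show ?thesis by simp
  qed
qed

lemma e_commute:
  "\<lbrakk>i < n; j < n; k < n; l < n; i \<noteq> j; k \<noteq> l; j \<noteq> k; i \<noteq> l\<rbrakk>
    \<Longrightarrow> e i j s \<otimes> e k l t = e k l t \<otimes> e i j s"
  by (intro int_pow_commute E_commute E_closed)

lemma e_steinberg:
  assumes "i < n" "j < n" "k < n" "i \<noteq> j" "j \<noteq> k" "i \<noteq> k" "s \<in> {1, -1}" "t \<in> {1, -1}"
  shows "e i j s \<otimes> e j k t = e j k t \<otimes> e i j s \<otimes> e i k (s * t)"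
  using assms by (intro commutator_shift_sign E_steinberg E_commute E_closed) auto

lemma e_weyl:
  assumes "i < n" "j < n" "i \<noteq> j" "s \<in> {1, -1}"
  shows "e i j s \<otimes> e j i (- s) \<otimes> e i j s \<in> W"
proof -
  have "inv (E i j \<otimes> inv (E j i) \<otimes> E i j) \<in> W"
    by (intro subgroup.m_inv_closed[OF W_subgroup] E_weyl assms)
  then have "inv (E i j) \<otimes> E j i \<otimes> inv (E i j) \<in> W"
    using assms by (simp add: E_closed inv_mult_group m_assoc)
  with E_weyl[of i j] show ?thesis
    using assms by (auto simp: int_pow_neg E_closed)
qed

lemma W_closed: "w \<in> W \<Longrightarrow> w \<in> carrier Q"
  using W_subgroup by (rule subgroup.mem_carrier)

text \<open>The signed permutations of the first \<open>k\<close> coordinates: the counterpart of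
  \<open>W\<close> in rank \<open>k\<close> for the induction on the rank.\<close>

definition W_fix :: "nat \<Rightarrow> 'a set" where
  "W_fix k = {w \<in> W. \<forall>v. \<forall>i\<ge>k. act w v i = v i}"

lemma W_fix_subgroup: "subgroup (W_fix k) Q"
proof (rule subgroupI)
  show "W_fix k \<subseteq> carrier Q" using W_closed by (auto simp: W_fix_def)
  have "\<one> \<in> W_fix k"
    using subgroup.one_closed[OF W_subgroup] by (simp add: W_fix_def act_one)
  then show "W_fix k \<noteq> {}" by blast
  fix w assume w: "w \<in> W_fix k"
  have "act (inv w) v i = v i" if "i \<ge> k" for v i
  proof -
    have "act w (act (inv w) v) i = act (inv w) v i"
      using w that by (auto simp: W_fix_def)
    then show ?thesis using w W_closed act_inv(2) by (simp add: W_fix_def)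
  qed
  then show "inv w \<in> W_fix k"
    using w subgroup.m_inv_closed[OF W_subgroup] by (simp add: W_fix_def)
  fix w' assume "w' \<in> W_fix k"
  then show "w \<otimes> w' \<in> W_fix k"
    using w subgroup.m_closed[OF W_subgroup] W_closed by (simp add: W_fix_def act_mult)
qed

lemma W_fix_closed: "w \<in> W_fix k \<Longrightarrow> w \<in> carrier Q"
  using W_closed by (simp add: W_fix_def)

lemma W_fix_signed:
  assumes "w \<in> W_fix k" "k \<le> n"
  obtains \<sigma> s where "\<sigma> permutes {..<k}" "\<And>i. s i \<in> {1, -1}" "\<And>v i. act w v (\<sigma> i) = s i * v i"
    "\<And>i j t. \<lbrakk>i < n; j < n; i \<noteq> j\<rbrakk> \<Longrightarrow> w \<otimes> e i j t = e (\<sigma> i) (\<sigma> j) (s i * s j * t) \<otimes> w"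
    "\<And>i. i \<ge> k \<Longrightarrow> s i = 1"
proof -
  have "w \<in> W" using assms(1) by (simp add: W_fix_def)
  from W_signed[OF this] obtain \<sigma> and s :: "nat \<Rightarrow> int" where ws: "\<sigma> permutes {..<n} \<and> (\<forall>i. s i \<in> {1, -1})
      \<and> (\<forall>v i. act w v (\<sigma> i) = s i * v i)
      \<and> (\<forall>i j. i < n \<longrightarrow> j < n \<longrightarrow> i \<noteq> j \<longrightarrow> w \<otimes> E i j \<otimes> inv w = E (\<sigma> i) (\<sigma> j) [^] (s i * s j :: int))"
    by (elim exE)
  then have \<sigma>: "\<sigma> permutes {..<n}" and s: "\<And>i. s i \<in> {1, -1}"
    and a: "\<And>v i. act w v (\<sigma> i) = s i * v i"
    and c: "\<And>i j. \<lbrakk>i < n; j < n; i \<noteq> j\<rbrakk> \<Longrightarrow> w \<otimes> E i j \<otimes> inv w = e (\<sigma> i) (\<sigma> j) (s i * s j)"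
    by simp_all
  have w: "w \<in> carrier Q" using assms W_fix_closed by blast
  have fixd: "\<sigma> i = i \<and> s i = 1" if "i \<ge> k" for i
  proof -
    obtain j where j: "i = \<sigma> j" using permutes_surj[OF \<sigma>] by blast
    \<comment> \<open>Evaluation at the \<open>i\<close>-th basis vector shows that the preimage
      \<open>j\<close> of a fixed coordinate \<open>i\<close> is \<open>i\<close> itself, with sign
      one.\<close>
    have "s j * basis_vec i j = basis_vec i i"
      using a[of "basis_vec i" j] assms(1) that j by (simp add: W_fix_def)
    then have "j = i" "s j = 1" by (auto simp: basis_vec_def split: if_splits)
    then show ?thesis using j by simp
  qed
  have "\<sigma> permutes {..<k}"
    using fixd by (intro permutes_superset[OF \<sigma>]) auto
  moreover have "w \<otimes> e i j t = e (\<sigma> i) (\<sigma> j) (s i * s j * t) \<otimes> w" if ij: "i < n" "j < n" "i \<noteq> j" for i j t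
  proof -
    have \<sigma>': "\<sigma> i < n" "\<sigma> j < n" "\<sigma> i \<noteq> \<sigma> j"
      using \<sigma> ij permutes_in_image[OF \<sigma>] permutes_inj[OF \<sigma>] by (auto simp: inj_eq)
    have "group_hom Q Q (\<lambda>x. w \<otimes> x \<otimes> inv w)"
      using w conjugation_hom by unfold_locales
    then have "w \<otimes> e i j t \<otimes> inv w = (w \<otimes> E i j \<otimes> inv w) [^] t"
      by (rule group_hom.hom_int_pow) (rule E_closed[OF ij])
    also have "\<dots> = e (\<sigma> i) (\<sigma> j) (s i * s j * t)"
      using c[OF ij] \<sigma>' by (simp add: int_pow_pow E_closed)
    finally show ?thesis
      using w by (simp add: inv_solve_right' e_closed[OF ij] e_closed[OF \<sigma>'])
  qed
  ultimately show ?thesis using that[of \<sigma> s] s a fixd by simp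
qed

end

section \<open>Reduction of vectors with coordinates up to \<open>b\<close>, recorded in the
  group\<close>

locale steinberg_rank = steinberg_action Q n act E W
  for Q (structure) and n act E W +
  fixes b :: nat
  assumes b: "b < n"
begin

text \<open>Candidate for the stabilizer of \<open>basis_vec b\<close> in rank \<open>b + 1\<close>:
  an elementary generator fixes this vector exactly when its source \<open>j\<close> is not
  \<open>b\<close>. That nothing else stabilizes it is the aim of this part.\<close>

definition P :: "'a set" where
  "P = generate Q ({E i j |i j. i \<le> b \<and> j < b \<and> i \<noteq> j} \<union> W_fix b)"

text \<open>A reduction step: the subtraction lowers the absolute value of \<open>v i\<close> by
  exactly that of \<open>v j\<close>, without passing zero.\<close>

definition proper :: "(nat \<Rightarrow> int) \<Rightarrow> nat \<Rightarrow> nat \<Rightarrow> int \<Rightarrow> bool" where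
  "proper v i j s \<longleftrightarrow> i \<le> b \<and> j \<le> b \<and> i \<noteq> j \<and> v j \<noteq> 0 \<and> \<bar>v j\<bar> \<le> \<bar>v i\<bar> \<and> s = sgn (v i) * sgn (v j)"

text \<open>\<open>g\<close> turns \<open>basis_vec b\<close> into a signed basis vector and then
  retraces a reduction path upwards to \<open>v\<close>. Elements of \<open>P\<close> may be
  appended, so \<open>R v\<close> is a union of left cosets of \<open>P\<close>; the goal is that it
  is a single one for every unimodular \<open>v\<close>.\<close>

inductive R :: "(nat \<Rightarrow> int) \<Rightarrow> 'a \<Rightarrow> bool" where
  R_base: "\<lbrakk>w \<in> W_fix (Suc b); p \<in> P\<rbrakk> \<Longrightarrow> R (act w (basis_vec b)) (w \<otimes> p)"
| R_step: "\<lbrakk>proper v i j s; u = v(i := v i - s * v j); R u g\<rbrakk> \<Longrightarrow> R v (e i j s \<otimes> g)"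

definition nrm :: "(nat \<Rightarrow> int) \<Rightarrow> nat" where
  "nrm v = (\<Sum>i\<le>b. nat \<bar>v i\<bar>)"

definition unimodular :: "(nat \<Rightarrow> int) \<Rightarrow> bool" where
  "unimodular v \<longleftrightarrow> (\<forall>i>b. v i = 0) \<and> (\<exists>c. (\<Sum>i\<le>b. c i * v i) = 1)"

definition uniq :: "(nat \<Rightarrow> int) \<Rightarrow> bool" where
  "uniq v \<longleftrightarrow> (\<forall>g h. R v g \<longrightarrow> R v h \<longrightarrow> inv g \<otimes> h \<in> P)"

text \<open>A generator whose source entry vanishes fixes \<open>v\<close>, but no reduction step
  accounts for it. That it preserves \<open>R v\<close> is carried through the induction together
  with \<open>uniq\<close>, because comparing two paths produces such generators.\<close>

definition fixd :: "(nat \<Rightarrow> int) \<Rightarrow> bool" where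
  "fixd v \<longleftrightarrow> (\<forall>i j s g. i \<le> b \<longrightarrow> j \<le> b \<longrightarrow> i \<noteq> j \<longrightarrow> s \<in> {1, -1} \<longrightarrow> v j = 0 \<longrightarrow> R v g \<longrightarrow> R v (e i j s \<otimes> g))"

lemma nrm_upd: "i \<le> b \<Longrightarrow> nrm (v(i := x)) + nat \<bar>v i\<bar> = nrm v + nat \<bar>x\<bar>"
  unfolding nrm_def by (simp add: sum.remove[of "{..b}" i])

lemma properD:
  assumes "proper v i j s"
  shows "i \<le> b" "j \<le> b" "i < n" "j < n" "i \<noteq> j" "j \<noteq> i" "s \<in> {1, -1}" "s * s = 1"
    "v i \<noteq> 0" "v j \<noteq> 0"
    "e i j x \<in> carrier Q" "e j i x \<in> carrier Q"
  using assms b by (auto simp: proper_def sgn_if e_closed)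

lemma proper_abs:
  assumes "proper v i j s"
  shows "s * v j = sgn (v i) * \<bar>v j\<bar>" "\<bar>v i - s * v j\<bar> = \<bar>v i\<bar> - \<bar>v j\<bar>" "\<bar>v j\<bar> \<le> \<bar>v i\<bar>"
  using assms by (auto simp: proper_def sgn_if)

lemma nrm_proper:
  assumes "proper v i j s"
  shows "nrm (v(i := v i - s * v j)) < nrm v"
proof -
  have "\<bar>v j\<bar> > 0" using properD(10)[OF assms] by simp
  then have "nat \<bar>v i - s * v j\<bar> < nat \<bar>v i\<bar>"
    unfolding proper_abs(2)[OF assms] using proper_abs(3)[OF assms] by simp
  then show ?thesis
    using nrm_upd[OF properD(1)[OF assms], of v "v i - s * v j"] by (simp only:)
qed

lemma P_subgroup: "subgroup P Q"
  unfolding P_def using b W_fix_closed by (intro generate_is_subgroup) (auto intro: E_closed)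

lemma P_closed: "p \<in> P \<Longrightarrow> p \<in> carrier Q"
  using P_subgroup by (rule subgroup.mem_carrier)

lemma P_E: "i \<le> b \<Longrightarrow> j < b \<Longrightarrow> i \<noteq> j \<Longrightarrow> e i j s \<in> P"
  by (intro subgroup_int_pow_closed P_subgroup) (auto simp: P_def intro: generate.incl)

lemma P_W: "w \<in> W_fix b \<Longrightarrow> w \<in> P"
  by (auto simp: P_def intro: generate.incl)

lemma W_fix_act_unit:
  assumes "w \<in> W_fix b"
  shows "act w (basis_vec b) = basis_vec b"
proof -
  obtain \<sigma> s where \<sigma>: "\<sigma> permutes {..<b}" and s: "\<And>v i. act w v (\<sigma> i) = s i * v i" "\<And>i. i \<ge> b \<Longrightarrow> s i = 1"
    using W_fix_signed[OF assms] b by (metis less_imp_le)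
  have \<sigma>b: "\<sigma> b = b" using \<sigma> by (simp add: permutes_def)
  show ?thesis
  proof
    fix i
    obtain j where "i = \<sigma> j" using permutes_surj[OF \<sigma>] by blast
    then show "act w (basis_vec b) i = basis_vec b i"
      using s \<sigma>b permutes_inj[OF \<sigma>] by (auto simp: basis_vec_def dest: injD)
  qed
qed

lemma act_P:
  assumes "p \<in> P"
  shows "act p (basis_vec b) = basis_vec b"
proof -
  have gen: "x \<in> carrier Q \<and> act x (basis_vec b) = basis_vec b"
    if "x \<in> {E i j |i j. i \<le> b \<and> j < b \<and> i \<noteq> j} \<union> W_fix b" for x
    using that b by (auto simp: W_fix_act_unit W_fix_closed E_closed act_E) (auto simp: basis_vec_def)
  show ?thesis
    using assms unfolding P_def
  proof (induction rule: generate.induct)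
    case (inv h)
    then show ?case using gen[OF inv] act_inv(1)[of h "basis_vec b"] by simp
  next
    case (eng h1 h2)
    then show ?case using P_closed by (simp add: act_mult P_def)
  qed (use gen in \<open>auto simp: act_one\<close>)
qed

lemma R_act: "R v g \<Longrightarrow> g \<in> carrier Q \<and> act g (basis_vec b) = v"
proof (induction rule: R.induct)
  case (R_base w p)
  then show ?case using W_fix_closed P_closed by (simp add: act_mult act_P)
next
  case (R_step v i j s u g)
  note pr = properD[OF R_step(1)]
  have "act (e i j s \<otimes> g) (basis_vec b) = act (e i j s) (v(i := v i - s * v j))"
    using R_step.IH R_step(2) pr by (simp add: act_mult fun_upd_def)
  also have "\<dots> = v" using pr by (simp add: act_e)
  finally show ?case using pr R_step.IH by simp
qed

lemma R_closed: "R v g \<Longrightarrow> g \<in> carrier Q"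
  using R_act by blast

text \<open>The transposed step applied to the coefficient vector keeps its pairing with the vector
  equal to one.\<close>

lemma unimodular_upd:
  assumes "unimodular (v(i := v i - s * v j))" "i \<le> b" "j \<le> b" "i \<noteq> j"
  shows "unimodular v"
proof -
  obtain c where c: "(\<Sum>k\<le>b. c k * (v(i := v i - s * v j)) k) = 1"
    using assms by (auto simp: unimodular_def)
  have "(\<Sum>k\<le>b. (c(j := c j - c i * s)) k * v k) = (\<Sum>k\<le>b. c k * v k - (if k = j then c i * s * v j else 0))"
    by (intro sum.cong) (auto simp: algebra_simps)
  also have "\<dots> = (\<Sum>k\<le>b. c k * v k) - c i * s * v j"
    using assms by (simp add: sum_subtractf)
  also have "\<dots> = (\<Sum>k\<le>b. c k * v k - (if k = i then c i * s * v j else 0))"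
    using assms by (simp add: sum_subtractf)
  also have "\<dots> = (\<Sum>k\<le>b. c k * (v(i := v i - s * v j)) k)"
    by (intro sum.cong) (auto simp: algebra_simps)
  finally show ?thesis
    using assms c unfolding unimodular_def by (metis fun_upd_other leD)
qed

lemma R_base_cases:
  assumes "w \<in> W_fix (Suc b)"
  obtains k t where "k \<le> b" "t \<in> {1, -1}" "act w (basis_vec b) = (\<lambda>i. if i = k then t else 0)"
proof -
  obtain \<sigma> s where \<sigma>: "\<sigma> permutes {..<Suc b}" and s: "\<And>i. s i \<in> {1, -1}" "\<And>v i. act w v (\<sigma> i) = s i * v i"
    using W_fix_signed[OF assms] b by (metis Suc_leI)
  have "act w (basis_vec b) = (\<lambda>i. if i = \<sigma> b then s b else 0)"
  proof
    fix i
    obtain j where "i = \<sigma> j" using permutes_surj[OF \<sigma>] by blast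
    then show "act w (basis_vec b) i = (if i = \<sigma> b then s b else 0)"
      using s permutes_inj[OF \<sigma>] by (auto simp: basis_vec_def dest: injD)
  qed
  moreover have "\<sigma> b \<le> b" using permutes_in_image[OF \<sigma>, of b] by simp
  ultimately show ?thesis using that s by blast
qed

lemma R_unimodular: "R v g \<Longrightarrow> unimodular v"
proof (induction rule: R.induct)
  case (R_base w p)
  obtain k t where "k \<le> b" "t \<in> {1, -1}" and v: "act w (basis_vec b) = (\<lambda>i. if i = k then t else 0)"
    using R_base_cases[OF R_base(1)] .
  then have "(\<Sum>i\<le>b. (if i = k then t else 0) * (if i = k then t else 0)) = 1"
    by (simp add: if_distrib cong: if_cong) auto
  then show ?case unfolding unimodular_def v using \<open>k \<le> b\<close>
    by (intro conjI exI[of _ "\<lambda>i. if i = k then t else 0"]) auto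
next
  case (R_step v i j s u g)
  then show ?case using unimodular_upd[of v i s j] properD[OF R_step(1)] by blast
qed

lemma R_P: "R v g \<Longrightarrow> p \<in> P \<Longrightarrow> R v (g \<otimes> p)"
proof (induction rule: R.induct)
  case (R_base w q)
  then show ?case
    using R.R_base[of w "q \<otimes> p"] subgroup.m_closed[OF P_subgroup] W_fix_closed P_closed
    by (simp add: m_assoc)
next
  case (R_step v i j s u g)
  have "R v (e i j s \<otimes> (g \<otimes> p))"
    by (rule R.R_step[OF R_step(1,2) R_step.IH[OF R_step.prems]])
  then show ?case
    using properD(11)[OF R_step(1)] R_closed[OF R_step(3)] P_closed[OF R_step.prems] by (simp add: m_assoc)
qed

text \<open>A signed permutation carries proper steps to proper steps and conjugates each recorded
  generator accordingly, so it transports whole reduction paths.\<close>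

lemma R_W:
  assumes "R v g" and w: "w \<in> W_fix (Suc b)"
  shows "R (act w v) (w \<otimes> g)"
proof -
  obtain \<sigma> and s :: "nat \<Rightarrow> int" where \<sigma>: "\<sigma> permutes {..<Suc b}" and s: "\<And>i. s i \<in> {1, -1}"
    and a: "\<And>v i. act w v (\<sigma> i) = s i * v i"
    and c: "\<And>i j t. \<lbrakk>i < n; j < n; i \<noteq> j\<rbrakk> \<Longrightarrow> w \<otimes> e i j t = e (\<sigma> i) (\<sigma> j) (s i * s j * t) \<otimes> w"
    using W_fix_signed[OF w] b by (metis Suc_leI)
  have ss: "s i * s i = 1" "\<bar>s i\<bar> = 1" "s i \<noteq> 0" "sgn (s i) = s i" for i
    using s[of i] by auto
  show ?thesis
    using assms(1)
  proof (induction rule: R.induct)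
    case (R_base w' p)
    then show ?case
      using R.R_base[of "w \<otimes> w'" p] w subgroup.m_closed[OF W_fix_subgroup] W_fix_closed P_closed
      by (simp add: m_assoc act_mult)
  next
    case (R_step v i j t u g)
    note pr = properD[OF R_step(1)]
    have \<sigma>': "\<sigma> i \<le> b" "\<sigma> j \<le> b" "\<sigma> i \<noteq> \<sigma> j"
      using permutes_in_image[OF \<sigma>, of i] permutes_in_image[OF \<sigma>, of j] pr permutes_inj[OF \<sigma>]
      by (auto dest: injD)
    have "proper (act w v) (\<sigma> i) (\<sigma> j) (s i * s j * t)"
      using \<sigma>' R_step(1) by (simp add: proper_def a ss abs_mult sgn_mult)
    moreover have "(act w v)(\<sigma> i := act w v (\<sigma> i) - s i * s j * t * act w v (\<sigma> j)) = act w (v(i := v i - t * v j))"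
    proof
      fix k
      obtain l where l: "k = \<sigma> l" using permutes_surj[OF \<sigma>] by blast
      have "s i * s j * t * (s j * v j) = (s j * s j) * s i * t * v j" by (simp add: algebra_simps)
      then have "s i * v i - s i * s j * t * (s j * v j) = s i * (v i - t * v j)"
        by (simp add: ss algebra_simps)
      then show "((act w v)(\<sigma> i := act w v (\<sigma> i) - s i * s j * t * act w v (\<sigma> j))) k = act w (v(i := v i - t * v j)) k"
        using permutes_inj[OF \<sigma>] by (auto simp: l a dest: injD)
    qed
    ultimately have "R (act w v) (e (\<sigma> i) (\<sigma> j) (s i * s j * t) \<otimes> (w \<otimes> g))"
      using R_step.IH R.R_step R_step(2) by metis
    moreover have "e (\<sigma> i) (\<sigma> j) (s i * s j * t) \<otimes> (w \<otimes> g) = w \<otimes> (e i j t \<otimes> g)"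
      using c[of i j t] pr \<sigma>' b R_closed[OF R_step(3)] W_fix_closed[OF w]
      by (simp add: e_closed flip: m_assoc)
    ultimately show ?case by simp
  qed
qed

section \<open>Independence of the reduction path\<close>

lemma R_transfer:
  assumes "uniq v" "R v g" "R v h" "x \<in> carrier Q" "R v' (x \<otimes> h)"
  shows "R v' (x \<otimes> g)"
proof -
  have "inv h \<otimes> g \<in> P" using assms by (simp add: uniq_def)
  then have "R v' (x \<otimes> h \<otimes> (inv h \<otimes> g))" using R_P assms(5) by blast
  then show ?thesis using assms(4) R_closed[OF assms(2)] R_closed[OF assms(3)]
    by (simp add: m_assoc inv_cancel_left)
qed

text \<open>The pattern of all comparisons below: one element \<open>a\<close> carries both recorded
  elements to the same vector \<open>z\<close>, and uniqueness at \<open>z\<close>, which has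
  smaller norm in every use, settles them.\<close>

lemma uniq_via:
  assumes "uniq z" "a \<in> carrier Q" "g \<in> carrier Q" "h \<in> carrier Q" "R z (a \<otimes> g)" "R z (a \<otimes> h)"
  shows "inv g \<otimes> h \<in> P"
proof -
  have "inv (a \<otimes> g) \<otimes> (a \<otimes> h) \<in> P" using assms by (simp add: uniq_def)
  then show ?thesis using assms by (simp add: inv_mult_group m_assoc inv_cancel_left)
qed

lemma unimodular_proper:
  assumes "proper v i j s" "unimodular v"
  shows "unimodular (v(i := v i - s * v j))"
  using assms(2) properD[OF assms(1)]
  by (intro unimodular_upd[of "v(i := v i - s * v j)" i "- s" j]) simp_all

lemma weyl_W_fix:
  assumes "i \<le> b" "j \<le> b" "i \<noteq> j" "s \<in> {1, -1}"
  shows "e i j s \<otimes> e j i (- s) \<otimes> e i j s \<in> W_fix (Suc b)"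
proof -
  have "i < n" "j < n" using assms b by auto
  then show ?thesis
    using assms by (simp add: W_fix_def e_weyl[of i j s, simplified] act_mult act_e e_closed)
qed

lemma act_weyl:
  assumes "i < n" "j < n" "i \<noteq> j" "s \<in> {1, -1}"
  shows "act (e i j s \<otimes> e j i (- s) \<otimes> e i j s) v = v(i := s * v j, j := - s * v i)"
proof -
  show ?thesis
    using assms(4) by (elim insertE emptyE) (use assms(1-3) in \<open>auto simp: act_mult act_e e_closed fun_eq_iff\<close>)
qed

text \<open>A Weyl element moves the entry at \<open>b\<close> to any other coordinate with either
  sign, which takes a second coordinate to exist.\<close>

lemma R_single:
  assumes "0 < b" "k \<le> b" "t \<in> {1, -1}"
  shows "\<exists>w \<in> W_fix (Suc b). act w (basis_vec b) = (\<lambda>i. if i = k then t else 0)"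
proof -
  have single: "\<exists>w \<in> W_fix (Suc b). act w (basis_vec b) = (\<lambda>i. if i = k then t else 0)"
    if "k < b" "t \<in> {1, -1}" for k t
    using that b weyl_W_fix[of k b t] act_weyl[of k b t "basis_vec b"]
    by (intro bexI[of _ "e k b t \<otimes> e b k (- t) \<otimes> e k b t"]) (auto simp: basis_vec_def fun_eq_iff)
  show ?thesis
  proof (cases "k = b")
    case False
    then show ?thesis using single assms by simp
  next
    case True
    \<comment> \<open>To end at \<open>b\<close> itself with a prescribed sign, the entry makes a
      detour through coordinate 0 by two Weyl elements.\<close>
    obtain w where w: "w \<in> W_fix (Suc b)" "act w (basis_vec b) = (\<lambda>i. if i = 0 then 1 else 0)"
      using single[of 0 1] assms by auto
    let ?x = "e b 0 t \<otimes> e 0 b (- t) \<otimes> e b 0 t"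
    have x: "?x \<in> W_fix (Suc b)" using weyl_W_fix[of b 0 t] assms by simp
    have "act (?x \<otimes> w) (basis_vec b) = (\<lambda>i. if i = k then t else 0)"
      using x w b assms act_weyl[of b 0 t] W_fix_closed True
      by (auto simp: act_mult fun_eq_iff)
    then show ?thesis
      using x w subgroup.m_closed[OF W_fix_subgroup] by blast
  qed
qed

text \<open>Two nonzero entries always admit a proper step, the larger being reduced by the smaller.
  A unimodular vector without proper steps therefore has one nonzero entry, and this entry is a
  unit.\<close>

lemma R_exists:
  assumes "0 < b" "unimodular v"
  shows "\<exists>g. R v g"
  using assms(2)
proof (induction "nrm v" arbitrary: v rule: less_induct)
  case less
  show ?case
  proof (cases "\<exists>i j s. proper v i j s")
    case True
    then obtain i j s where pr: "proper v i j s" by blast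
    then obtain g where "R (v(i := v i - s * v j)) g"
      using less unimodular_proper nrm_proper by blast
    with pr show ?thesis using R_step by blast
  next
    case False
    obtain c where c: "(\<Sum>i\<le>b. c i * v i) = 1" and sup: "\<And>i. i > b \<Longrightarrow> v i = 0"
      using less by (auto simp: unimodular_def)
    have "\<exists>k\<le>b. v k \<noteq> 0"
    proof (rule ccontr)
      assume "\<not> ?thesis"
      then have "(\<Sum>i\<le>b. c i * v i) = 0" by (intro sum.neutral) auto
      with c show False by simp
    qed
    then obtain k where k: "k \<le> b" "v k \<noteq> 0" by blast
    have other: "v i = 0" if "i \<noteq> k" for i
    proof (rule ccontr)
      assume i: "v i \<noteq> 0"
      then have "i \<le> b" using sup by (meson not_le)
      then have "proper v i k (sgn (v i) * sgn (v k)) \<or> proper v k i (sgn (v k) * sgn (v i))"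
        using i k that by (auto simp: proper_def)
      then show False using False by blast
    qed
    have "(\<Sum>i\<le>b. c i * v i) = c k * v k"
      using k other by (subst sum.remove[of _ k]) (auto intro!: sum.neutral)
    then have "v k \<in> {1, -1}" using c by (auto simp: zmult_eq_1_iff)
    from R_single[OF assms(1) k(1) this] obtain w where
      "w \<in> W_fix (Suc b)" "act w (basis_vec b) = (\<lambda>i. if i = k then v k else 0)" by blast
    moreover from this have "act w (basis_vec b) = v" using other by auto
    ultimately show ?thesis using R_base subgroup.one_closed[OF P_subgroup] by metis
  qed
qed

text \<open>The move passes zero, so it is not a step of a path. Instead \<open>v j\<close> is
  reduced by \<open>v i\<close> to reach \<open>u\<close>, a proper step is climbed from
  \<open>u\<close> to \<open>u'\<close>, and a Weyl element turns \<open>u'\<close> into the target.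
  The group element comes out right because the Weyl element absorbs the climb:
  \<open>e i j (- t) \<otimes> e j i t \<otimes> e i j (- t)\<close> times \<open>e i j t\<close> is
  \<open>e i j (- t) \<otimes> e j i t\<close>, and \<open>e j i t\<close> leads from
  \<open>u\<close> back to \<open>v\<close>.\<close>

lemma R_move_improper:
  assumes uv: "uniq v" and R: "R v g" and ij: "i \<le> b" "j \<le> b" "i \<noteq> j"
    and v: "v i \<noteq> 0" "v j \<noteq> 0" "\<bar>v i\<bar> < \<bar>v j\<bar>" "\<bar>v j\<bar> \<le> 2 * \<bar>v i\<bar>"
    and s: "s = - (sgn (v i) * sgn (v j))"
  shows "R (v(i := v i + s * v j)) (e i j s \<otimes> g)"
proof -
  have ijn: "i < n" "j < n" using ij b by auto
  have cl: "e i j x \<in> carrier Q" "e j i x \<in> carrier Q" for x using ijn ij by (simp_all add: e_closed)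
  define t where "t = sgn (v i) * sgn (v j)"
  have t: "t \<in> {1, -1}" "t * t = 1" using v by (auto simp: t_def sgn_if)
  have st: "s = - t" by (simp add: s t_def)
  define u where "u = v(j := v j - t * v i)"
  define u' where "u' = u(i := u i + t * u j)"
  have pr: "proper v j i t" using ij v by (auto simp: proper_def t_def)
  have u'_ij: "u' i = t * v j" "u' j = v j - t * v i"
    using ij t(2) by (simp_all add: u'_def u_def algebra_simps)
  have "\<bar>v j - t * v i\<bar> = \<bar>v j\<bar> - \<bar>v i\<bar>" "sgn (v j - t * v i) = sgn (v j)"
    using v by (auto simp: t_def sgn_if split: if_splits)
  then have pr': "proper u' i j t"
    using ij v t by (auto simp: proper_def u'_ij abs_mult sgn_mult)
  have u: "u = u'(i := u' i - t * u' j)"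
    using ij by (auto simp: u'_def)
  obtain g' where g': "R u g'"
    using R_exists unimodular_proper[OF pr R_unimodular[OF R]] ij unfolding u_def by fastforce
  have g'c: "g' \<in> carrier Q" using R_closed[OF g'] .
  have h: "R v (e j i t \<otimes> g')"
    using R_step[OF pr _ g'] u_def by simp
  have "R u' (e i j t \<otimes> g')"
    using R_step[OF pr' u g'] .
  let ?w = "e i j (- t) \<otimes> e j i t \<otimes> e i j (- t)"
  have "?w \<in> W_fix (Suc b)" using weyl_W_fix[of i j "- t"] ij t by auto
  from R_W[OF \<open>R u' _\<close> this] have w: "R (act ?w u') (e i j (- t) \<otimes> (e j i t \<otimes> g'))"
    using cl g'c e_cancel(2)[OF ijn ij(3) g'c] by (simp add: m_assoc)
  moreover have "act ?w u' = v(i := v i + s * v j)"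
    using R_act[OF h] R_act[OF w] R_closed[OF h] cl by (simp add: act_mult act_e ijn ij st)
  ultimately have "R (v(i := v i + s * v j)) (e i j s \<otimes> (e j i t \<otimes> g'))"
    by (simp add: st)
  then show ?thesis using R_transfer[OF uv R h] cl by blast
qed

text \<open>A move that climbs is a step by definition. A move that descends is inverse to a step,
  and uniqueness at \<open>v\<close> supplies the equality of cosets. A move through zero is an
  instance of \<open>R_move_improper\<close> at one of its two ends, and a move with zero source is
  the content of \<open>fixd\<close>.\<close>

lemma R_move:
  assumes uv: "uniq v" and fv: "fixd v" and uv': "uniq (v(i := v i + s * v j))"
    and R: "R v g" and ij: "i \<le> b" "j \<le> b" "i \<noteq> j" and s: "s \<in> {1, -1}"
  shows "R (v(i := v i + s * v j)) (e i j s \<otimes> g)"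
proof -
  have ijn: "i < n" "j < n" "0 < b" using ij b by auto
  have cl: "e i j x \<in> carrier Q" "e j i x \<in> carrier Q" for x using ijn ij by (simp_all add: e_closed)
  have gc: "g \<in> carrier Q" using R_closed[OF R] .
  define v' where "v' = v(i := v i + s * v j)"
  have v: "v = v'(i := v' i - s * v' j)" using ij by (auto simp: v'_def)
  have "unimodular v'"
    using unimodular_upd[of v' i s j] R_unimodular[OF R] ij v by simp
  then obtain h where h: "R v' h" using R_exists ijn by blast
  have hc: "h \<in> carrier Q" using R_closed[OF h] .
  consider (zero) "v j = 0" | (up) "v j \<noteq> 0" "proper v' i j s"
    | (down) "v j \<noteq> 0" "proper v i j (- s)"
    | (improper) "v i \<noteq> 0" "v j \<noteq> 0" "\<bar>v i\<bar> < \<bar>v j\<bar>" "\<bar>v j\<bar> \<le> 2 * \<bar>v i\<bar>" "s = - (sgn (v i) * sgn (v j))"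
    | (improper') "v' i \<noteq> 0" "v' j \<noteq> 0" "\<bar>v' i\<bar> < \<bar>v' j\<bar>" "\<bar>v' j\<bar> \<le> 2 * \<bar>v' i\<bar>" "- s = - (sgn (v' i) * sgn (v' j))"
  proof -
    have "v' i = v i + s * v j" "v' j = v j" using ij by (auto simp: v'_def)
    then have "v j = 0 \<or> (v j \<noteq> 0 \<and> proper v' i j s) \<or> (v j \<noteq> 0 \<and> proper v i j (- s))
      \<or> (v i \<noteq> 0 \<and> v j \<noteq> 0 \<and> \<bar>v i\<bar> < \<bar>v j\<bar> \<and> \<bar>v j\<bar> \<le> 2 * \<bar>v i\<bar> \<and> s = - (sgn (v i) * sgn (v j)))
      \<or> (v' i \<noteq> 0 \<and> v' j \<noteq> 0 \<and> \<bar>v' i\<bar> < \<bar>v' j\<bar> \<and> \<bar>v' j\<bar> \<le> 2 * \<bar>v' i\<bar> \<and> - s = - (sgn (v' i) * sgn (v' j)))"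
      using s ij move_cases[OF s, of "v j" "v i"] unfolding proper_def by (cases "v j = 0") simp_all
    then show ?thesis using that by blast
  qed
  then have "R v' (e i j s \<otimes> g)"
  proof cases
    case zero
    then have "R v (e i j s \<otimes> g)" using fv R ij s unfolding fixd_def by blast
    with zero show ?thesis by (simp add: v'_def)
  next
    case up
    then show ?thesis using R_step[OF up(2) v R] by simp
  next
    case down
    have "R v (e i j (- s) \<otimes> h)"
      using R_step[OF down(2) _ h] by (simp add: v'_def)
    moreover have "R v' (e i j s \<otimes> (e i j (- s) \<otimes> h))"
      using h hc ijn ij by (simp add: e_cancel)
    ultimately show ?thesis using R_transfer[OF uv R] cl by blast
  next
    case improper
    then show ?thesis using R_move_improper[OF uv R ij] by (simp add: v'_def)
  next
    case improper'
    have "R (v'(i := v' i + - s * v' j)) (e i j (- s) \<otimes> h)"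
      using R_move_improper[OF uv'[folded v'_def] h ij improper'] .
    then have "R v (e i j (- s) \<otimes> h)" using v by simp
    moreover have "R v' (e i j s \<otimes> (e i j (- s) \<otimes> h))"
      using h hc ijn ij by (simp add: e_cancel)
    ultimately show ?thesis using R_transfer[OF uv R] cl by blast
  qed
  then show ?thesis by (simp add: v'_def)
qed

text \<open>The two steps commute and complete to a square with fourth vertex \<open>z\<close>. The
  sides at \<open>z\<close> need not be reduction steps, because \<open>R_move\<close> works in both
  directions; only \<open>z\<close> must have smaller norm than \<open>v\<close>. For a common
  target \<open>i = k\<close> the last assumption ensures this.\<close>

lemma uniq_commuting:
  assumes small: "\<And>u. nrm u < nrm v \<Longrightarrow> uniq u \<and> fixd u"
    and p1: "proper v i j s" and R1: "R (v(i := v i - s * v j)) g1"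
    and p2: "proper v k l t" and R2: "R (v(k := v k - t * v l)) g2"
    and ne: "i \<noteq> l" "j \<noteq> k" and ik: "i = k \<longrightarrow> \<bar>v j\<bar> + \<bar>v l\<bar> < 2 * \<bar>v i\<bar>"
  shows "inv (e i j s \<otimes> g1) \<otimes> (e k l t \<otimes> g2) \<in> P"
proof -
  note pr1 = properD[OF p1] and pr2 = properD[OF p2]
  note cl = pr1(11,12) pr2(11,12) and cancel = e_cancel[OF pr1(3-5)] e_cancel[OF pr2(3-5)]
  define u1 where "u1 = v(i := v i - s * v j)"
  define u2 where "u2 = v(k := v k - t * v l)"
  define z where "z = u1(k := u1 k - t * u1 l)"
  have z': "z = u2(i := u2 i - s * u2 j)"
    using ne by (auto simp: z_def u1_def u2_def)
  have "nrm z < nrm v"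
  proof (cases "i = k")
    case False
    then have "proper u1 k l t \<or> u1 l = 0"
      using ne p2 by (auto simp: proper_def u1_def)
    then have "nrm z \<le> nrm u1"
      using nrm_proper[of u1 k l t] by (auto simp: z_def)
    then show ?thesis using nrm_proper[OF p1] by (simp add: u1_def)
  next
    case True
    have "z = v(i := v i - s * v j - t * v l)"
      using True ne by (auto simp: z_def u1_def)
    moreover have "\<bar>v i - s * v j - t * v l\<bar> < \<bar>v i\<bar>"
    proof -
      have "0 < \<bar>v j\<bar> + \<bar>v l\<bar>" using pr1(10) by linarith
      from abs_diff_sgn_less[OF this] show ?thesis
        using proper_abs(1)[OF p1] proper_abs(1)[OF p2] ik True
        by (simp add: distrib_left flip: diff_diff_eq)
    qed
    ultimately show ?thesis
      using nrm_upd[OF pr1(1), of v "v i - s * v j - t * v l"] by (simp only:)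
  qed
  then have small': "uniq z" "uniq u1" "fixd u1" "uniq u2" "fixd u2"
    using small nrm_proper[OF p1] nrm_proper[OF p2] by (simp_all add: u1_def u2_def)
  have g: "g1 \<in> carrier Q" "g2 \<in> carrier Q" using R1 R2 R_closed by blast+
  have ze: "z = u1(k := u1 k + - t * u1 l)" "z = u2(i := u2 i + - s * u2 j)"
    by (simp add: z_def, simp add: z')
  have a1: "R z (e k l (- t) \<otimes> g1)"
    unfolding ze(1)
    by (rule R_move[OF small'(2,3) small'(1)[unfolded ze(1)] R1[folded u1_def]]) (use pr2(1,2,5,7) in auto)
  have a2: "R z (e i j (- s) \<otimes> g2)"
    unfolding ze(2)
    by (rule R_move[OF small'(4,5) small'(1)[unfolded ze(2)] R2[folded u2_def]]) (use pr1(1,2,5,7) in auto)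
  have comm: "e i j (- s) \<otimes> e k l (- t) = e k l (- t) \<otimes> e i j (- s)"
    by (rule e_commute) (use pr1(3-6) pr2(3-6) ne in auto)
  show ?thesis
  proof (rule uniq_via[OF small'(1)])
    show "R z (e k l (- t) \<otimes> e i j (- s) \<otimes> (e i j s \<otimes> g1))"
      using a1 g cl by (simp add: m_assoc cancel)
    show "R z (e k l (- t) \<otimes> e i j (- s) \<otimes> (e k l t \<otimes> g2))"
      unfolding comm[symmetric] using a2 g cl by (simp add: m_assoc cancel)
  qed (use g cl in simp_all)
qed

text \<open>Both steps clear the entry \<open>i\<close> and lead to the same vector
  \<open>u\<close>, so \<open>e i j (- s) \<otimes> e i l t\<close> fixes \<open>u\<close> and must
  be seen to preserve its coset. By the Steinberg relation it is the conjugate of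
  \<open>e i j (- s)\<close> by \<open>e j l r\<close>. As \<open>u\<close> has entries of equal
  size at \<open>j\<close> and \<open>l\<close>, undoing \<open>e j l r\<close> leads to a vector
  \<open>y\<close> with \<open>y j = 0\<close>, where \<open>fixd\<close> applies.\<close>

lemma uniq_same_target:
  assumes small: "\<And>u. nrm u < nrm v \<Longrightarrow> uniq u \<and> fixd u"
    and p1: "proper v i j s" and R1: "R (v(i := v i - s * v j)) g1"
    and p2: "proper v i l t" and R2: "R (v(i := v i - t * v l)) g2"
    and ne: "j \<noteq> l" and eq: "\<bar>v j\<bar> = \<bar>v i\<bar>" "\<bar>v l\<bar> = \<bar>v i\<bar>"
  shows "inv (e i j s \<otimes> g1) \<otimes> (e i l t \<otimes> g2) \<in> P"
proof -
  note pr1 = properD[OF p1] and pr2 = properD[OF p2]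
  note cl = pr1(11,12) pr2(11,12) and cancel = e_cancel[OF pr1(3-5)] e_cancel[OF pr2(3-5)]
  define u where "u = v(i := 0)"
  have "v i - s * v j = 0" "v i - t * v l = 0"
    using proper_abs(2)[OF p1] proper_abs(2)[OF p2] eq by auto
  then have R1: "R u g1" and R2: "R u g2" and nu: "nrm u < nrm v"
    using R1 R2 nrm_proper[OF p1] by (simp_all add: u_def)
  define r where "r = s * t"
  have p3: "proper u j l r"
    using p1 p2 ne eq by (auto simp: proper_def u_def r_def sgn_if)
  note pr3 = properD[OF p3]
  define y where "y = u(j := u j - r * u l)"
  have ny: "nrm y < nrm u" using nrm_proper[OF p3] by (simp add: y_def)
  have "0 < b" using pr1 by auto
  then obtain h where h: "R y h"
    using R_exists unimodular_proper[OF p3 R_unimodular[OF R1]] unfolding y_def by blast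
  have yj: "y j = 0"
    using proper_abs(2)[OF p3] eq pr1(5) pr2(5) ne by (simp add: y_def u_def)
  have hc: "h \<in> carrier Q" "g1 \<in> carrier Q" "g2 \<in> carrier Q" using h R1 R2 R_closed by blast+
  have "R y (e i j (- s) \<otimes> h)"
    using small[of y] ny nu yj h pr1(1,2,5,7) unfolding fixd_def by auto
  then have 1: "R u (e j l r \<otimes> (e i j (- s) \<otimes> h))"
    using R_step[OF p3] y_def by blast
  have 2: "R u (e j l r \<otimes> h)"
    using R_step[OF p3 _ h] y_def by blast
  have st: "- s * r = - t" using pr1 by (simp add: r_def)
  have c1: "e i j (- s) \<otimes> e j l r = e j l r \<otimes> e i j (- s) \<otimes> e i l (- t)"
    unfolding st[symmetric] by (rule e_steinberg) (use pr1(3-7) pr2(4-7) pr3(7) ne in auto)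
  have c2: "e i l (- t) \<otimes> e i l t = \<one>"
    using cancel(4)[of \<one>] cl by simp
  have c3: "e i l t \<otimes> e j l r = e j l r \<otimes> e i l t"
    by (rule e_commute) (use pr1(3-6) pr2(4-6) ne in auto)
  have "e i j (- s) \<otimes> e i l t \<otimes> (e j l r \<otimes> h) = e i j (- s) \<otimes> (e i l t \<otimes> e j l r) \<otimes> h"
    using hc cl pr3(11) by (simp add: m_assoc)
  also have "\<dots> = (e i j (- s) \<otimes> e j l r) \<otimes> e i l t \<otimes> h"
    unfolding c3 using hc cl pr3(11) by (simp add: m_assoc)
  also have "\<dots> = e j l r \<otimes> e i j (- s) \<otimes> (e i l (- t) \<otimes> e i l t) \<otimes> h"
    unfolding c1 using hc cl pr3(11) by (simp add: m_assoc)
  also have "\<dots> = e j l r \<otimes> (e i j (- s) \<otimes> h)"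
    unfolding c2 using hc cl pr3(11) by (simp add: m_assoc)
  finally have "R u (e i j (- s) \<otimes> e i l t \<otimes> (e j l r \<otimes> h))"
    using 1 by simp
  then have 3: "R u (e i j (- s) \<otimes> e i l t \<otimes> g2)"
    using R_transfer[OF _ R2 2] small[OF nu] cl by blast
  show ?thesis
  proof (rule uniq_via[of u "e i j (- s)"])
    show "R u (e i j (- s) \<otimes> (e i j s \<otimes> g1))" using R1 hc cl by (simp add: cancel)
    show "R u (e i j (- s) \<otimes> (e i l t \<otimes> g2))" using 3 hc cl by (simp add: m_assoc)
  qed (use small[OF nu] hc cl in simp_all)
qed

text \<open>The target of the first step is the source of the second. The Steinberg relation closes
  the two steps to a pentagon \<open>v\<close>, \<open>u1\<close>, \<open>y\<close>,
  \<open>z\<close>, \<open>u2\<close>, whose extra side is a move of \<open>k\<close> by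
  \<open>j\<close>.\<close>

lemma uniq_chain:
  assumes small: "\<And>u. nrm u < nrm v \<Longrightarrow> uniq u \<and> fixd u"
    and p1: "proper v i j s" and R1: "R (v(i := v i - s * v j)) g1"
    and p2: "proper v k i t" and R2: "R (v(k := v k - t * v i)) g2"
    and ne: "j \<noteq> k"
  shows "inv (e i j s \<otimes> g1) \<otimes> (e k i t \<otimes> g2) \<in> P"
proof -
  note pr1 = properD[OF p1] and pr2 = properD[OF p2]
  note cl = pr1(11,12) pr2(11,12) and cancel = e_cancel[OF pr1(3-5)] e_cancel[OF pr2(3-5)]
  define u1 where "u1 = v(i := v i - s * v j)"
  define u2 where "u2 = v(k := v k - t * v i)"
  define y where "y = u1(k := u1 k - t * u1 i)"
  define z where "z = u2(i := u2 i - s * u2 j)"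
  have z': "z = y(k := y k + - (t * s) * y j)"
    using ne pr1(5,6) pr2(5,6) by (simp add: fun_eq_iff z_def y_def u1_def u2_def algebra_simps)
  have "nrm u1 < nrm v" "nrm u2 < nrm v"
    using nrm_proper[OF p1] nrm_proper[OF p2] by (simp_all add: u1_def u2_def)
  moreover have "nrm z < nrm v"
  proof -
    have "\<bar>v i - s * v j\<bar> \<le> \<bar>v i\<bar>" using proper_abs[OF p1] by linarith
    then have "nrm z \<le> nrm u2"
      using nrm_upd[of i u2 "v i - s * v j"] ne pr1(1,5) pr2(5) by (simp add: z_def u2_def)
    then show ?thesis using \<open>nrm u2 < nrm v\<close> by simp
  qed
  moreover have "nrm y < nrm v"
  proof -
    \<comment> \<open>The subtracted amount has the sign of \<open>v k\<close>, and its size is the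
      difference of the sizes of \<open>v i\<close> and \<open>v j\<close>, which lies between 0 and
      the size of \<open>v k\<close>; so the entry does not grow.\<close>
    have "\<bar>v k - t * (v i - s * v j)\<bar> \<le> \<bar>v k\<bar>"
    proof -
      have "t * sgn (v i) = sgn (v k)" "t * v i = sgn (v k) * \<bar>v i\<bar>"
        using p2 pr1(9) proper_abs(1)[OF p2] by (auto simp: proper_def sgn_if)
      then have "t * (v i - s * v j) = sgn (v k) * (\<bar>v i\<bar> - \<bar>v j\<bar>)"
        unfolding proper_abs(1)[OF p1] by (simp add: right_diff_distrib flip: mult.assoc)
      then show ?thesis
        using proper_abs(3)[OF p1] proper_abs(3)[OF p2] abs_diff_sgn_le[of "\<bar>v i\<bar> - \<bar>v j\<bar>" "v k"]
        by simp
    qed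
    then have "nrm y \<le> nrm u1"
      using nrm_upd[of k u1 "v k - t * (v i - s * v j)"] ne pr1(5) pr2(1,5) by (simp add: y_def u1_def)
    then show ?thesis using \<open>nrm u1 < nrm v\<close> by simp
  qed
  ultimately have small': "uniq z" "uniq u1" "fixd u1" "uniq u2" "fixd u2" "uniq y" "fixd y"
    using small by simp_all
  have g: "g1 \<in> carrier Q" "g2 \<in> carrier Q" using R1 R2 R_closed by blast+
  have clk: "e k j x \<in> carrier Q" for x using ne pr1(4) pr2(3) by (simp add: e_closed)
  have ze: "z = u2(i := u2 i + - s * u2 j)" and ye: "y = u1(k := u1 k + - t * u1 i)"
    by (simp_all add: z_def y_def)
  have a2: "R z (e i j (- s) \<otimes> g2)"
    unfolding ze
    by (rule R_move[OF small'(4,5) small'(1)[unfolded ze] R2[folded u2_def]]) (use pr1(1,2,5,7) in auto)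
  have "R y (e k i (- t) \<otimes> g1)"
    unfolding ye
    by (rule R_move[OF small'(2,3) small'(6)[unfolded ye] R1[folded u1_def]]) (use pr2(1,2,5,7) in auto)
  then have a1: "R z (e k j (- (t * s)) \<otimes> (e k i (- t) \<otimes> g1))"
    unfolding z'
    by (rule R_move[OF small'(6,7) small'(1)[unfolded z']]) (use pr1(1,2,7) pr2(1,7) ne in auto)
  have c1: "e k i (- t) \<otimes> e i j s = e i j s \<otimes> e k i (- t) \<otimes> e k j (- t * s)"
    by (rule e_steinberg) (use pr1(3-7) pr2(3-7) ne in auto)
  have c2: "e k i (- t) \<otimes> e k j (- t * s) = e k j (- t * s) \<otimes> e k i (- t)"
    by (rule e_commute) (use pr1(3-6) pr2(3-6) ne in auto)
  have "e i j (- s) \<otimes> e k i (- t) \<otimes> (e i j s \<otimes> g1) = e i j (- s) \<otimes> (e k i (- t) \<otimes> e i j s) \<otimes> g1"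
    using g cl by (simp add: m_assoc)
  also have "\<dots> = e i j (- s) \<otimes> (e i j s \<otimes> ((e k i (- t) \<otimes> e k j (- t * s)) \<otimes> g1))"
    unfolding c1 using g cl clk by (simp add: m_assoc)
  also have "\<dots> = e k j (- t * s) \<otimes> (e k i (- t) \<otimes> g1)"
    unfolding c2 using g cl clk by (simp add: m_assoc cancel)
  finally have a1': "R z (e i j (- s) \<otimes> e k i (- t) \<otimes> (e i j s \<otimes> g1))"
    using a1 by simp
  show ?thesis
  proof (rule uniq_via[OF small'(1) _ _ _ a1'])
    show "R z (e i j (- s) \<otimes> e k i (- t) \<otimes> (e k i t \<otimes> g2))"
      using a2 g cl by (simp add: m_assoc cancel)
  qed (use g cl in simp_all)
qed

text \<open>Both steps are possible only if the two entries agree in absolute value, so one path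
  clears \<open>i\<close> and the other clears \<open>j\<close>. A Weyl element exchanges the two
  results, and up to a generator with vanishing source it is the passage from one path to the
  other.\<close>

lemma uniq_opposite:
  assumes small: "\<And>u. nrm u < nrm v \<Longrightarrow> uniq u \<and> fixd u"
    and p1: "proper v i j s" and R1: "R (v(i := v i - s * v j)) g1"
    and p2: "proper v j i t" and R2: "R (v(j := v j - t * v i)) g2"
  shows "inv (e i j s \<otimes> g1) \<otimes> (e j i t \<otimes> g2) \<in> P"
proof -
  note pr1 = properD[OF p1] and pr2 = properD[OF p2]
  note cl = pr1(11,12) pr2(11,12) and cancel = e_cancel[OF pr1(3-5)] e_cancel[OF pr2(3-5)]
  have "s = sgn (v i) * sgn (v j)" using p1 unfolding proper_def by (elim conjE)
  moreover have "t = sgn (v j) * sgn (v i)" using p2 unfolding proper_def by (elim conjE)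
  ultimately have ts: "t = s" by (simp only: mult.commute)
  have z: "v i - s * v j = 0" "v j - s * v i = 0"
  proof -
    have "\<bar>v i\<bar> = \<bar>v j\<bar>" using proper_abs(3)[OF p1] proper_abs(3)[OF p2] by simp
    then have "\<bar>v i - s * v j\<bar> = 0" "\<bar>v j - s * v i\<bar> = 0"
      using proper_abs(2)[OF p1] proper_abs(2)[OF p2] by (simp_all only: ts)
    then show "v i - s * v j = 0" "v j - s * v i = 0" by simp_all
  qed
  define u where "u = v(j := 0)"
  have R1: "R (v(i := 0)) g1" and R2: "R u g2" and nu: "nrm u < nrm v"
    using R1 R2 nrm_proper[OF p2] unfolding ts z u_def by simp_all
  have g: "g1 \<in> carrier Q" "g2 \<in> carrier Q" using R1 R2 R_closed by blast+
  let ?w = "e i j s \<otimes> e j i (- s) \<otimes> e i j s"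
  have w: "?w \<in> W_fix (Suc b)" by (rule weyl_W_fix[OF pr1(1,2,5,7)])
  have "act ?w (v(i := 0)) = u"
    using act_weyl[OF pr1(3-5,7)] z pr1(5) by (auto simp: u_def fun_eq_iff)
  then have "R u (?w \<otimes> g1)" using R_W[OF R1 w] by simp
  then have "R u (e i j (- s) \<otimes> (?w \<otimes> g1))"
    using small[OF nu] pr1(1,2,5,7) unfolding fixd_def u_def by auto
  moreover have "e i j (- s) \<otimes> (?w \<otimes> g1) = e j i (- s) \<otimes> (e i j s \<otimes> g1)"
    using g cl by (simp add: m_assoc cancel)
  ultimately have a1: "R u (e j i (- s) \<otimes> (e i j s \<otimes> g1))" by simp
  show ?thesis
  proof (rule uniq_via[OF _ _ _ _ a1])
    show "R u (e j i (- s) \<otimes> (e j i t \<otimes> g2))"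
      using R2 g cl by (simp add: cancel ts[symmetric])
  qed (use small[OF nu] g cl in simp_all)
qed

text \<open>The generators of two first steps commute unless the target of one is the source of the
  other. For a common target the square of \<open>uniq_commuting\<close> fails to lower the norm
  only when both sources match the target in absolute value.\<close>

lemma uniq_steps:
  assumes small: "\<And>u. nrm u < nrm v \<Longrightarrow> uniq u \<and> fixd u"
    and p1: "proper v i j s" and R1: "R (v(i := v i - s * v j)) g1"
    and p2: "proper v k l t" and R2: "R (v(k := v k - t * v l)) g2"
  shows "inv (e i j s \<otimes> g1) \<otimes> (e k l t \<otimes> g2) \<in> P"
proof -
  note pr1 = properD[OF p1] and pr2 = properD[OF p2]
  have g: "g1 \<in> carrier Q" "g2 \<in> carrier Q" using R1 R2 R_closed by blast+
  consider (same) "i = k" "j = l" | (target) "i = k" "j \<noteq> l" "\<bar>v j\<bar> = \<bar>v i\<bar>" "\<bar>v l\<bar> = \<bar>v i\<bar>"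
    | (comm) "i \<noteq> l" "j \<noteq> k" "i = k \<longrightarrow> \<bar>v j\<bar> + \<bar>v l\<bar> < 2 * \<bar>v i\<bar>"
    | (chain) "i = l" "j \<noteq> k" | (chain') "i \<noteq> l" "j = k" | (opp) "i = l" "j = k"
  proof (cases "i = k")
    case True
    have "\<bar>v j\<bar> + \<bar>v l\<bar> < 2 * \<bar>v i\<bar> \<or> (\<bar>v j\<bar> = \<bar>v i\<bar> \<and> \<bar>v l\<bar> = \<bar>v i\<bar>)"
      using proper_abs(3)[OF p1] proper_abs(3)[OF p2] unfolding True by linarith
    then show ?thesis using that(1,2,3) True pr1(5) pr2(5) by blast
  qed (use that in blast)
  then show ?thesis
  proof cases
    case same
    have "s = t" using p1 p2 same unfolding proper_def by simp
    then have R2': "R (v(i := v i - s * v j)) g2" using R2 same by simp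
    show ?thesis
      using uniq_via[of "v(i := v i - s * v j)" "e i j (- s)" "e i j s \<otimes> g1" "e k l t \<otimes> g2"]
        small[OF nrm_proper[OF p1]] e_cancel(2)[OF pr1(3-5)] g pr1(11) R1 R2' same \<open>s = t\<close>
      by simp
  next
    case target
    show ?thesis
      using uniq_same_target[OF small p1 R1 _ _ target(2-4)] p2 R2 target(1) by simp
  next
    case comm
    show ?thesis
      by (rule uniq_commuting[OF small p1 R1 p2 R2 comm])
  next
    case chain
    show ?thesis
      using uniq_chain[OF small p1 R1 _ _ chain(2)] p2 R2 chain(1) by simp
  next
    case chain'
    have "inv (e k l t \<otimes> g2) \<otimes> (e i j s \<otimes> g1) \<in> P"
      using uniq_chain[OF small p2 R2 _ _ chain'(1)[symmetric]] p1 R1 chain'(2) by simp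
    then have "inv (inv (e k l t \<otimes> g2) \<otimes> (e i j s \<otimes> g1)) \<in> P"
      by (rule subgroup.m_inv_closed[OF P_subgroup])
    then show ?thesis
      using g pr1(11) pr2(11) by (simp add: inv_mult_group m_assoc)
  next
    case opp
    show ?thesis
      using uniq_opposite[OF small p1 R1] p2 R2 opp by simp
  qed
qed

text \<open>The quotient of the two signed permutations fixes \<open>basis_vec b\<close>, hence
  coordinate \<open>b\<close> with its sign, and so lies in \<open>W_fix b\<close>.\<close>

lemma uniq_base:
  assumes "w \<in> W_fix (Suc b)" "w' \<in> W_fix (Suc b)" "act w (basis_vec b) = act w' (basis_vec b)" "p \<in> P" "p' \<in> P"
  shows "inv (w \<otimes> p) \<otimes> (w' \<otimes> p') \<in> P"
proof -
  have wc: "w \<in> carrier Q" "w' \<in> carrier Q" "p \<in> carrier Q" "p' \<in> carrier Q"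
    using assms W_fix_closed P_closed by blast+
  define x where "x = inv w \<otimes> w'"
  have x: "x \<in> W_fix (Suc b)"
    using subgroup.m_closed[OF W_fix_subgroup] subgroup.m_inv_closed[OF W_fix_subgroup] assms by (simp add: x_def)
  have xb: "act x (basis_vec b) = basis_vec b"
    using wc by (simp add: x_def act_mult flip: assms(3)) (simp add: act_inv)
  obtain \<sigma> and s :: "nat \<Rightarrow> int" where \<sigma>: "\<sigma> permutes {..<Suc b}" "\<And>i. s i \<in> {1, -1}" "\<And>v i. act x v (\<sigma> i) = s i * v i"
    using W_fix_signed[OF x] b by (metis Suc_leI)
  have "s b * basis_vec b b = basis_vec b (\<sigma> b)"
    using \<sigma>(3)[of "basis_vec b" b] xb by simp
  then have sb: "\<sigma> b = b" "s b = 1" using \<sigma>(2)[of b] by (auto simp: basis_vec_def split: if_splits)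
  have "act x v b = v b" for v using \<sigma>(3)[of v b] sb by simp
  then have "x \<in> W_fix b"
    using x unfolding W_fix_def by (auto simp: le_Suc_eq Suc_le_eq dest: le_neq_implies_less)
  then have "inv p \<otimes> (x \<otimes> p') \<in> P"
    using P_W assms subgroup.m_closed[OF P_subgroup] subgroup.m_inv_closed[OF P_subgroup] by simp
  then show ?thesis using wc by (simp add: x_def inv_mult_group m_assoc)
qed

text \<open>A signed basis vector has a single nonzero entry and hence no proper step, so the two
  ways to build \<open>R v\<close> never meet at one vector.\<close>

lemma R_cases_split:
  assumes "R v g"
  obtains (base) w p where "w \<in> W_fix (Suc b)" "p \<in> P" "v = act w (basis_vec b)" "g = w \<otimes> p"
      "\<And>i j s. \<not> proper v i j s"
    | (step) i j s h where "proper v i j s" "R (v(i := v i - s * v j)) h" "g = e i j s \<otimes> h"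
proof (cases rule: R.cases[OF assms])
  case (1 w p)
  obtain k t where "v = (\<lambda>i. if i = k then t else 0)"
    using R_base_cases[OF 1(3)] 1(1) by blast
  then have "\<not> proper v i j s" for i j s
    by (auto simp: proper_def)
  then show ?thesis using 1 base by blast
next
  case (2 v' i j s u h)
  then show ?thesis using step by blast
qed

text \<open>Induction on the norm, as in the proof that local confluence implies confluence: only
  the first steps of two paths are compared, and the rest is covered by smaller vectors.\<close>

theorem uniq_fixd: "uniq v \<and> fixd v"
proof (induction "nrm v" arbitrary: v rule: less_induct)
  case less
  note small = less
  have "inv g \<otimes> h \<in> P" if gh: "R v g" "R v h" for g h
    using gh(1)
  proof (cases rule: R_cases_split)
    case (base w p)
    from gh(2) show ?thesis
    proof (cases rule: R_cases_split)
      case (base w' p')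
      then show ?thesis using uniq_base \<open>w \<in> _\<close> \<open>p \<in> P\<close> \<open>v = act w _\<close> \<open>g = _\<close> by simp
    qed (use base in blast)
  next
    case (step i j s g1)
    note s1 = step
    from gh(2) show ?thesis
    proof (cases rule: R_cases_split)
      case (step k l t g2)
      show ?thesis
        unfolding s1(3) step(3) by (rule uniq_steps[OF small s1(1,2) step(1,2)])
    qed (use step in blast)
  qed
  \<comment> \<open>The generator is pushed through the path of \<open>g\<close>. At the end of the
    path it turns into a generator whose source is not \<open>b\<close>, hence into an element of
    \<open>P\<close>.\<close>
  moreover have "R v (e i j s \<otimes> g)"
    if ij: "i \<le> b" "j \<le> b" "i \<noteq> j" "s \<in> {1, -1}" "v j = 0" and R: "R v g" for i j s g
    using R
  proof (cases rule: R_cases_split)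
    case (base w p)
    obtain \<sigma> and z :: "nat \<Rightarrow> int" where \<sigma>: "\<sigma> permutes {..<Suc b}" and z: "\<And>i. z i \<in> {1, -1}"
      "\<And>v i. act w v (\<sigma> i) = z i * v i"
      and c: "\<And>i j t. \<lbrakk>i < n; j < n; i \<noteq> j\<rbrakk> \<Longrightarrow> w \<otimes> e i j t = e (\<sigma> i) (\<sigma> j) (z i * z j * t) \<otimes> w"
      using W_fix_signed[OF base(1)] b by (metis Suc_leI)
    obtain k l where kl: "i = \<sigma> k" "j = \<sigma> l" using permutes_surj[OF \<sigma>] by (metis surjD)
    have kl': "k \<le> b" "l \<le> b" "k \<noteq> l"
      using permutes_in_image[OF \<sigma>, of k] permutes_in_image[OF \<sigma>, of l] ij kl by auto
    have "v j = z l * basis_vec b l" using z(2) base(3) kl by simp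
    then have "l \<noteq> b" using ij z(1)[of l] by (auto simp: basis_vec_def)
    have zz: "z k * z l * (z k * z l * s) = s" using z(1)[of k] z(1)[of l] by auto
    have "e i j s \<otimes> w = w \<otimes> e k l (z k * z l * s)"
      using c[of k l "z k * z l * s"] kl kl' b by (simp add: zz)
    moreover have "e k l (z k * z l * s) \<otimes> p \<in> P"
      using P_E kl' \<open>l \<noteq> b\<close> base(2) subgroup.m_closed[OF P_subgroup] by simp
    moreover have "e k l x \<in> carrier Q" "e i j x \<in> carrier Q" for x using kl' ij b by (simp_all add: e_closed)
    ultimately show ?thesis
      using R_base[OF base(1)] W_fix_closed[OF base(1)] P_closed[OF base(2)] base(3,4)
      by (metis m_assoc)
  next
    case (step k l t h)
    note pr = properD[OF step(1)]
    have jkl: "k \<noteq> j" "l \<noteq> j" using pr(9,10) ij by auto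
    define u where "u = v(k := v k - t * v l)"
    have fu: "fixd u" and Ru: "R u h" and uj: "u j = 0"
      using small[OF nrm_proper[OF step(1)]] step(2) jkl ij by (simp_all add: u_def)
    have hc: "h \<in> carrier Q" using R_closed Ru by blast
    have ijn: "i < n" "j < n" using ij b by auto
    have cl: "e i j x \<in> carrier Q" "e k l x \<in> carrier Q" "e k j x \<in> carrier Q" for x
      using ijn ij pr(3-5) jkl by (simp_all add: e_closed)
    show ?thesis
    proof (cases "i = l")
      case False
      have "R u (e i j s \<otimes> h)" using fu Ru uj ij unfolding fixd_def by blast
      then have "R v (e k l t \<otimes> (e i j s \<otimes> h))" using R_step[OF step(1)] u_def by blast
      moreover have "e i j s \<otimes> e k l t = e k l t \<otimes> e i j s"
        by (rule e_commute) (use ijn ij pr(3-5) jkl False in auto)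
      ultimately show ?thesis
        using hc cl step(3) by (simp flip: m_assoc)
    next
      case True
      \<comment> \<open>Passing the step leaves the commutator \<open>e k j (t * s)\<close>. Its
        source \<open>j\<close> is again a zero entry of \<open>u\<close>, so its inverse can be
        inserted at \<open>u\<close> in advance.\<close>
      have ts: "- (t * s) \<in> {1, -1}" using pr(7) ij(4) by auto
      have "R u (e k j (- (t * s)) \<otimes> h)" using fu Ru uj ij pr(1) jkl ts unfolding fixd_def by blast
      then have "R u (e i j s \<otimes> (e k j (- (t * s)) \<otimes> h))" using fu uj ij unfolding fixd_def by blast
      then have "R v (e k l t \<otimes> (e i j s \<otimes> (e k j (- (t * s)) \<otimes> h)))" using R_step[OF step(1)] u_def by blast
      moreover have "e k l t \<otimes> e i j s = e i j s \<otimes> e k l t \<otimes> e k j (t * s)"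
        unfolding True by (rule e_steinberg) (use ijn ij pr(3-7) jkl True in auto)
      then have "e k l t \<otimes> (e i j s \<otimes> (e k j (- (t * s)) \<otimes> h)) = e i j s \<otimes> (e k l t \<otimes> (e k j (t * s) \<otimes> (e k j (- (t * s)) \<otimes> h)))"
        using hc cl by (simp flip: m_assoc)
      moreover have "e k j (t * s) \<otimes> (e k j (- (t * s)) \<otimes> h) = h"
        using e_cancel(1)[OF pr(3) ijn(2) jkl(1) hc] .
      ultimately show ?thesis using step(3) by simp
    qed
  qed
  ultimately show ?case unfolding uniq_def fixd_def by blast
qed

section \<open>The stabilizer of the last basis vector\<close>

definition gens :: "'a set" where
  "gens = {E i j |i j. i \<le> b \<and> j \<le> b \<and> i \<noteq> j} \<union> W_fix (Suc b)"

lemma gens_closed: "gens \<subseteq> carrier Q"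
  using b W_fix_closed by (auto simp: gens_def intro: E_closed)

text \<open>With \<open>uniq\<close> and \<open>fixd\<close> known for all vectors,
  \<open>R_move\<close> applies without restriction, so the generated group acts on the recorded
  elements by left multiplication.\<close>

lemma R_generate:
  assumes "g \<in> generate Q gens" "R v h"
  shows "R (act g v) (g \<otimes> h)"
  using assms
proof (induction arbitrary: v h rule: generate.induct)
  case one
  then show ?case using R_closed by (simp add: act_one)
next
  case (incl x)
  then consider i j where "x = E i j" "i \<le> b" "j \<le> b" "i \<noteq> j" | "x \<in> W_fix (Suc b)"
    by (auto simp: gens_def)
  then show ?case
  proof cases
    case 1
    then have "i < n" "j < n" using b by auto
    then show ?thesis using 1 R_move[of v i 1 j h] uniq_fixd incl by (simp add: act_E E_closed fun_upd_def)
  qed (use R_W incl in blast)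
next
  case (inv x)
  then consider i j where "x = E i j" "i \<le> b" "j \<le> b" "i \<noteq> j" | "x \<in> W_fix (Suc b)"
    by (auto simp: gens_def)
  then show ?case
  proof cases
    case 1
    then have ijn: "i < n" "j < n" using b by auto
    then have "inv x = e i j (- 1)" using 1 by (simp add: int_pow_neg E_closed)
    then show ?thesis using 1 ijn R_move[of v i "- 1" j h] uniq_fixd inv by (simp add: act_e fun_upd_def)
  next
    case 2
    then show ?thesis using R_W subgroup.m_inv_closed[OF W_fix_subgroup] inv by blast
  qed
next
  case (eng x y)
  have "x \<in> carrier Q" "y \<in> carrier Q"
    using eng gens_closed generate_in_carrier by blast+
  then show ?case
    using eng.IH(1)[OF eng.IH(2)[OF eng.prems]] R_closed[OF eng.prems] by (simp add: act_mult m_assoc)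
qed

text \<open>Both \<open>\<one>\<close> and \<open>g\<close> are recorded for
  \<open>basis_vec b\<close>, and elements recorded for one vector differ by an element of
  \<open>P\<close>.\<close>

lemma stabilizer_subset_P:
  assumes "g \<in> generate Q gens" "act g (basis_vec b) = basis_vec b"
  shows "g \<in> P"
proof -
  have "R (basis_vec b) \<one>"
    using R_base[OF subgroup.one_closed[OF W_fix_subgroup] subgroup.one_closed[OF P_subgroup]]
    by (simp add: act_one)
  moreover from R_generate[OF assms(1) this] have "R (basis_vec b) (g \<otimes> \<one>)"
    using assms(2) by simp
  ultimately have "inv \<one> \<otimes> (g \<otimes> \<one>) \<in> P" using uniq_fixd uniq_def by blast
  then show ?thesis using assms(1) generate_in_carrier[OF gens_closed] by simp
qed

lemma R_in_generate: "R v g \<Longrightarrow> g \<in> generate Q gens"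
proof (induction rule: R.induct)
  case (R_base w p)
  have "P \<subseteq> generate Q gens"
    unfolding P_def using b
    by (intro mono_generate) (auto simp: gens_def W_fix_def)
  moreover have "w \<in> generate Q gens" using R_base(1) by (intro generate.incl) (simp add: gens_def)
  ultimately show ?case using R_base(2) by (blast intro: generate.eng)
next
  case (R_step v i j s u g)
  have "E i j \<in> generate Q gens"
    using properD(1,2,5)[OF R_step(1)] by (intro generate.incl) (auto simp: gens_def)
  then have "e i j s \<in> generate Q gens"
    using generate_is_subgroup[OF gens_closed] subgroup_int_pow_closed by blast
  then show ?case using R_step.IH by (blast intro: generate.eng)
qed

lemma transitive_unimodular:
  assumes "0 < b" "unimodular v"
  obtains g where "g \<in> generate Q gens" "act g (basis_vec b) = v"
  using R_exists[OF assms] R_in_generate R_act by blast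

section \<open>Unipotent part and block part of the stabilizer\<close>

definition U :: "'a set" where
  "U = generate Q {E b j |j. j < b}"

text \<open>Normal form of the elements of \<open>U\<close>: the generators commute, so every
  element has this form, and its exponents can be read off from the action.\<close>

primrec U_prod :: "(nat \<Rightarrow> int) \<Rightarrow> nat \<Rightarrow> 'a" where
  "U_prod k 0 = \<one>"
| "U_prod k (Suc j) = U_prod k j \<otimes> e b j (k j)"

lemma U_gens_closed: "{E b j |j. j < b} \<subseteq> carrier Q"
  using b by (auto intro: E_closed)

lemma U_subgroup: "subgroup U Q"
  unfolding U_def by (rule generate_is_subgroup[OF U_gens_closed])

lemma U_closed: "u \<in> U \<Longrightarrow> u \<in> carrier Q"
  by (rule subgroup.mem_carrier[OF U_subgroup])

lemma U_e: "j < b \<Longrightarrow> e b j x \<in> U"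
  by (intro subgroup_int_pow_closed U_subgroup) (auto simp: U_def intro: generate.incl)

lemma U_prod_closed: "m \<le> b \<Longrightarrow> U_prod k m \<in> carrier Q"
  using b by (induction m) (simp_all add: e_closed)

lemma U_prod_commute:
  assumes "j < b" "m \<le> b"
  shows "U_prod k m \<otimes> e b j x = e b j x \<otimes> U_prod k m"
  using assms(2)
proof (induction m)
  case 0
  then show ?case using assms b by (simp add: e_closed)
next
  case (Suc m)
  have cl: "U_prod k m \<in> carrier Q" "e b m y \<in> carrier Q" "e b j x \<in> carrier Q" for y
    using Suc assms b by (simp_all add: U_prod_closed e_closed)
  have "e b m (k m) \<otimes> e b j x = e b j x \<otimes> e b m (k m)"
    by (rule e_commute) (use Suc assms b in auto)
  then have "U_prod k m \<otimes> e b m (k m) \<otimes> e b j x = (U_prod k m \<otimes> e b j x) \<otimes> e b m (k m)"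
    using cl by (simp add: m_assoc)
  also have "U_prod k m \<otimes> e b j x = e b j x \<otimes> U_prod k m" using Suc by simp
  finally show ?case using cl by (simp add: m_assoc)
qed

lemma U_prod_mult:
  "m \<le> b \<Longrightarrow> U_prod k m \<otimes> U_prod l m = U_prod (\<lambda>i. k i + l i) m"
proof (induction m)
  case (Suc m)
  have cl: "U_prod k m \<in> carrier Q" "e b m y \<in> carrier Q" for y k
    using Suc b by (simp_all add: U_prod_closed e_closed)
  have "U_prod k m \<otimes> e b m (k m) \<otimes> (U_prod l m \<otimes> e b m (l m))
      = U_prod k m \<otimes> (e b m (k m) \<otimes> U_prod l m) \<otimes> e b m (l m)"
    using cl by (simp add: m_assoc)
  also have "e b m (k m) \<otimes> U_prod l m = U_prod l m \<otimes> e b m (k m)"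
    using U_prod_commute[of m m l "k m"] Suc by simp
  also have "U_prod k m \<otimes> (U_prod l m \<otimes> e b m (k m)) \<otimes> e b m (l m)
      = (U_prod k m \<otimes> U_prod l m) \<otimes> (e b m (k m) \<otimes> e b m (l m))"
    using cl by (simp add: m_assoc)
  finally show ?case using Suc b by (simp add: int_pow_mult E_closed)
qed simp

lemma U_prod_single:
  "m \<le> b \<Longrightarrow> U_prod (\<lambda>i. if i = j then x else 0) m = (if j < m then e b j x else \<one>)"
proof (induction m)
  case (Suc m)
  have "l < b \<Longrightarrow> e b l y \<in> carrier Q" for l y using b by (simp add: e_closed)
  then show ?case using Suc by (auto simp: less_Suc_eq)
qed simp

lemma U_prod_act:
  "m \<le> b \<Longrightarrow> act (U_prod k m) v = v(b := v b + (\<Sum>j<m. k j * v j))"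
proof (induction m arbitrary: v)
  case (Suc m)
  have "e b m y \<in> carrier Q" for y using Suc b by (simp add: e_closed)
  moreover have "b \<noteq> m" "m < n" using Suc b by auto
  ultimately show ?case using Suc b
    by (auto simp: act_mult U_prod_closed act_e fun_eq_iff intro!: sum.cong)
qed (simp add: act_one)

lemma U_eq_U_prod:
  assumes "u \<in> U"
  shows "\<exists>k. u = U_prod k b"
  using assms unfolding U_def
proof (induction rule: generate.induct)
  case one
  \<comment> \<open>The zero exponents, written in the form that \<open>U_prod_single\<close> asks
    for; the index \<open>b\<close> lies outside the product.\<close>
  have "U_prod (\<lambda>i. if i = b then 0 else 0) b = \<one>" using U_prod_single[of b b 0] by simp
  then show ?case by metis
next
  case (incl x)
  then obtain j where j: "x = E b j" "j < b" by auto
  then have "x = U_prod (\<lambda>i. if i = j then 1 else 0) b"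
    using U_prod_single[of b j 1] b by (simp add: E_closed)
  then show ?case by blast
next
  case (inv x)
  then obtain j where j: "x = E b j" "j < b" by auto
  then have "inv x = U_prod (\<lambda>i. if i = j then - 1 else 0) b"
    using U_prod_single[of b j "- 1"] b by (simp add: E_closed int_pow_neg)
  then show ?case by blast
next
  case (eng x y)
  then show ?case using U_prod_mult by blast
qed

definition gens' :: "'a set" where
  "gens' = {E i j |i j. i < b \<and> j < b \<and> i \<noteq> j} \<union> W_fix b"

lemma gens'_closed: "gens' \<subseteq> carrier Q"
  using b W_fix_closed by (auto simp: gens'_def intro: E_closed)

lemma gens'_fix:
  assumes "a \<in> generate Q gens'" "b \<le> i"
  shows "act a v i = v i"
  using assms(1)
proof (induction arbitrary: v rule: generate.induct)
  case (incl x)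
  then show ?case using assms(2) b by (auto simp: gens'_def W_fix_def act_E)
next
  case (inv x)
  have "act x w i = w i" for w
    using inv assms(2) b by (auto simp: gens'_def W_fix_def act_E)
  from this[of "act (inv x) v"] show ?case
    using act_inv(2)[of x v] inv gens'_closed by auto
next
  case (eng x y)
  then show ?case using generate_in_carrier[OF gens'_closed] by (simp add: act_mult)
qed (simp add: act_one)

text \<open>Elementary elements of rank \<open>b\<close> act on the generators of \<open>U\<close>
  by the Steinberg relation, signed permutations by permuting them up to sign.\<close>

lemma conj_U:
  assumes a: "a \<in> generate Q gens'" and u: "u \<in> U"
  shows "a \<otimes> u \<otimes> inv a \<in> U"
proof -
  have sub: "a \<otimes> u \<otimes> inv a \<in> U"
    if "a \<in> carrier Q" "u \<in> U" and gen: "\<And>l. l < b \<Longrightarrow> a \<otimes> E b l \<otimes> inv a \<in> U" for a u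
    using that(2) unfolding U_def
  proof (induction rule: generate.induct)
    case one
    then show ?case using that(1) by (simp add: generate.one)
  next
    case (incl x)
    then show ?case using gen by (auto simp: U_def)
  next
    case (inv x)
    then obtain l where l: "x = E b l" "l < b" by auto
    have x: "x \<in> carrier Q" using l b by (simp add: E_closed)
    have "inv (a \<otimes> x \<otimes> inv a) \<in> U"
      using gen[OF l(2)] l(1) subgroup.m_inv_closed[OF U_subgroup] by blast
    then show ?case using x that(1) by (simp add: inv_mult_group m_assoc U_def)
  next
    case (eng x y)
    then have xy: "x \<in> carrier Q" "y \<in> carrier Q" using U_closed by (auto simp: U_def)
    have "a \<otimes> x \<otimes> inv a \<otimes> (a \<otimes> y \<otimes> inv a) \<in> U"
      using eng.IH subgroup.m_closed[OF U_subgroup] by (simp add: U_def)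
    then show ?case using xy that(1) by (simp add: m_assoc inv_cancel_left U_def)
  qed
  have E: "e i j (- t) \<otimes> E b l \<otimes> e i j t \<in> U"
    if ij: "i < b" "j < b" "i \<noteq> j" "l < b" "t \<in> {1, -1}" for i j l t
  proof -
    have cl: "e i j y \<in> carrier Q" "E b l \<in> carrier Q" "e b j y \<in> carrier Q" for y
      using ij b by (simp_all add: e_closed E_closed)
    show ?thesis
    proof (cases "l = i")
      case True
      have "e b i 1 \<otimes> e i j t = e i j t \<otimes> e b i 1 \<otimes> e b j (1 * t)"
        by (rule e_steinberg) (use ij b in auto)
      then have "E b l \<otimes> e i j t = e i j t \<otimes> (E b l \<otimes> e b j t)"
        using cl True by (simp add: m_assoc)
      then have "e i j (- t) \<otimes> E b l \<otimes> e i j t = E b l \<otimes> e b j t"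
        using cl ij b by (simp add: m_assoc e_cancel)
      then show ?thesis
        using U_e[OF ij(2)] U_e[OF ij(4), of 1] cl subgroup.m_closed[OF U_subgroup] by simp
    next
      case False
      have "e b l 1 \<otimes> e i j t = e i j t \<otimes> e b l 1"
        by (rule e_commute) (use False ij b in auto)
      then have "e i j (- t) \<otimes> E b l \<otimes> e i j t = E b l"
        using cl ij b by (simp add: m_assoc e_cancel)
      then show ?thesis using U_e[OF ij(4), of 1] cl by simp
    qed
  qed
  have W: "w \<otimes> E b l \<otimes> inv w \<in> U" if w: "w \<in> W_fix b" and l: "l < b" for w l
  proof -
    obtain \<sigma> and s :: "nat \<Rightarrow> int" where \<sigma>: "\<sigma> permutes {..<b}"
      and c: "\<And>i j t. \<lbrakk>i < n; j < n; i \<noteq> j\<rbrakk> \<Longrightarrow> w \<otimes> e i j t = e (\<sigma> i) (\<sigma> j) (s i * s j * t) \<otimes> w"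
      using W_fix_signed[OF w] b by (metis less_imp_le)
    have \<sigma>l: "\<sigma> b = b" "\<sigma> l < b"
      using permutes_in_image[OF \<sigma>, of l] l permutes_not_in[OF \<sigma>, of b] by auto
    have cl: "w \<in> carrier Q" "e b (\<sigma> l) x \<in> carrier Q" "E b l \<in> carrier Q" for x
      using w W_fix_closed \<sigma>l l b by (simp_all add: e_closed E_closed)
    have "w \<otimes> E b l \<otimes> inv w = e b (\<sigma> l) (s b * s l)"
      using c[of b l 1] cl \<sigma>l l b by (simp add: m_assoc)
    then show ?thesis using U_e[OF \<sigma>l(2)] by simp
  qed
  show ?thesis
    using a u
  proof (induction arbitrary: u rule: generate.induct)
    case one
    then show ?case using U_closed by simp
  next
    case (incl x)
    then have x: "x \<in> carrier Q" using gens'_closed by blast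
    from incl consider i j where "x = E i j" "i < b" "j < b" "i \<noteq> j" | "x \<in> W_fix b" by (auto simp: gens'_def)
    then show ?case
    proof cases
      case 1
      show ?thesis
        by (rule sub[OF x incl(2)]) (use E[OF 1(2-4), of _ "- 1"] 1(1) x in \<open>simp add: int_pow_neg\<close>)
    next
      case 2
      show ?thesis by (rule sub[OF x incl(2) W[OF 2]])
    qed
  next
    case (inv x)
    then have x: "x \<in> carrier Q" using gens'_closed by blast
    from inv consider i j where "x = E i j" "i < b" "j < b" "i \<noteq> j" | "x \<in> W_fix b" by (auto simp: gens'_def)
    then show ?case
    proof cases
      case 1
      show ?thesis
        by (rule sub[OF inv_closed[OF x] inv(2)]) (use E[OF 1(2-4), of _ 1] 1(1) x in \<open>simp add: int_pow_neg\<close>)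
    next
      case 2
      show ?thesis
        by (rule sub[OF inv_closed[OF x] inv(2) W[OF subgroup.m_inv_closed[OF W_fix_subgroup 2]]])
    qed
  next
    case (eng x y)
    have xy: "x \<in> carrier Q" "y \<in> carrier Q"
      using eng.hyps generate_in_carrier[OF gens'_closed] by blast+
    have "x \<otimes> (y \<otimes> u \<otimes> inv y) \<otimes> inv x \<in> U" using eng by blast
    then show ?case using xy U_closed[OF eng.prems] by (simp add: m_assoc inv_mult_group)
  qed
qed

text \<open>Since the group of rank \<open>b\<close> normalizes \<open>U\<close>, factors of the two
  kinds can be sorted, as for block triangular matrices.\<close>

lemma P_decomp:
  assumes "p \<in> P"
  obtains u a where "u \<in> U" "a \<in> generate Q gens'" "p = u \<otimes> a"
proof -
  note Hsub = generate_is_subgroup[OF gens'_closed]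
  have gen: "\<exists>u\<in>U. \<exists>a\<in>generate Q gens'. x = u \<otimes> a"
    if x: "x \<in> {E i j |i j. i \<le> b \<and> j < b \<and> i \<noteq> j} \<union> W_fix b \<or> inv x \<in> {E i j |i j. i \<le> b \<and> j < b \<and> i \<noteq> j} \<union> W_fix b"
      and xc: "x \<in> carrier Q" for x
  proof -
    have split: "y \<in> U \<or> y \<in> generate Q gens'"
      if "y \<in> {E i j |i j. i \<le> b \<and> j < b \<and> i \<noteq> j} \<union> W_fix b" for y
    proof -
      from that consider j where "y = E b j" "j < b" | "y \<in> gens'"
        by (auto simp: gens'_def le_less)
      then show ?thesis
        by cases (auto simp: U_def intro: generate.incl)
    qed
    have "x \<in> U \<or> x \<in> generate Q gens'"
      using x split[of x] split[of "inv x"] subgroup.m_inv_closed[OF U_subgroup, of "inv x"]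
        subgroup.m_inv_closed[OF Hsub, of "inv x"] xc by auto
    then show ?thesis
    proof
      assume "x \<in> U"
      then show ?thesis using xc by (intro bexI[of _ x] bexI[of _ \<one>]) (simp_all add: generate.one)
    next
      assume "x \<in> generate Q gens'"
      then show ?thesis
        using xc subgroup.one_closed[OF U_subgroup] by (intro bexI[of _ \<one>] bexI[of _ x]) simp_all
    qed
  qed
  have "\<exists>u\<in>U. \<exists>a\<in>generate Q gens'. p = u \<otimes> a"
    using assms unfolding P_def
  proof (induction rule: generate.induct)
    case one
    show ?case
      using subgroup.one_closed[OF U_subgroup] by (intro bexI[of _ \<one>]) (simp_all add: generate.one)
  next
    case (incl x)
    have "x \<in> carrier Q" by (rule P_closed, unfold P_def, rule generate.incl[OF incl])
    then show ?case by (rule gen[OF disjI1[OF incl]])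
  next
    case (inv x)
    have "x \<in> carrier Q" by (rule P_closed, unfold P_def, rule generate.incl[OF inv])
    then show ?case using gen[of "inv x"] inv by simp
  next
    case (eng x y)
    then obtain u a u' a' where x: "u \<in> U" "a \<in> generate Q gens'" "x = u \<otimes> a"
      and y: "u' \<in> U" "a' \<in> generate Q gens'" "y = u' \<otimes> a'" by blast
    have cl: "u \<in> carrier Q" "u' \<in> carrier Q" "a \<in> carrier Q" "a' \<in> carrier Q"
      using x y U_closed generate_in_carrier[OF gens'_closed] by auto
    have "x \<otimes> y = (u \<otimes> (a \<otimes> u' \<otimes> inv a)) \<otimes> (a \<otimes> a')"
      using cl by (simp add: x y m_assoc inv_cancel_left)
    moreover have "u \<otimes> (a \<otimes> u' \<otimes> inv a) \<in> U"
      using conj_U x y subgroup.m_closed[OF U_subgroup] by blast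
    moreover have "a \<otimes> a' \<in> generate Q gens'" using x y by (blast intro: generate.eng)
    ultimately show ?case by blast
  qed
  then show ?thesis using that by blast
qed

text \<open>An element acting trivially fixes \<open>basis_vec b\<close>, so it lies in
  \<open>P\<close> and splits as \<open>u \<otimes> a\<close>. Here \<open>u\<close> changes only
  coordinate \<open>b\<close> and \<open>a\<close> only the coordinates below, so both act
  trivially. The induction hypothesis disposes of \<open>a\<close>, and the action on basis vectors
  reveals the exponents of \<open>u\<close>.\<close>

lemma faithful_step:
  assumes IH: "\<And>a. \<lbrakk>a \<in> generate Q gens'; \<And>v. act a v = v\<rbrakk> \<Longrightarrow> a = \<one>"
    and g: "g \<in> generate Q gens" "\<And>v. act g v = v"
  shows "g = \<one>"
proof -
  have "g \<in> P" using stabilizer_subset_P g by blast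
  then obtain u a where u: "u \<in> U" and a: "a \<in> generate Q gens'" and ga: "g = u \<otimes> a"
    using P_decomp by blast
  obtain k where k: "u = U_prod k b" using U_eq_U_prod[OF u] by blast
  have ac: "a \<in> carrier Q" using a generate_in_carrier[OF gens'_closed] by blast
  have uact: "act u v = v(b := v b + (\<Sum>j<b. k j * v j))" for v
    using U_prod_act[of b k v] k by simp
  have "act a v = v" for v
  proof
    fix i
    have "act u (act a v) i = v i" using g(2)[of v] ga ac U_closed[OF u] by (simp add: act_mult)
    then show "act a v i = v i"
      using gens'_fix[OF a, of b v] by (cases "i = b") (simp_all add: uact)
  qed
  then have "a = \<one>" using IH a by blast
  then have gu: "g = u" using ga U_closed[OF u] by simp
  have "k j = 0" if "j < b" for j
  proof -
    have "act u (basis_vec j) b = basis_vec j b" using g(2) gu by simp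
    then have "(\<Sum>l<b. k l * basis_vec j l) = 0" unfolding uact by simp
    moreover have "(\<Sum>l<b. k l * basis_vec j l) = (\<Sum>l<b. if l = j then k j else 0)"
      by (intro sum.cong) (auto simp: basis_vec_def)
    ultimately show ?thesis using that by simp
  qed
  then have "U_prod k m = U_prod (\<lambda>i. if i = b then 0 else 0) m" if "m \<le> b" for m
    using that by (induction m) auto
  then have "U_prod k b = \<one>" using U_prod_single[of b b 0] by (metis order_refl less_irrefl)
  then show ?thesis using gu k by simp
qed

end

section \<open>Induction on the rank\<close>

context steinberg_action
begin

text \<open>In rank 0 only signed permutations that fix every coordinate remain, and these are
  covered by \<open>W_faithful\<close>.\<close>

lemma steinberg_faithful_rank:
  assumes "m \<le> n" "g \<in> generate Q ({E i j |i j. i < m \<and> j < m \<and> i \<noteq> j} \<union> W_fix m)" "\<And>v. act g v = v"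
  shows "g = \<one>"
  using assms
proof (induction m arbitrary: g)
  case 0
  then have "g \<in> generate Q (W_fix 0)" by simp
  then have "g \<in> W_fix 0" using generateI[OF W_fix_subgroup[of 0], of "W_fix 0"] by auto
  then show ?case using W_faithful 0 by (simp add: W_fix_def)
next
  case (Suc b)
  then interpret steinberg_rank Q n act E W b by unfold_locales simp
  show ?case
  proof (rule faithful_step)
    show "a = \<one>" if "a \<in> generate Q gens'" "\<And>v. act a v = v" for a
      by (rule Suc.IH) (use Suc.prems(1) that in \<open>simp_all add: gens'_def\<close>)
    show "g \<in> generate Q gens" using Suc.prems(2) by (simp only: gens_def less_Suc_eq_le)
    show "act g v = v" for v by (rule Suc.prems(3))
  qed
qed

theorem steinberg_faithful:
  assumes "g \<in> generate Q ({E i j |i j. i < n \<and> j < n \<and> i \<noteq> j} \<union> W)" "\<And>v. act g v = v"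
  shows "g = \<one>"
proof -
  have "W_fix n = W" using act_outside by (auto simp: W_fix_def)
  then show ?thesis using steinberg_faithful_rank[of n g] assms by simp
qed

end

section \<open>Perfect groups with a center of finite index\<close>

lemma (in group) group_centerD:
  assumes "z \<in> group_center G"
  shows "z \<in> carrier G" "x \<in> carrier G \<Longrightarrow> z \<otimes> x = x \<otimes> z"
  using assms by (auto simp: group_center_def)

text \<open>Adjoining one central element \<open>f\<close> multiplies the size by at most the
  exponent \<open>m\<close>, because only the exponents of \<open>f\<close> modulo \<open>m\<close>
  count.\<close>

lemma (in group) finite_exponent_central_subgroup:
  assumes "finite F" "F \<subseteq> group_center G" "0 < m" and exp: "\<And>z. z \<in> group_center G \<Longrightarrow> z [^] (m :: nat) = \<one>"
  shows "\<exists>B. finite B \<and> subgroup B G \<and> F \<subseteq> B \<and> B \<subseteq> group_center G"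
  using assms(1,2)
proof (induction F rule: finite_induct)
  case empty
  have "\<one> \<in> group_center G" by (simp add: group_center_def)
  then show ?case using triv_subgroup by (intro exI[of _ "{\<one>}"]) auto
next
  case (insert f F)
  then obtain B where B: "finite B" "subgroup B G" "F \<subseteq> B" "B \<subseteq> group_center G" by blast
  interpret Z: normal "group_center G" G by (rule normal_group_center)
  have f: "f \<in> group_center G" using insert by simp
  have fc: "f \<in> carrier G" using f group_centerD by blast
  have fp: "f [^] (i :: int) \<in> group_center G" for i
    by (rule subgroup_int_pow_closed[OF Z.subgroup_axioms f])
  have Bc: "a \<in> carrier G" if "a \<in> B" for a using that B group_centerD by blast
  define B' where "B' = {f [^] (i :: int) \<otimes> a |i a. a \<in> B}"
  have mod: "f [^] (i :: int) = f [^] (i mod int m)" for i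
  proof -
    have "f [^] i = f [^] (int m * (i div int m) + i mod int m)" by simp
    also have "\<dots> = (f [^] int m) [^] (i div int m) \<otimes> f [^] (i mod int m)"
      using fc by (simp only: int_pow_mult int_pow_pow)
    also have "f [^] int m = \<one>" using exp[OF f] by (simp add: int_pow_int)
    finally show ?thesis using fc by simp
  qed
  have "B' \<subseteq> (\<lambda>(i, a). f [^] i \<otimes> a) ` ({0..<int m} \<times> B)"
  proof
    fix x assume "x \<in> B'"
    then obtain i a where x: "x = f [^] (i :: int) \<otimes> a" "a \<in> B" by (auto simp: B'_def)
    then have "x = f [^] (i mod int m) \<otimes> a" using mod[of i] by (simp only:)
    then show "x \<in> (\<lambda>(i, a). f [^] i \<otimes> a) ` ({0..<int m} \<times> B)"
      using x(2) \<open>0 < m\<close> by (intro image_eqI[of _ _ "(i mod int m, a)"]) auto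
  qed
  then have "finite B'" using B(1) by (meson finite_SigmaI finite_atLeastLessThan_int finite_imageI finite_subset)
  moreover have "subgroup B' G"
  proof (rule subgroupI)
    show "B' \<subseteq> carrier G" using fc Bc by (auto simp: B'_def)
    show "B' \<noteq> {}" using subgroup.one_closed[OF B(2)] by (auto simp: B'_def)
    fix x assume "x \<in> B'"
    then obtain i a where x: "x = f [^] (i :: int) \<otimes> a" "a \<in> B" by (auto simp: B'_def)
    have ia: "inv a \<in> B" using x(2) B(2) subgroup.m_inv_closed by metis
    have "inv x = inv a \<otimes> inv (f [^] i)" using x fc Bc by (simp add: inv_mult_group)
    also have "\<dots> = inv (f [^] i) \<otimes> inv a"
      using ia B(4) fc by (intro group_centerD(2)) auto
    also have "inv (f [^] i) = f [^] (- i)" using fc by (simp add: int_pow_neg)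
    finally show "inv x \<in> B'" using ia by (auto simp: B'_def)
    fix y assume "y \<in> B'"
    then obtain j c where y: "y = f [^] (j :: int) \<otimes> c" "c \<in> B" by (auto simp: B'_def)
    have "a \<otimes> f [^] j = f [^] j \<otimes> a"
      using x(2) B(4) fc by (intro group_centerD(2)) auto
    then have "x \<otimes> y = f [^] (i + j) \<otimes> (a \<otimes> c)"
      using x y fc Bc by (simp add: int_pow_mult m_assoc) (simp flip: m_assoc)
    then show "x \<otimes> y \<in> B'" using x(2) y(2) subgroup.m_closed[OF B(2)] by (auto simp: B'_def)
  qed
  moreover have "insert f F \<subseteq> B'"
  proof -
    have "f \<in> B'" using subgroup.one_closed[OF B(2)] fc unfolding B'_def
      by (intro CollectI exI[of _ 1] exI[of _ \<one>]) simp
    moreover have "x \<in> B'" if "x \<in> F" for x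
      using that B(3) Bc unfolding B'_def by (intro CollectI exI[of _ 0] exI[of _ x]) auto
    ultimately show ?thesis by blast
  qed
  moreover have "B' \<subseteq> group_center G"
    using fp B(4) Z.m_closed by (auto simp: B'_def)
  ultimately show ?case by blast
qed

text \<open>The exponent of the center is bounded by the transfer homomorphism into the center, which is
  trivial on a perfect group and is \<open>z \<mapsto> z\<^sup>m\<close> on the center.\<close>

theorem (in group) finite_of_perfect_center_finite_index:
  assumes perfect: "carrier G \<subseteq> generate G {x \<otimes> y \<otimes> inv x \<otimes> inv y |x y. x \<in> carrier G \<and> y \<in> carrier G}"
    and T0: "finite T0" "T0 \<subseteq> carrier G" "\<And>x. x \<in> carrier G \<Longrightarrow> \<exists>t\<in>T0. x \<otimes> inv t \<in> group_center G"
  shows "finite (carrier G)"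
proof -
  define Z where "Z = group_center G"
  define com where "com = {x \<otimes> y \<otimes> inv x \<otimes> inv y |x y. x \<in> carrier G \<and> y \<in> carrier G}"
  interpret Z: normal Z G unfolding Z_def by (rule normal_group_center)
  define M where "M = G\<lparr>carrier := Z\<rparr>"
  have Zc: "z \<otimes> x = x \<otimes> z" if "z \<in> Z" "x \<in> carrier G" for z x
    using that group_centerD(2) by (simp add: Z_def)
  interpret M: comm_group M
    unfolding M_def using Z.subgroup_is_group[OF is_group] Zc
    by (intro group.group_comm_groupI) auto
  have M_simps [simp]: "carrier M = Z" "\<one>\<^bsub>M\<^esub> = \<one>" "\<And>x y. x \<otimes>\<^bsub>M\<^esub> y = x \<otimes> y"
    by (simp_all add: M_def)
  \<comment> \<open>The choice depends only on the set of admissible \<open>t\<close>, hence only on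
    the coset of \<open>x\<close> modulo the center; \<open>rep_cong\<close> relies on this.\<close>
  define rep where "rep x = (SOME t. t \<in> T0 \<and> x \<otimes> inv t \<in> Z)" for x
  have rep: "rep x \<in> T0" "x \<otimes> inv (rep x) \<in> Z" if "x \<in> carrier G" for x
    using someI_ex[of "\<lambda>t. t \<in> T0 \<and> x \<otimes> inv t \<in> Z"] T0(3)[OF that] by (auto simp: rep_def Z_def)
  have repc: "rep x \<in> carrier G" if "x \<in> carrier G" for x using rep that T0 by blast
  have rep_cong: "rep x = rep y" if "x \<in> carrier G" "y \<in> carrier G" "x \<otimes> inv y \<in> Z" for x y
  proof -
    have "x \<otimes> inv t \<in> Z \<longleftrightarrow> y \<otimes> inv t \<in> Z" if "t \<in> T0" for t
    proof -
      have t: "t \<in> carrier G" using that T0 by blast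
      have 1: "x \<otimes> inv t = (x \<otimes> inv y) \<otimes> (y \<otimes> inv t)"
        using \<open>x \<in> _\<close> \<open>y \<in> _\<close> t by (simp add: m_assoc) (simp flip: m_assoc)
      have 2: "y \<otimes> inv t = inv (x \<otimes> inv y) \<otimes> (x \<otimes> inv t)"
        using \<open>x \<in> _\<close> \<open>y \<in> _\<close> t by (simp add: inv_mult_group m_assoc) (simp flip: m_assoc)
      show ?thesis using 1 2 \<open>x \<otimes> inv y \<in> Z\<close> Z.m_closed Z.m_inv_closed by metis
    qed
    then show ?thesis unfolding rep_def by meson
  qed
  \<comment> \<open>The central factor of \<open>x\<close> relative to its representative. Its
    values on products of representatives form the cocycle of the central extension.\<close>
  define \<zeta> where "\<zeta> x = x \<otimes> inv (rep x)" for x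
  have \<zeta>: "\<zeta> x \<in> Z" "\<zeta> x \<in> carrier G" "x = \<zeta> x \<otimes> rep x" if "x \<in> carrier G" for x
    using that rep(2)[OF that] repc[OF that] by (auto simp: \<zeta>_def m_assoc)
  have rep_central: "rep (z \<otimes> x) = rep x" if "z \<in> Z" "x \<in> carrier G" for z x
    using that by (intro rep_cong) (auto simp: m_assoc)
  have \<zeta>_central: "\<zeta> (z \<otimes> x) = z \<otimes> \<zeta> x" if "z \<in> Z" "x \<in> carrier G" for z x
    using that repc by (simp add: \<zeta>_def rep_central m_assoc)
  define T where "T = rep ` carrier G"
  have T: "finite T" "T \<subseteq> carrier G" "T \<noteq> {}"
    using T0 rep(1) repc by (auto simp: T_def intro: finite_subset)
  have rep_T: "rep t = t" if tT: "t \<in> T" for t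
  proof -
    obtain a where a: "a \<in> carrier G" "t = rep a" using tT by (auto simp: T_def)
    have "rep a \<otimes> inv a = inv (a \<otimes> inv (rep a))" using a repc by (simp add: inv_mult_group)
    then show ?thesis
      using rep_cong[of "rep a" a] a repc rep(2)[OF a(1)] Z.m_inv_closed by simp
  qed
  have bij: "bij_betw (\<lambda>t. rep (t \<otimes> x)) T T" if x: "x \<in> carrier G" for x
  proof -
    have inj: "inj_on (\<lambda>t. rep (t \<otimes> x)) T"
    proof
      fix s t assume st: "s \<in> T" "t \<in> T" "rep (s \<otimes> x) = rep (t \<otimes> x)"
      have c: "s \<in> carrier G" "t \<in> carrier G" using st T by auto
      define z where "z = \<zeta> (s \<otimes> x) \<otimes> inv (\<zeta> (t \<otimes> x))"
      have z: "z \<in> Z" using \<zeta>(1) c x by (simp add: z_def)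
      have "s \<otimes> x = \<zeta> (s \<otimes> x) \<otimes> (inv (\<zeta> (t \<otimes> x)) \<otimes> (\<zeta> (t \<otimes> x) \<otimes> rep (t \<otimes> x)))"
        using \<zeta>(2,3)[of "s \<otimes> x"] \<zeta>(2)[of "t \<otimes> x"] repc[of "t \<otimes> x"] c x st(3) by (simp flip: m_assoc)
      also have "\<dots> = z \<otimes> t \<otimes> x"
        using \<zeta>(2)[of "s \<otimes> x"] \<zeta>(2)[of "t \<otimes> x"] \<zeta>(3)[of "t \<otimes> x"] c x by (simp add: z_def m_assoc)
      finally have "s = z \<otimes> t" using c x Z.mem_carrier[OF z] by (simp only: right_cancel m_closed)
      then show "s = t" using rep_central[OF z c(2)] rep_T st by simp
    qed
    moreover have "(\<lambda>t. rep (t \<otimes> x)) ` T \<subseteq> T" using T x by (auto simp: T_def)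
    ultimately show ?thesis by (simp add: bij_betw_def endo_inj_surj T)
  qed
  \<comment> \<open>The transfer. It is multiplicative because right multiplication by
    \<open>x\<close> permutes the representatives up to central factors.\<close>
  define V where "V x = finprod M (\<lambda>t. \<zeta> (t \<otimes> x)) T" for x
  have V_mult: "V (x \<otimes> y) = V x \<otimes> V y" if xy: "x \<in> carrier G" "y \<in> carrier G" for x y
  proof -
    have "\<zeta> (t \<otimes> (x \<otimes> y)) = \<zeta> (t \<otimes> x) \<otimes> \<zeta> (rep (t \<otimes> x) \<otimes> y)" if "t \<in> T" for t
    proof -
      have t: "t \<in> carrier G" using that T by blast
      have "t \<otimes> (x \<otimes> y) = \<zeta> (t \<otimes> x) \<otimes> rep (t \<otimes> x) \<otimes> y"
        using \<zeta>(3)[of "t \<otimes> x"] t xy by (simp flip: m_assoc)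
      also have "\<dots> = \<zeta> (t \<otimes> x) \<otimes> (rep (t \<otimes> x) \<otimes> y)"
        using t xy \<zeta>(2) repc by (simp add: m_assoc)
      finally show ?thesis using \<zeta>_central[of "\<zeta> (t \<otimes> x)" "rep (t \<otimes> x) \<otimes> y"] \<zeta>(1) repc t xy by simp
    qed
    then have "V (x \<otimes> y) = finprod M (\<lambda>t. \<zeta> (t \<otimes> x) \<otimes>\<^bsub>M\<^esub> \<zeta> (rep (t \<otimes> x) \<otimes> y)) T"
      unfolding V_def using T xy \<zeta> repc by (intro M.finprod_cong) (auto simp: simp_implies_def)
    also have "\<dots> = V x \<otimes>\<^bsub>M\<^esub> finprod M (\<lambda>t. \<zeta> (rep (t \<otimes> x) \<otimes> y)) T"
      unfolding V_def using T xy \<zeta> repc by (intro M.finprod_multf) auto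
    also have "finprod M (\<lambda>t. \<zeta> (rep (t \<otimes> x) \<otimes> y)) T = V y"
    proof -
      have "finprod M (\<lambda>t. \<zeta> (t \<otimes> y)) ((\<lambda>t. rep (t \<otimes> x)) ` T) = finprod M (\<lambda>t. \<zeta> (rep (t \<otimes> x) \<otimes> y)) T"
        using bij[OF xy(1)] T xy \<zeta> repc by (intro M.finprod_reindex) (auto simp: bij_betw_def)
      then show ?thesis using bij[OF xy(1)] by (simp add: V_def bij_betw_def)
    qed
    finally show ?thesis by simp
  qed
  have V_closed: "V x \<in> Z" if "x \<in> carrier G" for x
    unfolding V_def using M.finprod_closed[of "\<lambda>t. \<zeta> (t \<otimes> x)" T] T \<zeta> that by (auto simp: Pi_def)
  interpret V: group_hom G M V
    using V_mult V_closed by unfold_locales (auto simp: hom_def)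
  have V_com: "V c = \<one>" if c: "c \<in> com" for c
  proof -
    obtain x y where xy: "x \<in> carrier G" "y \<in> carrier G" "c = x \<otimes> y \<otimes> inv x \<otimes> inv y"
      using c by (auto simp: com_def)
    have "V c = V x \<otimes>\<^bsub>M\<^esub> V y \<otimes>\<^bsub>M\<^esub> inv\<^bsub>M\<^esub> V x \<otimes>\<^bsub>M\<^esub> inv\<^bsub>M\<^esub> V y" using xy by simp
    also have "V x \<otimes>\<^bsub>M\<^esub> V y \<otimes>\<^bsub>M\<^esub> inv\<^bsub>M\<^esub> V x \<otimes>\<^bsub>M\<^esub> inv\<^bsub>M\<^esub> V y = (V x \<otimes>\<^bsub>M\<^esub> inv\<^bsub>M\<^esub> V x) \<otimes>\<^bsub>M\<^esub> (V y \<otimes>\<^bsub>M\<^esub> inv\<^bsub>M\<^esub> V y)"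
      using V.hom_closed[OF xy(1)] V.hom_closed[OF xy(2)] M.inv_closed
      by (simp only: M.m_ac M.m_closed M.inv_closed)
    also have "\<dots> = \<one>\<^bsub>M\<^esub>" using V.hom_closed xy by (simp only: M.r_inv M.r_one M.one_closed)
    finally show ?thesis by simp
  qed
  have comc: "com \<subseteq> carrier G" by (auto simp: com_def)
  have V_triv: "V x = \<one>" if "x \<in> carrier G" for x
  proof -
    have "x \<in> generate G com" using that perfect by (auto simp: com_def)
    then show ?thesis
    proof (induction rule: generate.induct)
      case one show ?case using V.hom_one by simp
    next
      case (incl h) then show ?case by (rule V_com)
    next
      case (inv h)
      then show ?case using V_com[OF inv] V.hom_inv[of h] comc M.inv_one by auto
    next
      case (eng h k)
      then show ?case using V_mult generate_in_carrier[OF comc] by simp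
    qed
  qed
  define m where "m = card T"
  have "0 < m" using T by (simp add: m_def card_gt_0_iff)
  have exp: "z [^] m = \<one>" if "z \<in> Z" for z
  proof -
    have z: "z \<in> carrier G" using that by simp
    have "\<zeta> (t \<otimes> z) = z \<otimes> \<zeta> (t \<otimes> \<one>)" if "t \<in> T" for t
      using \<zeta>_central[OF \<open>z \<in> Z\<close>, of t] Zc[OF \<open>z \<in> Z\<close>, of t] that T by auto
    then have "V z = finprod M (\<lambda>t. z \<otimes>\<^bsub>M\<^esub> \<zeta> (t \<otimes> \<one>)) T"
      unfolding V_def using T z \<zeta> \<open>z \<in> Z\<close> by (intro M.finprod_cong) (auto simp: simp_implies_def)
    also have "\<dots> = finprod M (\<lambda>t. z) T \<otimes>\<^bsub>M\<^esub> V \<one>"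
      unfolding V_def using T \<zeta> \<open>z \<in> Z\<close> by (intro M.finprod_multf) auto
    also have "finprod M (\<lambda>t. z) T = z [^]\<^bsub>M\<^esub> m"
      using M.finprod_const[of z T] \<open>z \<in> Z\<close> by (simp add: m_def)
    also have "z [^]\<^bsub>M\<^esub> m = z [^] m" by (simp add: M_def nat_pow_def)
    finally show ?thesis using V_triv z by simp
  qed
  \<comment> \<open>The central elements that arise when products and inverses of representatives,
    and the unit, are rewritten with representatives. There are finitely many, so the bound on the
    exponent puts them into a finite central subgroup.\<close>
  define F where "F = (\<lambda>(t, s). \<zeta> (t \<otimes> s)) ` (T \<times> T) \<union> (\<lambda>t. \<zeta> (inv t)) ` T \<union> {inv (rep \<one>)}"
  have r1: "inv (rep \<one>) \<in> Z" using rep(2)[of \<one>] repc[of \<one>] by simp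
  have "finite F" "F \<subseteq> group_center G"
    using T(1) subsetD[OF T(2)] \<zeta>(1) r1 by (auto simp: F_def Z_def[symmetric])
  then obtain B where B: "finite B" "subgroup B G" "F \<subseteq> B" "B \<subseteq> Z"
    using finite_exponent_central_subgroup[of F m] exp \<open>0 < m\<close> by (auto simp: Z_def)
  interpret B: subgroup B G by (rule B(2))
  define H where "H = (\<lambda>(a, t). a \<otimes> t) ` (B \<times> T)"
  have HI: "a \<otimes> t \<in> H" if "a \<in> B" "t \<in> T" for a t using that by (auto simp: H_def)
  have HE: "\<exists>a\<in>B. \<exists>t\<in>T. x = a \<otimes> t" if "x \<in> H" for x using that by (auto simp: H_def)
  have repT: "rep x \<in> T" if "x \<in> carrier G" for x using that by (simp add: T_def)
  have "subgroup H G"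
  proof (rule subgroupI)
    show "H \<subseteq> carrier G" using T B.subset by (auto simp: H_def)
    show "H \<noteq> {}" using T(3) HI[OF B.one_closed] by blast
    fix x assume "x \<in> H"
    then obtain a t where x: "a \<in> B" "t \<in> T" "x = a \<otimes> t" using HE by blast
    have t: "t \<in> carrier G" using x T by blast
    have z: "\<zeta> (inv t) \<in> B" using x B by (auto simp: F_def)
    have "inv x = inv t \<otimes> inv a" using x t B.mem_carrier by (simp add: inv_mult_group)
    also have "\<dots> = inv a \<otimes> inv t" using Zc[of "inv a" "inv t"] x B.m_inv_closed B(4) t by auto
    also have "\<dots> = (inv a \<otimes> \<zeta> (inv t)) \<otimes> rep (inv t)"
      using \<zeta>(2,3)[of "inv t"] t repc x B.mem_carrier by (simp add: m_assoc)
    finally show "inv x \<in> H" using HI[of "inv a \<otimes> \<zeta> (inv t)" "rep (inv t)"] x z t repT by simp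
    fix y assume "y \<in> H"
    then obtain c s where y: "c \<in> B" "s \<in> T" "y = c \<otimes> s" using HE by blast
    have s: "s \<in> carrier G" using y T by blast
    have c: "c \<in> Z" "c \<in> carrier G" "a \<in> carrier G" using x y B B.mem_carrier by auto
    have w: "\<zeta> (t \<otimes> s) \<in> B" using x y B by (auto simp: F_def)
    have "x \<otimes> y = a \<otimes> (t \<otimes> c) \<otimes> s" using x y s t c by (simp add: m_assoc)
    also have "t \<otimes> c = c \<otimes> t" using Zc[OF c(1) t] by simp
    also have "a \<otimes> (c \<otimes> t) \<otimes> s = (a \<otimes> c \<otimes> \<zeta> (t \<otimes> s)) \<otimes> rep (t \<otimes> s)"
      using \<zeta>(2,3)[of "t \<otimes> s"] repc[of "t \<otimes> s"] s t c by (simp add: m_assoc)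
    finally show "x \<otimes> y \<in> H"
      using HI[of "a \<otimes> c \<otimes> \<zeta> (t \<otimes> s)" "rep (t \<otimes> s)"] x(1) y(1) w s t repT by simp
  qed
  \<comment> \<open>A commutator depends only on the cosets of its entries modulo the center, so it
    can be computed from representatives.\<close>
  moreover have "com \<subseteq> H"
  proof
    fix k assume "k \<in> com"
    then obtain x y where xy: "x \<in> carrier G" "y \<in> carrier G" "k = x \<otimes> y \<otimes> inv x \<otimes> inv y"
      by (auto simp: com_def)
    define s t where "s = rep x" and "t = rep y"
    have st: "s \<in> carrier G" "t \<in> carrier G" "s \<in> T" "t \<in> T" using xy repc repT by (auto simp: s_def t_def)
    have z: "\<zeta> x \<in> Z" "\<zeta> y \<in> Z" "\<zeta> x \<in> carrier G" "\<zeta> y \<in> carrier G" using \<zeta> xy by auto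
    have xs: "x = \<zeta> x \<otimes> s" "y = \<zeta> y \<otimes> t" using \<zeta>(3) xy by (simp_all add: s_def t_def)
    have conj: "z \<otimes> a \<otimes> c \<otimes> inv (z \<otimes> a) = a \<otimes> c \<otimes> inv a"
      if "z \<in> Z" "a \<in> carrier G" "c \<in> carrier G" for z a c
    proof -
      have zc: "z \<in> carrier G" using that by simp
      have "z \<otimes> a \<otimes> c \<otimes> inv (z \<otimes> a) = z \<otimes> (a \<otimes> c \<otimes> inv a) \<otimes> inv z"
        using that zc by (simp add: m_assoc inv_mult_group)
      also have "z \<otimes> (a \<otimes> c \<otimes> inv a) = (a \<otimes> c \<otimes> inv a) \<otimes> z"
        using that by (intro Zc) auto
      finally show ?thesis using that zc by (simp add: m_assoc)
    qed
    have "k = (x \<otimes> y \<otimes> inv x) \<otimes> inv y" using xy by simp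
    also have "x \<otimes> y \<otimes> inv x = s \<otimes> y \<otimes> inv s"
      using conj[OF z(1) st(1) xy(2)] xs(1) by simp
    also have "s \<otimes> y \<otimes> inv s \<otimes> inv y = s \<otimes> (y \<otimes> inv s \<otimes> inv y)"
      using xy st by (simp add: m_assoc)
    also have "y \<otimes> inv s \<otimes> inv y = t \<otimes> inv s \<otimes> inv t"
      using conj[OF z(2) st(2) inv_closed[OF st(1)]] xs(2) by simp
    finally have k: "k = s \<otimes> t \<otimes> inv s \<otimes> inv t" using st by (simp add: m_assoc)
    have "s \<in> H" "t \<in> H" using HI[OF B.one_closed] st by fastforce+
    then show "k \<in> H"
      unfolding k using \<open>subgroup H G\<close> by (intro subgroup.m_closed subgroup.m_inv_closed)
  qed
  ultimately have "generate G com \<subseteq> H" using generate_subgroup_incl by blast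
  then have "carrier G \<subseteq> H" using perfect by (auto simp: com_def)
  moreover have "finite H" using B(1) T(1) by (simp add: H_def)
  ultimately show ?thesis by (rule finite_subset)
qed

text \<open>One element from each fibre of \<open>\<kappa>\<close> gives a finite set of
  representatives modulo the center; \<open>\<kappa>\<close> need not be constant on cosets.\<close>

corollary (in group) finite_of_perfect_finite_classes:
  assumes perfect: "carrier G \<subseteq> generate G {x \<otimes> y \<otimes> inv x \<otimes> inv y |x y. x \<in> carrier G \<and> y \<in> carrier G}"
    and fin: "finite (\<kappa> ` carrier G)"
    and \<kappa>: "\<And>x y. \<lbrakk>x \<in> carrier G; y \<in> carrier G; \<kappa> x = \<kappa> y\<rbrakk> \<Longrightarrow> x \<otimes> inv y \<in> group_center G"
  shows "finite (carrier G)"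
proof (rule finite_of_perfect_center_finite_index[OF perfect])
  let ?T = "inv_into (carrier G) \<kappa> ` \<kappa> ` carrier G"
  show "finite ?T" using fin by simp
  show "?T \<subseteq> carrier G" by (auto intro: inv_into_into)
  show "\<exists>t\<in>?T. x \<otimes> inv t \<in> group_center G" if "x \<in> carrier G" for x
    using that by (intro bexI[of _ "inv_into (carrier G) \<kappa> (\<kappa> x)"] \<kappa>) (auto intro: inv_into_into simp: f_inv_into_f)
qed

section \<open>Normal subgroups of general linear groups over the integers\<close>

text \<open>Take for \<open>t\<close> the product of the primes that divide \<open>d\<close> but not
  \<open>a\<close>. A prime divisor of \<open>d\<close> then divides exactly one of \<open>a\<close>
  and \<open>t\<close>, and when it divides \<open>a\<close> it does not divide
  \<open>b\<close>.\<close>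

lemma exists_coprime_shift:
  fixes a b d :: int
  assumes "d \<noteq> 0" and cop: "\<And>p. prime p \<Longrightarrow> p dvd a \<Longrightarrow> p dvd b \<Longrightarrow> p dvd d \<Longrightarrow> False"
  shows "\<exists>t. coprime (a + t * b) d"
proof -
  define Q where "Q = {p \<in> prime_factors d. \<not> p dvd a}"
  have fin: "finite Q" by (simp add: Q_def)
  have prQ: "prime p" if "p \<in> Q" for p using that by (auto simp: Q_def)
  define t where "t = \<Prod>Q"
  have "coprime (a + t * b) d"
  proof (rule ccontr)
    assume "\<not> ?thesis"
    then have "\<not> is_unit (gcd (a + t * b) d)" using is_unit_gcd by blast
    moreover have "gcd (a + t * b) d \<noteq> 0" using assms(1) by simp
    ultimately obtain p where "prime p" "p dvd gcd (a + t * b) d"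
      using prime_divisor_exists by blast
    then have p: "prime p" "p dvd a + t * b" "p dvd d" by simp_all
    show False
    proof (cases "p dvd a")
      case True
      then have "p dvd t * b" using p(2) by (simp add: dvd_add_right_iff)
      then have "p dvd t \<or> p dvd b" using p(1) by (simp add: prime_dvd_mult_iff)
      moreover have "\<not> p dvd t"
      proof
        assume "p dvd t"
        then obtain q where "q \<in> Q" "p dvd q"
          unfolding t_def using prime_dvd_prod_iff[OF fin p(1)] by auto
        then have "p = q" using prQ p(1) primes_dvd_imp_eq by blast
        then show False using \<open>q \<in> Q\<close> True by (simp add: Q_def)
      qed
      ultimately show False using cop p True by blast
    next
      case False
      then have "p \<in> Q" using p assms(1) by (simp add: Q_def prime_factors_dvd)
      then have "p dvd t" unfolding t_def using fin by (rule dvd_prodI[rotated])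
      then have "p dvd a" using p(2) by (simp add: dvd_add_left_iff)
      then show False using False by simp
    qed
  qed
  then show ?thesis by blast
qed

lemma Gcd_linear_combination:
  fixes v :: "nat \<Rightarrow> int"
  assumes "finite A"
  shows "\<exists>c. (\<Sum>i\<in>A. c i * v i) = Gcd (v ` A)"
  using assms
proof (induction A rule: finite_induct)
  case (insert a A)
  then obtain c where c: "(\<Sum>i\<in>A. c i * v i) = Gcd (v ` A)" by blast
  obtain x y where xy: "x * v a + y * Gcd (v ` A) = gcd (v a) (Gcd (v ` A))"
    using bezout_int by blast
  have "(\<Sum>i\<in>insert a A. (if i = a then x else y * c i) * v i) = x * v a + (\<Sum>i\<in>A. y * (c i * v i))"
    using insert by (simp, intro sum.cong) auto
  also have "\<dots> = Gcd (v ` insert a A)" using xy c by (simp flip: sum_distrib_left)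
  finally show ?case by (intro exI[of _ "\<lambda>i. if i = a then x else y * c i"])
qed simp

text \<open>This is the stable range condition for \<open>\<int>\<close>; it is where three coordinates are needed.\<close>

lemma unimodular_shorten:
  fixes v c :: "nat \<Rightarrow> int"
  assumes b: "2 \<le> b" and c: "(\<Sum>i\<le>b. c i * v i) = 1"
  shows "\<exists>s t. (\<Sum>i<b. s i * (v i + t i * v b)) = 1"
proof -
  \<comment> \<open>The middle coordinates, nonempty by \<open>2 \<le> b\<close>.\<close>
  define A where "A = {1..<b}"
  have split: "{..<b} = insert 0 A" "{..b} = insert b (insert 0 A)" "0 \<notin> A" "b \<notin> insert 0 A" "finite A" "1 \<in> A"
    using b by (auto simp: A_def)
  have c': "c b * v b + (c 0 * v 0 + (\<Sum>i\<in>A. c i * v i)) = 1"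
    using c split by simp
  show ?thesis
  proof (cases "Gcd (v ` A) = 0")
    case True
    \<comment> \<open>With zeros in the middle, \<open>v b\<close> is simply added to coordinate 1,
      and the old coefficients \<open>c 0\<close> and \<open>c b\<close> serve.\<close>
    then have 0: "v i = 0" if "i \<in> A" for i using that by (auto simp: Gcd_0_iff)
    have "(\<Sum>i\<in>A. (if i = 0 then c 0 else if i = 1 then c b else 0) * (v i + (if i = 1 then 1 else 0) * v b))
        = (\<Sum>i\<in>A. if i = 1 then c b * v b else 0)"
      using 0 split by (intro sum.cong) auto
    also have "\<dots> = c b * v b" using split by simp
    finally have "(\<Sum>i<b. (if i = 0 then c 0 else if i = 1 then c b else 0) * (v i + (if i = 1 then 1 else 0) * v b)) = 1"
      using c' split 0 by simp
    then show ?thesis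
      by (intro exI[of _ "\<lambda>i. if i = 0 then c 0 else if i = 1 then c b else 0"] exI[of _ "\<lambda>i. if i = 1 then 1 else 0"])
  next
    case False
    \<comment> \<open>If the gcd of the middle entries is nonzero, \<open>v 0\<close> can be shifted
      by a multiple of \<open>v b\<close> so as to become coprime to it.\<close>
    obtain e where e: "(\<Sum>i\<in>A. e i * v i) = Gcd (v ` A)"
      using Gcd_linear_combination split by blast
    have "\<exists>t. coprime (v 0 + t * v b) (Gcd (v ` A))"
    proof (rule exists_coprime_shift[OF False])
      fix p :: int assume p: "prime p" "p dvd v 0" "p dvd v b" "p dvd Gcd (v ` A)"
      have "p dvd c b * v b + (c 0 * v 0 + (\<Sum>i\<in>A. c i * v i))"
        using p by (intro dvd_add dvd_mult dvd_sum) (auto dest: dvd_trans[OF _ Gcd_dvd])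
      then have "p dvd 1" by (simp only: c')
      then show False using p(1) not_prime_unit by blast
    qed
    then obtain t where "coprime (v 0 + t * v b) (Gcd (v ` A))" by blast
    then obtain x y where xy: "x * (v 0 + t * v b) + y * Gcd (v ` A) = 1"
      using bezout_int[of "v 0 + t * v b" "Gcd (v ` A)"] by (metis coprime_imp_gcd_eq_1)
    have "(\<Sum>i\<in>A. (if i = 0 then x else y * e i) * (v i + (if i = 0 then t else 0) * v b)) = (\<Sum>i\<in>A. y * (e i * v i))"
      using split by (intro sum.cong) auto
    also have "\<dots> = y * Gcd (v ` A)" using e by (simp flip: sum_distrib_left)
    finally have "(\<Sum>i<b. (if i = 0 then x else y * e i) * (v i + (if i = 0 then t else 0) * v b)) = 1"
      using xy split by simp
    then show ?thesis by (intro exI[of _ "\<lambda>i. if i = 0 then x else y * e i"] exI[of _ "\<lambda>i. if i = 0 then t else 0"])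
  qed
qed

text \<open>Coordinates beyond the rows are left alone rather than set to zero: this makes the
  identity matrix act as the identity on all functions and suits the axiom
  \<open>act_outside\<close>.\<close>

definition mat_act :: "int mat \<Rightarrow> (nat \<Rightarrow> int) \<Rightarrow> nat \<Rightarrow> int" where
  "mat_act A v = (\<lambda>i. if i < dim_row A then \<Sum>j<dim_col A. A $$ (i, j) * v j else v i)"

definition dot :: "nat \<Rightarrow> (nat \<Rightarrow> int) \<Rightarrow> (nat \<Rightarrow> int) \<Rightarrow> int" where
  "dot n f v = (\<Sum>j<n. f j * v j)"

text \<open>The matrix of the map \<open>v \<mapsto> v + f(v) x\<close> for a vector
  \<open>x\<close> and a linear form \<open>f\<close>, invertible when \<open>f\<close> vanishes on
  \<open>x\<close>. Two distinct basis vectors give an elementary matrix.\<close>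

definition transvection :: "nat \<Rightarrow> (nat \<Rightarrow> int) \<Rightarrow> (nat \<Rightarrow> int) \<Rightarrow> int mat" where
  "transvection n x f = mat n n (\<lambda>(i, j). (if i = j then 1 else 0) + x i * f j)"

definition supported :: "nat \<Rightarrow> (nat \<Rightarrow> int) \<Rightarrow> bool" where
  "supported n x \<longleftrightarrow> (\<forall>i\<ge>n. x i = 0)"

lemma dot_add_right: "dot n f (\<lambda>i. v i + c * x i) = dot n f v + c * dot n f x"
  by (simp add: dot_def algebra_simps sum.distrib sum_distrib_left)

lemma dot_add_left: "dot n (\<lambda>k. c * g k + d * g' k) v = c * dot n g v + d * dot n g' v"
  by (simp add: dot_def algebra_simps sum.distrib sum_distrib_left)

lemma dot_scale_left: "dot n (\<lambda>i. c * f i) v = c * dot n f v"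
  by (simp add: dot_def algebra_simps sum_distrib_left)

lemma dot_scale_right: "dot n f (\<lambda>i. c * v i) = c * dot n f v"
  by (simp add: dot_def algebra_simps sum_distrib_left)

lemma dot_basis_left: "dot n (basis_vec a) v = (if a < n then v a else 0)"
  by (simp add: dot_def basis_vec_def if_distrib[of "\<lambda>x. x * _"] cong: if_cong)

lemma dot_basis_right: "dot n f (basis_vec a) = (if a < n then f a else 0)"
  by (simp add: dot_def basis_vec_def if_distrib[of "\<lambda>x. _ * x"] cong: if_cong)

lemma dot_basis_basis: "a < n \<Longrightarrow> dot n (basis_vec a) (basis_vec b) = (if a = b then 1 else 0)"
  by (simp add: dot_basis_left) (simp add: basis_vec_def)

lemma mat_act_one: "mat_act (1\<^sub>m n) v = v"
  by (auto simp: mat_act_def fun_eq_iff if_distrib[of "\<lambda>x. x * _"] cong: if_cong)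

lemma mat_act_mult:
  assumes "A \<in> carrier_mat n n" "B \<in> carrier_mat n n"
  shows "mat_act (A * B) v = mat_act A (mat_act B v)"
proof
  fix i
  show "mat_act (A * B) v i = mat_act A (mat_act B v) i"
  proof (cases "i < n")
    case True
    have "mat_act (A * B) v i = (\<Sum>j<n. \<Sum>k<n. A $$ (i, k) * B $$ (k, j) * v j)"
      using assms True by (auto simp: mat_act_def scalar_prod_def sum_distrib_right atLeast0LessThan intro!: sum.cong)
    also have "\<dots> = (\<Sum>k<n. \<Sum>j<n. A $$ (i, k) * B $$ (k, j) * v j)"
      by (rule sum.swap)
    also have "\<dots> = mat_act A (mat_act B v) i"
      using assms True by (auto simp: mat_act_def sum_distrib_left mult.assoc intro!: sum.cong)
    finally show ?thesis .
  qed (use assms in \<open>simp add: mat_act_def\<close>)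
qed

lemma mat_act_add_scale: "mat_act A (\<lambda>i. v i + c * x i) = (\<lambda>i. if i < dim_row A then mat_act A v i + c * mat_act A x i else v i + c * x i)"
  by (auto simp: mat_act_def fun_eq_iff algebra_simps sum.distrib sum_distrib_left)

lemma mat_act_basis:
  "A \<in> carrier_mat n n \<Longrightarrow> i < n \<Longrightarrow> j < n \<Longrightarrow> mat_act A (basis_vec j) i = A $$ (i, j)"
  by (auto simp: mat_act_def basis_vec_def if_distrib[of "\<lambda>x. _ * x"] cong: if_cong)

lemma supported_basis: "i < n \<Longrightarrow> supported n (basis_vec i)"
  by (simp add: supported_def basis_vec_def)

lemma supported_mat_act: "A \<in> carrier_mat n n \<Longrightarrow> supported n v \<Longrightarrow> supported n (mat_act A v)"
  by (simp add: supported_def mat_act_def)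

lemma mat_eqI_act:
  assumes "A \<in> carrier_mat n n" "B \<in> carrier_mat n n"
    and "\<And>v. supported n v \<Longrightarrow> mat_act A v = mat_act B v"
  shows "A = B"
proof (rule eq_matI)
  fix i j assume "i < dim_row B" "j < dim_col B"
  then show "A $$ (i, j) = B $$ (i, j)"
    using assms(3)[OF supported_basis[of j n]] mat_act_basis[OF assms(1)] mat_act_basis[OF assms(2)] assms(1,2)
    by (metis carrier_matD)
qed (use assms in auto)

lemma dot_mat_act:
  assumes "A \<in> carrier_mat n n"
  shows "dot n s (mat_act A v) = dot n (\<lambda>j. dot n s (mat_act A (basis_vec j))) v"
proof -
  have "dot n s (mat_act A v) = (\<Sum>i<n. \<Sum>j<n. s i * A $$ (i, j) * v j)"
    using assms by (auto simp: dot_def mat_act_def sum_distrib_left mult.assoc intro!: sum.cong)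
  also have "\<dots> = (\<Sum>j<n. \<Sum>i<n. s i * A $$ (i, j) * v j)" by (rule sum.swap)
  also have "\<dots> = dot n (\<lambda>j. dot n s (mat_act A (basis_vec j))) v"
    using mat_act_basis[OF assms] by (auto simp: dot_def sum_distrib_right intro!: sum.cong)
  finally show ?thesis .
qed

lemma transvection_carrier: "transvection n x f \<in> carrier_mat n n"
  by (simp add: transvection_def)

lemma mat_act_transvection:
  assumes "supported n x"
  shows "mat_act (transvection n x f) v = (\<lambda>i. v i + dot n f v * x i)"
proof
  fix i
  show "mat_act (transvection n x f) v i = v i + dot n f v * x i"
  proof (cases "i < n")
    case True
    have "mat_act (transvection n x f) v i = (\<Sum>j<n. (if i = j then v j else 0) + x i * (f j * v j))"
      using True by (auto simp: mat_act_def transvection_def algebra_simps intro!: sum.cong)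
    also have "\<dots> = v i + dot n f v * x i"
      using True by (simp add: sum.distrib dot_def flip: sum_distrib_left)
    finally show ?thesis .
  qed (use assms in \<open>simp add: mat_act_def transvection_def supported_def\<close>)
qed

lemma one_GL_int: "\<one>\<^bsub>GL_int n\<^esub> = 1\<^sub>m n"
  by (simp add: GL_int_def units_of_def ring_mat_def)

lemma GL_carrier_mat: "A \<in> carrier (GL_int n) \<Longrightarrow> A \<in> carrier_mat n n"
  by (simp add: carrier_GL_int)

lemma GL_act_mult:
  "A \<in> carrier (GL_int n) \<Longrightarrow> B \<in> carrier (GL_int n) \<Longrightarrow>
   mat_act (A \<otimes>\<^bsub>GL_int n\<^esub> B) v = mat_act A (mat_act B v)"
  by (simp add: mult_GL_int mat_act_mult[OF GL_carrier_mat GL_carrier_mat])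

lemma GL_act_inv:
  assumes "A \<in> carrier (GL_int n)"
  shows "mat_act (inv\<^bsub>GL_int n\<^esub> A) (mat_act A v) = v" "mat_act A (mat_act (inv\<^bsub>GL_int n\<^esub> A) v) = v"
proof -
  interpret group "GL_int n" by (rule group_GL_int)
  show "mat_act (inv\<^bsub>GL_int n\<^esub> A) (mat_act A v) = v" "mat_act A (mat_act (inv\<^bsub>GL_int n\<^esub> A) v) = v"
    using assms GL_act_mult[of "inv\<^bsub>GL_int n\<^esub> A" n A v] GL_act_mult[of A n "inv\<^bsub>GL_int n\<^esub> A" v]
    by (simp_all add: one_GL_int mat_act_one)
qed

lemma GL_act_add_scale:
  assumes "A \<in> carrier (GL_int n)"
  shows "mat_act A (\<lambda>i. v i + c * x i) = (\<lambda>i. mat_act A v i + c * mat_act A x i)"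
  unfolding mat_act_add_scale using GL_carrier_mat[OF assms] by (auto simp: fun_eq_iff mat_act_def)

lemma GL_eqI:
  assumes "A \<in> carrier (GL_int n)" "B \<in> carrier (GL_int n)"
    and "\<And>v. supported n v \<Longrightarrow> mat_act A v = mat_act B v"
  shows "A = B"
  using assms mat_eqI_act GL_carrier_mat by blast

lemma transvection_GL:
  assumes "supported n x" "dot n f x = 0"
  shows "transvection n x f \<in> carrier (GL_int n)"
    and "inv\<^bsub>GL_int n\<^esub> (transvection n x f) = transvection n (\<lambda>i. - 1 * x i) f"
proof -
  interpret group "GL_int n" by (rule group_GL_int)
  let ?x = "\<lambda>i. - 1 * x i"
  have sup: "supported n ?x" using assms(1) by (simp add: supported_def)
  have 1: "transvection n x f * transvection n ?x f = 1\<^sub>m n"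
  proof (rule mat_eqI_act[of _ n])
    show "mat_act (transvection n x f * transvection n ?x f) v = mat_act (1\<^sub>m n) v" for v
      using assms sup mat_act_mult[OF transvection_carrier transvection_carrier]
      by (simp only: mat_act_transvection mat_act_one dot_add_right dot_scale_right) (simp add: fun_eq_iff)
  qed (simp_all add: mult_carrier_mat[OF transvection_carrier transvection_carrier])
  have 2: "transvection n ?x f * transvection n x f = 1\<^sub>m n"
  proof (rule mat_eqI_act[of _ n])
    show "mat_act (transvection n ?x f * transvection n x f) v = mat_act (1\<^sub>m n) v" for v
      using assms sup mat_act_mult[OF transvection_carrier transvection_carrier]
      by (simp only: mat_act_transvection mat_act_one dot_add_right dot_scale_right) (simp add: fun_eq_iff)
  qed (simp_all add: mult_carrier_mat[OF transvection_carrier transvection_carrier])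
  show c: "transvection n x f \<in> carrier (GL_int n)"
    using 1 2 transvection_carrier unfolding carrier_GL_int by blast
  have "transvection n ?x f \<in> carrier (GL_int n)"
    using 1 2 transvection_carrier unfolding carrier_GL_int by blast
  then show "inv\<^bsub>GL_int n\<^esub> (transvection n x f) = transvection n ?x f"
    using 2 c by (intro inv_equality) (simp_all add: mult_GL_int one_GL_int)
qed

lemma mat_act_transvection_inv:
  assumes "supported n x" "dot n f x = 0"
  shows "mat_act (inv\<^bsub>GL_int n\<^esub> (transvection n x f)) v = (\<lambda>i. v i - dot n f v * x i)"
proof -
  have "supported n (\<lambda>i. - 1 * x i)" using assms(1) by (simp add: supported_def)
  then show ?thesis 
    unfolding transvection_GL(2)[OF assms] by (simp only: mat_act_transvection) (simp add: fun_eq_iff)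
qed

text \<open>Comparing both products on \<open>basis_vec j\<close> shows that
  \<open>basis_vec i\<close> is an eigenvector whose eigenvalue is the entry \<open>(j, j)\<close>,
  for every \<open>j \<noteq> i\<close>; so \<open>M\<close> is scalar. For \<open>n \<le> 1\<close>
  there are no elementary matrices, but then all matrices commute.\<close>

lemma commuting_elementary_central:
  assumes M: "M \<in> carrier (GL_int n)"
    and comm: "\<And>i j. \<lbrakk>i < n; j < n; i \<noteq> j\<rbrakk> \<Longrightarrow>
      M \<otimes>\<^bsub>GL_int n\<^esub> transvection n (basis_vec i) (basis_vec j)
      = transvection n (basis_vec i) (basis_vec j) \<otimes>\<^bsub>GL_int n\<^esub> M"
  shows "M \<in> group_center (GL_int n)"
proof -
  interpret group "GL_int n" by (rule group_GL_int)
  have Mc: "M \<in> carrier_mat n n" using M by (rule GL_carrier_mat)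
  have col: "mat_act M (basis_vec i) = (\<lambda>k. M $$ (j, j) * basis_vec i k)" if ij: "i < n" "j < n" "i \<noteq> j" for i j
  proof -
    let ?E = "transvection n (basis_vec i) (basis_vec j)"
    have E: "?E \<in> carrier (GL_int n)"
      using ij by (intro transvection_GL supported_basis) (simp_all add: dot_basis_basis)
    have s: "supported n (basis_vec i)" using ij supported_basis by blast
    have "mat_act M (mat_act ?E (basis_vec j)) = mat_act ?E (mat_act M (basis_vec j))"
      using comm[OF ij] GL_act_mult[OF M E] GL_act_mult[OF E M] by simp
    then have "(\<lambda>k. mat_act M (basis_vec j) k + dot n (basis_vec j) (basis_vec j) * mat_act M (basis_vec i) k)
        = (\<lambda>k. mat_act M (basis_vec j) k + dot n (basis_vec j) (mat_act M (basis_vec j)) * basis_vec i k)"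
      by (simp only: mat_act_transvection[OF s] GL_act_add_scale[OF M])
    moreover have "dot n (basis_vec j) (basis_vec j) = 1" "dot n (basis_vec j) (mat_act M (basis_vec j)) = M $$ (j, j)"
      using ij by (simp_all add: dot_basis_basis) (simp add: dot_basis_left mat_act_basis[OF Mc])
    ultimately show ?thesis by (simp add: fun_eq_iff)
  qed
  show ?thesis
  proof (cases "n \<le> 1")
    case True
    have "M * A = A * M" if "A \<in> carrier (GL_int n)" for A
    proof (rule eq_matI)
      fix i j assume "i < dim_row (A * M)" "j < dim_col (A * M)"
      then have "n = 1" "i = 0" "j = 0" using True Mc GL_carrier_mat[OF that] by auto
      then show "(M * A) $$ (i, j) = (A * M) $$ (i, j)"
        using Mc GL_carrier_mat[OF that] by (simp add: scalar_prod_def)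
    qed (use Mc GL_carrier_mat[OF that] in auto)
    then show ?thesis using M by (simp add: group_center_def mult_GL_int)
  next
    case False
    define c where "c = M $$ (0, 0)"
    have diag: "M $$ (j, j) = c" if "j < n" for j
    proof (cases "j = 0")
      case False
      have "mat_act M (basis_vec j) j = c * basis_vec j j"
        using col[of j 0] that False by (simp add: c_def)
      then show ?thesis using mat_act_basis[OF Mc that that] by (simp add: basis_vec_def)
    qed (simp add: c_def)
    have colc: "mat_act M (basis_vec i) = (\<lambda>k. c * basis_vec i k)" if "i < n" for i
      using col[of i "if i = 0 then 1 else 0"] diag that False by (simp split: if_splits)
    have act: "mat_act M v = (\<lambda>k. if k < n then c * v k else v k)" for v
    proof
      fix k
      have "M $$ (k, j) = (if k = j then c else 0)" if "k < n" "j < n" for j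
        using mat_act_basis[OF Mc that] colc[OF that(2)] by (cases "k = j") (auto simp: basis_vec_def)
      then show "mat_act M v k = (if k < n then c * v k else v k)"
        using Mc by (auto simp: mat_act_def if_distrib[of "\<lambda>x. x * _"] cong: if_cong)
    qed
    have "M \<otimes>\<^bsub>GL_int n\<^esub> A = A \<otimes>\<^bsub>GL_int n\<^esub> M" if A: "A \<in> carrier (GL_int n)" for A
    proof (rule GL_eqI[of _ n])
      fix v :: "nat \<Rightarrow> int" assume v: "supported n v"
      have "mat_act A (\<lambda>k. 0 + c * v k) = (\<lambda>k. mat_act A (\<lambda>_. 0) k + c * mat_act A v k)"
        using GL_act_add_scale[OF A, of "\<lambda>_. 0"] by simp
      moreover have "mat_act A (\<lambda>_. 0) = (\<lambda>_. 0)" by (auto simp: mat_act_def)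
      ultimately have "mat_act A (\<lambda>k. c * v k) = (\<lambda>k. c * mat_act A v k)" by simp
      moreover have "(\<lambda>k. if k < n then c * w k else w k) = (\<lambda>k. c * w k)" if "supported n w" for w
        using that by (auto simp: supported_def fun_eq_iff)
      ultimately show "mat_act (M \<otimes>\<^bsub>GL_int n\<^esub> A) v = mat_act (A \<otimes>\<^bsub>GL_int n\<^esub> M) v"
        using v supported_mat_act[OF GL_carrier_mat[OF A] v] M A by (simp add: GL_act_mult act)
    qed (use M A in auto)
    then show ?thesis using M by (simp add: group_center_def)
  qed
qed


section \<open>Noncentral kernels contain multiples of elementary matrices\<close>

locale GL_hom = group_hom "GL_int n" G \<psi> for n :: nat and G (structure) and \<psi> +
  assumes n: "3 \<le> n"
begin

abbreviation "\<Gamma> \<equiv> GL_int n"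

definition triv :: "int mat \<Rightarrow> bool" where
  "triv M \<longleftrightarrow> M \<in> carrier \<Gamma> \<and> \<psi> M = \<one>"

lemma triv_mult: "triv A \<Longrightarrow> triv B \<Longrightarrow> triv (A \<otimes>\<^bsub>\<Gamma>\<^esub> B)"
  by (simp add: triv_def)

lemma triv_inv: "triv A \<Longrightarrow> triv (inv\<^bsub>\<Gamma>\<^esub> A)"
  by (simp add: triv_def)

lemma triv_conj: "triv A \<Longrightarrow> B \<in> carrier \<Gamma> \<Longrightarrow> triv (B \<otimes>\<^bsub>\<Gamma>\<^esub> A \<otimes>\<^bsub>\<Gamma>\<^esub> inv\<^bsub>\<Gamma>\<^esub> B)"
  by (simp add: triv_def)

abbreviation "tv \<equiv> transvection n"

lemmas tv_GL = transvection_GL(1)[of n]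
lemmas tv_act = mat_act_transvection[of n]
lemmas tv_act_inv = mat_act_transvection_inv[of n]

lemma triv_tvI:
  assumes "triv M" "supported n x" "\<And>v. supported n v \<Longrightarrow> mat_act M v = (\<lambda>i. v i + dot n f v * x i)"
  shows "triv (tv x f)"
proof -
  have "M = tv x f"
    using assms transvection_carrier GL_carrier_mat
    by (intro mat_eqI_act[of _ n]) (auto simp: triv_def tv_act)
  then show ?thesis using assms(1) by simp
qed

lemma dot_diff_right: "dot n f (\<lambda>i. v i - c * x i) = dot n f v - c * dot n f x"
  using dot_add_right[of n f v "- c" x] by simp

text \<open>The kernel is normal, so it contains the commutators of its elements with
  \<open>tv x g\<close>. This one replaces the form of a transvection in the kernel;
  \<open>triv_tv_column\<close> replaces the vector.\<close>

lemma triv_tv_row: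
  assumes "triv (tv y f)" "supported n y" "supported n x" "dot n f y = 0" "dot n g y = 0" "dot n g x = 0"
  shows "triv (tv y (\<lambda>j. dot n f x * g j))"
proof -
  let ?t = "tv y f" and ?s = "tv x g"
  have t: "?t \<in> carrier \<Gamma>" and s: "?s \<in> carrier \<Gamma>" using assms tv_GL by auto
  let ?k = "?t \<otimes>\<^bsub>\<Gamma>\<^esub> (?s \<otimes>\<^bsub>\<Gamma>\<^esub> inv\<^bsub>\<Gamma>\<^esub> ?t \<otimes>\<^bsub>\<Gamma>\<^esub> inv\<^bsub>\<Gamma>\<^esub> ?s)"
  have "triv ?k" by (intro triv_mult triv_conj triv_inv assms(1) s)
  then show ?thesis
  proof (rule triv_tvI)
    fix v
    show "mat_act ?k v = (\<lambda>i. v i + dot n (\<lambda>j. dot n f x * g j) v * y i)"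
      using s t assms
      by (simp add: GL_act_mult tv_act tv_act_inv dot_add_right dot_diff_right dot_scale_left; simp add: fun_eq_iff algebra_simps)
  qed (rule assms)
qed

lemma triv_tv_column:
  assumes "triv (tv y f)" "supported n y" "supported n x" "dot n f y = 0" "dot n f x = 0" "dot n g x = 0"
  shows "triv (tv (\<lambda>i. dot n g y * x i) f)"
proof -
  let ?t = "tv y f" and ?s = "tv x g"
  have t: "?t \<in> carrier \<Gamma>" and s: "?s \<in> carrier \<Gamma>" using assms tv_GL by auto
  let ?k = "(?s \<otimes>\<^bsub>\<Gamma>\<^esub> ?t \<otimes>\<^bsub>\<Gamma>\<^esub> inv\<^bsub>\<Gamma>\<^esub> ?s) \<otimes>\<^bsub>\<Gamma>\<^esub> inv\<^bsub>\<Gamma>\<^esub> ?t"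
  have "triv ?k" by (intro triv_mult triv_conj triv_inv assms(1) s)
  then show ?thesis
  proof (rule triv_tvI)
    show "supported n (\<lambda>i. dot n g y * x i)" using assms by (simp add: supported_def)
    fix v
    show "mat_act ?k v = (\<lambda>i. v i + dot n f v * (dot n g y * x i))"
      using s t assms
      by (simp add: GL_act_mult tv_act tv_act_inv dot_add_right dot_diff_right; simp add: fun_eq_iff algebra_simps)
  qed
qed

lemma exists_third: "\<exists>b<n. b \<noteq> a \<and> b \<noteq> c"
proof -
  have "\<exists>b\<in>{0, 1, 2 :: nat}. b \<noteq> a \<and> b \<noteq> c" by auto
  then obtain b where "b \<in> {0, 1, 2}" "b \<noteq> a" "b \<noteq> c" by blast
  moreover from this have "b < n" using n by auto
  ultimately show ?thesis by blast
qed

lemma exists_two: "\<exists>p q. p < n \<and> q < n \<and> p \<noteq> q \<and> p \<noteq> a \<and> q \<noteq> a"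
  using exists_third[of a a] exists_third by metis

text \<open>The commutator \<open>h\<close> of \<open>M\<close> with an elementary matrix differs
  from the identity only in the directions \<open>basis_vec i\<close> and \<open>y\<close>. As
  \<open>n \<ge> 3\<close>, some nonzero form \<open>f\<close> vanishes on both, and so
  \<open>h\<close> preserves \<open>f\<close>. If \<open>h\<close> moves a vector \<open>x\<close>
  in the kernel of \<open>f\<close>, the commutator of \<open>h\<close> with \<open>tv x f\<close>
  is a transvection along \<open>f\<close>; otherwise \<open>h\<close> itself is one, up to a
  denominator.\<close>

lemma exists_triv_transvection:
  assumes M: "triv M" "M \<notin> group_center \<Gamma>"
  shows "\<exists>y f. triv (tv y f) \<and> supported n y \<and> dot n f y = 0 \<and> (\<exists>i<n. y i \<noteq> 0) \<and> (\<exists>i<n. f i \<noteq> 0)"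
proof -
  have Mc: "M \<in> carrier \<Gamma>" using M by (simp add: triv_def)
  obtain i j where ij: "i < n" "j < n" "i \<noteq> j"
    and ne: "M \<otimes>\<^bsub>\<Gamma>\<^esub> tv (basis_vec i) (basis_vec j) \<noteq> tv (basis_vec i) (basis_vec j) \<otimes>\<^bsub>\<Gamma>\<^esub> M"
    using commuting_elementary_central[OF Mc] M(2) by blast
  let ?e = "tv (basis_vec i) (basis_vec j)"
  have d0: "dot n (basis_vec j) (basis_vec i) = 0" using ij by (simp add: dot_basis_basis)
  have si: "supported n (basis_vec i)" using ij supported_basis by blast
  have e: "?e \<in> carrier \<Gamma>" using tv_GL si d0 by blast
  define h where "h = M \<otimes>\<^bsub>\<Gamma>\<^esub> (?e \<otimes>\<^bsub>\<Gamma>\<^esub> inv\<^bsub>\<Gamma>\<^esub> M \<otimes>\<^bsub>\<Gamma>\<^esub> inv\<^bsub>\<Gamma>\<^esub> ?e)"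
  have h: "triv h" unfolding h_def by (intro triv_mult triv_conj triv_inv M e)
  have hc: "h \<in> carrier \<Gamma>" using h by (simp add: triv_def)
  define y where "y = mat_act M (basis_vec i)"
  define a where "a v = dot n (basis_vec j) (mat_act (inv\<^bsub>\<Gamma>\<^esub> M) (\<lambda>k. v k - dot n (basis_vec j) v * basis_vec i k))" for v
  have hact: "mat_act h v = (\<lambda>k. v k - dot n (basis_vec j) v * basis_vec i k + a v * y k)" for v
    using Mc e unfolding h_def
    by (simp add: GL_act_mult tv_act[OF si] tv_act_inv[OF si d0] GL_act_add_scale[OF Mc] GL_act_inv a_def y_def)
  have "h \<noteq> \<one>\<^bsub>\<Gamma>\<^esub>"
  proof
    assume "h = \<one>\<^bsub>\<Gamma>\<^esub>"
    then have "M \<otimes>\<^bsub>\<Gamma>\<^esub> ?e \<otimes>\<^bsub>\<Gamma>\<^esub> inv\<^bsub>\<Gamma>\<^esub> (?e \<otimes>\<^bsub>\<Gamma>\<^esub> M) = \<one>\<^bsub>\<Gamma>\<^esub>"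
      using Mc e by (simp add: h_def G.inv_mult_group G.m_assoc)
    then show False using ne Mc e by (simp add: G.inv_solve_right')
  qed
  obtain p q where pq: "p < n" "q < n" "p \<noteq> q" "p \<noteq> i" "q \<noteq> i" using exists_two by blast
  \<comment> \<open>Supported on two coordinates other than \<open>i\<close>, the form vanishes on
    \<open>basis_vec i\<close>; its coefficients make it vanish on \<open>y\<close>. If both entries
    of \<open>y\<close> are zero, \<open>basis_vec p\<close> does and keeps the form
    nonzero.\<close>
  define f where "f = (if y p = 0 \<and> y q = 0 then basis_vec p else (\<lambda>k. y q * basis_vec p k + - y p * basis_vec q k))"
  have fi: "dot n f (basis_vec i) = 0" and fy: "dot n f y = 0"
    using pq by (auto simp: f_def dot_add_left dot_basis_left simp del: mult_minus_left) (simp_all add: basis_vec_def)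
  have fne: "\<exists>c<n. f c \<noteq> 0"
  proof (cases "y p = 0 \<and> y q = 0")
    case True
    then show ?thesis using pq by (intro exI[of _ p]) (simp add: f_def basis_vec_def)
  next
    case False
    then have "f p \<noteq> 0 \<or> f q \<noteq> 0" using pq by (auto simp: f_def basis_vec_def)
    then show ?thesis using pq by blast
  qed
  have fh: "dot n f (mat_act h v) = dot n f v" for v
    unfolding hact dot_add_right dot_diff_right by (simp add: fi fy)
  have fh': "dot n f (mat_act (inv\<^bsub>\<Gamma>\<^esub> h) v) = dot n f v" for v
    using fh[of "mat_act (inv\<^bsub>\<Gamma>\<^esub> h) v"] GL_act_inv(2)[OF hc] by simp
  have suph: "supported n (mat_act h v)" if "supported n v" for v
    using supported_mat_act[OF GL_carrier_mat[OF hc] that] .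
  show ?thesis
  proof (cases "\<exists>x. supported n x \<and> dot n f x = 0 \<and> mat_act h x \<noteq> x")
    case True
    then obtain x where x: "supported n x" "dot n f x = 0" "mat_act h x \<noteq> x" by blast
    let ?T = "tv x f"
    have T: "?T \<in> carrier \<Gamma>" using tv_GL x by blast
    let ?k = "h \<otimes>\<^bsub>\<Gamma>\<^esub> (?T \<otimes>\<^bsub>\<Gamma>\<^esub> inv\<^bsub>\<Gamma>\<^esub> h \<otimes>\<^bsub>\<Gamma>\<^esub> inv\<^bsub>\<Gamma>\<^esub> ?T)"
    let ?z = "\<lambda>k. mat_act h x k + (- 1) * x k"
    have "triv ?k" by (intro triv_mult triv_conj triv_inv h T)
    moreover have sz: "supported n ?z" using suph[OF x(1)] x(1) by (simp add: supported_def)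
    moreover have "mat_act ?k v = (\<lambda>k. v k + dot n f v * ?z k)" for v
    proof -
      have "mat_act ?k v = mat_act h (mat_act ?T (mat_act (inv\<^bsub>\<Gamma>\<^esub> h) (\<lambda>k. v k - dot n f v * x k)))"
        using hc T by (simp add: GL_act_mult tv_act_inv[OF x(1,2)])
      also have "mat_act ?T (mat_act (inv\<^bsub>\<Gamma>\<^esub> h) (\<lambda>k. v k - dot n f v * x k))
          = (\<lambda>k. mat_act (inv\<^bsub>\<Gamma>\<^esub> h) (\<lambda>k. v k - dot n f v * x k) k + dot n f v * x k)"
        by (simp add: tv_act[OF x(1)] fh' dot_diff_right x(2))
      also have "mat_act h \<dots> = (\<lambda>k. v k - dot n f v * x k + dot n f v * mat_act h x k)"
        by (simp only: GL_act_add_scale[OF hc] GL_act_inv[OF hc])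
      finally show ?thesis by (simp add: fun_eq_iff algebra_simps)
    qed
    ultimately have "triv (tv ?z f)" by (rule triv_tvI)
    moreover have "dot n f ?z = 0" unfolding dot_add_right fh x(2) by simp
    moreover have "\<exists>i<n. ?z i \<noteq> 0"
    proof (rule ccontr)
      assume "\<not> ?thesis"
      then have "mat_act h x i = x i" for i using sz by (cases "i < n") (auto simp: supported_def)
      then show False using x(3) by blast
    qed
    ultimately show ?thesis using fne sz by blast
  next
    case False
    then have ker: "mat_act h x = x" if "supported n x" "dot n f x = 0" for x using that by blast
    \<comment> \<open>With \<open>f c\<close> as denominator, \<open>h v - v\<close> is
      \<open>z\<close> times the value of \<open>f\<close> at \<open>v\<close>. The power of
      \<open>h\<close> whose exponent is the absolute value of \<open>f c\<close> cancels this
      denominator up to sign.\<close>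
    obtain c where c: "c < n" "f c \<noteq> 0" using fne by blast
    define z where "z = (\<lambda>k. mat_act h (basis_vec c) k + (- 1) * basis_vec c k)"
    have sc: "supported n (basis_vec c)" using c supported_basis by blast
    have sz: "supported n z" using suph[OF sc] sc by (simp add: supported_def z_def)
    have fz: "dot n f z = 0" unfolding z_def dot_add_right fh by simp
    have scaled: "f c * (mat_act h v k - v k) = dot n f v * z k" if v: "supported n v" for v k
    proof -
      let ?w = "\<lambda>k. f c * v k + (- dot n f v) * basis_vec c k"
      have "supported n ?w" using v sc by (simp add: supported_def)
      moreover have "dot n f ?w = 0"
        unfolding dot_add_right by (simp add: dot_scale_right dot_basis_right c)
      ultimately have "mat_act h ?w = ?w" by (rule ker)
      moreover have "mat_act h (\<lambda>k. 0 + f c * v k) = (\<lambda>k. mat_act h (\<lambda>_. 0) k + f c * mat_act h v k)"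
        using GL_act_add_scale[OF hc, of "\<lambda>_. 0"] by simp
      then have "mat_act h (\<lambda>k. f c * v k) = (\<lambda>k. f c * mat_act h v k)"
        by (simp add: mat_act_def fun_eq_iff)
      ultimately have "f c * mat_act h v k + (- dot n f v) * mat_act h (basis_vec c) k = f c * v k + (- dot n f v) * basis_vec c k"
        unfolding GL_act_add_scale[OF hc] by (simp add: fun_eq_iff)
      then show ?thesis by (simp add: z_def algebra_simps)
    qed
    have pow: "mat_act (h [^]\<^bsub>\<Gamma>\<^esub> l) v = (\<lambda>k. v k + int l * (mat_act h v k + (- 1) * v k))" if v: "supported n v" for l :: nat and v
    proof (induction l)
      case 0
      then show ?case by (simp add: one_GL_int mat_act_one)
    next
      case (Suc l)
      let ?d = "\<lambda>k. mat_act h v k + (- 1) * v k"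
      have d: "mat_act h ?d = ?d"
        using suph[OF v] v by (intro ker) (simp add: supported_def, simp only: dot_add_right fh)
      have "h [^]\<^bsub>\<Gamma>\<^esub> Suc l = h \<otimes>\<^bsub>\<Gamma>\<^esub> h [^]\<^bsub>\<Gamma>\<^esub> l"
        using hc G.nat_pow_Suc2 by blast
      then have "mat_act (h [^]\<^bsub>\<Gamma>\<^esub> Suc l) v = mat_act h (\<lambda>k. v k + int l * ?d k)"
        using hc Suc by (simp add: GL_act_mult)
      also have "\<dots> = (\<lambda>k. mat_act h v k + int l * ?d k)"
        by (rule GL_act_add_scale[OF hc, of v "int l" ?d, unfolded d])
      finally show ?case by (simp add: fun_eq_iff algebra_simps)
    qed
    let ?z = "\<lambda>k. sgn (f c) * z k"
    have "triv (h [^]\<^bsub>\<Gamma>\<^esub> l)" for l :: nat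
      using h by (induction l) (simp_all add: triv_def)
    then have "triv (h [^]\<^bsub>\<Gamma>\<^esub> nat \<bar>f c\<bar>)" .
    moreover have sz': "supported n ?z" using sz by (simp add: supported_def)
    moreover have "mat_act (h [^]\<^bsub>\<Gamma>\<^esub> nat \<bar>f c\<bar>) v = (\<lambda>k. v k + dot n f v * ?z k)" if v: "supported n v" for v
    proof -
      have "\<bar>f c\<bar> * (mat_act h v k + (- 1) * v k) = dot n f v * ?z k" for k
        using scaled[OF v, of k] by (simp add: abs_sgn mult.commute mult.left_commute)
      then show ?thesis unfolding pow[OF v] by simp
    qed
    ultimately have "triv (tv ?z f)" by (rule triv_tvI)
    moreover have "dot n f ?z = 0" by (simp add: dot_scale_right fz)
    moreover have "\<exists>i<n. ?z i \<noteq> 0"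
    proof (rule ccontr)
      assume "\<not> ?thesis"
      then have "z i = 0" for i using sz c by (cases "i < n") (auto simp: supported_def sgn_eq_0_iff)
      then have "mat_act h v = v" if "supported n v" for v using scaled[OF that] c by auto
      then have "h = \<one>\<^bsub>\<Gamma>\<^esub>"
        by (intro GL_eqI[OF hc G.one_closed]) (simp add: one_GL_int mat_act_one)
      then show False using \<open>h \<noteq> _\<close> by simp
    qed
    ultimately show ?thesis using fne sz' by blast
  qed
qed

text \<open>Some \<open>c \<noteq> a\<close> has \<open>f c \<noteq> 0\<close>, because
  \<open>f\<close> vanishes on \<open>y\<close> while \<open>y a \<noteq> 0\<close>. Three
  commutators replace the form by a multiple of \<open>g\<close>, which lives on two coordinates and
  vanishes on \<open>y\<close>, then the vector by a multiple of \<open>basis_vec c\<close>, then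
  the form by a multiple of \<open>basis_vec a\<close>. The factor that accumulates is
  \<open>- f c * y a * y a\<close>.\<close>

lemma exists_triv_elementary:
  assumes M: "triv M" "M \<notin> group_center \<Gamma>"
  shows "\<exists>c a r. c < n \<and> a < n \<and> c \<noteq> a \<and> r \<noteq> 0 \<and> triv (tv (\<lambda>i. r * basis_vec c i) (basis_vec a))"
proof -
  obtain y f where yf: "triv (tv y f)" "supported n y" "dot n f y = 0" "\<exists>i<n. y i \<noteq> 0" "\<exists>i<n. f i \<noteq> 0"
    using exists_triv_transvection[OF M] by blast
  obtain a where a: "a < n" "y a \<noteq> 0" using yf by blast
  have "\<exists>c<n. c \<noteq> a \<and> f c \<noteq> 0"
  proof (rule ccontr)
    assume "\<not> ?thesis"
    then have 0: "f c = 0" if "c < n" "c \<noteq> a" for c using that by blast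
    then have "dot n f y = (\<Sum>j<n. if j = a then f a * y a else 0)"
      unfolding dot_def by (intro sum.cong) auto
    then have "f a = 0" using yf(3) a by simp
    then show False using 0 yf(5) by metis
  qed
  then obtain c where c: "c < n" "c \<noteq> a" "f c \<noteq> 0" by blast
  obtain b where b: "b < n" "b \<noteq> a" "b \<noteq> c" using exists_third by blast
  note sup = supported_basis[OF a(1)] supported_basis[OF b(1)] supported_basis[OF c(1)]
  define g where "g = (\<lambda>j. y b * basis_vec a j + - y a * basis_vec b j)"
  have dg: "dot n g v = y b * v a - y a * v b" for v
  proof -
    have "dot n g v = y b * dot n (basis_vec a) v + - y a * dot n (basis_vec b) v"
      unfolding g_def by (rule dot_add_left)
    then show ?thesis using a b by (simp add: dot_basis_left)
  qed
  have bv: "basis_vec i j = (if j = i then 1 else 0)" for i j by (simp add: basis_vec_def)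
  have "triv (tv y (\<lambda>j. dot n f (basis_vec c) * g j))"
    using yf c b sup by (intro triv_tv_row; simp add: dg; simp add: bv)
  then have 1: "triv (tv y (\<lambda>j. f c * g j))" using c by (simp add: dot_basis_right)
  have "triv (tv (\<lambda>i. dot n (basis_vec a) y * basis_vec c i) (\<lambda>j. f c * g j))"
    using 1 yf(2) sup c b a by (intro triv_tv_column; simp add: dg dot_scale_left dot_basis_basis; simp add: bv)
  then have 2: "triv (tv (\<lambda>i. y a * basis_vec c i) (\<lambda>j. f c * g j))" using a by (simp add: dot_basis_left)
  have sc: "supported n (\<lambda>i. y a * basis_vec c i)" using sup by (simp add: supported_def)
  have "triv (tv (\<lambda>i. y a * basis_vec c i) (\<lambda>j. dot n (\<lambda>j. f c * g j) (basis_vec b) * basis_vec a j))"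
    using 2 sc sup c b a
    by (intro triv_tv_row; simp add: dg dot_scale_left dot_scale_right dot_basis_basis; simp add: bv)
  moreover have "dot n (\<lambda>j. f c * g j) (basis_vec b) = - f c * y a"
    using b by (simp add: dot_scale_left dg) (simp add: bv)
  moreover have "tv (\<lambda>i. y a * basis_vec c i) (\<lambda>j. - f c * y a * basis_vec a j)
      = tv (\<lambda>i. (- f c * y a * y a) * basis_vec c i) (basis_vec a)"
    by (simp add: transvection_def algebra_simps)
  ultimately have "triv (tv (\<lambda>i. (- f c * y a * y a) * basis_vec c i) (basis_vec a))" by simp
  then show ?thesis using c a by (intro exI[of _ c] exI[of _ a] exI[of _ "- f c * y a * y a"]) simp
qed

text \<open>Commutators move the index of the vector and that of the form independently as long as
  the two stay distinct. For \<open>i = a\<close> the index of the form first makes room by moving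
  to a third one.\<close>

lemma triv_all_elementary:
  assumes "c < n" "a < n" "c \<noteq> a" "triv (tv (\<lambda>i. r * basis_vec c i) (basis_vec a))"
    and ij: "i < n" "j < n" "i \<noteq> j"
  shows "triv (tv (\<lambda>k. r * basis_vec i k) (basis_vec j))"
proof -
  have sup: "supported n (\<lambda>i. r * basis_vec c i)" if "c < n" for c
    using supported_basis[OF that] by (simp add: supported_def)
  have column: "triv (tv (\<lambda>k. r * basis_vec i k) (basis_vec a))"
    if "triv (tv (\<lambda>i. r * basis_vec c i) (basis_vec a))" "c < n" "a < n" "i < n" "c \<noteq> a" "i \<noteq> a" for i c a
  proof (cases "i = c")
    case False
    have "triv (tv (\<lambda>k. dot n (basis_vec c) (\<lambda>i. r * basis_vec c i) * basis_vec i k) (basis_vec a))"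
      using that False sup supported_basis
      by (intro triv_tv_column) (simp_all add: dot_scale_right dot_basis_basis)
    then show ?thesis using that by (simp add: dot_scale_right dot_basis_basis)
  qed (use that in simp)
  have row: "triv (tv (\<lambda>k. r * basis_vec c k) (basis_vec j))"
    if "triv (tv (\<lambda>i. r * basis_vec c i) (basis_vec a))" "c < n" "a < n" "j < n" "c \<noteq> a" "j \<noteq> c" for j c a
  proof (cases "j = a")
    case False
    have "triv (tv (\<lambda>k. r * basis_vec c k) (\<lambda>k. dot n (basis_vec a) (basis_vec a) * basis_vec j k))"
      using that False sup supported_basis
      by (intro triv_tv_row) (simp_all add: dot_scale_right dot_basis_basis)
    then show ?thesis using that by (simp add: dot_basis_basis)
  qed (use that in simp)
  obtain b where b: "b < n" "b \<noteq> c" "b \<noteq> a" using exists_third by blast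
  show ?thesis
  proof (cases "i = a")
    case False
    then show ?thesis using row[OF column[OF assms(4), of i], of j] assms by simp
  next
    case True
    have "triv (tv (\<lambda>k. r * basis_vec c k) (basis_vec b))" using row[OF assms(4), of b] assms b by simp
    from column[OF this, of a] have "triv (tv (\<lambda>k. r * basis_vec a k) (basis_vec b))" using assms b by simp
    from row[OF this, of j] show ?thesis using assms b True by simp
  qed
qed

text \<open>A commutator passing through the index \<open>a\<close> needs a form that vanishes
  there, so the entry of \<open>g\<close> at \<open>a\<close> is split off and produced through a
  third index \<open>b\<close>. The column version is dual.\<close>

lemma triv_tv_times_row:
  assumes el: "\<And>i j. \<lbrakk>i < n; j < n; i \<noteq> j\<rbrakk> \<Longrightarrow> triv (tv (\<lambda>k. q * basis_vec i k) (basis_vec j))"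
    and c: "c < n" "g c = 0"
  shows "triv (tv (\<lambda>k. q * basis_vec c k) g)"
proof -
  obtain a where a: "a < n" "a \<noteq> c" using exists_third by blast
  obtain b where b: "b < n" "b \<noteq> a" "b \<noteq> c" using exists_third by blast
  let ?y = "\<lambda>k. q * basis_vec c k"
  let ?g1 = "g(a := 0)" and ?g2 = "\<lambda>k. g a * basis_vec a k"
  have sup: "supported n ?y" "supported n (basis_vec a)" "supported n (basis_vec b)"
    using a b c supported_basis by (auto simp: supported_def)
  have d: "dot n f ?y = q * f c" for f using c by (simp add: dot_scale_right dot_basis_right)
  have "triv (tv ?y (\<lambda>k. dot n (basis_vec a) (basis_vec a) * ?g1 k))"
    using el[OF c(1) a(1)] sup a c by (intro triv_tv_row; simp add: d dot_basis_right; simp add: basis_vec_def)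
  then have 1: "triv (tv ?y ?g1)" using a by (simp add: dot_basis_basis fun_upd_def)
  have "triv (tv ?y (\<lambda>k. dot n (basis_vec b) (basis_vec b) * ?g2 k))"
    using el[OF c(1) b(1)] sup a b c by (intro triv_tv_row; simp add: d dot_basis_right; simp add: basis_vec_def)
  then have 2: "triv (tv ?y ?g2)" using b by (simp add: dot_basis_basis)
  show ?thesis
  proof (rule triv_tvI[OF triv_mult[OF 1 2] sup(1)])
    fix v
    have g: "dot n g v = dot n ?g1 v + dot n ?g2 v"
      unfolding dot_def sum.distrib[symmetric] by (intro sum.cong) (auto simp: basis_vec_def)
    have "dot n ?g1 ?y = 0" using a c by (simp only: d) simp
    then show "mat_act (tv ?y ?g1 \<otimes>\<^bsub>\<Gamma>\<^esub> tv ?y ?g2) v = (\<lambda>k. v k + dot n g v * ?y k)"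
      using 1 2 by (simp only: GL_act_mult triv_def tv_act[OF sup(1)] dot_add_right g) (simp add: fun_eq_iff algebra_simps)
  qed
qed

lemma triv_tv_times_column:
  assumes el: "\<And>i j. \<lbrakk>i < n; j < n; i \<noteq> j\<rbrakk> \<Longrightarrow> triv (tv (\<lambda>k. q * basis_vec i k) (basis_vec j))"
    and a: "a < n" "x a = 0" and x: "supported n x"
  shows "triv (tv (\<lambda>k. q * x k) (basis_vec a))"
proof -
  obtain c where c: "c < n" "c \<noteq> a" using exists_third by blast
  obtain b where b: "b < n" "b \<noteq> a" "b \<noteq> c" using exists_third by blast
  let ?f = "basis_vec a"
  let ?x1 = "x(c := 0)" and ?x2 = "\<lambda>k. x c * basis_vec c k"
  have sup: "supported n ?x1" "supported n ?x2" "supported n (\<lambda>k. q * ?x1 k)" "supported n (\<lambda>k. q * ?x2 k)"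
      "supported n (\<lambda>k. q * x k)" "supported n (\<lambda>k. q * basis_vec c k)" "supported n (\<lambda>k. q * basis_vec b k)"
    using x c b supported_basis[OF c(1)] supported_basis[OF b(1)] by (auto simp: supported_def)
  have "triv (tv (\<lambda>k. dot n (basis_vec c) (\<lambda>k. q * basis_vec c k) * ?x1 k) ?f)"
    using a c by (intro triv_tv_column[OF el[OF c(1) a(1)] sup(6,1)]; simp add: dot_scale_right dot_basis_left; simp add: basis_vec_def)
  then have 1: "triv (tv (\<lambda>k. q * ?x1 k) ?f)" using c by (simp add: dot_scale_right dot_basis_basis)
  have "triv (tv (\<lambda>k. dot n (basis_vec b) (\<lambda>k. q * basis_vec b k) * ?x2 k) ?f)"
    using a b c by (intro triv_tv_column[OF el[OF b(1) a(1)] sup(7,2)]; simp add: dot_scale_right dot_basis_left; simp add: basis_vec_def)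
  then have 2: "triv (tv (\<lambda>k. q * ?x2 k) ?f)" using b by (simp add: dot_scale_right dot_basis_basis)
  show ?thesis
  proof (rule triv_tvI[OF triv_mult[OF 1 2] sup(5)])
    fix v
    have "x k = ?x1 k + ?x2 k" for k by (simp add: basis_vec_def)
    then have xs: "q * x k = q * ?x1 k + q * ?x2 k" for k by (metis distrib_left)
    have d0: "dot n ?f (\<lambda>k. q * ?x2 k) = 0" using a c by (simp add: dot_basis_left) (simp add: basis_vec_def)
    have "mat_act (tv (\<lambda>k. q * ?x1 k) ?f \<otimes>\<^bsub>\<Gamma>\<^esub> tv (\<lambda>k. q * ?x2 k) ?f) v
        = (\<lambda>k. v k + dot n ?f v * (q * ?x2 k) + dot n ?f v * (q * ?x1 k))"
      using 1 2 by (simp only: GL_act_mult triv_def tv_act[OF sup(3)] tv_act[OF sup(4)] dot_add_right d0) simp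
    then show "mat_act (tv (\<lambda>k. q * ?x1 k) ?f \<otimes>\<^bsub>\<Gamma>\<^esub> tv (\<lambda>k. q * ?x2 k) ?f) v = (\<lambda>k. v k + dot n ?f v * (q * x k))"
      unfolding xs by (simp only: distrib_left) (simp add: add_ac)
  qed
qed

section \<open>A decomposition with a bounded number of unipotent factors\<close>

definition b :: nat where "b = n - 1"

abbreviation "upper t \<equiv> tv t (basis_vec b)"
abbreviation "lower s \<equiv> tv (basis_vec b) s"

text \<open>The copy of \<open>GL_int (n - 1)\<close> in the upper left corner.\<close>

definition blocks :: "int mat set" where
  "blocks = {B \<in> carrier \<Gamma>. mat_act B (basis_vec b) = basis_vec b \<and> (\<forall>v. mat_act B v b = v b)}"

lemma bn: "b < n" "2 \<le> b"
  using n by (auto simp: b_def)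

lemma lessThan_n: "{..<n} = {..<Suc b}" "{..<n} = {..b}"
  using n by (auto simp: b_def)

lemma supported_b:
  assumes "supported b t"
  shows "supported n t" "t b = 0" "dot n (basis_vec b) t = 0" "dot n t (basis_vec b) = 0"
  using assms bn by (auto simp: supported_def dot_basis_left dot_basis_right)

lemma upper_lower_GL:
  assumes "supported b t"
  shows "upper t \<in> carrier \<Gamma>" "lower t \<in> carrier \<Gamma>"
    "inv\<^bsub>\<Gamma>\<^esub> (upper t) = upper (\<lambda>i. - 1 * t i)" "inv\<^bsub>\<Gamma>\<^esub> (lower t) = lower (\<lambda>i. - 1 * t i)"
proof -
  note sup = supported_b[OF assms] supported_basis[OF bn(1)]
  show "upper t \<in> carrier \<Gamma>" "lower t \<in> carrier \<Gamma>" "inv\<^bsub>\<Gamma>\<^esub> (upper t) = upper (\<lambda>i. - 1 * t i)"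
    using transvection_GL sup by blast+
  have "inv\<^bsub>\<Gamma>\<^esub> (lower t) = tv (\<lambda>i. - 1 * basis_vec b i) t"
    using transvection_GL(2) sup by blast
  then show "inv\<^bsub>\<Gamma>\<^esub> (lower t) = lower (\<lambda>i. - 1 * t i)"
    by (simp add: transvection_def)
qed

lemma upper_act: "supported b t \<Longrightarrow> mat_act (upper t) v = (\<lambda>i. v i + v b * t i)"
  using tv_act[OF supported_b(1)] bn by (simp add: dot_basis_left)

lemma lower_act: "mat_act (lower s) v = (\<lambda>i. v i + dot n s v * basis_vec b i)"
  using tv_act[OF supported_basis[OF bn(1)]] .

text \<open>The number of factors does not depend on \<open>M\<close>, which is what makes a finite
  count of classes possible. The last column of \<open>M\<close> is unimodular; by the stable range
  condition an \<open>upper\<close> factor makes its first \<open>b\<close> entries unimodular, so a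
  \<open>lower\<close> factor can set entry \<open>b\<close> to one and another \<open>upper\<close>
  factor can clear the rest. A \<open>lower\<close> factor on the right clears the last row.\<close>

lemma GL_decomposition:
  assumes M: "M \<in> carrier \<Gamma>"
  shows "\<exists>t s t' B s'. supported b t \<and> supported b s \<and> supported b t' \<and> supported b s' \<and> B \<in> blocks
    \<and> M = upper t \<otimes>\<^bsub>\<Gamma>\<^esub> lower s \<otimes>\<^bsub>\<Gamma>\<^esub> upper t' \<otimes>\<^bsub>\<Gamma>\<^esub> B \<otimes>\<^bsub>\<Gamma>\<^esub> lower s'"
proof -
  define v where "v = mat_act M (basis_vec b)"
  have supv: "supported n v"
    unfolding v_def by (rule supported_mat_act[OF GL_carrier_mat[OF M] supported_basis[OF bn(1)]])
  define c where "c j = (inv\<^bsub>\<Gamma>\<^esub> M) $$ (b, j)" for j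
  have "mat_act (inv\<^bsub>\<Gamma>\<^esub> M) v b = 1"
    unfolding v_def by (simp only: GL_act_inv[OF M]) (simp add: basis_vec_def)
  moreover have "mat_act (inv\<^bsub>\<Gamma>\<^esub> M) v b = (\<Sum>j<n. c j * v j)"
    using GL_carrier_mat[OF G.inv_closed[OF M]] bn(1) by (simp add: mat_act_def c_def)
  ultimately have "(\<Sum>j\<le>b. c j * v j) = 1" by (simp add: lessThan_n(2))
  then obtain s t where st: "(\<Sum>i<b. s i * (v i + t i * v b)) = 1"
    using unimodular_shorten[OF bn(2)] by blast
  define t1 where "t1 i = (if i < b then t i else 0)" for i
  \<comment> \<open>The combination of the first \<open>b\<close> entries that has value one, scaled
    by what entry \<open>b\<close> lacks to one.\<close>
  define s1 where "s1 i = (if i < b then (1 - v b) * s i else 0)" for i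
  define v1 where "v1 = mat_act (upper t1) v"
  define v2 where "v2 = mat_act (lower s1) v1"
  define t2 where "t2 i = (if i < b then - v2 i else 0)" for i
  have sup: "supported b t1" "supported b s1" "supported b t2"
    by (simp_all add: supported_def t1_def s1_def t2_def)
  have v1: "v1 i = v i + v b * t1 i" for i
    unfolding v1_def upper_act[OF sup(1)] ..
  have "dot n s1 v1 = (\<Sum>i<Suc b. s1 i * v1 i)" by (simp add: dot_def lessThan_n(1))
  also have "\<dots> = (\<Sum>i<b. (1 - v b) * (s i * (v i + t i * v b)))"
    using supported_b(2)[OF sup(2)] by (auto simp: v1 s1_def t1_def algebra_simps intro!: sum.cong)
  also have "\<dots> = 1 - v b" using st by (simp flip: sum_distrib_left)
  finally have v2: "v2 i = (if i = b then 1 else v1 i)" for i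
    using supported_b(2)[OF sup(1)] unfolding v2_def lower_act by (simp add: basis_vec_def v1)
  have v3: "mat_act (upper t2) v2 = basis_vec b"
  proof
    fix i
    have "n \<le> i" if "\<not> i < b" "i \<noteq> b" using that by (simp add: b_def)
    then show "mat_act (upper t2) v2 i = basis_vec b i"
      unfolding upper_act[OF sup(3)] using supv supported_b(1)[OF sup(1)]
      by (auto simp: v2 t2_def basis_vec_def v1 supported_def)
  qed
  define M3 where "M3 = upper t2 \<otimes>\<^bsub>\<Gamma>\<^esub> (lower s1 \<otimes>\<^bsub>\<Gamma>\<^esub> (upper t1 \<otimes>\<^bsub>\<Gamma>\<^esub> M))"
  note cl = upper_lower_GL[OF sup(1)] upper_lower_GL[OF sup(2)] upper_lower_GL[OF sup(3)]
  have M3: "M3 \<in> carrier \<Gamma>" unfolding M3_def using cl M by simp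
  have M3b: "mat_act M3 (basis_vec b) = basis_vec b"
    using cl M v3 by (simp add: M3_def GL_act_mult v2_def v1_def v_def)
  define s2 where "s2 j = (if j < b then - M3 $$ (b, j) else 0)" for j
  have sup2: "supported b s2" by (simp add: supported_def s2_def)
  define B where "B = M3 \<otimes>\<^bsub>\<Gamma>\<^esub> lower s2"
  have Bc: "B \<in> carrier \<Gamma>" using M3 upper_lower_GL[OF sup2] by (simp add: B_def)
  have Bact: "mat_act B v = (\<lambda>i. mat_act M3 v i + dot n s2 v * basis_vec b i)" for v
    using M3 upper_lower_GL[OF sup2] by (simp add: B_def GL_act_mult lower_act GL_act_add_scale[OF M3] M3b)
  have "B \<in> blocks"
  proof -
    have "mat_act B v b = v b" for v
    proof -
      have "mat_act M3 v b = (\<Sum>j<Suc b. M3 $$ (b, j) * v j)"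
        using GL_carrier_mat[OF M3] bn(1) by (simp add: mat_act_def lessThan_n(1))
      moreover have "M3 $$ (b, b) = 1"
        using mat_act_basis[OF GL_carrier_mat[OF M3] bn(1) bn(1)] M3b by (simp add: basis_vec_def)
      moreover have "dot n s2 v = (\<Sum>j<Suc b. s2 j * v j)" by (simp add: dot_def lessThan_n(1))
      moreover have "(\<Sum>j<b. s2 j * v j) = - (\<Sum>j<b. M3 $$ (b, j) * v j)"
        unfolding sum_negf[symmetric] by (intro sum.cong) (auto simp: s2_def)
      ultimately show ?thesis by (simp add: Bact basis_vec_def s2_def)
    qed
    moreover have "mat_act B (basis_vec b) = basis_vec b"
      by (simp add: Bact M3b supported_b(4)[OF sup2])
    ultimately show ?thesis using Bc by (simp add: blocks_def)
  qed
  have "M = inv\<^bsub>\<Gamma>\<^esub> (upper t1) \<otimes>\<^bsub>\<Gamma>\<^esub> inv\<^bsub>\<Gamma>\<^esub> (lower s1) \<otimes>\<^bsub>\<Gamma>\<^esub> inv\<^bsub>\<Gamma>\<^esub> (upper t2) \<otimes>\<^bsub>\<Gamma>\<^esub> B \<otimes>\<^bsub>\<Gamma>\<^esub> inv\<^bsub>\<Gamma>\<^esub> (lower s2)"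
    using cl(1,2,5,6,9,10) M upper_lower_GL(2)[OF sup2]
    by (simp add: B_def M3_def G.m_assoc G.inv_cancel_left)
  then have "M = upper (\<lambda>i. - 1 * t1 i) \<otimes>\<^bsub>\<Gamma>\<^esub> lower (\<lambda>i. - 1 * s1 i) \<otimes>\<^bsub>\<Gamma>\<^esub> upper (\<lambda>i. - 1 * t2 i) \<otimes>\<^bsub>\<Gamma>\<^esub> B \<otimes>\<^bsub>\<Gamma>\<^esub> lower (\<lambda>i. - 1 * s2 i)"
    by (simp only: upper_lower_GL(3,4)[OF sup(1)] upper_lower_GL(3,4)[OF sup(2)] upper_lower_GL(3,4)[OF sup(3)] upper_lower_GL(3,4)[OF sup2])
  moreover have "supported b (\<lambda>i. - 1 * t1 i)" "supported b (\<lambda>i. - 1 * s1 i)" "supported b (\<lambda>i. - 1 * t2 i)" "supported b (\<lambda>i. - 1 * s2 i)"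
    using sup sup2 by (simp_all add: supported_def)
  ultimately show ?thesis using \<open>B \<in> blocks\<close> by blast
qed

text \<open>Conjugation by \<open>D\<close> turns \<open>upper t\<close> into the upper matrix of
  \<open>mat_act D t\<close>. The two differ by a transvection whose vector is divisible by
  \<open>q\<close>, and \<open>\<psi>\<close> kills it. For \<open>lower t\<close> the same happens
  with the form in place of the vector.\<close>

lemma congruence_commutes:
  assumes el: "\<And>i j. \<lbrakk>i < n; j < n; i \<noteq> j\<rbrakk> \<Longrightarrow> triv (tv (\<lambda>k. q * basis_vec i k) (basis_vec j))"
    and D: "D \<in> blocks" "\<And>v i. i < n \<Longrightarrow> q dvd mat_act D v i - v i"
    and t: "supported b t"
  shows "\<psi> D \<otimes> \<psi> (upper t) = \<psi> (upper t) \<otimes> \<psi> D" "\<psi> D \<otimes> \<psi> (lower t) = \<psi> (lower t) \<otimes> \<psi> D"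
proof -
  have Dc: "D \<in> carrier \<Gamma>" and Db: "mat_act D (basis_vec b) = basis_vec b" and Dv: "\<And>v. mat_act D v b = v b"
    using D by (auto simp: blocks_def)
  have iDc: "inv\<^bsub>\<Gamma>\<^esub> D \<in> carrier \<Gamma>" using Dc by simp
  note cl = upper_lower_GL[OF t]
  have iDv: "mat_act (inv\<^bsub>\<Gamma>\<^esub> D) v b = v b" for v
    using Dv[of "mat_act (inv\<^bsub>\<Gamma>\<^esub> D) v"] by (simp add: GL_act_inv[OF Dc])
  have iDb: "mat_act (inv\<^bsub>\<Gamma>\<^esub> D) (basis_vec b) = basis_vec b"
    using GL_act_inv(1)[OF Dc, of "basis_vec b"] by (simp only: Db)
  have iDq: "q dvd mat_act (inv\<^bsub>\<Gamma>\<^esub> D) v i - v i" if "i < n" for v i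
    using D(2)[OF that, of "mat_act (inv\<^bsub>\<Gamma>\<^esub> D) v"] by (simp add: GL_act_inv[OF Dc] dvd_diff_commute)
  define u where "u i = (if i < n then (mat_act D t i - t i) div q else 0)" for i
  have u: "mat_act D t i = t i + q * u i" for i
    using D(2)[of i t] supported_mat_act[OF GL_carrier_mat[OF Dc] supported_b(1)[OF t]] supported_b(1)[OF t]
    by (cases "i < n") (auto simp: u_def supported_def)
  have su: "supported n u" "u b = 0"
    using Dv[of t] by (simp_all add: u_def supported_def)
  have sqb: "supported n (\<lambda>i. q * u i)" using su by (simp add: supported_def)
  have 1: "triv (tv (\<lambda>i. q * u i) (basis_vec b))"
    using triv_tv_times_column[where x = u, OF el bn(1) su(2,1)] by blast
  have "D \<otimes>\<^bsub>\<Gamma>\<^esub> upper t = upper t \<otimes>\<^bsub>\<Gamma>\<^esub> tv (\<lambda>i. q * u i) (basis_vec b) \<otimes>\<^bsub>\<Gamma>\<^esub> D"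
  proof (rule GL_eqI[of _ n])
    fix v
    have "dot n (basis_vec b) w = w b" for w using bn by (simp add: dot_basis_left)
    then show "mat_act (D \<otimes>\<^bsub>\<Gamma>\<^esub> upper t) v = mat_act (upper t \<otimes>\<^bsub>\<Gamma>\<^esub> tv (\<lambda>i. q * u i) (basis_vec b) \<otimes>\<^bsub>\<Gamma>\<^esub> D) v"
      using cl Dc 1 by (simp add: GL_act_mult triv_def upper_act[OF t] tv_act[OF sqb] GL_act_add_scale[OF Dc] Dv u su)
        (simp add: algebra_simps)
  qed (use cl Dc 1 in \<open>simp_all add: triv_def\<close>)
  then have "\<psi> (D \<otimes>\<^bsub>\<Gamma>\<^esub> upper t) = \<psi> (upper t) \<otimes> \<one> \<otimes> \<psi> D"
    using cl Dc 1 by (simp add: triv_def)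
  then show "\<psi> D \<otimes> \<psi> (upper t) = \<psi> (upper t) \<otimes> \<psi> D"
    using cl Dc by simp
  define f where "f j = (dot n t (mat_act D (basis_vec j)) - dot n t (basis_vec j)) div q" for j
  have f: "dot n t (mat_act D v) = dot n t v + q * dot n f v" for v
  proof -
    have q: "dot n t (mat_act D (basis_vec j)) = dot n t (basis_vec j) + q * f j" for j
    proof -
      have "dot n t (mat_act D (basis_vec j)) - dot n t (basis_vec j) = (\<Sum>i<n. t i * (mat_act D (basis_vec j) i - basis_vec j i))"
        by (simp add: dot_def sum_subtractf algebra_simps)
      also have "q dvd \<dots>" using D(2) by (intro dvd_sum dvd_mult) auto
      finally show ?thesis by (simp add: f_def)
    qed
    have "dot n t (mat_act D v) = dot n (\<lambda>j. 1 * dot n t (basis_vec j) + q * f j) v"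
      by (subst dot_mat_act[OF GL_carrier_mat[OF Dc]]) (simp add: q)
    also have "\<dots> = dot n (\<lambda>j. dot n t (basis_vec j)) v + q * dot n f v"
      unfolding dot_add_left by simp
    also have "dot n (\<lambda>j. dot n t (basis_vec j)) v = dot n t v"
      unfolding dot_def[of n _ v] by (intro sum.cong) (auto simp: dot_basis_right)
    finally show ?thesis .
  qed
  have fb: "f b = 0" by (simp add: f_def Db)
  have 2: "triv (tv (\<lambda>k. q * basis_vec b k) f)"
    using triv_tv_times_row[where g = f, OF el bn(1) fb] by blast
  have sb: "supported n (\<lambda>k. q * basis_vec b k)" using supported_basis[OF bn(1)] by (simp add: supported_def)
  have "lower t \<otimes>\<^bsub>\<Gamma>\<^esub> D = D \<otimes>\<^bsub>\<Gamma>\<^esub> lower t \<otimes>\<^bsub>\<Gamma>\<^esub> tv (\<lambda>k. q * basis_vec b k) f"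
  proof (rule GL_eqI[of _ n])
    fix v
    have "dot n t (\<lambda>k. q * basis_vec b k) = 0"
      using supported_b(4)[OF t] by (simp add: dot_scale_right)
    then show "mat_act (lower t \<otimes>\<^bsub>\<Gamma>\<^esub> D) v = mat_act (D \<otimes>\<^bsub>\<Gamma>\<^esub> lower t \<otimes>\<^bsub>\<Gamma>\<^esub> tv (\<lambda>k. q * basis_vec b k) f) v"
      using cl Dc 2
      by (simp add: GL_act_mult triv_def lower_act tv_act[OF sb] GL_act_add_scale[OF Dc] Db f dot_add_right flip: mult.assoc)
        (simp add: algebra_simps supported_b(4)[OF t])
  qed (use cl Dc 2 in \<open>simp_all add: triv_def\<close>)
  then have "\<psi> (lower t \<otimes>\<^bsub>\<Gamma>\<^esub> D) = \<psi> D \<otimes> \<psi> (lower t) \<otimes> \<one>"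
    using cl Dc 2 by (simp add: triv_def)
  then show "\<psi> D \<otimes> \<psi> (lower t) = \<psi> (lower t) \<otimes> \<psi> D"
    using cl Dc by simp
qed

section \<open>Finiteness of the image of the elementary group\<close>

definition elementary :: "int mat set" where
  "elementary = {tv (basis_vec i) (basis_vec j) |i j. i < n \<and> j < n \<and> i \<noteq> j}"

lemma elementary_closed: "elementary \<subseteq> carrier \<Gamma>"
  by (auto simp: elementary_def dot_basis_basis intro!: tv_GL supported_basis)

text \<open>The Steinberg relation through a third index \<open>k\<close>; it makes the elementary
  group perfect.\<close>

lemma elementary_commutator:
  assumes "i < n" "j < n" "k < n" "i \<noteq> j" "i \<noteq> k" "j \<noteq> k"
  shows "tv (basis_vec i) (basis_vec j) = tv (basis_vec i) (basis_vec k) \<otimes>\<^bsub>\<Gamma>\<^esub> tv (basis_vec k) (basis_vec j)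
    \<otimes>\<^bsub>\<Gamma>\<^esub> inv\<^bsub>\<Gamma>\<^esub> tv (basis_vec i) (basis_vec k) \<otimes>\<^bsub>\<Gamma>\<^esub> inv\<^bsub>\<Gamma>\<^esub> tv (basis_vec k) (basis_vec j)"
proof -
  have cl: "tv (basis_vec i) (basis_vec j) \<in> carrier \<Gamma>" if "i < n" "j < n" "i \<noteq> j" for i j
    using elementary_closed that by (auto simp: elementary_def)
  note sup = supported_basis[OF assms(1)] supported_basis[OF assms(2)] supported_basis[OF assms(3)]
  have d: "dot n (basis_vec k) (basis_vec i) = 0" "dot n (basis_vec j) (basis_vec k) = 0"
    using assms by (simp_all add: dot_basis_basis)
  show ?thesis
  proof (rule GL_eqI[of _ n])
    fix v
    show "mat_act (tv (basis_vec i) (basis_vec j)) v = mat_act (tv (basis_vec i) (basis_vec k) \<otimes>\<^bsub>\<Gamma>\<^esub> tv (basis_vec k) (basis_vec j)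
    \<otimes>\<^bsub>\<Gamma>\<^esub> inv\<^bsub>\<Gamma>\<^esub> tv (basis_vec i) (basis_vec k) \<otimes>\<^bsub>\<Gamma>\<^esub> inv\<^bsub>\<Gamma>\<^esub> tv (basis_vec k) (basis_vec j)) v"
      using assms cl sup
      by (simp add: GL_act_mult tv_act tv_act_inv[OF sup(1) d(1)] tv_act_inv[OF sup(3) d(2)] dot_basis_left) (auto simp: fun_eq_iff basis_vec_def)
  qed (use assms cl in simp_all)
qed

lemma finite_image_bounded:
  fixes f :: "(nat \<Rightarrow> int) \<Rightarrow> 'c"
  assumes "0 < q" and f: "\<And>t. supported b t \<Longrightarrow> f t = f (\<lambda>i. t i mod q)"
  shows "finite (f ` {t. supported b t})"
proof -
  let ?T = "{t. \<forall>i. (i \<in> {..<b} \<longrightarrow> t i \<in> {0..<q}) \<and> (i \<notin> {..<b} \<longrightarrow> t i = 0)}"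
  have "f ` {t. supported b t} \<subseteq> f ` ?T"
  proof
    fix y assume "y \<in> f ` {t. supported b t}"
    then obtain t where t: "supported b t" "y = f t" by blast
    have "(\<lambda>i. t i mod q) \<in> ?T" using t(1) \<open>0 < q\<close> by (auto simp: supported_def)
    then show "y \<in> f ` ?T" using f[OF t(1)] t(2) by blast
  qed
  moreover have "finite ?T" by (rule finite_set_of_finite_funs) simp_all
  ultimately show ?thesis by (meson finite_imageI finite_subset)
qed

theorem finite_image_elementary:
  assumes M: "triv M" "M \<notin> group_center \<Gamma>"
  shows "finite (\<psi> ` generate \<Gamma> elementary)"
proof -
  obtain c a r where r: "c < n" "a < n" "c \<noteq> a" "r \<noteq> 0" "triv (tv (\<lambda>i. r * basis_vec c i) (basis_vec a))"
    using exists_triv_elementary[OF M] by blast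
  \<comment> \<open>Residues need a positive modulus; the sign of \<open>r\<close> is absorbed by
    inverting the transvection.\<close>
  define q where "q = \<bar>r\<bar>"
  have q: "0 < q" using r by (simp add: q_def)
  have el: "triv (tv (\<lambda>k. q * basis_vec i k) (basis_vec j))" if ij: "i < n" "j < n" "i \<noteq> j" for i j
  proof -
    have 1: "triv (tv (\<lambda>k. r * basis_vec i k) (basis_vec j))"
      by (rule triv_all_elementary[OF r(1,2,3,5) ij])
    have "inv\<^bsub>\<Gamma>\<^esub> tv (\<lambda>k. r * basis_vec i k) (basis_vec j) = tv (\<lambda>k. - 1 * (r * basis_vec i k)) (basis_vec j)"
      using ij supported_basis[OF ij(1)]
      by (intro transvection_GL) (simp_all add: dot_scale_right dot_basis_basis supported_def)
    then have "triv (tv (\<lambda>k. - r * basis_vec i k) (basis_vec j))"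
      using triv_inv[OF 1] by simp
    with 1 show ?thesis by (cases "r > 0") (simp_all add: q_def)
  qed
  let ?S = "\<psi> ` generate \<Gamma> elementary"
  \<comment> \<open>The image is made a group of its own, because perfectness and the center are to
    be taken inside it and not inside \<open>G\<close>.\<close>
  define Sg where "Sg = G\<lparr>carrier := ?S\<rparr>"
  have EEsub: "subgroup (generate \<Gamma> elementary) \<Gamma>"
    by (rule G.generate_is_subgroup[OF elementary_closed])
  have Ssub: "subgroup ?S G" by (rule subgroup_img_is_subgroup[OF EEsub])
  have S_closed: "x \<in> carrier G" if "x \<in> ?S" for x using subgroup.mem_carrier[OF Ssub that] .
  interpret Sg: group Sg unfolding Sg_def by (rule subgroup.subgroup_is_group[OF Ssub H.is_group])
  have Sg_simps: "carrier Sg = ?S" "x \<otimes>\<^bsub>Sg\<^esub> y = x \<otimes> y" for x y by (simp_all add: Sg_def)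
  have Sg_inv: "inv\<^bsub>Sg\<^esub> x = inv x" if "x \<in> ?S" for x
    unfolding Sg_def by (rule H.m_inv_consistent[OF Ssub that])
  let ?com = "{x \<otimes>\<^bsub>Sg\<^esub> y \<otimes>\<^bsub>Sg\<^esub> inv\<^bsub>Sg\<^esub> x \<otimes>\<^bsub>Sg\<^esub> inv\<^bsub>Sg\<^esub> y |x y. x \<in> carrier Sg \<and> y \<in> carrier Sg}"
  have com_sub: "?com \<subseteq> ?S" using Sg.m_closed Sg.inv_closed Sg_simps(1) by auto
  have "\<psi> ` elementary \<subseteq> ?com"
  proof
    fix x assume "x \<in> \<psi> ` elementary"
    then obtain i j where ij: "i < n" "j < n" "i \<noteq> j" "x = \<psi> (tv (basis_vec i) (basis_vec j))"
      by (auto simp: elementary_def)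
    obtain k where k: "k < n" "k \<noteq> i" "k \<noteq> j" using exists_third by blast
    let ?y = "tv (basis_vec i) (basis_vec k)" and ?z = "tv (basis_vec k) (basis_vec j)"
    have yz: "?y \<in> elementary" "?z \<in> elementary" using ij k by (auto simp: elementary_def)
    then have yzc: "?y \<in> carrier \<Gamma>" "?z \<in> carrier \<Gamma>" using elementary_closed by blast+
    have yzS: "\<psi> ?y \<in> ?S" "\<psi> ?z \<in> ?S" using yz by (auto intro: generate.incl)
    have "x = \<psi> ?y \<otimes> \<psi> ?z \<otimes> inv (\<psi> ?y) \<otimes> inv (\<psi> ?z)"
      unfolding ij(4) using elementary_commutator[OF ij(1,2) k(1) ij(3)] k yzc by simp
    then have "x = \<psi> ?y \<otimes>\<^bsub>Sg\<^esub> \<psi> ?z \<otimes>\<^bsub>Sg\<^esub> inv\<^bsub>Sg\<^esub> (\<psi> ?y) \<otimes>\<^bsub>Sg\<^esub> inv\<^bsub>Sg\<^esub> (\<psi> ?z)"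
      using yzS by (simp add: Sg_simps Sg_inv)
    then show "x \<in> ?com" using yzS Sg_simps(1) by blast
  qed
  then have "generate G (\<psi> ` elementary) \<subseteq> generate G ?com" by (rule H.mono_generate)
  moreover have "generate G (\<psi> ` elementary) = ?S"
    using generate_img[OF elementary_closed] by simp
  moreover have "generate Sg ?com = generate G ?com"
    unfolding Sg_def using H.generate_consistent[OF _ Ssub] com_sub[unfolded Sg_def] by blast
  ultimately have perfect: "carrier Sg \<subseteq> generate Sg ?com" using Sg_simps(1) by simp
  \<comment> \<open>An arbitrary choice of decomposition. It need not respect products, because it
    only serves to sort elements into finitely many classes by \<open>\<kappa>\<close>.\<close>
  define d where "d M = (SOME (t, s, t', B, s'). supported b t \<and> supported b s \<and> supported b t' \<and> supported b s' \<and> B \<in> blocks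
    \<and> M = upper t \<otimes>\<^bsub>\<Gamma>\<^esub> lower s \<otimes>\<^bsub>\<Gamma>\<^esub> upper t' \<otimes>\<^bsub>\<Gamma>\<^esub> B \<otimes>\<^bsub>\<Gamma>\<^esub> lower s')" for M
  define red where "red B = (\<lambda>(i, j). if i < n \<and> j < n then B $$ (i, j) mod q else 0)" for B :: "int mat"
  define pre where "pre x = (SOME M. M \<in> generate \<Gamma> elementary \<and> \<psi> M = x)" for x
  define \<kappa> where "\<kappa> x = (case d (pre x) of (t, s, t', B, s') \<Rightarrow>
    (\<psi> (upper t), \<psi> (lower s), \<psi> (upper t'), red B, \<psi> (lower s')))" for x
  let ?U = "(\<lambda>t. \<psi> (upper t)) ` {t. supported b t}" and ?L = "(\<lambda>t. \<psi> (lower t)) ` {t. supported b t}"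
  have dec: "\<exists>t s t' B s'. supported b t \<and> supported b s \<and> supported b t' \<and> supported b s' \<and> B \<in> blocks
      \<and> x = \<psi> (upper t) \<otimes> \<psi> (lower s) \<otimes> \<psi> (upper t') \<otimes> \<psi> B \<otimes> \<psi> (lower s')
      \<and> \<kappa> x = (\<psi> (upper t), \<psi> (lower s), \<psi> (upper t'), red B, \<psi> (lower s'))" if x: "x \<in> ?S" for x
  proof -
    have "\<exists>M. M \<in> generate \<Gamma> elementary \<and> \<psi> M = x" using x by blast
    then have p: "pre x \<in> generate \<Gamma> elementary" "\<psi> (pre x) = x"
      using someI_ex[of "\<lambda>M. M \<in> generate \<Gamma> elementary \<and> \<psi> M = x"] unfolding pre_def by blast+
    have pc: "pre x \<in> carrier \<Gamma>" using p(1) G.generate_in_carrier[OF elementary_closed] by blast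
    obtain t s t' B s' where ds: "d (pre x) = (t, s, t', B, s')" by (cases "d (pre x)") auto
    have "\<exists>z. case z of (t, s, t', B, s') \<Rightarrow> supported b t \<and> supported b s \<and> supported b t' \<and> supported b s' \<and> B \<in> blocks
      \<and> pre x = upper t \<otimes>\<^bsub>\<Gamma>\<^esub> lower s \<otimes>\<^bsub>\<Gamma>\<^esub> upper t' \<otimes>\<^bsub>\<Gamma>\<^esub> B \<otimes>\<^bsub>\<Gamma>\<^esub> lower s'"
      using GL_decomposition[OF pc] by auto
    from someI_ex[OF this] have D: "supported b t \<and> supported b s \<and> supported b t' \<and> supported b s' \<and> B \<in> blocks
      \<and> pre x = upper t \<otimes>\<^bsub>\<Gamma>\<^esub> lower s \<otimes>\<^bsub>\<Gamma>\<^esub> upper t' \<otimes>\<^bsub>\<Gamma>\<^esub> B \<otimes>\<^bsub>\<Gamma>\<^esub> lower s'"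
      unfolding d_def[symmetric] ds by simp
    have Bc: "B \<in> carrier \<Gamma>" using D by (simp add: blocks_def)
    have "x = \<psi> (pre x)" using p by simp
    also have "\<dots> = \<psi> (upper t) \<otimes> \<psi> (lower s) \<otimes> \<psi> (upper t') \<otimes> \<psi> B \<otimes> \<psi> (lower s')"
      using D Bc upper_lower_GL by simp
    finally show ?thesis using D ds by (intro exI[of _ t] exI[of _ s] exI[of _ t'] exI[of _ B] exI[of _ s']) (simp add: \<kappa>_def)
  qed
  have "finite (\<kappa> ` ?S)"
  proof -
    have fU: "finite ?U"
    proof (rule finite_image_bounded[OF q])
      fix t assume t: "supported b t"
      let ?t = "\<lambda>i. t i mod q" and ?u = "\<lambda>i. t i div q"
      have sup: "supported b ?t" "supported n ?u" "supported n (\<lambda>i. q * ?u i)" "?u b = 0"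
        using t bn by (auto simp: supported_def)
      have 1: "triv (tv (\<lambda>i. q * ?u i) (basis_vec b))"
        by (rule triv_tv_times_column[where x = ?u, OF el bn(1) sup(4,2)])
      have "upper t = upper ?t \<otimes>\<^bsub>\<Gamma>\<^esub> tv (\<lambda>i. q * ?u i) (basis_vec b)"
      proof (rule GL_eqI[of _ n])
        fix v
        have "mat_act (upper ?t \<otimes>\<^bsub>\<Gamma>\<^esub> tv (\<lambda>i. q * ?u i) (basis_vec b)) v = (\<lambda>i. v i + v b * (q * ?u i) + v b * ?t i)"
          using upper_lower_GL[OF sup(1)] 1 bn sup(4)
          by (simp add: GL_act_mult triv_def upper_act[OF sup(1)] tv_act[OF sup(3)] dot_basis_left)
        also have "\<dots> = mat_act (upper t) v"
          unfolding upper_act[OF t] by (simp add: fun_eq_iff add.assoc flip: distrib_left)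
        finally show "mat_act (upper t) v = mat_act (upper ?t \<otimes>\<^bsub>\<Gamma>\<^esub> tv (\<lambda>i. q * ?u i) (basis_vec b)) v" ..
      qed (use upper_lower_GL[OF t] upper_lower_GL[OF sup(1)] 1 in \<open>simp_all add: triv_def\<close>)
      then show "\<psi> (upper t) = \<psi> (upper ?t)"
        using upper_lower_GL[OF sup(1)] 1 by (simp add: triv_def)
    qed
    have fL: "finite ?L"
    proof (rule finite_image_bounded[OF q])
      fix t assume t: "supported b t"
      let ?t = "\<lambda>i. t i mod q" and ?u = "\<lambda>i. t i div q"
      have sup: "supported b ?t" "?u b = 0" "supported n (\<lambda>i. q * basis_vec b i)"
        using t bn supported_basis[OF bn(1)] by (auto simp: supported_def)
      have 1: "triv (tv (\<lambda>i. q * basis_vec b i) ?u)"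
        by (rule triv_tv_times_row[where g = ?u, OF el bn(1) sup(2)])
      have "lower t = lower ?t \<otimes>\<^bsub>\<Gamma>\<^esub> tv (\<lambda>i. q * basis_vec b i) ?u"
      proof (rule GL_eqI[of _ n])
        fix v
        have "dot n ?t (\<lambda>i. q * basis_vec b i) = 0" using supported_b(4)[OF sup(1)] by (simp only: dot_scale_right)
        then have "mat_act (lower ?t \<otimes>\<^bsub>\<Gamma>\<^esub> tv (\<lambda>i. q * basis_vec b i) ?u) v
            = (\<lambda>i. v i + dot n ?u v * (q * basis_vec b i) + dot n ?t v * basis_vec b i)"
          using upper_lower_GL[OF sup(1)] 1
          by (simp only: GL_act_mult triv_def lower_act tv_act[OF sup(3)] dot_add_right) simp
        also have "\<dots> = (\<lambda>i. v i + dot n (\<lambda>i. 1 * ?t i + q * ?u i) v * basis_vec b i)"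
          unfolding dot_add_left by (simp add: algebra_simps)
        also have "(\<lambda>i. 1 * ?t i + q * ?u i) = t" by simp
        finally show "mat_act (lower t) v = mat_act (lower ?t \<otimes>\<^bsub>\<Gamma>\<^esub> tv (\<lambda>i. q * basis_vec b i) ?u) v"
          unfolding lower_act ..
      qed (use upper_lower_GL[OF t] upper_lower_GL[OF sup(1)] 1 in \<open>simp_all add: triv_def\<close>)
      then show "\<psi> (lower t) = \<psi> (lower ?t)"
        using upper_lower_GL[OF sup(1)] 1 by (simp add: triv_def)
    qed
    let ?F = "{g. \<forall>z. (z \<in> {..<n} \<times> {..<n} \<longrightarrow> g z \<in> {0..<q}) \<and> (z \<notin> {..<n} \<times> {..<n} \<longrightarrow> g z = 0)}"
    have fF: "finite ?F" by (rule finite_set_of_finite_funs) simp_all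
    have red: "red B \<in> ?F" for B using q by (auto simp: red_def)
    have "\<kappa> ` ?S \<subseteq> ?U \<times> ?L \<times> ?U \<times> ?F \<times> ?L"
    proof
      fix y assume "y \<in> \<kappa> ` ?S"
      then obtain x where "x \<in> ?S" "y = \<kappa> x" by blast
      with dec[of x] obtain t s t' B s' where "supported b t" "supported b s" "supported b t'" "supported b s'"
        "y = (\<psi> (upper t), \<psi> (lower s), \<psi> (upper t'), red B, \<psi> (lower s'))" by metis
      then show "y \<in> ?U \<times> ?L \<times> ?U \<times> ?F \<times> ?L" using red[of B] by blast
    qed
    then show ?thesis using fU fL fF by (meson finite_SigmaI finite_subset)
  qed
  \<comment> \<open>Elements of one class share all unipotent images and differ only in blocks
    \<open>B\<close> and \<open>B2\<close> with equal residues modulo \<open>q\<close>. So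
    \<open>x \<otimes> inv y\<close> is a conjugate of \<open>\<psi> D\<close>, and
    \<open>\<psi> D\<close> commutes with the conjugating factor \<open>p\<close> and with the
    images of all elementary matrices.\<close>
  moreover have "x \<otimes>\<^bsub>Sg\<^esub> inv\<^bsub>Sg\<^esub> y \<in> group_center Sg" if xy: "x \<in> ?S" "y \<in> ?S" "\<kappa> x = \<kappa> y" for x y
  proof -
    obtain t s t' B s' where x: "supported b t" "supported b s" "supported b t'" "supported b s'" "B \<in> blocks"
      "x = \<psi> (upper t) \<otimes> \<psi> (lower s) \<otimes> \<psi> (upper t') \<otimes> \<psi> B \<otimes> \<psi> (lower s')"
      "\<kappa> x = (\<psi> (upper t), \<psi> (lower s), \<psi> (upper t'), red B, \<psi> (lower s'))"
      using dec[OF xy(1)] by blast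
    obtain t2 s2 t2' B2 s2' where y: "supported b t2" "supported b s2" "supported b t2'" "supported b s2'" "B2 \<in> blocks"
      "y = \<psi> (upper t2) \<otimes> \<psi> (lower s2) \<otimes> \<psi> (upper t2') \<otimes> \<psi> B2 \<otimes> \<psi> (lower s2')"
      "\<kappa> y = (\<psi> (upper t2), \<psi> (lower s2), \<psi> (upper t2'), red B2, \<psi> (lower s2'))"
      using dec[OF xy(2)] by blast
    have y': "y = \<psi> (upper t) \<otimes> \<psi> (lower s) \<otimes> \<psi> (upper t') \<otimes> \<psi> B2 \<otimes> \<psi> (lower s')" and red: "red B = red B2"
      using x(7) y(6,7) xy(3) by auto
    have Bc: "B \<in> carrier \<Gamma>" "B2 \<in> carrier \<Gamma>" using x(5) y(5) by (auto simp: blocks_def)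
    define D where "D = B \<otimes>\<^bsub>\<Gamma>\<^esub> inv\<^bsub>\<Gamma>\<^esub> B2"
    have Dact: "mat_act D v = mat_act B (mat_act (inv\<^bsub>\<Gamma>\<^esub> B2) v)" for v
      using Bc by (simp add: D_def GL_act_mult)
    have D: "D \<in> blocks"
    proof -
      have "mat_act (inv\<^bsub>\<Gamma>\<^esub> B2) (basis_vec b) = basis_vec b"
        using GL_act_inv(1)[OF Bc(2), of "basis_vec b"] y(5) unfolding blocks_def by simp
      moreover have "mat_act (inv\<^bsub>\<Gamma>\<^esub> B2) v b = v b" for v
      proof -
        have "mat_act B2 (mat_act (inv\<^bsub>\<Gamma>\<^esub> B2) v) b = mat_act (inv\<^bsub>\<Gamma>\<^esub> B2) v b" using y(5) unfolding blocks_def by blast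
        then show ?thesis by (simp add: GL_act_inv[OF Bc(2)])
      qed
      moreover have "D \<in> carrier \<Gamma>" using Bc by (simp add: D_def)
      ultimately show ?thesis using x(5) unfolding blocks_def by (simp add: Dact)
    qed
    have Dq: "q dvd mat_act D v i - v i" if i: "i < n" for v i
    proof -
      let ?w = "mat_act (inv\<^bsub>\<Gamma>\<^esub> B2) v"
      have "mat_act D v i - v i = mat_act B ?w i - mat_act B2 ?w i"
        by (simp add: Dact GL_act_inv[OF Bc(2)])
      also have "\<dots> = (\<Sum>j<n. (B $$ (i, j) - B2 $$ (i, j)) * ?w j)"
        using i GL_carrier_mat[OF Bc(1)] GL_carrier_mat[OF Bc(2)] by (simp add: mat_act_def sum_subtractf algebra_simps)
      also have "q dvd \<dots>"
      proof (intro dvd_sum dvd_mult2)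
        fix j assume "j \<in> {..<n}"
        then have "B $$ (i, j) mod q = B2 $$ (i, j) mod q"
          using fun_cong[OF red, of "(i, j)"] i by (simp add: red_def)
        then show "q dvd B $$ (i, j) - B2 $$ (i, j)" by (rule mod_eq_dvd_iff[THEN iffD1])
      qed
      finally show ?thesis .
    qed
    have Dc: "D \<in> carrier \<Gamma>" using D by (simp add: blocks_def)
    have comm: "\<psi> D \<otimes> \<psi> (upper t) = \<psi> (upper t) \<otimes> \<psi> D" "\<psi> D \<otimes> \<psi> (lower t) = \<psi> (lower t) \<otimes> \<psi> D"
      if t: "supported b t" for t
      by (rule congruence_commutes[of q D t]; fact el D Dq t)+
    define p where "p = \<psi> (upper t) \<otimes> \<psi> (lower s) \<otimes> \<psi> (upper t')"
    note cl = upper_lower_GL(1,2)[OF x(1)] upper_lower_GL(1,2)[OF x(2)] upper_lower_GL(1,2)[OF x(3)] upper_lower_GL(1,2)[OF x(4)]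
    have pc: "p \<in> carrier G" using cl by (simp add: p_def)
    have "\<psi> D \<otimes> p = (\<psi> D \<otimes> \<psi> (upper t)) \<otimes> \<psi> (lower s) \<otimes> \<psi> (upper t')"
      using cl Dc by (simp add: p_def H.m_assoc)
    also have "\<dots> = \<psi> (upper t) \<otimes> (\<psi> D \<otimes> \<psi> (lower s)) \<otimes> \<psi> (upper t')"
      unfolding comm(1)[OF x(1)] using cl Dc by (simp add: H.m_assoc)
    also have "\<dots> = \<psi> (upper t) \<otimes> \<psi> (lower s) \<otimes> (\<psi> D \<otimes> \<psi> (upper t'))"
      unfolding comm(2)[OF x(2)] using cl Dc by (simp add: H.m_assoc)
    also have "\<dots> = p \<otimes> \<psi> D"
      unfolding comm(1)[OF x(3)] using cl Dc by (simp add: p_def H.m_assoc)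
    finally have pD: "\<psi> D \<otimes> p = p \<otimes> \<psi> D" .
    have "x = p \<otimes> \<psi> B \<otimes> \<psi> (lower s')" "y = p \<otimes> \<psi> B2 \<otimes> \<psi> (lower s')"
      using x(6) y' by (simp_all add: p_def)
    then have "x \<otimes> inv y = p \<otimes> (\<psi> B \<otimes> inv (\<psi> B2)) \<otimes> inv p"
      using pc Bc cl by (simp add: H.inv_mult_group H.m_assoc H.inv_cancel_left)
    also have "\<psi> B \<otimes> inv (\<psi> B2) = \<psi> D" using Bc by (simp add: D_def)
    also have "p \<otimes> \<psi> D \<otimes> inv p = \<psi> D"
      unfolding pD[symmetric] using pc Dc by (simp add: H.m_assoc)
    finally have xyD: "x \<otimes> inv y = \<psi> D" .
    have "generate \<Gamma> elementary \<subseteq> {M \<in> carrier \<Gamma>. \<psi> D \<otimes> \<psi> M = \<psi> M \<otimes> \<psi> D}" (is "_ \<subseteq> ?C")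
    proof (rule G.generate_subgroup_incl)
      have com_e: "tv (basis_vec i) (basis_vec j) \<in> ?C" if "i < n" "j < n" "i \<noteq> j" "i = b \<or> j = b" for i j
      proof -
        have c: "tv (basis_vec i) (basis_vec j) \<in> carrier \<Gamma>" using that elementary_closed by (auto simp: elementary_def)
        have "supported b (basis_vec k)" if "k < n" "k \<noteq> b" for k using that by (auto simp: supported_def basis_vec_def b_def)
        then show ?thesis using comm that c by blast
      qed
      show sub: "subgroup ?C \<Gamma>"
      proof (rule G.subgroupI)
        show "?C \<noteq> {}" using Dc by auto
        fix M assume M: "M \<in> ?C"
        then have "inv (\<psi> M) \<otimes> \<psi> D = \<psi> D \<otimes> inv (\<psi> M)"
          using Dc by (intro H.commute_inv) auto
        then show "inv\<^bsub>\<Gamma>\<^esub> M \<in> ?C" using M by auto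
        fix N assume N: "N \<in> ?C"
        have "\<psi> D \<otimes> (\<psi> M \<otimes> \<psi> N) = \<psi> M \<otimes> \<psi> D \<otimes> \<psi> N" using M N Dc by (simp flip: H.m_assoc)
        also have "\<dots> = \<psi> M \<otimes> \<psi> N \<otimes> \<psi> D" using M N Dc by (simp add: H.m_assoc)
        finally show "M \<otimes>\<^bsub>\<Gamma>\<^esub> N \<in> ?C" using M N by simp
      qed auto
      show "elementary \<subseteq> ?C"
      proof
        fix M assume "M \<in> elementary"
        then obtain i j where ij: "i < n" "j < n" "i \<noteq> j" "M = tv (basis_vec i) (basis_vec j)"
          by (auto simp: elementary_def)
        show "M \<in> ?C"
        proof (cases "i = b \<or> j = b")
          case True
          then show ?thesis using com_e ij by blast
        next
          case False
          \<comment> \<open>Elementary matrices that avoid the index \<open>b\<close> are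
            commutators through \<open>b\<close>.\<close>
          then have "tv (basis_vec i) (basis_vec b) \<in> ?C" "tv (basis_vec b) (basis_vec j) \<in> ?C"
            using com_e ij bn by blast+
          then show ?thesis
            unfolding ij(4) elementary_commutator[OF ij(1,2) bn(1) ij(3) conjunct1[OF False[unfolded de_Morgan_disj]] conjunct2[OF False[unfolded de_Morgan_disj]]]
            by (intro subgroup.m_closed[OF sub] subgroup.m_inv_closed[OF sub])
        qed
      qed
    qed
    then have "\<psi> D \<otimes> z = z \<otimes> \<psi> D" if "z \<in> ?S" for z using that by blast
    moreover have "x \<otimes>\<^bsub>Sg\<^esub> inv\<^bsub>Sg\<^esub> y = \<psi> D" using xyD xy by (simp add: Sg_simps Sg_inv)
    moreover have "x \<otimes>\<^bsub>Sg\<^esub> inv\<^bsub>Sg\<^esub> y \<in> carrier Sg" using xy Sg_simps(1) by (intro Sg.m_closed Sg.inv_closed) auto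
    ultimately show ?thesis by (simp add: group_center_def Sg_simps)
  qed
  ultimately have "finite (carrier Sg)"
    using Sg.finite_of_perfect_finite_classes[OF perfect, of \<kappa>] Sg_simps(1) by simp
  then show ?thesis using Sg_simps(1) by simp
qed

end

section \<open>Automorphisms of free groups\<close>

abbreviation word_inv :: "'a letter list \<Rightarrow> 'a letter list" where
  "word_inv w \<equiv> rev (map inv_letter w)"

lemma word_inv_word_inv [simp]: "word_inv (word_inv w) = w"
  by (induction w) auto

lemma inv_letter_inject [simp]: "inv_letter a = inv_letter b \<longleftrightarrow> a = b"
  by (metis inv_letter_inv_letter)

lemma reduced_word_Nil [simp]: "reduced_word []"
  by (simp add: reduced_word_def)

lemma reduced_word_single [simp]: "reduced_word [a]"
  by (simp add: reduced_word_def)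

lemma reduced_word_append:
  "reduced_word (u @ v) \<longleftrightarrow> reduced_word u \<and> reduced_word v \<and> (u = [] \<or> v = [] \<or> hd v \<noteq> inv_letter (last u))"
  by (auto simp: reduced_word_def successively_append_iff)

lemma reduced_word_inv_iff [simp]: "reduced_word (word_inv w) \<longleftrightarrow> reduced_word w"
  using reduced_inverse_word[of w] reduced_inverse_word[of "word_inv w"] unfolding word_inv_word_inv by blast

lemma last_word_inv: "r \<noteq> [] \<Longrightarrow> last (word_inv r) = inv_letter (hd r)"
  by (cases r) auto

lemma fst_set_word_inv [simp]: "fst ` set (word_inv w) = fst ` set w"
  by (simp add: image_image)

lemma foldr_cancel_cons_append:
  "reduced_word (u @ v) \<Longrightarrow> foldr cancel_cons u v = u @ v"
proof (induction u)
  case (Cons a u)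
  then have "foldr cancel_cons u v = u @ v" by (cases u) (auto simp: reduced_word_def successively_Cons split: list.splits)
  moreover have "cancel_cons a (u @ v) = a # u @ v"
    using Cons.prems by (cases "u @ v") (auto simp: cancel_cons_def reduced_word_def)
  ultimately show ?case by simp
qed simp

text \<open>Exactly \<open>p\<close> cancels: the inverse of \<open>v\<close> and the word
  \<open>w\<close> agree on \<open>p\<close> and then separate, so the remaining parts meet without
  cancellation.\<close>

lemma foldr_cancel_cons_overlap:
  assumes "word_inv v = p @ r" "w = p @ s" "reduced_word v" "reduced_word w" "r = [] \<or> s = [] \<or> hd r \<noteq> hd s"
  shows "foldr cancel_cons v w = word_inv r @ s"
proof -
  have v: "v = word_inv r @ word_inv p"
    using assms(1) by (metis map_append rev_append word_inv_word_inv)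
  have r: "reduced_word (word_inv r)" and p: "reduced_word p" and s: "reduced_word s"
    using assms(2-4) unfolding v by (simp_all add: reduced_word_append)
  have "foldr cancel_cons v w = foldr cancel_cons (word_inv r) (foldr cancel_cons (word_inv p) (p @ s))"
    by (simp add: v assms(2))
  also have "p @ s = foldr cancel_cons p s"
    using assms(2,4) foldr_cancel_cons_append by metis
  also have "foldr cancel_cons (word_inv p) (foldr cancel_cons p s) = s"
    by (rule foldr_cancel_cons_inverse[OF s])
  also have "foldr cancel_cons (word_inv r) s = word_inv r @ s"
  proof (rule foldr_cancel_cons_append)
    show "reduced_word (word_inv r @ s)"
      unfolding reduced_word_append using r s assms(5) last_word_inv[of r] by auto
  qed
  finally show ?thesis .
qed

definition letter_image :: "('a \<Rightarrow> 'b letter list) \<Rightarrow> 'a letter \<Rightarrow> 'b letter list" where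
  "letter_image f a = (if snd a then f (fst a) else word_inv (f (fst a)))"

definition ext :: "('a \<Rightarrow> 'b letter list) \<Rightarrow> 'a letter list \<Rightarrow> 'b letter list" where
  "ext f w = foldr (\<lambda>a. foldr cancel_cons (letter_image f a)) w []"

lemma ext_Nil [simp]: "ext f [] = []"
  and ext_Cons: "ext f (a # w) = foldr cancel_cons (letter_image f a) (ext f w)"
  by (simp_all add: ext_def)

lemma letter_image_inv: "letter_image f (inv_letter a) = word_inv (letter_image f a)"
  by (simp add: letter_image_def inv_letter_def)

section \<open>Endomorphisms and automorphisms given on the generators\<close>

locale free_group_on =
  fixes S :: "'a set"
begin

abbreviation "F \<equiv> free_group S"

sublocale F: group F by (rule group_free_group)

lemma F_simps [simp]: "u \<otimes>\<^bsub>F\<^esub> v = foldr cancel_cons u v" "\<one>\<^bsub>F\<^esub> = []"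
  by (simp_all add: free_group_def)

lemma F_carrier: "w \<in> carrier F \<longleftrightarrow> fst ` set w \<subseteq> S \<and> reduced_word w"
  by (simp add: free_group_def)

lemma F_inv: "w \<in> carrier F \<Longrightarrow> inv\<^bsub>F\<^esub> w = word_inv w"
proof (rule F.inv_equality)
  assume "w \<in> carrier F"
  then show "word_inv w \<otimes>\<^bsub>F\<^esub> w = \<one>\<^bsub>F\<^esub>"
    using foldr_cancel_cons_inverse[of "[]" w] by (simp add: F_carrier foldr_cancel_cons_Nil)
qed (auto simp: F_carrier)

definition maps :: "('a \<Rightarrow> 'a letter list) \<Rightarrow> bool" where
  "maps f \<longleftrightarrow> (\<forall>x\<in>S. f x \<in> carrier F)"

lemma letter_image_closed: "maps f \<Longrightarrow> fst a \<in> S \<Longrightarrow> letter_image f a \<in> carrier F"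
  by (simp add: maps_def letter_image_def F_carrier del: set_rev set_map)

lemma ext_closed: "maps f \<Longrightarrow> fst ` set w \<subseteq> S \<Longrightarrow> ext f w \<in> carrier F"
proof (induction w)
  case Nil
  then show ?case using F.one_closed by simp
next
  case (Cons a w)
  then have "letter_image f a \<otimes>\<^bsub>F\<^esub> ext f w \<in> carrier F"
    by (intro F.m_closed letter_image_closed) auto
  then show ?case by (simp add: ext_Cons)
qed

lemma ext_cancel_cons:
  assumes f: "maps f" and "fst a \<in> S" "fst ` set w \<subseteq> S"
  shows "ext f (cancel_cons a w) = foldr cancel_cons (letter_image f a) (ext f w)"
proof (cases "\<exists>v. w = inv_letter a # v")
  case True
  then obtain v where v: "w = inv_letter a # v" by blast
  have "reduced_word (ext f v)" using ext_closed[OF f, of v] assms(3) v by (simp add: F_carrier)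
  from foldr_cancel_cons_inverse[OF this, of "word_inv (letter_image f a)"]
  have "foldr cancel_cons (letter_image f a) (foldr cancel_cons (word_inv (letter_image f a)) (ext f v)) = ext f v"
    by (simp only: word_inv_word_inv)
  then show ?thesis by (simp add: v cancel_cons_def ext_Cons letter_image_inv)
next
  case False
  then have "cancel_cons a w = a # w" by (auto simp: cancel_cons_def split: list.splits)
  then show ?thesis by (simp add: ext_Cons)
qed

lemma ext_mult:
  assumes f: "maps f" and "fst ` set u \<subseteq> S" "fst ` set v \<subseteq> S"
  shows "ext f (foldr cancel_cons u v) = foldr cancel_cons (ext f u) (ext f v)"
  using assms(2)
proof (induction u)
  case (Cons a u)
  have "fst ` set (foldr cancel_cons u v) \<subseteq> S"
  proof (rule order_trans[OF image_mono[OF set_foldr_cancel_cons]])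
    show "fst ` (set u \<union> set v) \<subseteq> S" using Cons.prems assms(3) by auto
  qed
  then have "ext f (foldr cancel_cons (a # u) v) = foldr cancel_cons (letter_image f a) (ext f (foldr cancel_cons u v))"
    using ext_cancel_cons[OF f] Cons.prems by simp
  also have "\<dots> = letter_image f a \<otimes>\<^bsub>F\<^esub> (ext f u \<otimes>\<^bsub>F\<^esub> ext f v)"
    using Cons by simp
  also have "\<dots> = (letter_image f a \<otimes>\<^bsub>F\<^esub> ext f u) \<otimes>\<^bsub>F\<^esub> ext f v"
    using Cons.prems assms(3) letter_image_closed[OF f] ext_closed[OF f] by (intro F.m_assoc[symmetric]) auto
  finally show ?case by (simp add: ext_Cons)
qed simp

lemma hom_eq_ext:
  assumes h: "h \<in> hom F F" and f: "\<And>x. x \<in> S \<Longrightarrow> h [(x, True)] = f x" and w: "w \<in> carrier F"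
  shows "h w = ext f w"
proof -
  interpret h: group_hom F F h using h by unfold_locales
  have letter: "h [a] = letter_image f a" if "fst a \<in> S" for a
  proof -
    have c: "[(fst a, True)] \<in> carrier F" using that by (simp add: F_carrier)
    then have "h (inv\<^bsub>F\<^esub> [(fst a, True)]) = inv\<^bsub>F\<^esub> (h [(fst a, True)])" by (rule h.hom_inv)
    then have "h [(fst a, False)] = word_inv (f (fst a))"
      using c f[OF that] F_inv h.hom_closed[OF c] by (simp add: inv_letter_def)
    then show ?thesis using f[OF that] by (cases a; cases "snd a") (auto simp: letter_image_def)
  qed
  show ?thesis
    using w
  proof (induction w)
    case Nil
    then show ?case using h.hom_one by simp
  next
    case (Cons a w)
    then have aw: "[a] \<in> carrier F" "w \<in> carrier F" "fst a \<in> S"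
      by (auto simp: F_carrier reduced_word_def successively_Cons)
    have "a # w = [a] \<otimes>\<^bsub>F\<^esub> w"
      using Cons.prems foldr_cancel_cons_append[of "[a]" w] by (simp add: F_carrier)
    then have "h (a # w) = h [a] \<otimes>\<^bsub>F\<^esub> h w" using h.hom_mult aw by metis
    then show ?case using Cons.IH aw letter by (simp add: ext_Cons)
  qed
qed

abbreviation "A \<equiv> AutoGroup F"

sublocale A: group A by (rule F.AutoGroup)

lemma A_carrier: "\<alpha> \<in> carrier A \<longleftrightarrow> \<alpha> \<in> hom F F \<and> \<alpha> \<in> extensional (carrier F) \<and> bij_betw \<alpha> (carrier F) (carrier F)"
  by (auto simp: AutoGroup_def auto_def Bij_def)

lemma A_mult: "\<alpha> \<in> carrier A \<Longrightarrow> \<beta> \<in> carrier A \<Longrightarrow> w \<in> carrier F \<Longrightarrow> (\<alpha> \<otimes>\<^bsub>A\<^esub> \<beta>) w = \<alpha> (\<beta> w)"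
  by (simp add: AutoGroup_def BijGroup_def auto_def compose_def)

lemma A_one: "w \<in> carrier F \<Longrightarrow> \<one>\<^bsub>A\<^esub> w = w"
  by (simp add: AutoGroup_def BijGroup_def)

lemma A_closed: "\<alpha> \<in> carrier A \<Longrightarrow> w \<in> carrier F \<Longrightarrow> \<alpha> w \<in> carrier F"
  by (auto simp: A_carrier hom_def)

lemma gen_closed: "x \<in> S \<Longrightarrow> [(x, s)] \<in> carrier F"
  by (simp add: F_carrier)

lemma A_eq_ext:
  assumes "\<alpha> \<in> carrier A" "w \<in> carrier F"
  shows "\<alpha> w = ext (\<lambda>x. \<alpha> [(x, True)]) w"
  using assms by (intro hom_eq_ext) (simp_all add: A_carrier)

lemma A_maps: "\<alpha> \<in> carrier A \<Longrightarrow> maps (\<lambda>x. \<alpha> [(x, True)])"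
  using A_closed gen_closed by (simp add: maps_def)

lemma A_eqI:
  assumes "\<alpha> \<in> carrier A" "\<beta> \<in> carrier A" "\<And>x. x \<in> S \<Longrightarrow> \<alpha> [(x, True)] = \<beta> [(x, True)]"
  shows "\<alpha> = \<beta>"
proof
  fix w
  have "ext (\<lambda>x. \<alpha> [(x, True)]) w = ext (\<lambda>x. \<beta> [(x, True)]) w" if "fst ` set w \<subseteq> S"
    using that by (induction w) (simp_all add: ext_Cons letter_image_def assms(3))
  then show "\<alpha> w = \<beta> w"
    using A_eq_ext assms(1,2) by (cases "w \<in> carrier F") (auto simp: F_carrier A_carrier extensional_def)
qed

text \<open>Restricted to the carrier because the elements of \<open>AutoGroup\<close> are
  extensional functions.\<close>

definition endo :: "('a \<Rightarrow> 'a letter list) \<Rightarrow> 'a letter list \<Rightarrow> 'a letter list" where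
  "endo f = restrict (ext f) (carrier F)"

lemma ext_gen: "maps f \<Longrightarrow> x \<in> S \<Longrightarrow> ext f [(x, True)] = f x"
  by (simp add: ext_Cons letter_image_def maps_def F_carrier foldr_cancel_cons_Nil)

lemma endo_gen: "maps f \<Longrightarrow> x \<in> S \<Longrightarrow> endo f [(x, True)] = f x"
  using gen_closed[of x True] ext_gen by (simp add: endo_def)

lemma ext_hom: "maps f \<Longrightarrow> ext f \<in> hom F F"
proof (rule homI)
  assume f: "maps f"
  fix u v assume "u \<in> carrier F" "v \<in> carrier F"
  then have uv: "fst ` set u \<subseteq> S" "fst ` set v \<subseteq> S" by (simp_all add: F_carrier)
  show "ext f u \<in> carrier F" by (rule ext_closed[OF f uv(1)])
  show "ext f (u \<otimes>\<^bsub>F\<^esub> v) = ext f u \<otimes>\<^bsub>F\<^esub> ext f v" using ext_mult[OF f uv] by simp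
qed

lemma endo_automorphism:
  assumes f: "maps f" and g: "maps g" and fg: "\<And>x. x \<in> S \<Longrightarrow> ext f (g x) = [(x, True)]"
    and gf: "\<And>x. x \<in> S \<Longrightarrow> ext g (f x) = [(x, True)]"
  shows "endo f \<in> carrier A"
proof -
  have inv: "ext f (ext g w) = w"
    if f: "maps f" and g: "maps g" and fg: "\<And>x. x \<in> S \<Longrightarrow> ext f (g x) = [(x, True)]" and w: "w \<in> carrier F" for f g w
  proof -
    have comp: "ext f \<circ> ext g \<in> hom F F" using ext_hom[OF f] ext_hom[OF g] by (rule hom_compose[rotated])
    have "(ext f \<circ> ext g) w = ext (\<lambda>x. [(x, True)]) w"
      using fg ext_gen[OF g] by (intro hom_eq_ext[OF comp _ w]) simp
    moreover have "id w = ext (\<lambda>x. [(x, True)]) w"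
      by (rule hom_eq_ext[OF _ _ w]) (auto simp: hom_def)
    ultimately show ?thesis by simp
  qed
  have "bij_betw (ext f) (carrier F) (carrier F)"
    by (rule bij_betw_byWitness[where f' = "ext g"])
      (use inv[OF f g fg] inv[OF g f gf] ext_closed[OF f] ext_closed[OF g] in \<open>auto simp: F_carrier\<close>)
  then show ?thesis
    using ext_hom[OF f] unfolding A_carrier endo_def
    by (auto simp: hom_def F.m_closed simp del: F_simps cong: bij_betw_cong)
qed

text \<open>The right transvection that multiplies the generator \<open>j\<close> by
  \<open>i\<close> or its inverse; \<open>lam\<close> is the left one. The order of the indices is
  that of the elementary matrix obtained by abelianization, whose column \<open>j\<close> receives
  an entry in row \<open>i\<close>.\<close>

definition rho :: "'a \<Rightarrow> 'a \<Rightarrow> bool \<Rightarrow> 'a \<Rightarrow> 'a letter list" where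
  "rho i j s = (\<lambda>x. if x = j then [(j, True), (i, s)] else [(x, True)])"

definition lam :: "'a \<Rightarrow> 'a \<Rightarrow> bool \<Rightarrow> 'a \<Rightarrow> 'a letter list" where
  "lam i j s = (\<lambda>x. if x = j then [(i, s), (j, True)] else [(x, True)])"

text \<open>The sign is indexed by the image \<open>\<sigma> x\<close> and not by \<open>x\<close>;
  the product of two signed permutations then follows the rule of the semidirect product in
  \<open>W_group\<close>.\<close>

definition sperm :: "('a \<Rightarrow> 'a) \<Rightarrow> ('a \<Rightarrow> bool) \<Rightarrow> 'a \<Rightarrow> 'a letter list" where
  "sperm \<sigma> s = (\<lambda>x. [(\<sigma> x, s (\<sigma> x))])"

lemmas word_simps = ext_Cons letter_image_def cancel_cons_def inv_letter_def

lemma maps_elementary: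
  "i \<in> S \<Longrightarrow> i \<noteq> j \<Longrightarrow> maps (rho i j s)" "i \<in> S \<Longrightarrow> i \<noteq> j \<Longrightarrow> maps (lam i j s)"
  "\<sigma> permutes S \<Longrightarrow> maps (sperm \<sigma> t)"
  using permutes_in_image by (fastforce simp: maps_def rho_def lam_def sperm_def F_carrier reduced_word_def inv_letter_def)+

lemma aut_rho: "i \<in> S \<Longrightarrow> i \<noteq> j \<Longrightarrow> endo (rho i j s) \<in> carrier A"
  by (rule endo_automorphism[where g = "rho i j (\<not> s)"])
    (auto simp: rho_def word_simps intro: maps_elementary[unfolded rho_def])

lemma aut_lam: "i \<in> S \<Longrightarrow> i \<noteq> j \<Longrightarrow> endo (lam i j s) \<in> carrier A"
  by (rule endo_automorphism[where g = "lam i j (\<not> s)"])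
    (auto simp: lam_def word_simps intro: maps_elementary[unfolded lam_def])

lemma aut_sperm:
  assumes \<sigma>: "\<sigma> permutes S"
  shows "endo (sperm \<sigma> s) \<in> carrier A"
proof (rule endo_automorphism)
  show "maps (sperm \<sigma> s)" "maps (sperm (inv_into UNIV \<sigma>) (\<lambda>x. s (\<sigma> x)))"
    using \<sigma> by (auto intro: maps_elementary permutes_inv)
qed (use permutes_inverses[OF \<sigma>] in \<open>auto simp: sperm_def word_simps\<close>)

end

section \<open>Generation by Nielsen automorphisms\<close>

text \<open>The number of letters that each factor loses in the reduced product of \<open>v\<close>
  and \<open>w\<close>.\<close>

definition cancellation :: "'a letter list \<Rightarrow> 'a letter list \<Rightarrow> nat" where
  "cancellation v w = length (longest_common_prefix (word_inv v) w)"

lemma cancellation_split: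
  obtains p r s where "word_inv v = p @ r" "w = p @ s" "r = [] \<or> s = [] \<or> hd r \<noteq> hd s" "length p = cancellation v w"
proof -
  let ?p = "longest_common_prefix (word_inv v) w"
  obtain r where r: "word_inv v = ?p @ r" using longest_common_prefix_prefix1 by (metis prefixE)
  obtain s where s: "w = ?p @ s" using longest_common_prefix_prefix2 by (metis prefixE)
  have "r = [] \<or> s = [] \<or> hd r \<noteq> hd s"
  proof (rule ccontr)
    assume "\<not> ?thesis"
    then obtain a r' s' where "r = a # r'" "s = a # s'" by (metis list.collapse)
    then have "prefix (?p @ [a]) (word_inv v)" "prefix (?p @ [a]) w"
      using r s by (metis append.assoc append_Cons append_Nil prefixI)+
    then have "prefix (?p @ [a]) ?p" by (rule longest_common_prefix_max_prefix)
    then show False by (simp add: prefix_def)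
  qed
  then show ?thesis using that r s by (simp add: cancellation_def)
qed

lemma cancellation_eqI:
  assumes "word_inv v = p @ r" "w = p @ s" "r = [] \<or> s = [] \<or> hd r \<noteq> hd s"
  shows "cancellation v w = length p"
proof -
  have "longest_common_prefix (p @ r) (p @ s) = p" using assms(3)
    by (induction p) (cases r; cases s; auto)+
  then show ?thesis unfolding cancellation_def assms(1,2) by simp
qed

lemma mult_eq_take_drop:
  assumes "reduced_word v" "reduced_word w"
  shows "foldr cancel_cons v w = take (length v - cancellation v w) v @ drop (cancellation v w) w"
proof -
  obtain p r s where p: "word_inv v = p @ r" "w = p @ s" "r = [] \<or> s = [] \<or> hd r \<noteq> hd s" "length p = cancellation v w"
    by (rule cancellation_split)
  have v: "v = word_inv r @ word_inv p" using p(1) by (metis map_append rev_append word_inv_word_inv)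
  have "take (length v - cancellation v w) v = word_inv r" unfolding p(4)[symmetric] by (simp add: v)
  moreover have "drop (cancellation v w) w = s" unfolding p(4)[symmetric] by (simp add: p(2))
  ultimately show ?thesis using foldr_cancel_cons_overlap[OF p(1,2) assms p(3)] by simp
qed

lemma cancellation_le: "cancellation v w \<le> length v" "cancellation v w \<le> length w"
proof -
  obtain p r s where p: "word_inv v = p @ r" "w = p @ s" "length p = cancellation v w"
    using cancellation_split by metis
  have "length v = length p + length r" using p(1) by (metis length_append length_map length_rev)
  moreover have "length w = length p + length s" using p(2) by simp
  ultimately show "cancellation v w \<le> length v" "cancellation v w \<le> length w" using p(3) by linarith+
qed

lemma length_mult:
  assumes "reduced_word v" "reduced_word w"
  shows "length (foldr cancel_cons v w) + 2 * cancellation v w = length v + length w"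
  using mult_eq_take_drop[OF assms] cancellation_le[of v w] by simp

lemma cancellation_inv: "cancellation (word_inv w) (word_inv v) = cancellation v w"
proof -
  obtain p r s where p: "word_inv v = p @ r" "w = p @ s" "r = [] \<or> s = [] \<or> hd r \<noteq> hd s" "length p = cancellation v w"
    by (rule cancellation_split)
  have "cancellation (word_inv w) (word_inv v) = length p"
    by (rule cancellation_eqI[of _ _ s _ r]) (use p in auto)
  then show ?thesis using p(4) by simp
qed

lemma word_inv_nth: "i < length w \<Longrightarrow> word_inv w ! i = inv_letter (w ! (length w - Suc i))"
  by (simp add: rev_nth)

text \<open>If half of \<open>w\<close> cancelled against \<open>w\<close>, letters in mirror
  positions would be inverse to each other up to the middle: then either the two middle letters
  cancel or the single middle letter is its own inverse.\<close>

lemma cancellation_self: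
  assumes "reduced_word w" "w \<noteq> []"
  shows "2 * cancellation w w < length w"
proof (rule ccontr)
  assume *: "\<not> ?thesis"
  obtain p r s where p: "word_inv w = p @ r" "w = p @ s" "length p = cancellation w w"
    using cancellation_split by metis
  have eq: "w ! i = inv_letter (w ! (length w - Suc i))" if "i < cancellation w w" for i
  proof -
    have "i < length p" using that p(3) by simp
    then have "word_inv w ! i = w ! i" using p(1,2) by (metis nth_append)
    moreover have "i < length w" using that cancellation_le(1)[of w w] by simp
    ultimately show ?thesis by (simp only: word_inv_nth)
  qed
  have succ: "w ! Suc i \<noteq> inv_letter (w ! i)" if "Suc i < length w" for i
    using assms(1) that by (simp add: reduced_word_def successively_conv_nth)
  show False
  proof (cases "even (length w)")
    case True
    then obtain k where k: "length w = 2 * k" by blast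
    then have "0 < k" using assms(2) by (cases k) auto
    then have "k - 1 < cancellation w w" "length w - Suc (k - 1) = k" "Suc (k - 1) = k" "k < length w" using * k by auto
    then show False using eq[of "k - 1"] succ[of "k - 1"] by (metis inv_letter_inv_letter)
  next
    case False
    then obtain k where k: "length w = 2 * k + 1" by (metis oddE)
    then have "k < cancellation w w" "length w - Suc k = k" using * by auto
    then show False using eq[of k] by simp
  qed
qed

section \<open>Numerals for words, to break ties between equal lengths\<close>

definition digit :: "nat letter \<Rightarrow> nat" where
  "digit a = 2 * fst a + (if snd a then 1 else 0)"

text \<open>Words as numerals in base \<open>K\<close>: on words of equal length the value orders
  them lexicographically, and numbers can be summed to a termination measure.\<close>

definition code :: "nat \<Rightarrow> nat letter list \<Rightarrow> nat" where
  "code K w = foldl (\<lambda>c a. c * K + digit a) 0 w"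

definition half :: "'b list \<Rightarrow> 'b list" where
  "half w = take ((length w + 1) div 2) w"

lemma code_append: "code K (u @ v) = code K u * K ^ length v + code K v"
proof (induction v rule: rev_induct)
  case (snoc a v)
  then show ?case by (simp add: code_def algebra_simps)
qed (simp add: code_def)

lemma code_less:
  assumes "\<And>a. a \<in> set w \<Longrightarrow> digit a < K"
  shows "code K w < K ^ length w"
  using assms
proof (induction w rule: rev_induct)
  case (snoc a w)
  then have "code K w + 1 \<le> K ^ length w" "digit a < K" by auto
  then have "(code K w + 1) * K \<le> K ^ length w * K" by (intro mult_right_mono) auto
  then show ?case using \<open>digit a < K\<close> by (simp add: code_append) (simp add: code_def algebra_simps)
qed (simp add: code_def)

lemma digit_inject: "digit a = digit b \<Longrightarrow> a = b"
  by (cases a; cases b) (auto simp: digit_def split: if_splits; presburger)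

lemma code_inject:
  assumes "length u = length v" "\<And>a. a \<in> set u \<union> set v \<Longrightarrow> digit a < K" "code K u = code K v"
  shows "u = v"
  using assms
proof (induction u v rule: rev_induct2)
  case (4 a u b v)
  have d: "digit a < K" "digit b < K" using 4 by auto
  have "code K u * K + digit a = code K v * K + digit b"
    using 4 by (simp add: code_def)
  then have "(code K u * K + digit a) div K = (code K v * K + digit b) div K"
    "(code K u * K + digit a) mod K = (code K v * K + digit b) mod K" by simp_all
  then have "code K u = code K v" "digit a = digit b" using d by simp_all
  then show ?case using 4 digit_inject by auto
qed auto

text \<open>The prefix decides, because the code of the rest is less than one unit in the last place
  of the prefix.\<close>

lemma code_append_less:
  assumes "length p = length q" "length u = length v" "\<And>a. a \<in> set u \<Longrightarrow> digit a < K" "code K p < code K q"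
  shows "code K (p @ u) < code K (q @ v)"
proof -
  have "code K (p @ u) < (code K p + 1) * K ^ length u"
    using code_less[OF assms(3)] by (simp add: code_append)
  also have "\<dots> \<le> code K q * K ^ length v"
    using assms by (intro mult_mono) auto
  also have "\<dots> \<le> code K (q @ v)" by (simp add: code_append)
  finally show ?thesis .
qed

locale free_group_n = free_group_on S for S :: "nat set" +
  fixes n :: nat
  assumes S_eq: "S = {1..n}"
begin

lemma finite_S: "finite S"
  by (simp add: S_eq)

text \<open>The letters over \<open>{1..n}\<close> have digits up to
  \<open>2 * n + 1\<close>.\<close>

definition K :: nat where "K = 2 * n + 2"

lemma digit_K: "fst a \<in> S \<Longrightarrow> digit a < K"
  by (auto simp: digit_def K_def S_eq)

text \<open>Nielsen's tie-breaking comparison of the initial halves of a word and of its inverse,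
  turned into a number that inversion does not change.\<close>

definition weight :: "nat letter list \<Rightarrow> nat" where
  "weight w = code K (half w) + code K (half (word_inv w))"

lemma weight_inv: "weight (word_inv w) = weight w"
  by (simp add: weight_def)

definition len_sum :: "(nat letter list \<Rightarrow> nat letter list) \<Rightarrow> nat" where
  "len_sum \<alpha> = (\<Sum>x\<in>S. length (\<alpha> [(x, True)]))"

definition weight_sum :: "(nat letter list \<Rightarrow> nat letter list) \<Rightarrow> nat" where
  "weight_sum \<alpha> = (\<Sum>x\<in>S. weight (\<alpha> [(x, True)]))"

definition nielsen_gens :: "(nat letter list \<Rightarrow> nat letter list) set" where
  "nielsen_gens = {endo (sperm \<sigma> s) |\<sigma> s. \<sigma> permutes S}
    \<union> {endo (rho i j s) |i j s. i \<in> S \<and> j \<in> S \<and> i \<noteq> j}"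

lemma nielsen_gens_closed: "nielsen_gens \<subseteq> carrier A"
  using aut_sperm aut_rho by (auto simp: nielsen_gens_def)

text \<open>Inverting the generator \<open>j\<close> before and after turns right multiplication
  into left multiplication, so left transvections need not be among the generators.\<close>

lemma lam_eq_conj_rho:
  assumes "i \<in> S" "j \<in> S" "i \<noteq> j"
  shows "endo (lam i j s) = endo (sperm id (\<lambda>x. x \<noteq> j)) \<otimes>\<^bsub>A\<^esub> endo (rho i j (\<not> s)) \<otimes>\<^bsub>A\<^esub> endo (sperm id (\<lambda>x. x \<noteq> j))"
proof -
  have p: "id permutes S" by (rule permutes_id)
  have cl: "endo (sperm id (\<lambda>x. x \<noteq> j)) \<in> carrier A" "endo (rho i j (\<not> s)) \<in> carrier A" "endo (lam i j s) \<in> carrier A"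
    using aut_sperm[OF p] aut_rho aut_lam assms by auto
  have m: "maps (sperm id (\<lambda>x. x \<noteq> j))" "maps (rho i j (\<not> s))" "maps (lam i j s)"
    using maps_elementary(3)[OF p] maps_elementary(1,2) assms by auto
  show ?thesis
  proof (rule A_eqI)
    fix x assume x: "x \<in> S"
    have "[(x, y)] \<in> carrier F" for y using x by (rule gen_closed)
    moreover have "[(j, False), (i, \<not> s)] \<in> carrier F" "[(i, s), (j, False)] \<in> carrier F" "[(j, True), (i, \<not> s)] \<in> carrier F"
      using assms by (auto simp: F_carrier reduced_word_def inv_letter_def)
    ultimately show "endo (lam i j s) [(x, True)] = (endo (sperm id (\<lambda>x. x \<noteq> j)) \<otimes>\<^bsub>A\<^esub> endo (rho i j (\<not> s)) \<otimes>\<^bsub>A\<^esub> endo (sperm id (\<lambda>x. x \<noteq> j))) [(x, True)]"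
      using assms x cl m A_mult
      by (simp add: A_closed endo_def restrict_apply') (auto simp: sperm_def rho_def lam_def word_simps)
  qed (use cl in auto)
qed

lemma nielsen_gens_lam:
  assumes "i \<in> S" "j \<in> S" "i \<noteq> j"
  shows "endo (lam i j s) \<in> generate A nielsen_gens"
proof -
  have "endo (sperm id (\<lambda>x. x \<noteq> j)) \<in> nielsen_gens" "endo (rho i j (\<not> s)) \<in> nielsen_gens"
    unfolding nielsen_gens_def using assms permutes_id by blast+
  then show ?thesis unfolding lam_eq_conj_rho[OF assms]
    by (intro generate.eng generate.incl)
qed

definition improves :: "(nat letter list \<Rightarrow> nat letter list) \<Rightarrow> (nat letter list \<Rightarrow> nat letter list) \<Rightarrow> bool" where
  "improves \<beta> \<alpha> \<longleftrightarrow> len_sum \<beta> < len_sum \<alpha> \<or> (len_sum \<beta> = len_sum \<alpha> \<and> weight_sum \<beta> < weight_sum \<alpha>)"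

end

section \<open>Automorphisms that no transvection improves\<close>

locale nielsen_minimal = free_group_n +
  fixes \<alpha> :: "nat letter list \<Rightarrow> nat letter list"
  assumes \<alpha>: "\<alpha> \<in> carrier A"
    and minimal: "\<And>i j s. \<lbrakk>i \<in> S; j \<in> S; i \<noteq> j\<rbrakk> \<Longrightarrow> \<not> improves (\<alpha> \<otimes>\<^bsub>A\<^esub> endo (rho i j s)) \<alpha>"
      "\<And>i j s. \<lbrakk>i \<in> S; j \<in> S; i \<noteq> j\<rbrakk> \<Longrightarrow> \<not> improves (\<alpha> \<otimes>\<^bsub>A\<^esub> endo (lam i j s)) \<alpha>"
begin

text \<open>The images of all letters, inverses included; the Nielsen conditions \<open>N1\<close>
  and \<open>N2\<close> concern this family.\<close>

definition U :: "nat letter \<Rightarrow> nat letter list" where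
  "U = letter_image (\<lambda>x. \<alpha> [(x, True)])"

lemma U_True: "U (x, True) = \<alpha> [(x, True)]"
  by (simp add: U_def letter_image_def)

lemma U_inv: "U (inv_letter a) = word_inv (U a)"
  by (simp add: U_def letter_image_inv)

lemma U_carrier: "fst a \<in> S \<Longrightarrow> U a \<in> carrier F"
  unfolding U_def by (rule letter_image_closed[OF A_maps[OF \<alpha>]])

lemma U_reduced: "fst a \<in> S \<Longrightarrow> reduced_word (U a)"
  using U_carrier by (simp add: F_carrier)

lemma \<alpha>_ext: "w \<in> carrier F \<Longrightarrow> \<alpha> w = ext (\<lambda>x. \<alpha> [(x, True)]) w"
  by (rule A_eq_ext[OF \<alpha>])

lemma \<alpha>_letter: "fst a \<in> S \<Longrightarrow> \<alpha> [a] = U a"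
  using gen_closed[of "fst a" "snd a"] U_reduced[of a]
  by (simp add: \<alpha>_ext ext_Cons U_def foldr_cancel_cons_Nil)

lemma \<alpha>_pair:
  assumes "fst a \<in> S" "fst b \<in> S" "fst a \<noteq> fst b"
  shows "\<alpha> [a, b] = foldr cancel_cons (U a) (U b)"
proof -
  have "[a, b] \<in> carrier F" using assms by (auto simp: F_carrier reduced_word_def inv_letter_def)
  then show ?thesis
    using U_reduced[OF assms(2)] by (simp add: \<alpha>_ext ext_Cons U_def foldr_cancel_cons_Nil)
qed

lemma \<alpha>_inj: "w \<in> carrier F \<Longrightarrow> w' \<in> carrier F \<Longrightarrow> \<alpha> w = \<alpha> w' \<Longrightarrow> w = w'"
  using \<alpha> by (auto simp: A_carrier bij_betw_def dest: inj_onD)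

lemma \<alpha>_Nil: "\<alpha> [] = []"
  using \<alpha>_ext[of "[]"] F.one_closed by simp

lemma U_nonempty: "fst a \<in> S \<Longrightarrow> U a \<noteq> []"
  using \<alpha>_inj[of "[a]" "[]"] \<alpha>_letter[of a] \<alpha>_Nil F.one_closed gen_closed[of "fst a" "snd a"] by auto

lemma word_inv_mult:
  assumes "v \<in> carrier F" "w \<in> carrier F"
  shows "word_inv (foldr cancel_cons v w) = foldr cancel_cons (word_inv w) (word_inv v)"
  using F.inv_mult_group[OF assms] F_inv F.m_closed[OF assms] assms by (simp only: F_simps)

text \<open>The composition that replaces \<open>U a\<close> by the product of \<open>U a\<close>
  and \<open>U b\<close>. For an inverse letter \<open>a\<close> the image of the generator is the
  inverse of \<open>U a\<close>, so it is multiplied from the left by the inverse of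
  \<open>U b\<close>.\<close>

definition rep :: "nat letter \<Rightarrow> nat letter \<Rightarrow> (nat letter list \<Rightarrow> nat letter list)" where
  "rep a b = (if snd a then \<alpha> \<otimes>\<^bsub>A\<^esub> endo (rho (fst b) (fst a) (snd b))
    else \<alpha> \<otimes>\<^bsub>A\<^esub> endo (lam (fst b) (fst a) (\<not> snd b)))"

lemma rep_gen:
  assumes ab: "fst a \<in> S" "fst b \<in> S" "fst a \<noteq> fst b" and x: "x \<in> S"
  shows "rep a b [(x, True)] = (if x = fst a then
      (if snd a then foldr cancel_cons (U a) (U b) else word_inv (foldr cancel_cons (U a) (U b)))
    else \<alpha> [(x, True)])"
proof (cases "snd a")
  case True
  have m: "maps (rho (fst b) (fst a) (snd b))" "endo (rho (fst b) (fst a) (snd b)) \<in> carrier A"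
    using maps_elementary(1) aut_rho ab by auto
  have "rep a b [(x, True)] = \<alpha> (rho (fst b) (fst a) (snd b) x)"
    using True m x \<alpha> gen_closed[OF x, of True] by (simp add: rep_def A_mult endo_gen)
  moreover have "rho (fst b) (fst a) (snd b) (fst a) = [a, b]"
    using True by (simp add: rho_def prod_eq_iff)
  moreover have "rho (fst b) (fst a) (snd b) x = [(x, True)]" if "x \<noteq> fst a"
    using that by (simp add: rho_def)
  ultimately show ?thesis using True \<alpha>_pair[OF ab] by simp
next
  case False
  have m: "maps (lam (fst b) (fst a) (\<not> snd b))" "endo (lam (fst b) (fst a) (\<not> snd b)) \<in> carrier A"
    using maps_elementary(2) aut_lam ab by auto
  have "rep a b [(x, True)] = \<alpha> (lam (fst b) (fst a) (\<not> snd b) x)"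
    using False m x \<alpha> gen_closed[OF x, of True] by (simp add: rep_def A_mult endo_gen)
  moreover have "lam (fst b) (fst a) (\<not> snd b) (fst a) = [inv_letter b, inv_letter a]"
    using False by (simp add: lam_def inv_letter_def)
  moreover have "\<alpha> [inv_letter b, inv_letter a] = word_inv (foldr cancel_cons (U a) (U b))"
    using \<alpha>_pair[of "inv_letter b" "inv_letter a"] ab word_inv_mult[OF U_carrier U_carrier, of a b]
    by (simp add: U_inv)
  moreover have "lam (fst b) (fst a) (\<not> snd b) x = [(x, True)]" if "x \<noteq> fst a"
    using that by (simp add: lam_def)
  ultimately show ?thesis using False by simp
qed

text \<open>Only the summand of the generator underlying \<open>a\<close> changes, and invariance of
  \<open>g\<close> under inversion makes the sign of the letter \<open>a\<close> irrelevant.\<close>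

lemma rep_sum:
  fixes g :: "nat letter list \<Rightarrow> nat"
  assumes ab: "fst a \<in> S" "fst b \<in> S" "fst a \<noteq> fst b" and g: "\<And>w. g (word_inv w) = g w"
  shows "(\<Sum>x\<in>S. g (rep a b [(x, True)])) + g (U a) = (\<Sum>x\<in>S. g (\<alpha> [(x, True)])) + g (foldr cancel_cons (U a) (U b))"
proof -
  have 1: "(\<Sum>x\<in>S - {fst a}. g (rep a b [(x, True)])) = (\<Sum>x\<in>S - {fst a}. g (\<alpha> [(x, True)]))"
    using rep_gen[OF ab] by (intro sum.cong) auto
  have 2: "g (rep a b [(fst a, True)]) = g (foldr cancel_cons (U a) (U b))"
    using rep_gen[OF ab ab(1)] g by simp
  have 3: "g (\<alpha> [(fst a, True)]) = g (U a)"
    using g by (simp add: U_def letter_image_def)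
  show ?thesis
    using ab(1) finite_S 1 2 3 by (simp add: sum.remove[of S "fst a"])
qed

lemma rep_not_improves:
  assumes "fst a \<in> S" "fst b \<in> S" "fst a \<noteq> fst b"
  shows "\<not> improves (rep a b) \<alpha>"
  using minimal assms by (auto simp: rep_def)

text \<open>If more than half of one factor cancelled, the product would be shorter than the other
  factor, and replacing the latter would shorten \<open>\<alpha>\<close>.\<close>

lemma N1:
  assumes ab: "fst a \<in> S" "fst b \<in> S" "fst a \<noteq> fst b"
  shows "2 * cancellation (U a) (U b) \<le> length (U a)" "2 * cancellation (U a) (U b) \<le> length (U b)"
proof -
  have le: "2 * cancellation (U a) (U b) \<le> length (U b)"
    if ab: "fst a \<in> S" "fst b \<in> S" "fst a \<noteq> fst b" for a b
  proof -
    have "len_sum \<alpha> \<le> len_sum (rep a b)" using rep_not_improves[OF ab] by (auto simp: improves_def)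
    then have "length (U a) \<le> length (foldr cancel_cons (U a) (U b))"
      using rep_sum[OF ab, of length] by (simp add: len_sum_def)
    then show ?thesis using length_mult[OF U_reduced[OF ab(1)] U_reduced[OF ab(2)]] by linarith
  qed
  show "2 * cancellation (U a) (U b) \<le> length (U b)" by (rule le[OF ab])
  show "2 * cancellation (U a) (U b) \<le> length (U a)"
    using le[of "inv_letter b" "inv_letter a"] ab by (simp add: U_inv cancellation_inv)
qed

lemma half_prefix:
  assumes "length y \<le> length x"
  shows "half (x @ y) = take ((length x + length y + 1) div 2) x"
  using assms by (simp add: half_def)

text \<open>The product of \<open>U a\<close> and \<open>U b\<close> arises from \<open>U a\<close>
  by exchanging its final segment, the inverse of \<open>p\<close>, for the inverse of
  \<open>q\<close>. The length and, by \<open>N1\<close>, the initial half stay the same, while the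
  inverse words start with \<open>p\<close> and \<open>q\<close>; so a smaller code of
  \<open>q\<close> would lower the weight.\<close>

lemma N2_aux:
  assumes ab: "fst a \<in> S" "fst b \<in> S" "fst a \<noteq> fst b"
    and b: "U b = p @ word_inv q" "length p = length q" and can: "cancellation (U a) (U b) = length p"
  shows "code K p \<le> code K q"
proof (rule ccontr)
  assume less: "\<not> code K p \<le> code K q"
  have red: "reduced_word (U a)" "reduced_word (U b)" using U_reduced ab by auto
  obtain p' r s where p': "word_inv (U a) = p' @ r" "U b = p' @ s" "length p' = cancellation (U a) (U b)"
    using cancellation_split by metis
  then have "p' = p" using b can by (metis append_eq_append_conv)
  then have Ua: "U a = word_inv r @ word_inv p" using p'(1) by (metis map_append rev_append word_inv_word_inv)
  have prod: "foldr cancel_cons (U a) (U b) = word_inv r @ word_inv q"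
    unfolding mult_eq_take_drop[OF red] can by (simp add: Ua b(1))
  have "2 * length p \<le> length (U a)" using N1(1)[OF ab] can by simp
  then have pr: "length p \<le> length r" using arg_cong[OF Ua, of length] by simp
  let ?k = "(length r + length p + 1) div 2"
  have k: "length p \<le> ?k" using pr by simp
  have half1: "half (U a) = half (word_inv r @ word_inv q)"
    unfolding Ua using pr b(2) by (simp add: half_prefix)
  have half2: "half (word_inv (U a)) = p @ take (?k - length p) r"
    unfolding Ua half_def using k by (simp add: add.commute)
  have half3: "half (word_inv (word_inv r @ word_inv q)) = q @ take (?k - length p) r"
    unfolding half_def using k b(2) by (simp add: add.commute)
  have "code K (q @ take (?k - length p) r) < code K (p @ take (?k - length p) r)"
  proof (rule code_append_less)
    fix c assume "c \<in> set (take (?k - length p) r)"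
    then have "c \<in> set (word_inv (U a))" using p'(1) by (auto dest: in_set_takeD)
    then have "fst c \<in> fst ` set (word_inv (U a))" by blast
    then have "fst c \<in> S" unfolding fst_set_word_inv using U_carrier[OF ab(1)] by (auto simp: F_carrier)
    then show "digit c < K" by (rule digit_K)
  qed (use b(2) less in auto)
  then have "weight (foldr cancel_cons (U a) (U b)) < weight (U a)"
    unfolding prod weight_def half1 half2 half3 by simp
  then have "weight_sum (rep a b) < weight_sum \<alpha>"
    using rep_sum[OF ab, of weight] by (simp add: weight_sum_def weight_inv)
  moreover have "length (foldr cancel_cons (U a) (U b)) = length (U a)"
    unfolding prod using arg_cong[OF Ua, of length] b(2) by simp
  then have "len_sum (rep a b) = len_sum \<alpha>"
    using rep_sum[OF ab, of length] by (simp add: len_sum_def)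
  ultimately show False using rep_not_improves[OF ab] by (simp add: improves_def)
qed

text \<open>By \<open>N1\<close> each neighbour cancels at most half of \<open>U b\<close>, and less
  than half if it is the same letter as \<open>b\<close>. So \<open>U b\<close> can be used up only
  if each side takes exactly half. Then \<open>N2_aux\<close>, applied from both sides, makes
  \<open>U b\<close> the product of a word and its inverse, which is not reduced.\<close>

lemma N2:
  assumes S: "fst a \<in> S" "fst b \<in> S" "fst c \<in> S" and ne: "b \<noteq> inv_letter a" "c \<noteq> inv_letter b"
  shows "cancellation (U a) (U b) + cancellation (U b) (U c) < length (U b)"
proof -
  have half: "2 * cancellation (U a) (U b) \<le> length (U b) \<and> (a = b \<longrightarrow> 2 * cancellation (U a) (U b) < length (U b))"
      "2 * cancellation (U a) (U b) \<le> length (U a) \<and> (a = b \<longrightarrow> 2 * cancellation (U a) (U b) < length (U a))"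
      if "fst a \<in> S" "fst b \<in> S" "b \<noteq> inv_letter a" for a b
  proof -
    have "fst a \<noteq> fst b \<or> a = b" using that by (auto simp: inv_letter_def prod_eq_iff)
    then show "2 * cancellation (U a) (U b) \<le> length (U b) \<and> (a = b \<longrightarrow> 2 * cancellation (U a) (U b) < length (U b))"
      "2 * cancellation (U a) (U b) \<le> length (U a) \<and> (a = b \<longrightarrow> 2 * cancellation (U a) (U b) < length (U a))"
      using N1[of a b] cancellation_self[OF U_reduced U_nonempty, of a] that by auto
  qed
  show ?thesis
  proof (rule ccontr)
    assume "\<not> ?thesis"
    then have eq: "2 * cancellation (U a) (U b) = length (U b)" "2 * cancellation (U b) (U c) = length (U b)" and ab: "a \<noteq> b" "b \<noteq> c"
      using half(1)[OF S(1,2) ne(1)] half(2)[OF S(2,3) ne(2)] by auto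
    have fne: "fst a \<noteq> fst b" "fst b \<noteq> fst c" using ab ne by (auto simp: inv_letter_def prod_eq_iff)
    define k where "k = cancellation (U a) (U b)"
    have k: "length (U b) = 2 * k" "cancellation (U b) (U c) = k" using eq by (simp_all add: k_def)
    define p where "p = take k (U b)"
    define q where "q = word_inv (drop k (U b))"
    have pq: "U b = p @ word_inv q" "length p = k" "length q = k" using k by (simp_all add: p_def q_def)
    have 1: "code K p \<le> code K q"
      by (rule N2_aux[OF S(1,2) fne(1) pq(1)]) (use pq k_def in simp_all)
    have 2: "code K q \<le> code K p"
    proof (rule N2_aux[of "inv_letter c" "inv_letter b"])
      show "U (inv_letter b) = q @ word_inv p" unfolding U_inv pq(1) by simp
      show "cancellation (U (inv_letter c)) (U (inv_letter b)) = length q"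
        unfolding U_inv cancellation_inv using k pq by simp
    qed (use S fne pq in simp_all)
    have dig: "digit d < K" if "d \<in> set p \<union> set q" for d
    proof -
      have "fst d \<in> fst ` set p \<union> fst ` set (word_inv q)" unfolding fst_set_word_inv using that by blast
      moreover have "fst ` set (p @ word_inv q) \<subseteq> S"
        using U_carrier[OF S(2)] unfolding pq(1) F_carrier by blast
      ultimately have "fst d \<in> S" unfolding set_append image_Un by blast
      then show ?thesis by (rule digit_K)
    qed
    have "p = q" by (rule code_inject[of _ _ K]) (use pq dig 1 2 in auto)
    moreover have "p \<noteq> []" using U_nonempty[OF S(2)] pq by auto
    ultimately have "\<not> reduced_word (U b)"
      unfolding pq(1) reduced_word_append by (cases p rule: rev_cases) auto
    then show False using U_reduced[OF S(2)] by simp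
  qed
qed

text \<open>By \<open>N2\<close> a nonempty part of every inner factor survives, so a cancellation
  never reaches beyond the neighbouring factor, and the first factor loses only what it cancels with
  the second.\<close>

lemma ext_U_shape:
  assumes "reduced_word (a # w)" "fst ` set (a # w) \<subseteq> S"
  shows "\<exists>t. ext (\<lambda>x. \<alpha> [(x, True)]) (a # w)
      = take (length (U a) - (case w of [] \<Rightarrow> 0 | b # _ \<Rightarrow> cancellation (U a) (U b))) (U a) @ t \<and> length w \<le> length t"
  using assms
proof (induction w arbitrary: a)
  case Nil
  then show ?case using U_reduced[of a] by (simp add: ext_Cons U_def foldr_cancel_cons_Nil)
next
  case (Cons b w)
  let ?u = "\<lambda>x. \<alpha> [(x, True)]"
  have S: "fst a \<in> S" "fst b \<in> S" and ne: "b \<noteq> inv_letter a"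
    using Cons.prems by (auto simp: reduced_word_def)
  have rbw: "reduced_word (b # w)" "fst ` set (b # w) \<subseteq> S" using Cons.prems by (auto simp: reduced_word_def)
  define k where "k = (case w of [] \<Rightarrow> 0 | c # _ \<Rightarrow> cancellation (U b) (U c))"
  obtain t where t: "ext ?u (b # w) = take (length (U b) - k) (U b) @ t" "length w \<le> length t"
    using Cons.IH[OF rbw] unfolding k_def by blast
  let ?k = "cancellation (U a) (U b)"
  have fne: "fst a \<noteq> fst b \<or> a = b" using ne by (auto simp: inv_letter_def prod_eq_iff)
  have lt: "?k < length (U a)" "?k < length (U b)"
    using fne N1[OF S] cancellation_self[OF U_reduced[OF S(1)] U_nonempty[OF S(1)]] U_nonempty[OF S(1)] U_nonempty[OF S(2)]
    by (auto simp flip: length_greater_0_conv)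
  \<comment> \<open>Room is left in \<open>U b\<close> between what it loses on the left and on the
    right; this keeps \<open>s'\<close> nonempty and the two cancellations apart.\<close>
  have m: "?k < length (U b) - k"
  proof (cases w)
    case (Cons c w')
    have "fst c \<in> S" "c \<noteq> inv_letter b" using rbw Cons by (auto simp: reduced_word_def)
    then show ?thesis using N2[OF S _ ne, of c] Cons by (simp add: k_def)
  qed (use lt in \<open>simp add: k_def\<close>)
  obtain p r s where p: "word_inv (U a) = p @ r" "U b = p @ s" "r = [] \<or> s = [] \<or> hd r \<noteq> hd s" "length p = ?k"
    by (rule cancellation_split)
  have Ua: "U a = word_inv r @ word_inv p" using p(1) by (metis map_append rev_append word_inv_word_inv)
  define s' where "s' = take (length (U b) - k - ?k) s"
  have tb: "take (length (U b) - k) (U b) = p @ s'"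
    using m p(4) by (subst p(2)) (simp add: s'_def)
  have s': "s' \<noteq> []" "hd s' = hd s" "s \<noteq> []"
    using m lt(2) p(2,4) by (auto simp: s'_def hd_take)
  have "reduced_word (ext ?u (b # w))"
    using ext_closed[OF A_maps[OF \<alpha>] rbw(2)] by (simp add: F_carrier)
  then have "foldr cancel_cons (U a) (ext ?u (b # w)) = word_inv r @ (s' @ t)"
    using t(1) tb s' p(3) by (intro foldr_cancel_cons_overlap[OF p(1) _ U_reduced[OF S(1)]]) auto
  then have "ext ?u (a # b # w) = word_inv r @ (s' @ t)"
    by (simp add: ext_Cons[of _ a] U_def)
  moreover have "take (length (U a) - ?k) (U a) = word_inv r"
    unfolding p(4)[symmetric] by (simp add: Ua)
  moreover have "length (b # w) \<le> length (s' @ t)" using s'(1) t(2) by (cases s') auto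
  ultimately show ?case by (intro exI[of _ "s' @ t"]) simp
qed

lemma length_ext_ge:
  assumes "w \<in> carrier F"
  shows "length w \<le> length (\<alpha> w)"
proof (cases w)
  case (Cons a v)
  have aw: "reduced_word (a # v)" "fst ` set (a # v) \<subseteq> S" using assms Cons by (simp_all add: F_carrier)
  let ?m = "length (U a) - (case v of [] \<Rightarrow> 0 | b # _ \<Rightarrow> cancellation (U a) (U b))"
  obtain t where t: "\<alpha> w = take ?m (U a) @ t" "length v \<le> length t"
    using ext_U_shape[OF aw] \<alpha>_ext[OF assms] Cons by auto
  have "0 < ?m"
  proof (cases v)
    case Nil
    then show ?thesis using U_nonempty[of a] aw by simp
  next
    case (Cons b v')
    have S: "fst a \<in> S" "fst b \<in> S" and ne: "b \<noteq> inv_letter a" using aw Cons by (auto simp: reduced_word_def)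
    then have "fst a \<noteq> fst b \<or> a = b" by (auto simp: inv_letter_def prod_eq_iff)
    then show ?thesis
      using Cons N1[OF S] cancellation_self[OF U_reduced[OF S(1)] U_nonempty[OF S(1)]] U_nonempty[OF S(1)]
      by (auto simp flip: length_greater_0_conv)
  qed
  then show ?thesis using t Cons U_nonempty[of a] aw by (simp add: min_def) linarith
qed simp

text \<open>Each generator is the image of some word, and that word has at most one letter by
  \<open>length_ext_ge\<close>; so each generator is the image of a letter.\<close>

lemma minimal_is_sperm: "\<exists>\<sigma> s. \<sigma> permutes S \<and> \<alpha> = endo (sperm \<sigma> s)"
proof -
  have ex: "\<exists>a. fst a \<in> S \<and> U a = [(x, True)]" if x: "x \<in> S" for x
  proof -
    have "[(x, True)] \<in> \<alpha> ` carrier F" using gen_closed[OF x] \<alpha> by (auto simp: A_carrier bij_betw_def)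
    then obtain w where w: "w \<in> carrier F" "\<alpha> w = [(x, True)]" by auto
    then have "length w \<le> 1" using length_ext_ge by fastforce
    moreover have "w \<noteq> []" using w \<alpha>_Nil by auto
    ultimately obtain a where "w = [a]" by (cases w) auto
    then have "fst a \<in> S" using w(1) by (simp add: F_carrier)
    then show ?thesis using w(2) \<alpha>_letter[of a] \<open>w = [a]\<close> by (intro exI[of _ a]) simp
  qed
  then obtain l where l: "\<And>x. x \<in> S \<Longrightarrow> fst (l x) \<in> S" "\<And>x. x \<in> S \<Longrightarrow> U (l x) = [(x, True)]" by metis
  have inj: "inj_on (\<lambda>x. fst (l x)) S"
  proof
    fix x y assume xy: "x \<in> S" "y \<in> S" "fst (l x) = fst (l y)"
    then have "l y = l x \<or> l y = inv_letter (l x)" by (auto simp: inv_letter_def prod_eq_iff)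
    then have "U (l y) = U (l x) \<or> U (l y) = word_inv (U (l x))" using U_inv by metis
    then show "x = y" using l(2) xy by (auto simp: inv_letter_def)
  qed
  define \<tau> where "\<tau> x = (if x \<in> S then fst (l x) else x)" for x
  have "bij_betw (\<lambda>x. fst (l x)) S S"
    using inj l(1) finite_S by (simp add: bij_betw_def endo_inj_surj image_subsetI)
  then have "bij_betw \<tau> S S" by (rule bij_betw_cong[THEN iffD1, rotated]) (simp add: \<tau>_def)
  then have \<tau>: "\<tau> permutes S" by (rule bij_imp_permutes) (simp add: \<tau>_def)
  let ?\<sigma> = "inv_into UNIV \<tau>"
  have \<sigma>: "?\<sigma> permutes S" using \<tau> by (rule permutes_inv)
  have "\<alpha> = endo (sperm ?\<sigma> (\<lambda>x. snd (l x)))"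
  proof (rule A_eqI[OF \<alpha> aut_sperm[OF \<sigma>]])
    fix y assume y: "y \<in> S"
    define x where "x = ?\<sigma> y"
    have x: "x \<in> S" "y = \<tau> x" using y permutes_in_image[OF \<sigma>, of y] permutes_inverses(1)[OF \<tau>, of y] by (simp_all add: x_def)
    have lx: "l x = (y, snd (l x))" using x by (simp add: \<tau>_def prod_eq_iff)
    have "\<alpha> [(y, True)] = [(x, snd (l x))]"
    proof (cases "snd (l x)")
      case True
      then show ?thesis using l(2)[OF x(1)] lx U_True[of y] by simp
    next
      case False
      then have "U (y, True) = word_inv (U (l x))" using lx U_inv[of "l x"] by (simp add: inv_letter_def)
      then show ?thesis using l(2)[OF x(1)] U_True False by (simp add: inv_letter_def)
    qed
    then show "\<alpha> [(y, True)] = endo (sperm ?\<sigma> (\<lambda>x. snd (l x))) [(y, True)]"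
      unfolding endo_gen[OF maps_elementary(3)[OF \<sigma>] y] by (simp add: sperm_def x_def)
  qed
  then show ?thesis using \<sigma> by blast
qed

end

section \<open>Nielsen's generation theorem\<close>

context free_group_n
begin

theorem nielsen:
  assumes "\<alpha> \<in> carrier A"
  shows "\<alpha> \<in> generate A nielsen_gens"
proof -
  have "wf (less_than <*lex*> less_than)" by (intro wf_lex_prod wf_less_than)
  then show ?thesis
    using assms
  proof (induction "(len_sum \<alpha>, weight_sum \<alpha>)" arbitrary: \<alpha> rule: wf_induct_rule)
    case less
    have gsub: "subgroup (generate A nielsen_gens) A" by (rule A.generate_is_subgroup[OF nielsen_gens_closed])
    show ?case
    proof (cases "\<exists>\<beta> \<in> generate A nielsen_gens. improves (\<alpha> \<otimes>\<^bsub>A\<^esub> \<beta>) \<alpha>")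
      case True
      then obtain \<beta> where \<beta>: "\<beta> \<in> generate A nielsen_gens" "improves (\<alpha> \<otimes>\<^bsub>A\<^esub> \<beta>) \<alpha>" by blast
      have \<beta>c: "\<beta> \<in> carrier A" using subgroup.mem_carrier[OF gsub \<beta>(1)] .
      have "\<alpha> \<otimes>\<^bsub>A\<^esub> \<beta> \<in> generate A nielsen_gens"
        using \<beta>(2) \<beta>c less.prems by (intro less.hyps) (auto simp: improves_def)
      then have "\<alpha> \<otimes>\<^bsub>A\<^esub> \<beta> \<otimes>\<^bsub>A\<^esub> inv\<^bsub>A\<^esub> \<beta> \<in> generate A nielsen_gens"
        by (rule subgroup.m_closed[OF gsub _ subgroup.m_inv_closed[OF gsub \<beta>(1)]])
      moreover have "\<alpha> \<otimes>\<^bsub>A\<^esub> \<beta> \<otimes>\<^bsub>A\<^esub> inv\<^bsub>A\<^esub> \<beta> = \<alpha>"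
        using less.prems \<beta>c by (simp add: A.m_assoc)
      ultimately show ?thesis by (simp only:)
    next
      case False
      interpret nielsen_minimal S n \<alpha>
      proof unfold_locales
        fix i j s assume ij: "i \<in> S" "j \<in> S" "i \<noteq> j"
        have "endo (rho i j s) \<in> generate A nielsen_gens"
          unfolding nielsen_gens_def using ij by (intro generate.incl) blast
        then show "\<not> improves (\<alpha> \<otimes>\<^bsub>A\<^esub> endo (rho i j s)) \<alpha>" using False by blast
        show "\<not> improves (\<alpha> \<otimes>\<^bsub>A\<^esub> endo (lam i j s)) \<alpha>" using False nielsen_gens_lam[OF ij] by blast
      qed (rule less.prems)
      show ?thesis
        using minimal_is_sperm by (auto simp: nielsen_gens_def intro!: generate.incl)
    qed
  qed
qed

end

section \<open>The action on the abelianization\<close>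

definition exponent_sum :: "'a \<Rightarrow> 'a letter list \<Rightarrow> int" where
  "exponent_sum x w = (\<Sum>a\<leftarrow>w. if fst a = x then (if snd a then 1 else - 1) else 0)"

lemma exponent_sum_Nil [simp]: "exponent_sum x [] = 0"
  and exponent_sum_Cons: "exponent_sum x (a # w) = (if fst a = x then (if snd a then 1 else - 1) else 0) + exponent_sum x w"
  by (simp_all add: exponent_sum_def)

lemma exponent_sum_mult: "exponent_sum x (foldr cancel_cons u v) = exponent_sum x u + exponent_sum x v"
proof (induction u)
  case (Cons a u)
  have "exponent_sum x (cancel_cons a w) = exponent_sum x [a] + exponent_sum x w" for w
    by (cases w) (auto simp: cancel_cons_def exponent_sum_Cons inv_letter_def)
  then show ?case using Cons by (simp add: exponent_sum_Cons)
qed simp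

lemma exponent_sum_append: "exponent_sum x (u @ v) = exponent_sum x u + exponent_sum x v"
  by (simp add: exponent_sum_def)

lemma exponent_sum_inv: "exponent_sum x (word_inv w) = - exponent_sum x w"
  by (induction w) (auto simp: exponent_sum_append exponent_sum_Cons inv_letter_def)

lemma exponent_sum_ext:
  assumes "finite S" "fst ` set w \<subseteq> S"
  shows "exponent_sum x (ext f w) = (\<Sum>y\<in>S. exponent_sum x (f y) * exponent_sum y w)"
  using assms(2)
proof (induction w)
  case (Cons a w)
  let ?e = "if snd a then 1 else - 1 :: int"
  have "(\<Sum>y\<in>S. exponent_sum x (f y) * exponent_sum y (a # w))
      = (\<Sum>y\<in>S. (if y = fst a then exponent_sum x (f y) * ?e else 0) + exponent_sum x (f y) * exponent_sum y w)"
    by (intro sum.cong) (auto simp: exponent_sum_Cons algebra_simps)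
  also have "\<dots> = exponent_sum x (f (fst a)) * ?e + (\<Sum>y\<in>S. exponent_sum x (f y) * exponent_sum y w)"
    using Cons.prems assms(1) by (simp add: sum.distrib)
  also have "exponent_sum x (f (fst a)) * ?e = exponent_sum x (letter_image f a)"
    by (simp add: letter_image_def exponent_sum_inv del: rev_map)
  finally show ?case using Cons by (simp add: ext_Cons exponent_sum_mult)
qed simp

context free_group_n
begin

text \<open>Column \<open>j\<close> holds the exponents of the image of the generator
  \<open>j + 1\<close>: generators are numbered from 1, coordinates from 0.\<close>

definition ab :: "(nat letter list \<Rightarrow> nat letter list) \<Rightarrow> int mat" where
  "ab \<alpha> = mat n n (\<lambda>(i, j). exponent_sum (Suc i) (\<alpha> [(Suc j, True)]))"

lemma Suc_S: "Suc i \<in> S \<longleftrightarrow> i < n" "S = Suc ` {..<n}"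
  by (auto simp: S_eq image_Suc_lessThan)

lemma ab_mult:
  assumes "\<alpha> \<in> carrier A" "\<beta> \<in> carrier A"
  shows "ab (\<alpha> \<otimes>\<^bsub>A\<^esub> \<beta>) = ab \<alpha> * ab \<beta>"
proof (rule eq_matI)
  fix i j assume ij: "i < dim_row (ab \<alpha> * ab \<beta>)" "j < dim_col (ab \<alpha> * ab \<beta>)"
  then have ij: "i < n" "j < n" by (simp_all add: ab_def)
  have g: "[(Suc j, True)] \<in> carrier F" using ij Suc_S(1) by (intro gen_closed) simp
  let ?w = "\<beta> [(Suc j, True)]"
  have w: "?w \<in> carrier F" using A_closed assms g by blast
  have "exponent_sum (Suc i) ((\<alpha> \<otimes>\<^bsub>A\<^esub> \<beta>) [(Suc j, True)]) = exponent_sum (Suc i) (ext (\<lambda>x. \<alpha> [(x, True)]) ?w)"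
    using A_mult[OF assms g] A_eq_ext[OF assms(1) w] by simp
  also have "\<dots> = (\<Sum>y\<in>S. exponent_sum (Suc i) (\<alpha> [(y, True)]) * exponent_sum y ?w)"
    using w by (intro exponent_sum_ext finite_S) (simp add: F_carrier)
  also have "\<dots> = (\<Sum>k<n. exponent_sum (Suc i) (\<alpha> [(Suc k, True)]) * exponent_sum (Suc k) ?w)"
    unfolding Suc_S(2) by (subst sum.reindex) simp_all
  finally show "ab (\<alpha> \<otimes>\<^bsub>A\<^esub> \<beta>) $$ (i, j) = (ab \<alpha> * ab \<beta>) $$ (i, j)"
    using ij by (simp add: ab_def scalar_prod_def atLeast0LessThan)
qed (simp_all add: ab_def)

lemma ab_one: "ab \<one>\<^bsub>A\<^esub> = 1\<^sub>m n"
  using gen_closed Suc_S(1) by (intro eq_matI) (auto simp: ab_def A_one exponent_sum_Cons)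

lemma ab_hom: "ab \<in> hom A (GL_int n)"
proof (rule homI)
  fix \<alpha> assume \<alpha>: "\<alpha> \<in> carrier A"
  have "ab (inv\<^bsub>A\<^esub> \<alpha>) * ab \<alpha> = 1\<^sub>m n" "ab \<alpha> * ab (inv\<^bsub>A\<^esub> \<alpha>) = 1\<^sub>m n"
    using \<alpha> by (simp_all add: ab_one flip: ab_mult)
  then show "ab \<alpha> \<in> carrier (GL_int n)"
    unfolding carrier_GL_int by (intro conjI bexI[of _ "ab (inv\<^bsub>A\<^esub> \<alpha>)"]) (simp_all add: ab_def)
qed (simp add: ab_mult mult_GL_int)

sublocale ab: group_hom A "GL_int n" ab
  using group_GL_int ab_hom by (intro group_hom.intro group_hom_axioms.intro) (simp_all add: A.is_group)

lemma ab_rho: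
  assumes "i < n" "j < n" "i \<noteq> j"
  shows "ab (endo (rho (Suc i) (Suc j) True)) = transvection n (basis_vec i) (basis_vec j)"
    "ab (endo (lam (Suc i) (Suc j) True)) = transvection n (basis_vec i) (basis_vec j)"
proof -
  have m: "maps (rho (Suc i) (Suc j) True)" "maps (lam (Suc i) (Suc j) True)"
    using assms(1,3) Suc_S(1)[of i] by (simp_all add: maps_elementary)
  have "exponent_sum (Suc a) (endo (rho (Suc i) (Suc j) True) [(Suc c, True)]) = (if a = c then 1 else 0) + basis_vec i a * basis_vec j c"
    "exponent_sum (Suc a) (endo (lam (Suc i) (Suc j) True) [(Suc c, True)]) = (if a = c then 1 else 0) + basis_vec i a * basis_vec j c"
    if "c < n" for a c
  proof -
    have c: "Suc c \<in> S" using that by (simp add: Suc_S(1))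
    show "exponent_sum (Suc a) (endo (rho (Suc i) (Suc j) True) [(Suc c, True)]) = (if a = c then 1 else 0) + basis_vec i a * basis_vec j c"
      "exponent_sum (Suc a) (endo (lam (Suc i) (Suc j) True) [(Suc c, True)]) = (if a = c then 1 else 0) + basis_vec i a * basis_vec j c"
      unfolding endo_gen[OF m(1) c] endo_gen[OF m(2) c]
      by (simp_all add: rho_def lam_def exponent_sum_Cons basis_vec_def)
  qed
  then show "ab (endo (rho (Suc i) (Suc j) True)) = transvection n (basis_vec i) (basis_vec j)"
    "ab (endo (lam (Suc i) (Suc j) True)) = transvection n (basis_vec i) (basis_vec j)"
    unfolding ab_def transvection_def by (intro cong_mat; simp)+
qed

lemma ab_sperm_act:
  assumes \<sigma>: "\<sigma> permutes S" and i: "i < n"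
  shows "mat_act (ab (endo (sperm \<sigma> s))) v (\<sigma> (Suc i) - 1) = (if s (\<sigma> (Suc i)) then 1 else - 1) * v i"
proof -
  define k where "k = \<sigma> (Suc i) - 1"
  have k: "\<sigma> (Suc i) = Suc k" "k < n"
    using permutes_in_image[OF \<sigma>, of "Suc i"] i by (auto simp: k_def S_eq)
  have "exponent_sum (Suc k) (endo (sperm \<sigma> s) [(Suc j, True)]) = (if j = i then (if s (Suc k) then 1 else - 1) else 0)" if "j < n" for j
  proof -
    have "endo (sperm \<sigma> s) [(Suc j, True)] = [(\<sigma> (Suc j), s (\<sigma> (Suc j)))]"
      using endo_gen[OF maps_elementary(3)[OF \<sigma>]] that Suc_S(1) by (simp add: sperm_def)
    moreover have "\<sigma> (Suc j) = Suc k \<longleftrightarrow> j = i" using permutes_inj[OF \<sigma>] k(1) by (metis injD nat.inject)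
    ultimately show ?thesis by (auto simp: exponent_sum_Cons)
  qed
  then have "(\<Sum>j<n. exponent_sum (Suc k) (endo (sperm \<sigma> s) [(Suc j, True)]) * v j)
      = (\<Sum>j<n. if j = i then (if s (Suc k) then 1 else - 1) * v i else 0)"
    by (intro sum.cong) auto
  then show ?thesis using i k by (simp add: mat_act_def ab_def flip: k_def)
qed

section \<open>Relations between transvections and signed permutations\<close>

lemma mult_gen:
  assumes "maps f" "maps g" "endo f \<in> carrier A" "endo g \<in> carrier A" "x \<in> S"
  shows "(endo f \<otimes>\<^bsub>A\<^esub> endo g) [(x, True)] = ext f (g x)"
proof -
  have "g x \<in> carrier F" using assms(2,5) by (simp add: maps_def)
  then show ?thesis
    unfolding A_mult[OF assms(3,4) gen_closed[OF assms(5)]] endo_gen[OF assms(2,5)] by (simp add: endo_def)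
qed

lemma mult_gen3:
  assumes "maps f" "maps g" "maps h" "endo f \<in> carrier A" "endo g \<in> carrier A" "endo h \<in> carrier A" "x \<in> S"
  shows "(endo f \<otimes>\<^bsub>A\<^esub> endo g \<otimes>\<^bsub>A\<^esub> endo h) [(x, True)] = ext f (ext g (h x))"
proof -
  have hx: "h x \<in> carrier F" using assms(3,7) by (simp add: maps_def)
  then have gx: "ext g (h x) \<in> carrier F" using ext_closed[OF assms(2)] by (simp add: F_carrier)
  show ?thesis
    unfolding A_mult[OF A.m_closed[OF assms(4,5)] assms(6) gen_closed[OF assms(7)]] endo_gen[OF assms(3,7)]
      A_mult[OF assms(4,5) hx]
    using hx gx by (simp add: endo_def)
qed

lemma endo_mult_eqI:
  assumes "maps f" "maps g" "endo f \<in> carrier A" "endo g \<in> carrier A" "maps h" "endo h \<in> carrier A"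
    "\<And>x. x \<in> S \<Longrightarrow> ext f (g x) = h x"
  shows "endo f \<otimes>\<^bsub>A\<^esub> endo g = endo h"
  by (rule A_eqI[OF A.m_closed[OF assms(3,4)] assms(6)]) (simp only: mult_gen[OF assms(1-4)] endo_gen[OF assms(5)] assms(7))

lemma endo_commuteI:
  assumes "maps f" "maps g" "endo f \<in> carrier A" "endo g \<in> carrier A" "\<And>x. x \<in> S \<Longrightarrow> ext f (g x) = ext g (f x)"
  shows "endo f \<otimes>\<^bsub>A\<^esub> endo g = endo g \<otimes>\<^bsub>A\<^esub> endo f"
  by (rule A_eqI[OF A.m_closed[OF assms(3,4)] A.m_closed[OF assms(4,3)]])
    (simp only: mult_gen[OF assms(1-4)] mult_gen[OF assms(2,1,4,3)] assms(5))

lemma rho_rho_commute: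
  assumes "i \<in> S" "j \<in> S" "k \<in> S" "l \<in> S" "i \<noteq> j" "k \<noteq> l" "j \<noteq> k" "i \<noteq> l" "j \<noteq> l"
  shows "endo (rho i j s) \<otimes>\<^bsub>A\<^esub> endo (rho k l t) = endo (rho k l t) \<otimes>\<^bsub>A\<^esub> endo (rho i j s)"
  by (intro endo_commuteI maps_elementary aut_rho assms) (use assms in \<open>auto simp: rho_def word_simps\<close>)

text \<open>The two transvections change opposite ends of the image of \<open>j\<close>.\<close>

lemma rho_lam_commute:
  assumes "i \<in> S" "j \<in> S" "k \<in> S" "i \<noteq> j" "k \<noteq> j"
  shows "endo (rho i j s) \<otimes>\<^bsub>A\<^esub> endo (lam k j t) = endo (lam k j t) \<otimes>\<^bsub>A\<^esub> endo (rho i j s)"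
  by (intro endo_commuteI maps_elementary aut_rho aut_lam assms) (use assms in \<open>auto simp: rho_def lam_def word_simps\<close>)

lemma rho_steinberg:
  assumes "i \<in> S" "j \<in> S" "k \<in> S" "i \<noteq> j" "j \<noteq> k" "i \<noteq> k"
  shows "endo (rho i j True) \<otimes>\<^bsub>A\<^esub> endo (rho j k True)
    = endo (rho j k True) \<otimes>\<^bsub>A\<^esub> endo (rho i j True) \<otimes>\<^bsub>A\<^esub> endo (rho i k True)"
proof (rule A_eqI)
  have m: "maps (rho i j True)" "maps (rho j k True)" "maps (rho i k True)" using assms by (simp_all add: maps_elementary)
  have a: "endo (rho i j True) \<in> carrier A" "endo (rho j k True) \<in> carrier A" "endo (rho i k True) \<in> carrier A"
    using assms by (simp_all add: aut_rho)
  then show "endo (rho i j True) \<otimes>\<^bsub>A\<^esub> endo (rho j k True) \<in> carrier A"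
    "endo (rho j k True) \<otimes>\<^bsub>A\<^esub> endo (rho i j True) \<otimes>\<^bsub>A\<^esub> endo (rho i k True) \<in> carrier A" by blast+
  show "(endo (rho i j True) \<otimes>\<^bsub>A\<^esub> endo (rho j k True)) [(x, True)]
    = (endo (rho j k True) \<otimes>\<^bsub>A\<^esub> endo (rho i j True) \<otimes>\<^bsub>A\<^esub> endo (rho i k True)) [(x, True)]" if "x \<in> S" for x
    unfolding mult_gen[OF m(1,2) a(1,2) that] mult_gen3[OF m(2,1,3) a(2,1,3) that]
    using assms by (auto simp: rho_def word_simps)
qed

lemma endo_mult_oneI:
  assumes "maps f" "maps g" "endo f \<in> carrier A" "endo g \<in> carrier A" "\<And>x. x \<in> S \<Longrightarrow> ext f (g x) = [(x, True)]"
  shows "endo f \<otimes>\<^bsub>A\<^esub> endo g = \<one>\<^bsub>A\<^esub>"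
  by (rule A_eqI[OF A.m_closed[OF assms(3,4)] A.one_closed])
    (simp only: mult_gen[OF assms(1-4)] A_one gen_closed assms(5))

lemma transvection_inverse:
  assumes "i \<in> S" "j \<in> S" "i \<noteq> j"
  shows "inv\<^bsub>A\<^esub> (endo (rho i j True)) = endo (rho i j False)" "inv\<^bsub>A\<^esub> (endo (lam i j True)) = endo (lam i j False)"
proof -
  have "endo (rho i j False) \<otimes>\<^bsub>A\<^esub> endo (rho i j True) = \<one>\<^bsub>A\<^esub>"
    by (intro endo_mult_oneI maps_elementary aut_rho assms) (use assms(3) in \<open>auto simp: rho_def word_simps\<close>)
  then show "inv\<^bsub>A\<^esub> (endo (rho i j True)) = endo (rho i j False)"
    by (rule A.inv_equality) (intro aut_rho assms)+
  have "endo (lam i j False) \<otimes>\<^bsub>A\<^esub> endo (lam i j True) = \<one>\<^bsub>A\<^esub>"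
    by (intro endo_mult_oneI maps_elementary aut_lam assms) (use assms(3) in \<open>auto simp: lam_def word_simps\<close>)
  then show "inv\<^bsub>A\<^esub> (endo (lam i j True)) = endo (lam i j False)"
    by (rule A.inv_equality) (intro aut_lam assms)+
qed

text \<open>A lift of the Weyl element of the matrix group to a signed permutation. It mixes left
  and right transvections, so it gives \<open>E_weyl\<close> once these are identified.\<close>

lemma weyl_sperm:
  assumes "i \<in> S" "j \<in> S" "i \<noteq> j"
  shows "endo (lam i j True) \<otimes>\<^bsub>A\<^esub> endo (lam j i False) \<otimes>\<^bsub>A\<^esub> endo (rho i j True) = endo (sperm (transpose i j) (\<lambda>x. x \<noteq> j))"
proof (rule A_eqI)
  have p: "transpose i j permutes S" using assms by (intro permutes_swap_id)
  have m: "maps (lam i j True)" "maps (lam j i False)" "maps (rho i j True)" using assms by (simp_all add: maps_elementary)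
  have a: "endo (lam i j True) \<in> carrier A" "endo (lam j i False) \<in> carrier A" "endo (rho i j True) \<in> carrier A"
    using assms by (simp_all add: aut_rho aut_lam)
  then show "endo (lam i j True) \<otimes>\<^bsub>A\<^esub> endo (lam j i False) \<otimes>\<^bsub>A\<^esub> endo (rho i j True) \<in> carrier A" by blast
  show "endo (sperm (transpose i j) (\<lambda>x. x \<noteq> j)) \<in> carrier A" by (rule aut_sperm[OF p])
  show "(endo (lam i j True) \<otimes>\<^bsub>A\<^esub> endo (lam j i False) \<otimes>\<^bsub>A\<^esub> endo (rho i j True)) [(x, True)]
    = endo (sperm (transpose i j) (\<lambda>x. x \<noteq> j)) [(x, True)]" if "x \<in> S" for x
    unfolding mult_gen3[OF m a that] endo_gen[OF maps_elementary(3)[OF p] that]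
    using assms(3) by (auto simp: rho_def lam_def sperm_def word_simps transpose_def)
qed

lemma sperm_mult:
  assumes \<sigma>: "\<sigma> permutes S" and \<tau>: "\<tau> permutes S"
  shows "endo (sperm \<sigma> s) \<otimes>\<^bsub>A\<^esub> endo (sperm \<tau> t) = endo (sperm (\<sigma> \<circ> \<tau>) (\<lambda>y. s y = t (inv_into UNIV \<sigma> y)))"
proof -
  have \<sigma>\<tau>: "\<sigma> \<circ> \<tau> permutes S" using \<tau> \<sigma> by (rule permutes_compose)
  show ?thesis
    by (intro endo_mult_eqI maps_elementary(3) aut_sperm \<sigma> \<tau> \<sigma>\<tau>)
      (simp add: sperm_def word_simps permutes_inverses[OF \<sigma>])
qed

lemma sperm_cong:
  assumes \<sigma>: "\<sigma> permutes S" and "\<And>x. x \<in> S \<Longrightarrow> s x = t x"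
  shows "endo (sperm \<sigma> s) = endo (sperm \<sigma> t)"
proof (rule A_eqI[OF aut_sperm[OF \<sigma>] aut_sperm[OF \<sigma>]])
  fix x assume x: "x \<in> S"
  then have "\<sigma> x \<in> S" using permutes_in_image[OF \<sigma>, of x] by simp
  then show "endo (sperm \<sigma> s) [(x, True)] = endo (sperm \<sigma> t) [(x, True)]"
    unfolding endo_gen[OF maps_elementary(3)[OF \<sigma>] x] using assms(2) by (simp add: sperm_def)
qed

lemma sperm_one: "endo (sperm id (\<lambda>x. True)) = \<one>\<^bsub>A\<^esub>"
proof (rule A_eqI[OF aut_sperm[OF permutes_id] A.one_closed])
  fix x assume x: "x \<in> S"
  show "endo (sperm id (\<lambda>x. True)) [(x, True)] = \<one>\<^bsub>A\<^esub> [(x, True)]"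
    unfolding endo_gen[OF maps_elementary(3)[OF permutes_id] x] A_one[OF gen_closed[OF x]] by (simp add: sperm_def)
qed

definition sperms :: "(nat letter list \<Rightarrow> nat letter list) set" where
  "sperms = {endo (sperm \<sigma> s) |\<sigma> s. \<sigma> permutes S}"

lemma sperms_subgroup: "subgroup sperms A"
proof (rule A.subgroupI)
  show "sperms \<subseteq> carrier A" using aut_sperm by (auto simp: sperms_def)
  show "sperms \<noteq> {}" using permutes_id[of S] unfolding sperms_def by blast
  fix \<alpha> assume "\<alpha> \<in> sperms"
  then obtain \<sigma> s where \<sigma>: "\<sigma> permutes S" "\<alpha> = endo (sperm \<sigma> s)" by (auto simp: sperms_def)
  let ?\<tau> = "inv_into UNIV \<sigma>"
  have \<tau>: "?\<tau> permutes S" using \<sigma>(1) by (rule permutes_inv)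
  have "endo (sperm ?\<tau> (\<lambda>y. s (\<sigma> y))) \<otimes>\<^bsub>A\<^esub> \<alpha> = \<one>\<^bsub>A\<^esub>"
    unfolding \<sigma>(2) sperm_mult[OF \<tau> \<sigma>(1)] using \<sigma>(1) by (simp add: permutes_inv_o inv_inv_eq permutes_bij sperm_one)
  then have "inv\<^bsub>A\<^esub> \<alpha> = endo (sperm ?\<tau> (\<lambda>y. s (\<sigma> y)))"
    using aut_sperm \<sigma> \<tau> by (intro A.inv_equality) auto
  then show "inv\<^bsub>A\<^esub> \<alpha> \<in> sperms" using \<tau> by (auto simp: sperms_def)
  fix \<beta> assume "\<beta> \<in> sperms"
  then obtain \<rho> t where "\<rho> permutes S" "\<beta> = endo (sperm \<rho> t)" by (auto simp: sperms_def)
  then show "\<alpha> \<otimes>\<^bsub>A\<^esub> \<beta> \<in> sperms" using \<sigma> sperm_mult permutes_compose unfolding sperms_def by blast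
qed

text \<open>Only the signs on \<open>S\<close> matter, so a subset of \<open>S\<close> encodes
  them.\<close>

lemma finite_sperms: "finite sperms"
proof -
  have "sperms \<subseteq> (\<lambda>(\<sigma>, T). endo (sperm \<sigma> (\<lambda>x. x \<in> T))) ` ({\<sigma>. \<sigma> permutes S} \<times> Pow S)"
  proof
    fix \<alpha> assume "\<alpha> \<in> sperms"
    then obtain \<sigma> s where \<sigma>: "\<sigma> permutes S" "\<alpha> = endo (sperm \<sigma> s)" by (auto simp: sperms_def)
    have "\<alpha> = endo (sperm \<sigma> (\<lambda>x. x \<in> {x \<in> S. s x}))"
      unfolding \<sigma>(2) by (rule sperm_cong[OF \<sigma>(1)]) simp
    then show "\<alpha> \<in> (\<lambda>(\<sigma>, T). endo (sperm \<sigma> (\<lambda>x. x \<in> T))) ` ({\<sigma>. \<sigma> permutes S} \<times> Pow S)"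
      using \<sigma>(1) by (intro image_eqI[of _ _ "(\<sigma>, {x \<in> S. s x})"]) auto
  qed
  then show ?thesis by (rule finite_subset) (intro finite_imageI finite_cartesian_product finite_permutations finite_S finite_Pow_iff[THEN iffD2])
qed

text \<open>Inverting the generator that a transvection changes exchanges right and left
  multiplication; this is the source of the two cases.\<close>

lemma sperm_conj_rho:
  assumes \<sigma>: "\<sigma> permutes S" and ij: "i \<in> S" "j \<in> S" "i \<noteq> j"
  shows "endo (sperm \<sigma> s) \<otimes>\<^bsub>A\<^esub> endo (rho i j True)
    = endo (if s (\<sigma> j) then rho (\<sigma> i) (\<sigma> j) (s (\<sigma> i)) else lam (\<sigma> i) (\<sigma> j) (\<not> s (\<sigma> i))) \<otimes>\<^bsub>A\<^esub> endo (sperm \<sigma> s)"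
proof -
  have \<sigma>ij: "\<sigma> i \<in> S" "\<sigma> j \<in> S" "\<sigma> i \<noteq> \<sigma> j"
    using permutes_in_image[OF \<sigma>] permutes_inj[OF \<sigma>] ij by (auto dest: injD)
have inj: "\<sigma> x = \<sigma> y \<longleftrightarrow> x = y" for x y using permutes_inj[OF \<sigma>] by (auto dest: injD)
  let ?h = "if s (\<sigma> j) then rho (\<sigma> i) (\<sigma> j) (s (\<sigma> i)) else lam (\<sigma> i) (\<sigma> j) (\<not> s (\<sigma> i))"
  have m: "maps ?h" "endo ?h \<in> carrier A" "maps (rho i j True)" "endo (rho i j True) \<in> carrier A"
    using \<sigma>ij ij by (simp_all add: maps_elementary aut_rho aut_lam)
  note w = maps_elementary(3)[OF \<sigma>, of s] aut_sperm[OF \<sigma>, of s]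
  show ?thesis
  proof (rule A_eqI[OF A.m_closed[OF w(2) m(4)] A.m_closed[OF m(2) w(2)]])
    fix x assume x: "x \<in> S"
    show "(endo (sperm \<sigma> s) \<otimes>\<^bsub>A\<^esub> endo (rho i j True)) [(x, True)] = (endo ?h \<otimes>\<^bsub>A\<^esub> endo (sperm \<sigma> s)) [(x, True)]"
      unfolding mult_gen[OF w(1) m(3) w(2) m(4) x] mult_gen[OF m(1) w(1) m(2) w(2) x]
      using ij \<sigma>ij by (cases "x = j"; cases "s (\<sigma> j)"; cases "s (\<sigma> x)") (simp_all add: rho_def lam_def sperm_def word_simps inj)
  qed
qed

end

section \<open>Homomorphisms identifying left and right transvections\<close>

lemma (in group) conj_generate:
  assumes K: "K \<subseteq> carrier G" and g: "g \<in> carrier G"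
    and conj: "\<And>h. h \<in> K \<Longrightarrow> g \<otimes> h \<otimes> inv g \<in> generate G K"
    and x: "x \<in> generate G K"
  shows "g \<otimes> x \<otimes> inv g \<in> generate G K"
  using x
proof (induction rule: generate.induct)
  case one
  then show ?case using g generate.one by simp
next
  case (incl h)
  then show ?case by (rule conj)
next
  case (inv h)
  have h: "h \<in> carrier G" using inv K by blast
  have "inv (g \<otimes> h \<otimes> inv g) \<in> generate G K" by (rule generate_m_inv_closed[OF K conj[OF inv]])
  then show ?case using g h by (simp add: inv_mult_group m_assoc)
next
  case (eng h k)
  have hk: "h \<in> carrier G" "k \<in> carrier G" using eng generate_in_carrier[OF K] by blast+
  have "(g \<otimes> h \<otimes> inv g) \<otimes> (g \<otimes> k \<otimes> inv g) \<in> generate G K"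
    using eng.IH by (rule generate.eng)
  also have "(g \<otimes> h \<otimes> inv g) \<otimes> (g \<otimes> k \<otimes> inv g) = g \<otimes> (h \<otimes> k) \<otimes> inv g"
    using g hk by (simp add: m_assoc inv_cancel_left)
  finally show ?case .
qed

text \<open>The copy of \<open>GL_int m\<close> acting on the first \<open>m\<close>
  coordinates.\<close>

definition stab :: "nat \<Rightarrow> nat \<Rightarrow> int mat set" where
  "stab n m = {M \<in> carrier (GL_int n). (\<forall>v. \<forall>k\<ge>m. mat_act M v k = v k) \<and> (\<forall>k\<ge>m. mat_act M (basis_vec k) = basis_vec k)}"

lemma stab_subgroup: "subgroup (stab n m) (GL_int n)"
proof -
  interpret GL: group "GL_int n" by (rule group_GL_int)
  show ?thesis
  proof (rule GL.subgroupI)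
    show "stab n m \<subseteq> carrier (GL_int n)" by (auto simp: stab_def)
    have "\<one>\<^bsub>GL_int n\<^esub> \<in> stab n m" unfolding stab_def using GL.one_closed by (simp add: one_GL_int mat_act_one)
    then show "stab n m \<noteq> {}" by blast
    fix M assume M: "M \<in> stab n m"
    then have Mc: "M \<in> carrier (GL_int n)" and M1: "\<And>v k. m \<le> k \<Longrightarrow> mat_act M v k = v k"
      and M2: "\<And>k. m \<le> k \<Longrightarrow> mat_act M (basis_vec k) = basis_vec k" by (simp_all add: stab_def)
    let ?N = "inv\<^bsub>GL_int n\<^esub> M"
    have "mat_act ?N v k = v k" if "m \<le> k" for v k
      using M1[OF that, of "mat_act ?N v"] by (simp add: GL_act_inv[OF Mc])
    moreover have "mat_act ?N (basis_vec k) = basis_vec k" if "m \<le> k" for k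
      using GL_act_inv(1)[OF Mc, of "basis_vec k"] by (simp add: M2[OF that])
    ultimately show "?N \<in> stab n m" using Mc by (simp add: stab_def)
    fix N assume N: "N \<in> stab n m"
    show "M \<otimes>\<^bsub>GL_int n\<^esub> N \<in> stab n m"
      using M N by (simp add: stab_def GL_act_mult)
  qed
qed

lemma stab_full: "M \<in> carrier (GL_int n) \<Longrightarrow> M \<in> stab n n"
  using GL_carrier_mat[of M n] by (auto simp: stab_def mat_act_def basis_vec_def fun_eq_iff)

section \<open>The pair of matrix and image\<close>

locale identified_hom = free_group_n S n + group G for S n and G (structure) +
  fixes \<phi> :: "(nat letter list \<Rightarrow> nat letter list) \<Rightarrow> 'g"
  assumes \<phi>: "\<phi> \<in> hom A G" and n3: "3 \<le> n"
    and rho_lam: "\<lbrakk>i \<in> S; j \<in> S; i \<noteq> j\<rbrakk> \<Longrightarrow> \<phi> (endo (rho i j True)) = \<phi> (endo (lam i j True))"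
begin

sublocale \<phi>: group_hom A G \<phi>
  by (intro group_hom.intro group_hom_axioms.intro A.is_group is_group \<phi>)

abbreviation "Q \<equiv> GL_int n \<times>\<times> G"

text \<open>The graph of the map to be constructed from matrices to \<open>G\<close>. As the action
  uses the first component only, faithfulness means that the matrix determines the second
  one.\<close>

definition \<Psi> :: "(nat letter list \<Rightarrow> nat letter list) \<Rightarrow> int mat \<times> 'g" where
  "\<Psi> \<alpha> = (ab \<alpha>, \<phi> \<alpha>)"

definition E :: "nat \<Rightarrow> nat \<Rightarrow> int mat \<times> 'g" where
  "E i j = \<Psi> (endo (rho (Suc i) (Suc j) True))"

definition act :: "int mat \<times> 'g \<Rightarrow> (nat \<Rightarrow> int) \<Rightarrow> nat \<Rightarrow> int" where
  "act g = mat_act (fst g)"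

sublocale Q: group Q by (rule DirProd_group[OF group_GL_int is_group])

lemma \<Psi>_hom: "\<Psi> \<in> hom A Q"
  by (rule homI) (simp_all add: \<Psi>_def)

sublocale \<Psi>: group_hom A Q \<Psi>
  by (intro group_hom.intro group_hom_axioms.intro A.is_group Q.is_group \<Psi>_hom)

lemma aut_E: "i < n \<Longrightarrow> i \<noteq> j \<Longrightarrow> endo (rho (Suc i) (Suc j) s) \<in> carrier A"
  "i < n \<Longrightarrow> i \<noteq> j \<Longrightarrow> endo (lam (Suc i) (Suc j) s) \<in> carrier A"
  by (simp_all add: aut_rho aut_lam Suc_S(1))

lemma E_lam: "\<lbrakk>i < n; j < n; i \<noteq> j\<rbrakk> \<Longrightarrow> \<Psi> (endo (lam (Suc i) (Suc j) True)) = E i j"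
  by (simp add: \<Psi>_def E_def ab_rho rho_lam Suc_S(1))

lemma E_inv:
  assumes "i < n" "j < n" "i \<noteq> j"
  shows "\<Psi> (endo (rho (Suc i) (Suc j) False)) = inv\<^bsub>Q\<^esub> (E i j)" "\<Psi> (endo (lam (Suc i) (Suc j) False)) = inv\<^bsub>Q\<^esub> (E i j)"
proof -
  have S: "Suc i \<in> S" "Suc j \<in> S" "Suc i \<noteq> Suc j" using assms by (simp_all add: Suc_S(1))
  show "\<Psi> (endo (rho (Suc i) (Suc j) False)) = inv\<^bsub>Q\<^esub> (E i j)"
    unfolding transvection_inverse(1)[OF S, symmetric] E_def by (rule \<Psi>.hom_inv[OF aut_E(1)[OF assms(1,3)]])
  show "\<Psi> (endo (lam (Suc i) (Suc j) False)) = inv\<^bsub>Q\<^esub> (E i j)"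
    unfolding transvection_inverse(2)[OF S, symmetric] E_lam[OF assms, symmetric]
    by (rule \<Psi>.hom_inv[OF aut_E(2)[OF assms(1,3)]])
qed

lemma E_mem: "\<lbrakk>i < n; j < n; i \<noteq> j\<rbrakk> \<Longrightarrow> E i j \<in> carrier Q"
  unfolding E_def by (intro \<Psi>.hom_closed aut_E)

lemma E_power:
  assumes "i < n" "j < n" "i \<noteq> j"
  shows "\<Psi> (endo (rho (Suc i) (Suc j) t)) = E i j [^]\<^bsub>Q\<^esub> (if t then 1 else - 1 :: int)"
    "\<Psi> (endo (lam (Suc i) (Suc j) t)) = E i j [^]\<^bsub>Q\<^esub> (if t then 1 else - 1 :: int)"
  using E_mem[OF assms] E_inv[OF assms] E_lam[OF assms] Q.int_pow_neg[OF E_mem[OF assms], of 1] Q.int_pow_1[OF E_mem[OF assms]]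
  by (cases t; simp add: E_def)+

lemma act_E: "\<lbrakk>i < n; j < n; i \<noteq> j\<rbrakk> \<Longrightarrow> act (E i j) v = v(i := v i + v j)"
  unfolding act_def E_def \<Psi>_def fst_conv
  by (simp add: ab_rho mat_act_transvection supported_basis)
    (auto simp: fun_eq_iff dot_def basis_vec_def if_distrib[of "\<lambda>x. x * _"] cong: if_cong)

text \<open>Translation to coordinates numbered from 0; from \<open>n\<close> on the permutation is
  the identity and the signs are one, because \<open>W_signed\<close> speaks about all
  indices.\<close>

lemma sperm_signed:
  fixes s :: "nat \<Rightarrow> bool"
  assumes \<sigma>: "\<sigma> permutes S"
  defines "\<sigma>' \<equiv> \<lambda>i. if i < n then \<sigma> (Suc i) - 1 else i"
    and "s' \<equiv> \<lambda>i. if i < n \<and> \<not> s (\<sigma> (Suc i)) then - 1 else 1 :: int"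
  shows "\<sigma>' permutes {..<n}" "\<And>i. i < n \<Longrightarrow> \<sigma> (Suc i) = Suc (\<sigma>' i)"
    "\<And>v i. act (\<Psi> (endo (sperm \<sigma> s))) v (\<sigma>' i) = s' i * v i"
proof -
  have Suc: "\<sigma> (Suc i) = Suc (\<sigma>' i)" "\<sigma>' i < n" if "i < n" for i
    using permutes_in_image[OF \<sigma>, of "Suc i"] that unfolding S_eq \<sigma>'_def by auto
  then show "\<And>i. i < n \<Longrightarrow> \<sigma> (Suc i) = Suc (\<sigma>' i)" by blast
  have "inj_on \<sigma>' {..<n}"
  proof (rule inj_onI)
    fix i j assume "i \<in> {..<n}" "j \<in> {..<n}" "\<sigma>' i = \<sigma>' j"
    then have "\<sigma> (Suc i) = \<sigma> (Suc j)" using Suc(1) by simp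
    then show "i = j" using permutes_inj[OF \<sigma>] by (simp add: inj_eq)
  qed
  moreover have "\<sigma>' ` {..<n} \<subseteq> {..<n}" using Suc(2) by blast
  ultimately have "bij_betw \<sigma>' {..<n} {..<n}" by (simp add: bij_betw_def endo_inj_surj)
  then show "\<sigma>' permutes {..<n}" by (rule bij_imp_permutes) (simp add: \<sigma>'_def)
  show "act (\<Psi> (endo (sperm \<sigma> s))) v (\<sigma>' i) = s' i * v i" for v i
  proof (cases "i < n")
    case True
    then show ?thesis using ab_sperm_act[OF \<sigma> True, of s v] by (simp add: act_def \<Psi>_def \<sigma>'_def s'_def)
  next
    case False
    then show ?thesis by (simp add: act_def \<Psi>_def \<sigma>'_def s'_def mat_act_def ab_def)
  qed
qed

sublocale steinberg: steinberg_action Q n act E "\<Psi> ` sperms"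
proof (intro steinberg_action.intro steinberg_action_axioms.intro Q.is_group)
  show "act \<one>\<^bsub>Q\<^esub> v = v" for v by (simp add: act_def one_GL_int mat_act_one)
  show "act (g \<otimes>\<^bsub>Q\<^esub> h) v = act g (act h v)" if "g \<in> carrier Q" "h \<in> carrier Q" for g h v
    using that by (cases g; cases h) (simp add: act_def GL_act_mult)
  show "E i j \<in> carrier Q" if "i < n" "j < n" "i \<noteq> j" for i j using E_mem that by blast
  show "act (E i j) v = v(i := v i + v j)" if "i < n" "j < n" "i \<noteq> j" for i j v using act_E that by blast
  show "E i j \<otimes>\<^bsub>Q\<^esub> E k l = E k l \<otimes>\<^bsub>Q\<^esub> E i j"
    if *: "i < n" "j < n" "k < n" "l < n" "i \<noteq> j" "k \<noteq> l" "j \<noteq> k" "i \<noteq> l" for i j k l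
  proof -
    have S: "Suc i \<in> S" "Suc j \<in> S" "Suc k \<in> S" "Suc l \<in> S" using * by (simp_all add: Suc_S(1))
    have ne: "Suc i \<noteq> Suc j" "Suc k \<noteq> Suc l" "Suc j \<noteq> Suc k" "Suc i \<noteq> Suc l" using * by simp_all
    show ?thesis
    proof (cases "j = l")
      case True
      \<comment> \<open>Two right transvections with the same target do not commute as
        automorphisms; one of them is replaced by the left transvection that has the same
        image.\<close>
      have "\<Psi> (endo (rho (Suc i) (Suc j) True) \<otimes>\<^bsub>A\<^esub> endo (lam (Suc k) (Suc j) True))
        = \<Psi> (endo (lam (Suc k) (Suc j) True) \<otimes>\<^bsub>A\<^esub> endo (rho (Suc i) (Suc j) True))"
        using rho_lam_commute[OF S(1-3) ne(1)] ne(3) by metis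
      then show ?thesis
        using * True aut_E E_lam[of k j] by (simp add: \<Psi>.hom_mult E_def)
    next
      case False
      then have "\<Psi> (endo (rho (Suc i) (Suc j) True) \<otimes>\<^bsub>A\<^esub> endo (rho (Suc k) (Suc l) True))
        = \<Psi> (endo (rho (Suc k) (Suc l) True) \<otimes>\<^bsub>A\<^esub> endo (rho (Suc i) (Suc j) True))"
        using rho_rho_commute[OF S ne] by simp
      then show ?thesis using * aut_E by (simp add: \<Psi>.hom_mult E_def)
    qed
  qed
  show "E i j \<otimes>\<^bsub>Q\<^esub> E j k = E j k \<otimes>\<^bsub>Q\<^esub> E i j \<otimes>\<^bsub>Q\<^esub> E i k"
    if *: "i < n" "j < n" "k < n" "i \<noteq> j" "j \<noteq> k" "i \<noteq> k" for i j k
  proof -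
    have "Suc i \<in> S" "Suc j \<in> S" "Suc k \<in> S" using * by (simp_all add: Suc_S(1))
    note rho_steinberg[OF this]
    then have "\<Psi> (endo (rho (Suc i) (Suc j) True) \<otimes>\<^bsub>A\<^esub> endo (rho (Suc j) (Suc k) True))
      = \<Psi> (endo (rho (Suc j) (Suc k) True) \<otimes>\<^bsub>A\<^esub> endo (rho (Suc i) (Suc j) True) \<otimes>\<^bsub>A\<^esub> endo (rho (Suc i) (Suc k) True))"
      using * by simp
    then show ?thesis using * aut_E A.m_closed by (simp add: \<Psi>.hom_mult E_def)
  qed
  show "E i j \<otimes>\<^bsub>Q\<^esub> inv\<^bsub>Q\<^esub> E j i \<otimes>\<^bsub>Q\<^esub> E i j \<in> \<Psi> ` sperms" if *: "i < n" "j < n" "i \<noteq> j" for i j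
  proof -
    have S: "Suc i \<in> S" "Suc j \<in> S" "Suc i \<noteq> Suc j" using * by (simp_all add: Suc_S(1))
    have "E i j \<otimes>\<^bsub>Q\<^esub> inv\<^bsub>Q\<^esub> E j i \<otimes>\<^bsub>Q\<^esub> E i j
      = \<Psi> (endo (lam (Suc i) (Suc j) True) \<otimes>\<^bsub>A\<^esub> endo (lam (Suc j) (Suc i) False) \<otimes>\<^bsub>A\<^esub> endo (rho (Suc i) (Suc j) True))"
      using * aut_E A.m_closed E_lam[OF *] E_inv(2)[of j i] by (simp add: \<Psi>.hom_mult E_def)
    also have "\<dots> \<in> \<Psi> ` sperms"
      unfolding weyl_sperm[OF S] sperms_def using permutes_swap_id[OF S(1,2)] by blast
    finally show ?thesis .
  qed
  show "subgroup (\<Psi> ` sperms) Q" by (rule \<Psi>.subgroup_img_is_subgroup[OF sperms_subgroup])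
  fix w assume w: "w \<in> \<Psi> ` sperms"
  then obtain \<sigma> s where \<sigma>: "\<sigma> permutes S" and w_eq: "w = \<Psi> (endo (sperm \<sigma> s))" by (auto simp: sperms_def)
  have wc: "w \<in> carrier Q" unfolding w_eq using aut_sperm[OF \<sigma>] by (rule \<Psi>.hom_closed)
  define \<sigma>' where "\<sigma>' i = (if i < n then \<sigma> (Suc i) - 1 else i)" for i
  define s' where "s' i = (if i < n \<and> \<not> s (\<sigma> (Suc i)) then - 1 else 1 :: int)" for i
  note sg = sperm_signed(1,2)[OF \<sigma>, folded \<sigma>'_def] sperm_signed(3)[OF \<sigma>, of s, folded \<sigma>'_def s'_def]
  have conj: "w \<otimes>\<^bsub>Q\<^esub> E i j \<otimes>\<^bsub>Q\<^esub> inv\<^bsub>Q\<^esub> w = E (\<sigma>' i) (\<sigma>' j) [^]\<^bsub>Q\<^esub> (s' i * s' j)" if *: "i < n" "j < n" "i \<noteq> j" for i j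
  proof -
    have S: "Suc i \<in> S" "Suc j \<in> S" "Suc i \<noteq> Suc j" using * by (simp_all add: Suc_S(1))
    have \<sigma>ij: "\<sigma>' i < n" "\<sigma>' j < n" "\<sigma>' i \<noteq> \<sigma>' j"
      using permutes_in_image[OF sg(1), of i] permutes_in_image[OF sg(1), of j] permutes_inj[OF sg(1)] *
      by (simp_all add: inj_eq)
    let ?h = "if s (\<sigma> (Suc j)) then rho (Suc (\<sigma>' i)) (Suc (\<sigma>' j)) (s (\<sigma> (Suc i))) else lam (Suc (\<sigma>' i)) (Suc (\<sigma>' j)) (\<not> s (\<sigma> (Suc i)))"
    have h: "endo ?h \<in> carrier A" using aut_E \<sigma>ij by simp
    have "endo (sperm \<sigma> s) \<otimes>\<^bsub>A\<^esub> endo (rho (Suc i) (Suc j) True) = endo ?h \<otimes>\<^bsub>A\<^esub> endo (sperm \<sigma> s)"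
      using sperm_conj_rho[OF \<sigma> S, of s] by (simp only: sg(2)[OF *(1)] sg(2)[OF *(2)])
    then have "w \<otimes>\<^bsub>Q\<^esub> E i j = \<Psi> (endo ?h) \<otimes>\<^bsub>Q\<^esub> w"
      unfolding w_eq E_def using \<Psi>.hom_mult[OF aut_sperm[OF \<sigma>] aut_E(1)[OF *(1,3)]] \<Psi>.hom_mult[OF h aut_sperm[OF \<sigma>]]
      by metis
    then have "w \<otimes>\<^bsub>Q\<^esub> E i j \<otimes>\<^bsub>Q\<^esub> inv\<^bsub>Q\<^esub> w = \<Psi> (endo ?h)"
      using wc \<Psi>.hom_closed[OF h] by (simp only: Q.m_assoc Q.r_inv Q.inv_closed Q.r_one)
    also have "\<dots> = E (\<sigma>' i) (\<sigma>' j) [^]\<^bsub>Q\<^esub> (s' i * s' j)"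
      using *(1,2) by (cases "s (\<sigma> (Suc i))"; cases "s (\<sigma> (Suc j))") (simp_all only: E_power[OF \<sigma>ij] s'_def if_True if_False simp_thms mult_1 mult_minus_left minus_minus)
    finally show ?thesis .
  qed
  show "\<exists>\<sigma> s. \<sigma> permutes {..<n} \<and> (\<forall>i. s i \<in> {1, - 1}) \<and> (\<forall>v i. act w v (\<sigma> i) = s i * v i)
      \<and> (\<forall>i j. i < n \<longrightarrow> j < n \<longrightarrow> i \<noteq> j \<longrightarrow> w \<otimes>\<^bsub>Q\<^esub> E i j \<otimes>\<^bsub>Q\<^esub> inv\<^bsub>Q\<^esub> w = E (\<sigma> i) (\<sigma> j) [^]\<^bsub>Q\<^esub> (s i * s j :: int))"
    by (rule exI[of _ \<sigma>'], rule exI[of _ s'], intro conjI allI impI conj sg(1)) (simp_all add: s'_def sg(3)[folded w_eq, unfolded s'_def])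
  show "act w v i = v i" if "n \<le> i" for v i
    using that by (simp add: w_eq act_def \<Psi>_def mat_act_def ab_def)
  show "w = \<one>\<^bsub>Q\<^esub>" if triv: "\<And>v. act w v = v"
  proof -
    have fx: "\<sigma> (Suc i) = Suc i" "s (Suc i)" if "i < n" for i
    proof -
      have eq: "basis_vec i (\<sigma>' i) = s' i" using sg(3)[of "basis_vec i" i] unfolding w_eq[symmetric] triv by (simp add: basis_vec_def)
      moreover have "s' i \<noteq> 0" by (simp add: s'_def)
      ultimately have i: "\<sigma>' i = i" by (metis basis_vec_def)
      then show "\<sigma> (Suc i) = Suc i" using sg(2)[OF that] by simp
      moreover have "s' i = 1" using eq i by (simp add: basis_vec_def)
      ultimately show "s (Suc i)" using that by (simp add: s'_def split: if_splits)
    qed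
    have fS: "\<sigma> x = x" "s x" if "x \<in> S" for x using that fx unfolding Suc_S(2) by auto
    have "\<sigma> = id" using fS(1) permutes_not_in[OF \<sigma>] by fastforce
    then have "endo (sperm \<sigma> s) = \<one>\<^bsub>A\<^esub>"
      using sperm_cong[OF \<sigma>, of s "\<lambda>_. True"] fS(2) sperm_one by simp
    then show ?thesis by (simp only: w_eq \<Psi>.hom_one)
  qed
qed

text \<open>By Nielsen's theorem \<open>\<Psi> \<alpha>\<close> lies in the group generated by
  transvections and signed permutations, where \<open>steinberg_faithful\<close> applies.\<close>

lemma ab_kernel:
  assumes "\<alpha> \<in> carrier A" "ab \<alpha> = 1\<^sub>m n"
  shows "\<phi> \<alpha> = \<one>"
proof -
  let ?K = "{E i j |i j. i < n \<and> j < n \<and> i \<noteq> j} \<union> \<Psi> ` sperms"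
  have K: "?K \<subseteq> carrier Q"
    using E_mem subgroup.subset[OF steinberg.W_subgroup] by blast
  have "\<Psi> ` nielsen_gens \<subseteq> generate Q ?K"
  proof
    fix g assume "g \<in> \<Psi> ` nielsen_gens"
    then consider h where "h \<in> sperms" "g = \<Psi> h" | i j t where "i \<in> S" "j \<in> S" "i \<noteq> j" "g = \<Psi> (endo (rho i j t))"
      unfolding nielsen_gens_def sperms_def by blast
    then show "g \<in> generate Q ?K"
    proof cases
      case 1
      then show ?thesis by (intro generate.incl) blast
    next
      case 2
      then obtain a b where ab: "i = Suc a" "j = Suc b" "a < n" "b < n" "a \<noteq> b" unfolding Suc_S(2) by blast
      then have "E a b \<in> ?K" by blast
      then show ?thesis
        using generate.incl[of "E a b" ?K Q] generate.inv[of "E a b" ?K Q] E_inv(1)[OF ab(3-5)] 2(4) ab(1,2)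
        by (cases t) (simp_all add: E_def)
    qed
  qed
  then have "generate Q (\<Psi> ` nielsen_gens) \<subseteq> generate Q ?K"
    by (rule Q.generate_subgroup_incl[OF _ Q.generate_is_subgroup[OF K]])
  moreover have "\<Psi> \<alpha> \<in> generate Q (\<Psi> ` nielsen_gens)"
    unfolding \<Psi>.generate_img[OF nielsen_gens_closed] using nielsen[OF assms(1)] by blast
  ultimately have "\<Psi> \<alpha> \<in> generate Q ?K" by blast
  moreover have "act (\<Psi> \<alpha>) v = v" for v by (simp add: act_def \<Psi>_def assms(2) mat_act_one)
  ultimately have "\<Psi> \<alpha> = \<one>\<^bsub>Q\<^esub>" by (rule steinberg.steinberg_faithful)
  then show ?thesis by (simp add: \<Psi>_def)
qed

section \<open>Surjectivity onto the matrix group\<close>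

lemma ab_image_subgroup: "subgroup (ab ` carrier A) (GL_int n)"
  by (rule ab.subgroup_img_is_subgroup[OF A.subgroup_self])

text \<open>Column \<open>b\<close> of \<open>M\<close> is unimodular, and the transitivity obtained
  from the norm reduction realizes it by an automorphism \<open>\<beta>\<close>. After division by
  \<open>ab \<beta>\<close>, a product of transvections \<open>\<gamma>\<close> clears row
  \<open>b\<close> and leaves a matrix in \<open>stab n b\<close>.\<close>

lemma stab_step:
  assumes b: "b < n"
    and IH: "stab n b \<subseteq> ab ` carrier A" and M: "M \<in> stab n (Suc b)"
  shows "M \<in> ab ` carrier A"
proof -
  interpret rk: steinberg_rank Q n act E "\<Psi> ` sperms" b by unfold_locales (rule b)
  define K where "K = {\<beta> \<in> carrier A. ab \<beta> \<in> stab n (Suc b)}"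
  have K_sub: "subgroup K A"
    using subgroup.m_closed[OF stab_subgroup] subgroup.m_inv_closed[OF stab_subgroup] subgroup.one_closed[OF stab_subgroup]
    by (intro A.subgroupI) (auto simp: K_def intro!: exI[of _ "\<one>\<^bsub>A\<^esub>"])
  have \<Psi>K: "subgroup (\<Psi> ` K) Q" by (rule \<Psi>.subgroup_img_is_subgroup[OF K_sub])
  have E_K: "E i j \<in> \<Psi> ` K" if ij: "i \<le> b" "j \<le> b" "i \<noteq> j" for i j
  proof -
    have ij': "i < n" "j < n" using ij b by simp_all
    have "mat_act (ab (endo (rho (Suc i) (Suc j) True))) v = v(i := v i + v j)" for v
      using act_E[OF ij' ij(3), of v] by (simp add: act_def E_def \<Psi>_def)
    then have "endo (rho (Suc i) (Suc j) True) \<in> K"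
      using ij ab.hom_closed[OF aut_E(1)[OF ij'(1) ij(3)]] aut_E(1)[OF ij'(1) ij(3)]
      by (auto simp: K_def stab_def basis_vec_def)
    then show ?thesis unfolding E_def by blast
  qed
  have W_K: "w \<in> \<Psi> ` K" if w: "w \<in> steinberg.W_fix (Suc b)" for w
  proof -
    obtain \<beta> where \<beta>: "\<beta> \<in> sperms" "w = \<Psi> \<beta>" using w by (auto simp: steinberg.W_fix_def)
    have \<beta>A: "\<beta> \<in> carrier A" using subgroup.mem_carrier[OF sperms_subgroup \<beta>(1)] .
    have act_w: "act w v = mat_act (ab \<beta>) v" for v by (simp add: \<beta>(2) act_def \<Psi>_def)
    obtain \<sigma> s where \<sigma>: "\<sigma> permutes {..<Suc b}" "\<And>v i. act w v (\<sigma> i) = s i * v i" "\<And>i. i \<ge> Suc b \<Longrightarrow> s i = (1::int)"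
      using steinberg.W_fix_signed[OF w] b by (metis Suc_leI)
    have "act w (basis_vec k) = basis_vec k" if k: "Suc b \<le> k" for k
    proof
      fix l
      obtain i where i: "l = \<sigma> i" using permutes_surj[OF \<sigma>(1)] by blast
      have "\<sigma> k = k" using permutes_not_in[OF \<sigma>(1)] k by simp
      then have "\<sigma> i = k \<longleftrightarrow> i = k" using permutes_inj[OF \<sigma>(1)] by (metis injD)
      then show "act w (basis_vec k) l = basis_vec k l" unfolding i \<sigma>(2) using \<sigma>(3)[OF k] by (auto simp: basis_vec_def)
    qed
    moreover have "act w v k = v k" if "Suc b \<le> k" for v k using w that by (simp add: steinberg.W_fix_def)
    ultimately have "\<beta> \<in> K" using \<beta>A ab.hom_closed[OF \<beta>A] by (simp add: K_def stab_def act_w)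
    then show ?thesis using \<beta>(2) by blast
  qed
  define v where "v = mat_act M (basis_vec b)"
  have Mc: "M \<in> carrier (GL_int n)" using M by (simp add: stab_def)
  let ?N = "inv\<^bsub>GL_int n\<^esub> M"
  have Nc: "?N \<in> carrier (GL_int n)" using Mc by simp
  have v0: "v i = 0" if "b < i" for i using M that by (simp add: stab_def v_def basis_vec_def)
  have "(\<Sum>j<n. ?N $$ (b, j) * v j) = mat_act ?N v b" using GL_carrier_mat[OF Nc] b by (simp add: mat_act_def)
  also have "\<dots> = 1" by (simp add: v_def GL_act_inv[OF Mc]) (simp add: basis_vec_def)
  also have "(\<Sum>j<n. ?N $$ (b, j) * v j) = (\<Sum>j\<le>b. ?N $$ (b, j) * v j)"
    using b v0 by (intro sum.mono_neutral_right) auto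
  finally have sum1: "(\<Sum>j\<le>b. ?N $$ (b, j) * v j) = 1" .
  have "\<exists>\<beta>\<in>K. mat_act (ab \<beta>) (basis_vec b) = v"
  proof (cases "b = 0")
    case False
    have "rk.unimodular v" unfolding rk.unimodular_def
      by (intro conjI allI impI v0 exI[of _ "\<lambda>j. ?N $$ (b, j)"] sum1)
    then obtain g where g: "g \<in> generate Q rk.gens" "act g (basis_vec b) = v"
      using rk.transitive_unimodular False by blast
    have "rk.gens \<subseteq> \<Psi> ` K" unfolding rk.gens_def using E_K W_K by blast
    then have "g \<in> \<Psi> ` K" using Q.generate_subgroup_incl[OF _ \<Psi>K] g(1) by blast
    then show ?thesis using g(2) by (auto simp: act_def \<Psi>_def)
  next
    case True
    \<comment> \<open>Transitivity needs two coordinates; for \<open>b = 0\<close> the only entry is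
      a unit and a sign change suffices.\<close>
    have "?N $$ (0, 0) * v 0 = 1" using sum1 True by simp
    then have vb: "v 0 = 1 \<or> v 0 = - 1" by (auto simp: zmult_eq_1_iff)
    define \<beta> where "\<beta> = endo (sperm id (\<lambda>x. x \<noteq> Suc 0 \<or> v 0 = 1))"
    have \<beta>: "\<beta> \<in> carrier A" unfolding \<beta>_def by (rule aut_sperm[OF permutes_id])
    have act\<beta>: "mat_act (ab \<beta>) u = (\<lambda>i. if i = 0 \<and> v 0 \<noteq> 1 then - u i else u i)" for u
    proof
      fix i show "mat_act (ab \<beta>) u i = (if i = 0 \<and> v 0 \<noteq> 1 then - u i else u i)"
        using sperm_signed(3)[OF permutes_id[of S], of "\<lambda>x. x \<noteq> Suc 0 \<or> v 0 = 1" u i] b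
        by (auto simp: act_def \<Psi>_def \<beta>_def split: if_splits)
    qed
    have "mat_act (ab \<beta>) (basis_vec b) = v"
      using vb v0 True by (auto simp: act\<beta> basis_vec_def fun_eq_iff)
    moreover have "\<beta> \<in> K" using \<beta> ab.hom_closed[OF \<beta>] True by (auto simp: K_def stab_def act\<beta> basis_vec_def fun_eq_iff)
    ultimately show ?thesis by blast
  qed
  then obtain \<beta> where \<beta>: "\<beta> \<in> K" "mat_act (ab \<beta>) (basis_vec b) = v" by blast
  have \<beta>s: "ab \<beta> \<in> stab n (Suc b)" and \<beta>A: "\<beta> \<in> carrier A" using \<beta>(1) by (simp_all add: K_def)
  have \<beta>c: "ab \<beta> \<in> carrier (GL_int n)" by (rule ab.hom_closed[OF \<beta>A])
  define R where "R = inv\<^bsub>GL_int n\<^esub> (ab \<beta>) \<otimes>\<^bsub>GL_int n\<^esub> M"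
  have Rs: "R \<in> stab n (Suc b)"
    unfolding R_def by (intro subgroup.m_closed[OF stab_subgroup] subgroup.m_inv_closed[OF stab_subgroup] \<beta>s M)
  then have Rc: "R \<in> carrier (GL_int n)" by (simp add: stab_def)
  have Rb: "mat_act R (basis_vec b) = basis_vec b"
    using GL_act_inv(1)[OF \<beta>c, of "basis_vec b"] Mc \<beta>c by (simp add: R_def GL_act_mult \<beta>(2) flip: v_def)
  define k where "k = (\<lambda>j. - R $$ (b, j))"
  have "rk.U_prod k m \<in> \<Psi> ` K" if "m \<le> b" for m
    using that
  proof (induction m)
    case 0
    then show ?case using subgroup.one_closed[OF \<Psi>K] by simp
  next
    case (Suc m)
    then have "E b m [^]\<^bsub>Q\<^esub> k m \<in> \<Psi> ` K" using E_K[of b m] Q.subgroup_int_pow_closed[OF \<Psi>K] by simp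
    then show ?case using Suc subgroup.m_closed[OF \<Psi>K] by simp
  qed
  then obtain \<gamma> where \<gamma>: "\<gamma> \<in> K" "rk.U_prod k b = \<Psi> \<gamma>" by blast
  have \<gamma>s: "ab \<gamma> \<in> stab n (Suc b)" and \<gamma>A: "\<gamma> \<in> carrier A" using \<gamma>(1) by (simp_all add: K_def)
  have \<gamma>c: "ab \<gamma> \<in> carrier (GL_int n)" by (rule ab.hom_closed[OF \<gamma>A])
  have act\<gamma>: "mat_act (ab \<gamma>) u = u(b := u b + (\<Sum>j<b. k j * u j))" for u
    using rk.U_prod_act[OF order_refl, of k u] by (simp add: \<gamma>(2) act_def \<Psi>_def)
  have Rrow: "mat_act R u b = u b + (\<Sum>j<b. R $$ (b, j) * u j)" for u
  proof -
    have Rm: "R \<in> carrier_mat n n" by (rule GL_carrier_mat[OF Rc])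
    have bb: "R $$ (b, b) = 1" using mat_act_basis[OF Rm b b, unfolded Rb] by (simp add: basis_vec_def)
    have "R $$ (b, j) = 0" if "b < j" "j < n" for j
    proof -
      have "mat_act R (basis_vec j) = basis_vec j" using Rs that(1) by (simp add: stab_def)
      from mat_act_basis[OF Rm b that(2), unfolded this] show ?thesis using that(1) by (simp add: basis_vec_def)
    qed
    then have "(\<Sum>j<n. R $$ (b, j) * u j) = (\<Sum>j<Suc b. R $$ (b, j) * u j)"
      using b by (intro sum.mono_neutral_right) auto
    then show ?thesis using Rm b bb by (simp add: mat_act_def)
  qed
  have prod: "R \<otimes>\<^bsub>GL_int n\<^esub> ab \<gamma> \<in> stab n (Suc b)" by (rule subgroup.m_closed[OF stab_subgroup Rs \<gamma>s])
  have "mat_act (R \<otimes>\<^bsub>GL_int n\<^esub> ab \<gamma>) u b = u b" for u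
    by (simp add: GL_act_mult[OF Rc \<gamma>c] Rrow act\<gamma> k_def sum_negf)
  moreover have "mat_act (ab \<gamma>) (basis_vec b) = basis_vec b" unfolding act\<gamma> by (auto simp: basis_vec_def fun_eq_iff)
  then have "mat_act (R \<otimes>\<^bsub>GL_int n\<^esub> ab \<gamma>) (basis_vec b) = basis_vec b"
    by (simp add: GL_act_mult[OF Rc \<gamma>c] Rb)
  ultimately have "R \<otimes>\<^bsub>GL_int n\<^esub> ab \<gamma> \<in> stab n b"
    using prod unfolding stab_def by (auto simp: le_eq_less_or_eq[of b])
  then have "R \<otimes>\<^bsub>GL_int n\<^esub> ab \<gamma> \<in> ab ` carrier A" using IH by blast
  then have "ab \<beta> \<otimes>\<^bsub>GL_int n\<^esub> (R \<otimes>\<^bsub>GL_int n\<^esub> ab \<gamma>) \<otimes>\<^bsub>GL_int n\<^esub> inv\<^bsub>GL_int n\<^esub> (ab \<gamma>) \<in> ab ` carrier A"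
    by (rule subgroup.m_closed[OF ab_image_subgroup subgroup.m_closed[OF ab_image_subgroup imageI[OF \<beta>A]]
        subgroup.m_inv_closed[OF ab_image_subgroup imageI[OF \<gamma>A]]])
  also have "ab \<beta> \<otimes>\<^bsub>GL_int n\<^esub> (R \<otimes>\<^bsub>GL_int n\<^esub> ab \<gamma>) \<otimes>\<^bsub>GL_int n\<^esub> inv\<^bsub>GL_int n\<^esub> (ab \<gamma>) = M"
    unfolding R_def using \<beta>c \<gamma>c Mc
    by (simp only: ab.H.m_assoc ab.H.inv_cancel_left ab.H.m_closed ab.H.inv_closed ab.H.r_inv ab.H.r_one)
  finally show ?thesis .
qed

lemma ab_surj: "ab ` carrier A = carrier (GL_int n)"
proof
  show "ab ` carrier A \<subseteq> carrier (GL_int n)" by (rule subgroup.subset[OF ab_image_subgroup])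
  have "m \<le> n \<Longrightarrow> stab n m \<subseteq> ab ` carrier A" for m
  proof (induction m)
    case 0
    show ?case
    proof
      fix M assume M: "M \<in> stab n 0"
      have "M = 1\<^sub>m n"
        using M by (intro GL_eqI[of _ n]) (auto simp: stab_def mat_act_one fun_eq_iff ab.H.one_closed[unfolded one_GL_int])
      then show "M \<in> ab ` carrier A" using ab_one A.one_closed by (metis imageI)
    qed
  next
    case (Suc b)
    then show ?case using stab_step[of b] by auto
  qed
  then show "carrier (GL_int n) \<subseteq> ab ` carrier A" using stab_full by blast
qed

end

section \<open>The induced homomorphism on matrices\<close>

context identified_hom
begin

text \<open>By \<open>ab_kernel\<close> any preimage under \<open>ab\<close> gives the same
  value.\<close>

definition \<psi> :: "int mat \<Rightarrow> 'g" where
  "\<psi> M = \<phi> (SOME \<alpha>. \<alpha> \<in> carrier A \<and> ab \<alpha> = M)"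

lemma \<psi>_ab:
  assumes \<alpha>: "\<alpha> \<in> carrier A"
  shows "\<psi> (ab \<alpha>) = \<phi> \<alpha>"
proof -
  define \<beta> where "\<beta> = (SOME \<beta>. \<beta> \<in> carrier A \<and> ab \<beta> = ab \<alpha>)"
  have \<beta>: "\<beta> \<in> carrier A" "ab \<beta> = ab \<alpha>"
    unfolding \<beta>_def using someI[of "\<lambda>\<beta>. \<beta> \<in> carrier A \<and> ab \<beta> = ab \<alpha>" \<alpha>] \<alpha> by simp_all
  have "ab (\<beta> \<otimes>\<^bsub>A\<^esub> inv\<^bsub>A\<^esub> \<alpha>) = ab \<alpha> \<otimes>\<^bsub>GL_int n\<^esub> inv\<^bsub>GL_int n\<^esub> (ab \<alpha>)"
    using \<alpha> \<beta> by (simp only: ab.hom_mult ab.hom_inv A.inv_closed)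
  also have "\<dots> = 1\<^sub>m n" using ab.H.r_inv[OF ab.hom_closed[OF \<alpha>]] by (simp only: one_GL_int)
  finally have "\<phi> (\<beta> \<otimes>\<^bsub>A\<^esub> inv\<^bsub>A\<^esub> \<alpha>) = \<one>" using \<alpha> \<beta> by (intro ab_kernel) simp_all
  then have "\<phi> \<beta> \<otimes> inv (\<phi> \<alpha>) = \<one>" using \<alpha> \<beta>(1) by simp
  then have "\<phi> \<beta> = \<phi> \<alpha>" using \<alpha> \<beta>(1) by (simp add: inv_solve_right')
  then show ?thesis by (simp only: \<psi>_def \<beta>_def)
qed

lemma \<psi>_image: "\<psi> ` carrier (GL_int n) = \<phi> ` carrier A"
  unfolding ab_surj[symmetric] image_image using \<psi>_ab by simp

lemma \<psi>_hom: "\<psi> \<in> hom (GL_int n) G"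
proof (rule homI)
  fix M assume M: "M \<in> carrier (GL_int n)"
  then obtain \<alpha> where \<alpha>: "\<alpha> \<in> carrier A" "M = ab \<alpha>" unfolding ab_surj[symmetric] by blast
  then show "\<psi> M \<in> carrier G" by (simp add: \<psi>_ab)
  fix N assume N: "N \<in> carrier (GL_int n)"
  then obtain \<beta> where \<beta>: "\<beta> \<in> carrier A" "N = ab \<beta>" unfolding ab_surj[symmetric] by blast
  have "\<psi> (ab (\<alpha> \<otimes>\<^bsub>A\<^esub> \<beta>)) = \<phi> \<alpha> \<otimes> \<phi> \<beta>" using \<alpha>(1) \<beta>(1) by (simp only: \<psi>_ab A.m_closed \<phi>.hom_mult)
  then show "\<psi> (M \<otimes>\<^bsub>GL_int n\<^esub> N) = \<psi> M \<otimes> \<psi> N"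
    using \<alpha> \<beta> by (simp only: \<psi>_ab ab.hom_mult)
qed

sublocale \<psi>: GL_hom n G \<psi>
  by (intro GL_hom.intro GL_hom_axioms.intro group_hom.intro group_hom_axioms.intro group_GL_int is_group \<psi>_hom n3)

text \<open>The images of the transvections generate a subgroup, finite by
  \<open>finite_image_elementary\<close>, which the finite group of images of signed permutations
  normalizes; by Nielsen's theorem the whole image is the product of the two.\<close>

lemma finite_image:
  assumes "\<psi>.triv M" "M \<notin> group_center (GL_int n)"
  shows "finite (\<phi> ` carrier A)"
proof -
  define K where "K = \<psi> ` \<psi>.elementary"
  have KE: "K = {\<phi> (endo (rho (Suc i) (Suc j) True)) |i j. i < n \<and> j < n \<and> i \<noteq> j}"
  proof -
    have "\<psi> (transvection n (basis_vec i) (basis_vec j)) = \<phi> (endo (rho (Suc i) (Suc j) True))"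
      if "i < n" "j < n" "i \<noteq> j" for i j
      using \<psi>_ab[OF aut_E(1)[of i j True]] that by (simp add: ab_rho(1))
    then show ?thesis unfolding K_def \<psi>.elementary_def by (auto intro!: image_eqI)
  qed
  have K: "K \<subseteq> carrier G" unfolding KE using aut_E(1) by auto
  let ?X = "generate G K" and ?Y = "\<phi> ` sperms"
  have "finite ?X"
    using \<psi>.finite_image_elementary[OF assms] unfolding K_def \<psi>.generate_img[OF \<psi>.elementary_closed] .
  then have fin: "finite ((\<lambda>(x, y). x \<otimes> y) ` (?X \<times> ?Y))"
    by (intro finite_imageI finite_cartesian_product finite_sperms)
  have X: "subgroup ?X G" by (rule generate_is_subgroup[OF K])
  have Y: "subgroup ?Y G" by (rule \<phi>.subgroup_img_is_subgroup[OF sperms_subgroup])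
  have Xc: "x \<in> carrier G" if "x \<in> ?X" for x using subgroup.mem_carrier[OF X that] .
  have Yc: "y \<in> carrier G" if "y \<in> ?Y" for y using subgroup.mem_carrier[OF Y that] .
  have rho_X: "\<phi> (endo (rho i j t)) \<in> ?X" "\<phi> (endo (lam i j t)) \<in> ?X" if ij: "i \<in> S" "j \<in> S" "i \<noteq> j" for i j t
  proof -
    obtain a b where ab: "i = Suc a" "j = Suc b" "a < n" "b < n" using ij unfolding Suc_S(2) by blast
    have "\<phi> (endo (rho i j True)) \<in> K" unfolding KE using ab ij(3) by blast
    then have X1: "\<phi> (endo (rho i j True)) \<in> ?X" by (rule generate.incl)
    then have X2: "inv (\<phi> (endo (rho i j True))) \<in> ?X" by (rule subgroup.m_inv_closed[OF X])
    have c: "endo (rho i j True) \<in> carrier A" "endo (lam i j True) \<in> carrier A" using ij by (simp_all add: aut_rho aut_lam)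
    have F: "\<phi> (endo (rho i j False)) = inv (\<phi> (endo (rho i j True)))" "\<phi> (endo (lam i j False)) = inv (\<phi> (endo (rho i j True)))"
      unfolding transvection_inverse[OF ij, symmetric] \<phi>.hom_inv[OF c(1)] \<phi>.hom_inv[OF c(2)] rho_lam[OF ij] by (rule refl)+
    show "\<phi> (endo (rho i j t)) \<in> ?X" "\<phi> (endo (lam i j t)) \<in> ?X"
      using X1 X2 F rho_lam[OF ij] by (cases t; simp)+
  qed
  have conj: "y \<otimes> x \<otimes> inv y \<in> ?X" if y: "y \<in> ?Y" and x: "x \<in> ?X" for x y
  proof (rule conj_generate[OF K Yc[OF y] _ x])
    obtain \<sigma> s where \<sigma>: "\<sigma> permutes S" "y = \<phi> (endo (sperm \<sigma> s))" using y by (auto simp: sperms_def)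
    note w = aut_sperm[OF \<sigma>(1), of s]
    fix h assume "h \<in> K"
    then obtain a b where ab: "a < n" "b < n" "a \<noteq> b" "h = \<phi> (endo (rho (Suc a) (Suc b) True))" unfolding KE by blast
    have ij: "Suc a \<in> S" "Suc b \<in> S" "Suc a \<noteq> Suc b" using ab by (simp_all add: Suc_S(1))
    have \<sigma>ij: "\<sigma> (Suc a) \<in> S" "\<sigma> (Suc b) \<in> S" "\<sigma> (Suc a) \<noteq> \<sigma> (Suc b)"
      using permutes_in_image[OF \<sigma>(1), of "Suc a"] permutes_in_image[OF \<sigma>(1), of "Suc b"] permutes_inj[OF \<sigma>(1)] ij
      by (simp_all add: inj_eq)
    let ?h = "if s (\<sigma> (Suc b)) then rho (\<sigma> (Suc a)) (\<sigma> (Suc b)) (s (\<sigma> (Suc a))) else lam (\<sigma> (Suc a)) (\<sigma> (Suc b)) (\<not> s (\<sigma> (Suc a)))"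
    have h: "endo ?h \<in> carrier A" "\<phi> (endo ?h) \<in> ?X" using \<sigma>ij rho_X by (simp_all add: aut_rho aut_lam)
    have "y \<otimes> h = \<phi> (endo ?h) \<otimes> y"
      unfolding \<sigma>(2) ab(4) using sperm_conj_rho[OF \<sigma>(1) ij, of s] \<phi>.hom_mult[OF w aut_E(1)[OF ab(1,3)]] \<phi>.hom_mult[OF h(1) w]
      by metis
    then have "y \<otimes> h \<otimes> inv y = \<phi> (endo ?h)"
      using Yc[OF y] \<phi>.hom_closed[OF h(1)] by (simp only: m_assoc r_inv inv_closed r_one)
    then show "y \<otimes> h \<otimes> inv y \<in> ?X" using h(2) by simp
  qed
  have gen: "\<phi> h \<in> ?X \<or> \<phi> h \<in> ?Y" if "h \<in> nielsen_gens" for h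
    using that rho_X(1) unfolding nielsen_gens_def sperms_def by blast
  have dec: "\<exists>x\<in>?X. \<exists>y\<in>?Y. g = x \<otimes> y" if "g \<in> ?X \<or> g \<in> ?Y" for g
    using that Xc Yc subgroup.one_closed[OF X] subgroup.one_closed[OF Y] by (metis l_one r_one)
  have "\<exists>x\<in>?X. \<exists>y\<in>?Y. \<phi> \<alpha> = x \<otimes> y" if "\<alpha> \<in> generate A nielsen_gens" for \<alpha>
    using that
  proof (induction rule: generate.induct)
    case one
    show ?case by (rule dec) (simp add: subgroup.one_closed[OF X])
  next
    case (incl h)
    show ?case by (rule dec[OF gen[OF incl]])
  next
    case (inv h)
    have "h \<in> carrier A" using inv nielsen_gens_closed by blast
    then show ?case
      using gen[OF inv] subgroup.m_inv_closed[OF X] subgroup.m_inv_closed[OF Y] by (intro dec) (auto simp only: \<phi>.hom_inv)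
  next
    case (eng h k)
    obtain x y x' y' where xy: "x \<in> ?X" "y \<in> ?Y" "\<phi> h = x \<otimes> y" "x' \<in> ?X" "y' \<in> ?Y" "\<phi> k = x' \<otimes> y'"
      using eng.IH by blast
    have hk: "h \<in> carrier A" "k \<in> carrier A" using eng A.generate_in_carrier[OF nielsen_gens_closed] by blast+
    have "\<phi> (h \<otimes>\<^bsub>A\<^esub> k) = x \<otimes> (y \<otimes> x' \<otimes> inv y) \<otimes> (y \<otimes> y')"
      using Xc[OF xy(1)] Yc[OF xy(2)] Xc[OF xy(4)] Yc[OF xy(5)] by (simp add: \<phi>.hom_mult[OF hk] xy(3,6) m_assoc inv_cancel_left)
    moreover have "x \<otimes> (y \<otimes> x' \<otimes> inv y) \<in> ?X" by (intro subgroup.m_closed[OF X] xy conj)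
    moreover have "y \<otimes> y' \<in> ?Y" by (intro subgroup.m_closed[OF Y] xy)
    ultimately show ?case by blast
  qed
  then have "\<phi> ` carrier A \<subseteq> (\<lambda>(x, y). x \<otimes> y) ` (?X \<times> ?Y)" using nielsen by fastforce
  then show ?thesis using fin by (rule finite_subset)
qed

text \<open>The diagonal matrix with exactly two entries \<open>- 1\<close> lies in the kernel; as
  \<open>n \<ge> 3\<close> it has an entry 1 as well and is not central.\<close>

lemma finite_image_of_signs:
  assumes eq: "\<And>i j. \<lbrakk>i \<in> S; j \<in> S; i \<noteq> j\<rbrakk> \<Longrightarrow> \<phi> (endo (sperm id (\<lambda>x. x \<noteq> i \<and> x \<noteq> j))) = \<one>"
  shows "finite (\<phi> ` carrier A)"
proof -
  define \<alpha> where "\<alpha> = endo (sperm id (\<lambda>x. x \<noteq> Suc 0 \<and> x \<noteq> Suc (Suc 0)))"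
  have \<alpha>: "\<alpha> \<in> carrier A" unfolding \<alpha>_def by (rule aut_sperm[OF permutes_id])
  have "\<phi> \<alpha> = \<one>" unfolding \<alpha>_def using n3 by (intro eq) (simp_all add: Suc_S(1))
  then have triv: "\<psi>.triv (ab \<alpha>)" using \<alpha> by (simp add: \<psi>.triv_def \<psi>_ab)
  have entry: "ab \<alpha> $$ (i, i) = (if i \<le> 1 then - 1 else 1)" if "i < n" for i
  proof -
    have "Suc i \<in> S" using that by (simp add: Suc_S(1))
    then have "\<alpha> [(Suc i, True)] = [(Suc i, Suc i \<noteq> Suc 0 \<and> Suc i \<noteq> Suc (Suc 0))]"
      unfolding \<alpha>_def using endo_gen[OF maps_elementary(3)[OF permutes_id]] by (simp add: sperm_def)
    then show ?thesis using that by (auto simp: ab_def exponent_sum_Cons)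
  qed
  have "ab \<alpha> \<noteq> 1\<^sub>m n" using entry[of 0] n3 by auto
  moreover have "ab \<alpha> \<noteq> - 1\<^sub>m n" using entry[of 2] n3 by auto
  ultimately have "ab \<alpha> \<notin> group_center (GL_int n)" by (simp add: group_center_GL_int)
  then show ?thesis by (rule finite_image[OF triv])
qed

lemma PGL_image:
  assumes inf: "infinite (\<phi> ` carrier A)" and \<Delta>: "\<phi> (endo (sperm id (\<lambda>x. False))) = \<one>"
  shows "G\<lparr>carrier := \<phi> ` carrier A\<rparr> \<cong> PGL_int n"
proof -
  define \<alpha> where "\<alpha> = endo (sperm id (\<lambda>x. False))"
  have \<alpha>: "\<alpha> \<in> carrier A" unfolding \<alpha>_def by (rule aut_sperm[OF permutes_id])
  have "ab \<alpha> = - 1\<^sub>m n"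
  proof (rule eq_matI)
    fix i j assume "i < dim_row (- 1\<^sub>m n :: int mat)" "j < dim_col (- 1\<^sub>m n :: int mat)"
    then have ij: "i < n" "j < n" by simp_all
    then have "Suc j \<in> S" by (simp add: Suc_S(1))
    then have "\<alpha> [(Suc j, True)] = [(Suc j, False)]"
      unfolding \<alpha>_def using endo_gen[OF maps_elementary(3)[OF permutes_id]] by (simp add: sperm_def)
    then show "ab \<alpha> $$ (i, j) = (- 1\<^sub>m n) $$ (i, j)" using ij by (auto simp: ab_def exponent_sum_Cons)
  qed (simp_all add: ab_def)
  then have "\<psi> (- 1\<^sub>m n) = \<one>" using \<psi>_ab[OF \<alpha>] \<Delta> by (simp add: \<alpha>_def)
  moreover have "\<psi> (1\<^sub>m n) = \<one>" using \<psi>.hom_one by (simp only: one_GL_int)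
  moreover have gc: "group_center (GL_int n) \<subseteq> carrier (GL_int n)" by (auto simp: group_center_def)
  ultimately have "group_center (GL_int n) \<subseteq> kernel (GL_int n) G \<psi>"
    using gc unfolding group_center_GL_int by (auto simp: kernel_def)
  moreover have "kernel (GL_int n) G \<psi> \<subseteq> group_center (GL_int n)"
    using finite_image inf by (auto simp: kernel_def \<psi>.triv_def)
  ultimately have ker: "kernel (GL_int n) G \<psi> = group_center (GL_int n)" by blast
  let ?I = "G\<lparr>carrier := \<phi> ` carrier A\<rparr>"
  have "group ?I" by (rule subgroup.subgroup_is_group[OF \<phi>.img_is_subgroup is_group])
  moreover have "\<psi> \<in> hom (GL_int n) ?I" using \<psi>_hom \<psi>_image by (auto simp: hom_def)
  ultimately interpret I: group_hom "GL_int n" ?I \<psi>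
    by (intro group_hom.intro group_hom_axioms.intro group_GL_int)
  have "kernel (GL_int n) ?I \<psi> = kernel (GL_int n) G \<psi>" by (simp add: kernel_def)
  then have "PGL_int n \<cong> ?I" using I.FactGroup_iso \<psi>_image by (simp add: ker PGL_int_def)
  moreover have "group (PGL_int n)" by (rule group_PGL_int)
  ultimately show ?thesis using group.iso_sym by blast
qed

end

section \<open>Noninjectivity on signed permutations\<close>

locale aut_hom = free_group_n S n + group G for S n and G (structure) +
  fixes \<phi> :: "(nat letter list \<Rightarrow> nat letter list) \<Rightarrow> 'g"
  assumes \<phi>: "\<phi> \<in> hom A G" and n3: "3 \<le> n"
begin

sublocale \<phi>: group_hom A G \<phi>
  by (intro group_hom.intro group_hom_axioms.intro A.is_group is_group \<phi>)

text \<open>A sign change that inverts both \<open>i\<close> and \<open>j\<close> conjugates the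
  right transvection into the left one, by \<open>sperm_conj_rho\<close>; inverting \<open>j\<close>
  alone would also invert the factor.\<close>

lemma identified_homI:
  assumes "\<And>i j. \<lbrakk>i \<in> S; j \<in> S; i \<noteq> j\<rbrakk> \<Longrightarrow> \<exists>s. \<phi> (endo (sperm id s)) = \<one> \<and> \<not> s i \<and> \<not> s j"
  shows "identified_hom S n G \<phi>"
proof unfold_locales
  fix i j assume ij: "i \<in> S" "j \<in> S" "i \<noteq> j"
  obtain s where s: "\<phi> (endo (sperm id s)) = \<one>" "\<not> s i" "\<not> s j" using assms[OF ij] by blast
  have w: "endo (sperm id s) \<in> carrier A" by (rule aut_sperm[OF permutes_id])
  have c: "endo (rho i j True) \<in> carrier A" "endo (lam i j True) \<in> carrier A" using ij by (simp_all add: aut_rho aut_lam)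
  have "endo (sperm id s) \<otimes>\<^bsub>A\<^esub> endo (rho i j True) = endo (lam i j True) \<otimes>\<^bsub>A\<^esub> endo (sperm id s)"
    using sperm_conj_rho[OF permutes_id ij, of s] s(2,3) by simp
  then have "\<phi> (endo (sperm id s)) \<otimes> \<phi> (endo (rho i j True)) = \<phi> (endo (lam i j True)) \<otimes> \<phi> (endo (sperm id s))"
    using \<phi>.hom_mult[OF w c(1)] \<phi>.hom_mult[OF c(2) w] by metis
  then show "\<phi> (endo (rho i j True)) = \<phi> (endo (lam i j True))"
    using \<phi>.hom_closed[OF c(1)] \<phi>.hom_closed[OF c(2)] by (simp only: s(1) l_one r_one)
qed (rule \<phi>, rule n3)

abbreviation \<epsilon> where "\<epsilon> i \<equiv> endo (sperm id (\<lambda>x. x \<noteq> i))"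

lemma \<epsilon>_closed: "\<epsilon> i \<in> carrier A"
  by (rule aut_sperm[OF permutes_id])

lemma \<epsilon>_square: "\<epsilon> i \<otimes>\<^bsub>A\<^esub> \<epsilon> i = \<one>\<^bsub>A\<^esub>"
  unfolding sperm_mult[OF permutes_id permutes_id] using sperm_one by simp

lemma \<epsilon>_mult: "i \<noteq> j \<Longrightarrow> \<epsilon> i \<otimes>\<^bsub>A\<^esub> \<epsilon> j = endo (sperm id (\<lambda>x. x \<noteq> i \<and> x \<noteq> j))"
proof -
  assume ij: "i \<noteq> j"
  show "\<epsilon> i \<otimes>\<^bsub>A\<^esub> \<epsilon> j = endo (sperm id (\<lambda>x. x \<noteq> i \<and> x \<noteq> j))"
    unfolding sperm_mult[OF permutes_id permutes_id] id_o
    by (rule sperm_cong[OF permutes_id]) (use ij in auto)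
qed

lemma sperm_\<epsilon>:
  assumes \<sigma>: "\<sigma> permutes S"
  shows "endo (sperm \<sigma> s) \<otimes>\<^bsub>A\<^esub> \<epsilon> i = \<epsilon> (\<sigma> i) \<otimes>\<^bsub>A\<^esub> endo (sperm \<sigma> s)"
proof -
  have "inv_into UNIV \<sigma> y = i \<longleftrightarrow> y = \<sigma> i" for y using permutes_inverses[OF \<sigma>] by metis
  then show ?thesis
    unfolding sperm_mult[OF \<sigma> permutes_id] sperm_mult[OF permutes_id \<sigma>] id_o o_id
    by (intro sperm_cong[OF \<sigma>]) auto
qed

lemma \<phi>_\<epsilon>_conj:
  assumes \<sigma>: "\<sigma> permutes S"
  shows "\<phi> (\<epsilon> (\<sigma> i)) = \<phi> (endo (sperm \<sigma> s)) \<otimes> \<phi> (\<epsilon> i) \<otimes> inv (\<phi> (endo (sperm \<sigma> s)))"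
proof -
  note w = aut_sperm[OF \<sigma>, of s]
  have "\<phi> (endo (sperm \<sigma> s)) \<otimes> \<phi> (\<epsilon> i) = \<phi> (\<epsilon> (\<sigma> i)) \<otimes> \<phi> (endo (sperm \<sigma> s))"
    using \<phi>.hom_mult[OF w \<epsilon>_closed] \<phi>.hom_mult[OF \<epsilon>_closed w] sperm_\<epsilon>[OF \<sigma>] by metis
  then show ?thesis
    using \<phi>.hom_closed[OF w] \<phi>.hom_closed[OF \<epsilon>_closed] by (simp only: m_assoc r_inv inv_closed r_one)
qed

text \<open>The symmetric group is doubly transitive, so one coincidence between sign changes
  spreads to all pairs, and each \<open>\<epsilon> a\<close> is an involution.\<close>

lemma signs_identified:
  assumes ik: "i \<in> S" "k \<in> S" "i \<noteq> k" and eq: "\<phi> (\<epsilon> i) = \<phi> (\<epsilon> k)"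
    and ab: "a \<in> S" "b \<in> S" "a \<noteq> b"
  shows "\<phi> (endo (sperm id (\<lambda>x. x \<noteq> a \<and> x \<noteq> b))) = \<one>"
proof -
  \<comment> \<open>The place to which \<open>k\<close> goes when \<open>i\<close> and
    \<open>a\<close> are exchanged; a second transposition brings it to \<open>b\<close> without
    moving \<open>a\<close>.\<close>
  define c where "c = transpose i a k"
  have c: "c \<in> S" "c \<noteq> a" using ik ab by (auto simp: c_def transpose_def)
  define \<tau> where "\<tau> = transpose c b \<circ> transpose i a"
  have \<tau>: "\<tau> permutes S" unfolding \<tau>_def using c ik ab by (intro permutes_compose permutes_swap_id)
  have "\<tau> i = a" "\<tau> k = b" using not_sym[OF c(2)] ab(3)
    by (simp_all add: \<tau>_def transpose_apply_other flip: c_def)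
  then have "\<phi> (\<epsilon> a) = \<phi> (\<epsilon> b)" using \<phi>_\<epsilon>_conj[OF \<tau>, of i] \<phi>_\<epsilon>_conj[OF \<tau>, of k] eq by metis
  moreover have "\<phi> (\<epsilon> b) \<otimes> \<phi> (\<epsilon> b) = \<one>"
    using \<phi>.hom_mult[OF \<epsilon>_closed \<epsilon>_closed, of b b] by (simp only: \<epsilon>_square \<phi>.hom_one)
  ultimately show ?thesis
    using \<phi>.hom_mult[OF \<epsilon>_closed \<epsilon>_closed, of a b] by (simp only: \<epsilon>_mult[OF ab(3)])
qed

text \<open>If the permutation moves \<open>i\<close>, conjugation by \<open>w\<close> identifies
  two sign changes. Otherwise \<open>w\<close> inverts either all generators or some but not all; in
  the latter case multiplying \<open>w\<close> by its conjugate under a transposition leaves just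
  two sign changes.\<close>

lemma kernel_sperm:
  assumes w: "w \<in> sperms" "w \<noteq> \<one>\<^bsub>A\<^esub>" "\<phi> w = \<one>"
  shows "\<phi> (endo (sperm id (\<lambda>x. False))) = \<one>
    \<or> (\<forall>i\<in>S. \<forall>j\<in>S. i \<noteq> j \<longrightarrow> \<phi> (endo (sperm id (\<lambda>x. x \<noteq> i \<and> x \<noteq> j))) = \<one>)"
proof -
  obtain \<sigma> s where \<sigma>: "\<sigma> permutes S" and w_eq: "w = endo (sperm \<sigma> s)" using w(1) by (auto simp: sperms_def)
  have goal: ?thesis if "i \<in> S" "k \<in> S" "i \<noteq> k" "\<phi> (\<epsilon> i) = \<phi> (\<epsilon> k)" for i k
    using signs_identified[OF that] by blast
  show ?thesis
  proof (cases "\<sigma> = id")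
    case False
    then obtain i where i: "\<sigma> i \<noteq> i" by (metis id_apply ext)
    then have "i \<in> S" "\<sigma> i \<in> S" using permutes_not_in[OF \<sigma>] permutes_in_image[OF \<sigma>, of i] by blast+
    moreover have "\<phi> (\<epsilon> (\<sigma> i)) = \<phi> (\<epsilon> i)"
      using \<phi>_\<epsilon>_conj[OF \<sigma>, of i s] \<phi>.hom_closed[OF \<epsilon>_closed] by (simp add: w(3)[unfolded w_eq])
    ultimately show ?thesis using goal[of "\<sigma> i" i] i by blast
  next
    case True
    have "\<not> (\<forall>x\<in>S. s x)"
    proof
      assume "\<forall>x\<in>S. s x"
      then have "w = \<one>\<^bsub>A\<^esub>" unfolding w_eq True sperm_one[symmetric] by (intro sperm_cong[OF permutes_id]) simp
      then show False using w(2) by simp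
    qed
    then obtain i where i: "i \<in> S" "\<not> s i" by blast
    show ?thesis
    proof (cases "\<exists>j\<in>S. s j")
      case False
      then have "w = endo (sperm id (\<lambda>x. False))" unfolding w_eq True by (intro sperm_cong[OF permutes_id]) simp
      then show ?thesis using w(3) by simp
    next
      case True': True
      then obtain j where j: "j \<in> S" "s j" by blast
      let ?t = "transpose i j"
      let ?T = "endo (sperm ?t (\<lambda>_. True))" and ?w = "endo (sperm id (\<lambda>y. s (?t y)))"
      have t: "?t permutes S" using i j by (intro permutes_swap_id)
      have wc: "w \<in> carrier A" "?w \<in> carrier A" "?T \<in> carrier A"
        unfolding w_eq using aut_sperm[OF \<sigma>] aut_sperm[OF permutes_id] aut_sperm[OF t] by blast+
      have "?T \<otimes>\<^bsub>A\<^esub> w = ?w \<otimes>\<^bsub>A\<^esub> ?T"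
        unfolding w_eq True sperm_mult[OF t permutes_id] sperm_mult[OF permutes_id t] by simp
      then have "\<phi> ?T \<otimes> \<phi> w = \<phi> ?w \<otimes> \<phi> ?T" using wc by (simp flip: \<phi>.hom_mult)
      then have "\<phi> ?w = \<one>" using wc \<phi>.hom_closed w(3) by (simp add: l_cancel_one' r_cancel_one' l_cancel_one r_cancel_one)
      have ij: "i \<noteq> j" using i j by blast
      have "w \<otimes>\<^bsub>A\<^esub> ?w = \<epsilon> i \<otimes>\<^bsub>A\<^esub> \<epsilon> j"
        unfolding w_eq True sperm_mult[OF permutes_id permutes_id] \<epsilon>_mult[OF ij] id_o
        by (rule sperm_cong[OF permutes_id]) (use i j in \<open>auto simp: transpose_def\<close>)
      then have "\<phi> (\<epsilon> i) \<otimes> \<phi> (\<epsilon> j) = \<one>"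
        using \<phi>.hom_mult[OF wc(1,2)] \<phi>.hom_mult[OF \<epsilon>_closed \<epsilon>_closed, of i j] w(3) \<open>\<phi> ?w = \<one>\<close> by simp
      moreover have "\<phi> (\<epsilon> j) \<otimes> \<phi> (\<epsilon> j) = \<one>"
        using \<phi>.hom_mult[OF \<epsilon>_closed \<epsilon>_closed, of j j] by (simp only: \<epsilon>_square \<phi>.hom_one)
      ultimately have "\<phi> (\<epsilon> i) = \<phi> (\<epsilon> j)" using \<phi>.hom_closed[OF \<epsilon>_closed] right_cancel by metis
      then show ?thesis using goal[OF i(1) j(1) ij] by blast
    qed
  qed
qed

text \<open>The residue 0 encodes the sign plus. As the signs of \<open>sperm\<close> are indexed by
  the image, the map from \<open>W_group\<close> is multiplicative without a twist.\<close>

lemma W_group_embedding: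
  assumes inj: "inj_on \<phi> sperms"
  shows "G\<lparr>carrier := \<phi> ` sperms\<rparr> \<cong> W_group n"
proof -
  define \<iota> where "\<iota> = (\<lambda>(v :: nat \<Rightarrow> int, \<sigma>). endo (sperm \<sigma> (\<lambda>y. v y = 0)))"
  have WC: "carrier (W_group n) = (S \<rightarrow>\<^sub>E {0..<2}) \<times> {\<sigma>. \<sigma> permutes S}"
    by (simp add: W_group_def semidirect_product_def sym_group_def carrier_integer_mod_group S_eq)
  have WM: "(v, \<sigma>) \<otimes>\<^bsub>W_group n\<^esub> (u, \<tau>) = (\<lambda>i\<in>S. (v i + u (inv_into UNIV \<sigma> i)) mod 2, \<sigma> \<circ> \<tau>)"
    if "u \<in> S \<rightarrow>\<^sub>E {0..<2}" for v \<sigma> u \<tau>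
    using that by (auto simp: W_group_def semidirect_product_def sym_group_def perm_action_def S_eq carrier_integer_mod_group
      mult_integer_mod_group fun_eq_iff restrict_def)
  have val: "v y \<in> {0, 1}" if "v \<in> S \<rightarrow>\<^sub>E {0..<2}" "y \<in> S" for v :: "nat \<Rightarrow> int" and y
    using PiE_mem[OF that] by auto
  have "\<iota> \<in> hom (W_group n) A"
  proof (rule homI)
    fix x assume x: "x \<in> carrier (W_group n)"
    obtain v \<sigma> where x_eq: "x = (v, \<sigma>)" by (cases x)
    have \<sigma>: "v \<in> S \<rightarrow>\<^sub>E {0..<2}" "\<sigma> permutes S" using x by (simp_all add: WC x_eq)
    show "\<iota> x \<in> carrier A" using aut_sperm[OF \<sigma>(2)] by (simp add: \<iota>_def x_eq)
    fix y assume y: "y \<in> carrier (W_group n)"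
    obtain u \<tau> where y_eq: "y = (u, \<tau>)" by (cases y)
    have \<tau>: "u \<in> S \<rightarrow>\<^sub>E {0..<2}" "\<tau> permutes S" using y by (simp_all add: WC y_eq)
    have c: "\<sigma> \<circ> \<tau> permutes S" by (rule permutes_compose[OF \<tau>(2) \<sigma>(2)])
    have "\<iota> (x \<otimes>\<^bsub>W_group n\<^esub> y) = endo (sperm (\<sigma> \<circ> \<tau>) (\<lambda>i. (\<lambda>i\<in>S. (v i + u (inv_into UNIV \<sigma> i)) mod 2) i = 0))"
      by (simp only: x_eq y_eq WM[OF \<tau>(1)] \<iota>_def prod.case)
    also have "\<dots> = endo (sperm (\<sigma> \<circ> \<tau>) (\<lambda>i. (v i = 0) = (u (inv_into UNIV \<sigma> i) = 0)))"
    proof (rule sperm_cong[OF c])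
      fix i assume i: "i \<in> S"
      then have i': "inv_into UNIV \<sigma> i \<in> S" using permutes_in_image[OF permutes_inv[OF \<sigma>(2)], of i] by simp
      show "((\<lambda>i\<in>S. (v i + u (inv_into UNIV \<sigma> i)) mod 2) i = 0) = ((v i = 0) = (u (inv_into UNIV \<sigma> i) = 0))"
        using val[OF \<sigma>(1) i] val[OF \<tau>(1) i'] i by auto
    qed
    also have "\<dots> = \<iota> x \<otimes>\<^bsub>A\<^esub> \<iota> y" by (simp only: x_eq y_eq \<iota>_def prod.case sperm_mult[OF \<sigma>(2) \<tau>(2)])
    finally show "\<iota> (x \<otimes>\<^bsub>W_group n\<^esub> y) = \<iota> x \<otimes>\<^bsub>A\<^esub> \<iota> y" .
  qed
  moreover have img: "\<iota> ` carrier (W_group n) = sperms"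
  proof
    show "\<iota> ` carrier (W_group n) \<subseteq> sperms" by (auto simp: WC \<iota>_def sperms_def)
    show "sperms \<subseteq> \<iota> ` carrier (W_group n)"
    proof
      fix w assume "w \<in> sperms"
      then obtain \<sigma> s where \<sigma>: "\<sigma> permutes S" "w = endo (sperm \<sigma> s)" by (auto simp: sperms_def)
      let ?v = "\<lambda>i\<in>S. if s i then 0 else 1 :: int"
      have "w = endo (sperm \<sigma> (\<lambda>y. ?v y = 0))" unfolding \<sigma>(2) by (rule sperm_cong[OF \<sigma>(1)]) simp
      then show "w \<in> \<iota> ` carrier (W_group n)"
        using \<sigma>(1) by (intro image_eqI[of _ _ "(?v, \<sigma>)"]) (auto simp: WC \<iota>_def)
    qed
  qed
  moreover have "inj_on \<iota> (carrier (W_group n))"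
  proof (rule inj_onI)
    fix x y assume x: "x \<in> carrier (W_group n)" and y: "y \<in> carrier (W_group n)" and eq: "\<iota> x = \<iota> y"
    obtain v \<sigma> where x_eq: "x = (v, \<sigma>)" by (cases x)
    obtain u \<tau> where y_eq: "y = (u, \<tau>)" by (cases y)
    have \<sigma>: "v \<in> S \<rightarrow>\<^sub>E {0..<2}" "\<sigma> permutes S" and \<tau>: "u \<in> S \<rightarrow>\<^sub>E {0..<2}" "\<tau> permutes S"
      using x y by (simp_all add: WC x_eq y_eq)
    have *: "\<sigma> i = \<tau> i" "(v (\<sigma> i) = 0) = (u (\<tau> i) = 0)" if "i \<in> S" for i
    proof -
      have "endo (sperm \<sigma> (\<lambda>y. v y = 0)) [(i, True)] = endo (sperm \<tau> (\<lambda>y. u y = 0)) [(i, True)]"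
        using eq by (simp only: \<iota>_def x_eq y_eq prod.case)
      then show "\<sigma> i = \<tau> i" "(v (\<sigma> i) = 0) = (u (\<tau> i) = 0)"
        unfolding endo_gen[OF maps_elementary(3)[OF \<sigma>(2)] that] endo_gen[OF maps_elementary(3)[OF \<tau>(2)] that]
        by (auto simp: sperm_def)
    qed
    have st: "\<sigma> = \<tau>" using *(1) permutes_not_in[OF \<sigma>(2)] permutes_not_in[OF \<tau>(2)] by fastforce
    have "v = u"
    proof (rule PiE_ext[OF \<sigma>(1) \<tau>(1)])
      fix i assume i: "i \<in> S"
      then obtain k where "k \<in> S" "i = \<sigma> k" using permutes_image[OF \<sigma>(2)] by blast
      then show "v i = u i" using *(2)[of k] val[OF \<sigma>(1) i] val[OF \<tau>(1) i] st by auto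
    qed
    then show "x = y" by (simp add: x_eq y_eq st)
  qed
  ultimately have bij: "bij_betw \<iota> (carrier (W_group n)) sperms" and hom: "\<iota> \<in> hom (W_group n) A"
    by (simp_all add: bij_betw_def)
  have "bij_betw (\<phi> \<circ> \<iota>) (carrier (W_group n)) (\<phi> ` sperms)"
    by (rule bij_betw_trans[OF bij]) (simp add: bij_betw_def inj)
  moreover have "\<phi> \<circ> \<iota> \<in> hom (W_group n) (G\<lparr>carrier := \<phi> ` sperms\<rparr>)"
  proof (rule homI)
    fix x assume x: "x \<in> carrier (W_group n)"
    then show "(\<phi> \<circ> \<iota>) x \<in> carrier (G\<lparr>carrier := \<phi> ` sperms\<rparr>)" using img by auto
    fix y assume y: "y \<in> carrier (W_group n)"
    have "\<iota> x \<in> carrier A" "\<iota> y \<in> carrier A" using hom x y by (auto simp: hom_def)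
    then show "(\<phi> \<circ> \<iota>) (x \<otimes>\<^bsub>W_group n\<^esub> y)
      = (\<phi> \<circ> \<iota>) x \<otimes>\<^bsub>G\<lparr>carrier := \<phi> ` sperms\<rparr>\<^esub> (\<phi> \<circ> \<iota>) y"
      using hom_mult[OF hom x y] by (simp add: \<phi>.hom_mult)
  qed
  ultimately have "\<phi> \<circ> \<iota> \<in> iso (W_group n) (G\<lparr>carrier := \<phi> ` sperms\<rparr>)"
    by (intro isoI) simp_all
  then show ?thesis using group.iso_sym[OF group_W_group] is_isoI by blast
qed

theorem image_PGL_or_finite:
  assumes "\<not> (\<exists>H. subgroup H G \<and> G\<lparr>carrier := H\<rparr> \<cong> W_group n)"
  shows "G\<lparr>carrier := \<phi> ` carrier A\<rparr> \<cong> PGL_int n \<or> finite (\<phi> ` carrier A)"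
proof -
  have "\<not> inj_on \<phi> sperms"
    using assms W_group_embedding \<phi>.subgroup_img_is_subgroup[OF sperms_subgroup] by blast
  then obtain a b where ab: "a \<in> sperms" "b \<in> sperms" "\<phi> a = \<phi> b" "a \<noteq> b" by (auto simp: inj_on_def)
  have c: "a \<in> carrier A" "b \<in> carrier A" using ab subgroup.mem_carrier[OF sperms_subgroup] by blast+
  let ?w = "a \<otimes>\<^bsub>A\<^esub> inv\<^bsub>A\<^esub> b"
  have "?w \<in> sperms" using ab by (intro subgroup.m_closed[OF sperms_subgroup] subgroup.m_inv_closed[OF sperms_subgroup])
  moreover have "?w \<noteq> \<one>\<^bsub>A\<^esub>" using c ab(4) A.inv_equality[of a "inv\<^bsub>A\<^esub> b"] A.inv_solve_right'[OF A.one_closed c] by auto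
  moreover have "\<phi> ?w = \<one>" using c ab(3) by simp
  ultimately consider "\<phi> (endo (sperm id (\<lambda>x. False))) = \<one>"
    | "\<And>i j. \<lbrakk>i \<in> S; j \<in> S; i \<noteq> j\<rbrakk> \<Longrightarrow> \<phi> (endo (sperm id (\<lambda>x. x \<noteq> i \<and> x \<noteq> j))) = \<one>"
    using kernel_sperm by blast
  then show ?thesis
  proof cases
    case 1
    interpret identified_hom S n G \<phi> by (rule identified_homI) (use 1 in blast)
    show ?thesis using PGL_image 1 by blast
  next
    case 2
    interpret identified_hom S n G \<phi>
    proof (rule identified_homI)
      fix i j assume "i \<in> S" "j \<in> S" "i \<noteq> j"
      from 2[OF this] show "\<exists>s. \<phi> (endo (sperm id s)) = \<one> \<and> \<not> s i \<and> \<not> s j" by (intro exI conjI) auto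
    qed
    show ?thesis using finite_image_of_signs 2 by blast
  qed
qed

end

theorem propositionC:
  fixes n :: nat
    and G :: "('g, 'm) monoid_scheme"
    and \<phi> :: "(nat letter list \<Rightarrow> nat letter list) \<Rightarrow> 'g"
  assumes "n \<ge> 3"
    and "group G"
    and "\<phi> \<in> hom (Aut_free n) G"
    and "\<not> (\<exists>H. subgroup H G \<and> G\<lparr>carrier := H\<rparr> \<cong> W_group n)"
  shows "G\<lparr>carrier := \<phi> ` carrier (Aut_free n)\<rparr> \<cong> PGL_int n
    \<or> finite (\<phi> ` carrier (Aut_free n))"
proof -
  interpret aut_hom "{1..n}" n G \<phi>
    by (intro aut_hom.intro free_group_n.intro aut_hom_axioms.intro assms(1-3) refl)
  show ?thesis by (rule image_PGL_or_finite[OF assms(4)])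
qed


end
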